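(* The groups $QF_{k,\ell}$, $QT_{k,\ell}$, and $QV_{k,\ell}$ have type $F_\infty$, for all integers $k,\ell\ge 0$.
   Context: Let $\mathcal{F}_{k,\ell}$ denote an ordered forest consisting of $k$ infinite rooted binary trees and $\ell$ isolated vertices. In each infinite rooted binary tree every vertex has a left child and a right child; isolated vertices have no children. $QV_{k,\ell}$ is the group (under composition) of all bijections $h$ of the vertex set of $\mathcal{F}_{k,\ell}$ such that, for all but finitely many vertices $v$, $h$ sends the left (respectively, right) child of $v$ to the left (respectively, right) child of $h(v)$. Each $h\in QV_{k,\ell}$ induces a bijection of the set of ends of $\mathcal{F}_{k,\ell}$. The set of ends may be identified with $\{1,\dots,k\}\times\{0,1\}^{\mathbb{N}}$ and is linearly ordered lexicographically (trees in the given order, ends within a tree from left to right); this linear order induces a cyclic order. $QF_{k,\ell}$ and $QT_{k,\ell}$ are the subgroups of $QV_{k,\ell}$ consisting of the elements that preserve, respectively, the linear and the cyclic ordering of the ends. A group $G$ has type $F_\infty$ if there is a $K(G,1)$ CW-complex with finitely many cells in each dimension. *)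

theory Defs
  imports "HOL-Analysis.Analysis" "HOL-Algebra.Bij" "HOL-Algebra.Elementary_Groups" "HOL-Library.Fun_Lexorder"
begin

section \<open>The groups QF, QT and QV\<close>

text \<open>\<open>Node i w\<close> is the vertex of the \<open>i\<close>-th tree reached from its root by the word \<open>w\<close>, where
  \<open>False\<close> means left and \<open>True\<close> means right. Trees and isolated vertices are numbered from 0.\<close>

datatype vertex = Node nat "bool list" | Isolated nat

definition forest :: "nat \<Rightarrow> nat \<Rightarrow> vertex set" where
  "forest k l = {Node i w | i w. i < k} \<union> {Isolated j | j. j < l}"

definition is_child :: "bool \<Rightarrow> vertex \<Rightarrow> vertex \<Rightarrow> bool" where
  "is_child d u v \<longleftrightarrow> (\<exists>i w. v = Node i w \<and> u = Node i (w @ [d]))"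

definition respects_children_at :: "(vertex \<Rightarrow> vertex) \<Rightarrow> vertex \<Rightarrow> bool" where
  "respects_children_at h v \<longleftrightarrow> (\<forall>d u. is_child d u v \<longrightarrow> is_child d (h u) (h v))"

definition QV :: "nat \<Rightarrow> nat \<Rightarrow> (vertex \<Rightarrow> vertex) monoid" where
  "QV k l = BijGroup (forest k l)
     \<lparr>carrier := {h \<in> Bij (forest k l). finite {v \<in> forest k l. \<not> respects_children_at h v}}\<rparr>"

definition ends :: "nat \<Rightarrow> (nat \<times> (nat \<Rightarrow> bool)) set" where
  "ends k = {..<k} \<times> UNIV"

definition end_less :: "nat \<times> (nat \<Rightarrow> bool) \<Rightarrow> nat \<times> (nat \<Rightarrow> bool) \<Rightarrow> bool" where
  "end_less e e' \<longleftrightarrow> fst e < fst e' \<or> (fst e = fst e' \<and> less_fun (snd e) (snd e'))"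

definition end_cyclic :: "nat \<times> (nat \<Rightarrow> bool) \<Rightarrow> nat \<times> (nat \<Rightarrow> bool) \<Rightarrow> nat \<times> (nat \<Rightarrow> bool) \<Rightarrow> bool" where
  "end_cyclic a b c \<longleftrightarrow>
     (end_less a b \<and> end_less b c) \<or> (end_less b c \<and> end_less c a) \<or> (end_less c a \<and> end_less a b)"

definition ray :: "nat \<times> (nat \<Rightarrow> bool) \<Rightarrow> nat \<Rightarrow> vertex" where
  "ray e n = Node (fst e) (map (snd e) [0..<n])"

text \<open>An element of \<open>QV k l\<close> maps all but finitely many vertices of a ray into a unique ray.\<close>

definition end_map :: "(vertex \<Rightarrow> vertex) \<Rightarrow> nat \<times> (nat \<Rightarrow> bool) \<Rightarrow> nat \<times> (nat \<Rightarrow> bool)" where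
  "end_map h e = (THE e'. \<forall>\<^sub>F n in sequentially. h (ray e n) \<in> range (ray e'))"

lemma ray_inj: "inj (ray e)"
proof (rule injI)
  fix m n assume "ray e m = ray e n"
  then have "length (map (snd e) [0..<m]) = length (map (snd e) [0..<n])"
    by (simp only: ray_def vertex.inject)
  then show "m = n" by simp
qed

lemma end_map_well_defined:
  assumes h: "h \<in> carrier (QV k l)" and e: "e \<in> ends k"
  shows "\<exists>!e'. \<forall>\<^sub>F n in sequentially. h (ray e n) \<in> range (ray e')"
    and "end_map h e \<in> ends k"
proof -
  let ?V = "forest k l"
  let ?P = "\<lambda>e'. \<forall>\<^sub>F n in sequentially. h (ray e n) \<in> range (ray e')"
  have hV: "h \<in> Bij ?V" and fin: "finite {v \<in> ?V. \<not> respects_children_at h v}"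
    using h by (auto simp: QV_def)
  have inj: "inj_on h ?V" and img: "\<And>v. v \<in> ?V \<Longrightarrow> h v \<in> ?V"
    using hV by (auto simp: Bij_def bij_betw_def)
  have rayV: "ray e n \<in> ?V" for n
    using e by (auto simp: ends_def forest_def ray_def)
  have "finite (ray e -` {v \<in> ?V. \<not> respects_children_at h v})"
    by (rule finite_vimageI[OF fin ray_inj])
  then obtain N where N: "\<And>n. n \<in> ray e -` {v \<in> ?V. \<not> respects_children_at h v} \<Longrightarrow> n < N"
    by (meson finite_nat_set_iff_bounded)
  have good: "respects_children_at h (ray e n)" if "n \<ge> N" for n
    using N[of n] that rayV[of n] by auto
  have step: "is_child (snd e n) (h (ray e (Suc n))) (h (ray e n))" if "n \<ge> N" for n
    using good[OF that] by (auto simp: respects_children_at_def is_child_def ray_def)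
  obtain j w where jw: "h (ray e N) = Node j w"
    using step[of N] by (auto simp: is_child_def)
  have path: "h (ray e (N + m)) = Node j (w @ map (\<lambda>i. snd e (N + i)) [0..<m])" for m
  proof (induction m)
    case 0 then show ?case by (simp add: jw)
  next
    case (Suc m) then show ?case
      using step[of "N + m"] by (auto simp: is_child_def)
  qed
  define x where "x = (\<lambda>i. if i < length w then w ! i else snd e (N + (i - length w)))"
  have on_ray: "h (ray e (N + m)) = ray (j, x) (length w + m)" for m
    unfolding path
    by (auto intro!: nth_equalityI simp: ray_def x_def nth_append)
  have j: "j < k"
    using img[OF rayV[of N]] jw by (auto simp: forest_def)
  have P: "?P (j, x)"
    unfolding eventually_sequentially
    by (metis on_ray le_add_diff_inverse rangeI)
  have uniq: "e' = (j, x)" if e': "?P e'" for e'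
  proof -
    obtain M where M: "\<And>n. n \<ge> M \<Longrightarrow> h (ray e n) \<in> range (ray e')"
      using e' unfolding eventually_sequentially by blast
    have *: "fst e' = j \<and> snd e' i = x i" for i
    proof -
      let ?m = "M + Suc i"
      obtain p where "ray (j, x) (length w + ?m) = ray e' p"
        using M[of "N + ?m"] on_ray[of ?m] by auto
      then have f: "fst e' = j" and m: "map x [0..<length w + ?m] = map (snd e') [0..<p]"
        by (simp_all only: ray_def vertex.inject fst_conv snd_conv)
      from arg_cong[OF m, of length] have "i < p" by simp
      have "x i = snd e' i"
        using arg_cong[OF m, of "\<lambda>xs. xs ! i"] \<open>i < p\<close> by (simp add: nth_map_upt del: upt_Suc)
      then show ?thesis using f by simp
    qed
    have "snd e' = x" using * by blast
    then show ?thesis using * by (metis prod.collapse)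
  qed
  show "\<exists>!e'. ?P e'" using P uniq by blast
  have "end_map h e = (j, x)"
    unfolding end_map_def using P uniq by (rule the_equality)
  then show "end_map h e \<in> ends k" using j by (simp add: ends_def)
qed

definition QF :: "nat \<Rightarrow> nat \<Rightarrow> (vertex \<Rightarrow> vertex) monoid" where
  "QF k l = (QV k l)
     \<lparr>carrier := {h \<in> carrier (QV k l). \<forall>a\<in>ends k. \<forall>b\<in>ends k.
        end_less a b \<longrightarrow> end_less (end_map h a) (end_map h b)}\<rparr>"

definition QT :: "nat \<Rightarrow> nat \<Rightarrow> (vertex \<Rightarrow> vertex) monoid" where
  "QT k l = (QV k l)
     \<lparr>carrier := {h \<in> carrier (QV k l). \<forall>a\<in>ends k. \<forall>b\<in>ends k. \<forall>c\<in>ends k.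
        end_cyclic a b c \<longrightarrow> end_cyclic (end_map h a) (end_map h b) (end_map h c)}\<rparr>"


section \<open>CW complexes\<close>

definition disc :: "nat \<Rightarrow> (nat \<Rightarrow> real) topology" where
  "disc n = subtopology (Euclidean_space n) {x. (\<Sum>i<n. x i ^ 2) \<le> 1}"

definition disc_interior :: "nat \<Rightarrow> (nat \<Rightarrow> real) set" where
  "disc_interior n = {x \<in> topspace (disc n). (\<Sum>i<n. x i ^ 2) < 1}"

definition disc_boundary :: "nat \<Rightarrow> (nat \<Rightarrow> real) set" where
  "disc_boundary n = {x \<in> topspace (disc n). (\<Sum>i<n. x i ^ 2) = 1}"

text \<open>A CW structure on \<open>X\<close>: \<open>C n\<close> indexes the \<open>n\<close>-cells and \<open>\<Phi> n i\<close> is the characteristic map of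
  the \<open>n\<close>-cell \<open>i\<close>. The last two conditions are closure-finiteness and the weak topology.\<close>

definition cw_complex ::
    "'a topology \<Rightarrow> (nat \<Rightarrow> 'i set) \<Rightarrow> (nat \<Rightarrow> 'i \<Rightarrow> (nat \<Rightarrow> real) \<Rightarrow> 'a) \<Rightarrow> bool" where
  "cw_complex X C \<Phi> \<longleftrightarrow>
     Hausdorff_space X \<and>
     (\<forall>n. \<forall>i\<in>C n. continuous_map (disc n) X (\<Phi> n i) \<and>
        embedding_map (subtopology (disc n) (disc_interior n)) X (\<Phi> n i)) \<and>
     disjoint_family_on (\<lambda>(n, i). \<Phi> n i ` disc_interior n) (SIGMA n:UNIV. C n) \<and>
     topspace X = (\<Union>n. \<Union>i\<in>C n. \<Phi> n i ` disc_interior n) \<and>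
     (\<forall>n. \<forall>i\<in>C n. \<exists>F. finite F \<and> F \<subseteq> (SIGMA m:{..<n}. C m) \<and>
        \<Phi> n i ` disc_boundary n \<subseteq> (\<Union>(m, j)\<in>F. \<Phi> m j ` disc_interior m)) \<and>
     (\<forall>A \<subseteq> topspace X.
        closedin X A \<longleftrightarrow>
        (\<forall>n. \<forall>i\<in>C n. closedin X (A \<inter> Abstract_Topology.closure_of X (\<Phi> n i ` disc_interior n))))"


section \<open>Homotopy groups and Eilenberg-MacLane spaces\<close>

definition cube :: "nat \<Rightarrow> (nat \<Rightarrow> real) topology" where
  "cube n = subtopology (Euclidean_space n) {x. \<forall>i<n. 0 \<le> x i \<and> x i \<le> 1}"

definition cube_boundary :: "nat \<Rightarrow> (nat \<Rightarrow> real) set" where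
  "cube_boundary n = {x \<in> topspace (cube n). \<exists>i<n. x i = 0 \<or> x i = 1}"

definition spheroids :: "nat \<Rightarrow> 'a topology \<Rightarrow> 'a \<Rightarrow> ((nat \<Rightarrow> real) \<Rightarrow> 'a) set" where
  "spheroids n X x = {f. continuous_map (cube n) X f \<and> (\<forall>t\<in>cube_boundary n. f t = x)}"

definition homotopy_class ::
    "nat \<Rightarrow> 'a topology \<Rightarrow> 'a \<Rightarrow> ((nat \<Rightarrow> real) \<Rightarrow> 'a) \<Rightarrow> ((nat \<Rightarrow> real) \<Rightarrow> 'a) set" where
  "homotopy_class n X x f =
     {g. homotopic_with (\<lambda>h. \<forall>t\<in>cube_boundary n. h t = x) (cube n) X f g}"

definition cube_concat :: "((nat \<Rightarrow> real) \<Rightarrow> 'a) \<Rightarrow> ((nat \<Rightarrow> real) \<Rightarrow> 'a) \<Rightarrow> (nat \<Rightarrow> real) \<Rightarrow> 'a" where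
  "cube_concat f g t = (if t 0 \<le> 1/2 then f (t(0 := 2 * t 0)) else g (t(0 := 2 * t 0 - 1)))"

text \<open>This is \<open>\<pi>\<^sub>n(X, x)\<close>; it is meaningful for \<open>n \<ge> 1\<close> and \<open>x \<in> topspace X\<close>.\<close>

definition homotopy_group ::
    "nat \<Rightarrow> 'a topology \<Rightarrow> 'a \<Rightarrow> ((nat \<Rightarrow> real) \<Rightarrow> 'a) set monoid" where
  "homotopy_group n X x =
     \<lparr>carrier = homotopy_class n X x ` spheroids n X x,
      mult = (\<lambda>A B. \<Union>f\<in>A. \<Union>g\<in>B. homotopy_class n X x (cube_concat f g)),
      one = homotopy_class n X x (\<lambda>_. x)\<rparr>"

definition is_K1 :: "('g, 'm) monoid_scheme \<Rightarrow> 'a topology \<Rightarrow> bool" where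
  "is_K1 G X \<longleftrightarrow>
     path_connected_space X \<and>
     (\<exists>x\<in>topspace X. G \<cong> homotopy_group 1 X x \<and> (\<forall>n\<ge>2. trivial_group (homotopy_group n X x)))"

text \<open>HOL cannot quantify over the type of points, but fixing it loses nothing: a CW complex with
  finitely many cells in each dimension has at most continuum many points and countably many cells,
  so up to homeomorphism its points are elements of \<open>nat \<Rightarrow> real\<close> and its cells are indexed by
  naturals. The topology of \<open>X\<close> is unrelated to the product topology of that type.\<close>

definition type_F_infinity :: "('g, 'm) monoid_scheme \<Rightarrow> bool" where
  "type_F_infinity G \<longleftrightarrow>
     group G \<and>
     (\<exists>(X :: (nat \<Rightarrow> real) topology) (C :: nat \<Rightarrow> nat set) \<Phi>.
        cw_complex X C \<Phi> \<and> (\<forall>n. finite (C n)) \<and> is_K1 G X)"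

end

theory Submission
  imports Defs
begin

text \<open>The group acts freely on the directed poset of labelled bases, that is, of quasi-automorphisms
from \<open>forest k l\<close> onto \<open>forest (k + n) (l + n)\<close>, ordered by the expansion of carets. The
level \<open>n\<close> filters the order complex with finitely many orbits of simplices in each stage. A base of
large level admits many pairwise compatible caret contractions, so a grounding argument makes the complex of bases
strictly below it null-homotopic in low dimensions: the filtration is essentially highly connected.
Colouring the vertices makes the action on simplices free. As in Brown's criterion one then attaches free orbits of
cells, finitely many in each dimension, to a complex in which every sphere bounds; equivariant maps to
the filtration and back, together with a homotopy, show that finitely many orbits suffice at each step.
By lifting cubes to this complex, its quotient by the group is seen to be a \<open>K(G, 1)\<close>.\<close>

section \<open>Cubes\<close>

text \<open>Connectivity enters only in the form that a map on the boundary of a cube extends over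
  the cube, and each map involved uses finitely many vertices or cells. Hence homotopies can be
  given by explicit weights, and points of all complexes can be real functions with the product
  topology. A base keeps its labels, so a group element fixing a base is trivial. The price is that
  all relabellings of a base compare with it both ways: the order is only a preorder, a simplex may
  contain several of them, and an element of finite order may permute its vertices. Colours rule
  this out. A sphere in stage r is only known to bound in a later stage s. Therefore the new n-cells
  come from two finite sources: the orbits of n-simplices of stage s, and the (n-1)-cells already
  present, each thickened to a prism that carries the homotopy from the identity to the round trip.
  A simplex beyond stage s needs no cell of its own, since its boundary already bounds in the
  enlarged complex.\<close>

type_synonym rseq = "nat => real"

abbreviation cyl :: "'a set => ('a * real) set" where
 "cyl K == K \<times> {0..1}"

lemmas continuous_on_pointwise = continuous_on_coordinatewise_then_product

definition cb :: "nat => rseq set" where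
 "cb n = {x. (ALL i<n. 0 <= x i & x i <= 1) & (ALL i>=n. x i = 0)}"

definition bd :: "nat => rseq set" where
 "bd n = {x:cb n. EX i<n. x i = 0 | x i = 1}"

lemma cube_eq: "cube n = top_of_set (cb n)"
proof -
 have "{x. ALL i>=n. x i = 0} Int {x. ALL i<n. 0 <= x i & x i <= 1} = cb n"
  by (auto simp: cb_def)
 thus ?thesis
  unfolding cube_def Euclidean_space_def subtopology_subtopology euclidean_product_topology
  by simp
qed

lemma cube_boundary_eq: "cube_boundary n = bd n"
 by (simp add: cube_boundary_def bd_def cube_eq)

lemma bd_subset: "bd n <= cb n"
 by (auto simp: bd_def)

lemma bd_0 [simp]: "bd 0 = {}"
 by (simp add: bd_def)

lemma continuous_on_coord: "continuous_on S (%x::nat => real. x i)"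
 by (rule continuous_on_subset[OF continuous_on_product_coordinates]) simp

lemma continuous_on_coord': "continuous_on S f ==> continuous_on S (%x. f x i)"
 by (rule continuous_on_product_then_coordinatewise)

lemma continuous_on_upd:
 fixes f :: "'k::topological_space => nat => real"
 assumes "continuous_on X f" "continuous_on X t" shows "continuous_on X (%x. (f x)(n := t x))"
proof (rule continuous_on_pointwise)
 fix i show "continuous_on X (%x. ((f x)(n := t x)) i)"
  using assms(2) continuous_on_coord'[OF assms(1)] by (cases "i = n") simp_all
qed

lemmas ctn = continuous_on_upd continuous_on_coord continuous_on_fst continuous_on_snd continuous_on_id continuous_on_const
 continuous_on_mult continuous_on_diff continuous_on_Pair continuous_on_add continuous_on_divide

lemma compact_cb: "compact (cb n)"
proof -
 have "cb n = (\<Pi>\<^sub>E i\<in>UNIV. if i < n then {0..1} else {0})"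
 proof (intro equalityI subsetI)
  fix x :: "nat => real"
  assume "x:cb n"
  thus "x:(\<Pi>\<^sub>E i\<in>UNIV. if i < n then {0..1} else {0})"
   by (simp add: cb_def PiE_iff)
 next
  fix x :: "nat => real"
  assume x: "x:(\<Pi>\<^sub>E i\<in>UNIV. if i < n then {0..1} else {0})"
  have "x i:(if i < n then {0..1} else {0})" for i
   by (rule PiE_mem[OF x]) simp
  thus "x:cb n"
   unfolding cb_def by (smt (verit, best) atLeastAtMost_iff linorder_not_less mem_Collect_eq singletonD)
 qed
 hence "compactin (product_topology (%i. euclideanreal) UNIV) (cb n)"
  by (simp add: compactin_PiE)
 thus ?thesis
  by (simp add: euclidean_product_topology)
qed

text \<open>Maximum norm about the centre of the cube, scaled so that the cube is the unit ball and
  \<open>bd n\<close> the unit sphere. For \<open>n = 0\<close> it is 0.\<close>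

fun nrm :: "nat => rseq => real" where
 "nrm 0 x = 0"
| "nrm (Suc n) x = max (nrm n x) \<bar>2 * x n - 1\<bar>"

lemma continuous_on_nrm [continuous_intros]:
 assumes f: "continuous_on S f" shows "continuous_on S (%x. nrm n (f x))"
proof (induction n)
 case (Suc n)
 have "continuous_on S (%x. f x n)"
  by (rule continuous_on_coord'[OF f])
 with Suc show ?case
  by (simp, intro continuous_on_max continuous_on_rabs continuous_on_diff continuous_on_mult_left continuous_on_const)
qed simp

lemma nrm_nonneg [simp]: "0 <= nrm n x"
 by (induction n) auto

lemma nrm_ge: "i < n ==> \<bar>2 * x i - 1\<bar> <= nrm n x"
 by (induction n) (auto simp: less_Suc_eq)

lemma nrm_le_iff: "0 <= c ==> nrm n x <= c \<longleftrightarrow> (ALL i<n. \<bar>2 * x i - 1\<bar> <= c)"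
 by (induction n) (auto simp: less_Suc_eq)

lemma nrm_attained: "nrm n x > 0 ==> EX i<n. nrm n x = \<bar>2 * x i - 1\<bar>"
 by (induction n) (auto simp: less_Suc_eq max_def split: if_splits)

lemma mem_cb_iff: "x:cb n \<longleftrightarrow> nrm n x <= 1 & (ALL i>=n. x i = 0)"
 by (auto simp: cb_def nrm_le_iff abs_le_iff)

lemma mem_bd_iff: "x:bd n \<longleftrightarrow> nrm n x = 1 & (ALL i>=n. x i = 0)"
proof -
 have "nrm n x = 1" if xb: "x:bd n"
 proof -
  obtain i where i: "i < n" "x i = 0 | x i = 1" and x: "x:cb n"
   using xb unfolding bd_def by blast
  have "1 <= nrm n x" using nrm_ge[OF i(1), of x] i(2) by auto
  thus ?thesis using x by (auto simp: mem_cb_iff)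
 qed
 moreover have "EX i<n. x i = 0 | x i = 1" if n1: "nrm n x = 1"
 proof -
  obtain i where "i < n" "\<bar>2 * x i - 1\<bar> = 1"
   using nrm_attained[of n x] n1 by auto
  thus ?thesis by (intro exI[of _ i]) linarith
 qed
 ultimately show ?thesis
  by (auto simp: bd_def mem_cb_iff)
qed

text \<open>The homothety with factor \<open>c\<close> about the centre (1/2, ..., 1/2); the
  coordinates from \<open>n\<close> on are 0.\<close>

definition scl :: "nat => real => rseq => nat => real" where
 "scl n c x = (%i. if i < n then 1/2 + c * (x i - 1/2) else 0)"

lemma nrm_scl: "nrm n (scl n c x) = \<bar>c\<bar> * nrm n x"
proof -
 have "nrm m (scl n c x) = \<bar>c\<bar> * nrm m x" if "m <= n" for m
  using that
 proof (induction m)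
  case (Suc m)
  have "\<bar>2 * scl n c x m - 1\<bar> = \<bar>c * (2 * x m - 1)\<bar>"
   using Suc by (simp add: scl_def algebra_simps)
  also have "\<dots> = \<bar>c\<bar> * \<bar>2 * x m - 1\<bar>"
   by (simp add: abs_mult)
  finally show ?case
   using Suc by (simp add: max_mult_distrib_left)
 qed simp
 thus ?thesis by simp
qed

lemma scl_1: "x:cb n ==> scl n 1 x = x"
 by (auto simp: scl_def cb_def)

lemma scl_scl: "scl n a (scl n b x) = scl n (a * b) x"
 by (auto simp: scl_def)

lemma continuous_on_scl [continuous_intros]:
 assumes "continuous_on S c" "continuous_on S f"
 shows "continuous_on S (%x. scl n (c x) (f x))"
proof (rule continuous_on_pointwise)
 fix i
 have "continuous_on S (%x. f x i)"
  by (rule continuous_on_coord'[OF assms(2)])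
 hence "continuous_on S (%x. 1/2 + c x * (f x i - 1/2))"
  by (intro ctn assms(1))
 thus "continuous_on S (%x. scl n (c x) (f x) i)"
  by (cases "i < n") (simp_all add: scl_def)
qed

text \<open>Radial projection from the centre onto the boundary, meaningful only away from the
  centre.\<close>

abbreviation rho :: "nat => rseq => nat => real" where
 "rho n x == scl n (1 / nrm n x) x"

lemma rho_in_bd: "nrm n x > 0 ==> rho n x:bd n"
 by (auto simp: mem_bd_iff nrm_scl) (simp add: scl_def)

lemma rho_bd: "x:bd n ==> rho n x = x"
 using scl_1[of x n] bd_subset[of n] by (metis div_by_1 mem_bd_iff subsetD)

lemma scl_in_cb: "\<bar>c\<bar> * nrm n x <= 1 ==> scl n c x:cb n"
 unfolding mem_cb_iff nrm_scl by (simp add: scl_def)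

text \<open>Homotopy extension for the pair of a cube and its boundary: the homotopy is run on the
  outer shell and the given map on the cube is shrunk into the inner half.\<close>

lemma collar:
 assumes H: "continuous_map (top_of_set (cyl (bd n))) Y H"
  and F: "continuous_map (top_of_set (cb n)) Y F"
  and H1: "!!x. x:bd n ==> H (x, 1::real) = F x"
 shows "EX f. continuous_map (top_of_set (cb n)) Y f & (ALL x:bd n. f x = H (x, 0)) &
  f`cb n <= F`cb n Un H`cyl (bd n)"
proof -
 define f where "f = (%x. if nrm n x <= 1/2 then F (scl n 2 x) else H (rho n x, 2 - 2 * nrm n x))"
 have "continuous_map (top_of_set (cb n)) Y f"
  unfolding f_def
 proof (rule continuous_map_cases_le)
  show "continuous_map (top_of_set (cb n)) euclideanreal (nrm n)"
   using continuous_on_nrm[OF continuous_on_id, of "cb n" n] by simp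
  have "continuous_map (top_of_set {x:cb n. nrm n x <= 1/2}) (top_of_set (cb n)) (scl n 2)"
   using continuous_on_scl[OF continuous_on_const continuous_on_id] by (auto intro!: scl_in_cb)
  from continuous_map_compose[OF this F]
  show "continuous_map (subtopology (top_of_set (cb n)) {x:topspace (top_of_set (cb n)). nrm n x <= 1/2}) Y
   (%x. F (scl n 2 x))"
   by (simp add: subtopology_subtopology o_def Int_def conj_commute cong: conj_cong)
  have "continuous_map (top_of_set {x:cb n. 1/2 <= nrm n x}) (top_of_set (cyl (bd n)))
    (%x. (rho n x, 2 - 2 * nrm n x))"
  proof -
   have "continuous_on {x:cb n. 1/2 <= nrm n x} (%x. (rho n x, 2 - 2 * nrm n x))"
    by (intro continuous_on_Pair continuous_on_scl ctn
     continuous_on_nrm ctn) auto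
   thus ?thesis
    using rho_in_bd[of n] by (auto simp: mem_cb_iff)
  qed
  from continuous_map_compose[OF this H]
  show "continuous_map (subtopology (top_of_set (cb n)) {x:topspace (top_of_set (cb n)). 1/2 <= nrm n x}) Y
   (%x. H (rho n x, 2 - 2 * nrm n x))"
   by (simp add: subtopology_subtopology o_def Int_def conj_commute cong: conj_cong)
  show "F (scl n 2 x) = H (rho n x, 2 - 2 * nrm n x)" if "nrm n x = 1/2" for x
  proof -
   have 1: "rho n x = scl n 2 x" and 2: "2 - 2 * nrm n x = 1" unfolding that by simp_all
   have "rho n x:bd n" by (rule rho_in_bd) (use that in linarith)
   hence "H (rho n x, 1) = F (rho n x)" by (rule H1)
   thus ?thesis by (simp only: 1 2)
  qed
 qed simp
 moreover have "ALL x:bd n. f x = H (x, 0)"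
  using rho_bd[of _ n] by (auto simp: f_def mem_bd_iff)
 moreover have "f`cb n <= F`cb n Un H`cyl (bd n)"
  using rho_in_bd[of n] by (fastforce simp: f_def mem_cb_iff[of _ n] intro!: imageI scl_in_cb)
 ultimately show ?thesis by blast
qed

section \<open>Geometric realizations\<close>

definition spt :: "('v => real) => 'v set" where
 "spt u = {v. u v ~= 0}"

definition scomplex :: "'v set set => bool" where
 "scomplex S \<longleftrightarrow> (ALL si:S. finite si & si ~= {} & (ALL ta<=si. ta ~= {} --> ta:S))"

definition realiz :: "'v set set => ('v => real) set" where
 "realiz S = {u. spt u:S & (ALL v. 0 <= u v) & sum u (spt u) = 1}"

text \<open>Bounding all supports by one finite set keeps the image in a finite complex, where the
  product topology is the usual topology of the realization.\<close>

definition smap :: "'k::topological_space set => 'v set set => ('k => 'v => real) => bool" where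
 "smap K S f \<longleftrightarrow> continuous_on K f & f`K <= realiz S & finite (UN k:K. spt (f k))"

text \<open>For \<open>d = 0\<close> the boundary is empty, and the condition only says that the
  complex has a point.\<close>

abbreviation sfills where
 "sfills d S f == EX F. smap (cb d) S F & (ALL x:bd d. F x = f x)"

definition vpt :: "'v => 'v => real" where
 "vpt z = (%v. if v = z then 1 else 0)"

lemma spt_vpt [simp]: "spt (vpt z) = {z}"
 by (auto simp: spt_def vpt_def)

lemma realiz_mono: "S <= T ==> realiz S <= realiz T"
 by (auto simp: realiz_def)

lemma smap_mono: "smap K S f ==> S <= T ==> smap K T f"
 using realiz_mono unfolding smap_def by blast

lemma smap_compose:
 assumes "smap K S f" "continuous_on L h" "h`L <= K"
 shows "smap L S (%x. f (h x))"
proof -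
 have "(UN k:L. spt (f (h k))) <= (UN k:K. spt (f k))" using assms(3) by blast
 hence "finite (UN k:L. spt (f (h k)))"
  by (rule finite_subset) (use assms(1) in \<open>simp add: smap_def\<close>)
 moreover have "continuous_on L (%x. f (h x))"
  by (rule continuous_on_compose2[of K]) (use assms in \<open>simp_all add: smap_def\<close>)
 moreover have "(%x. f (h x))`L <= realiz S"
  using assms(1,3) unfolding smap_def by (metis (no_types, lifting) image_subset_iff)
 ultimately show ?thesis
  unfolding smap_def by blast
qed

lemma smap_subset: "smap K S f ==> L <= K ==> smap L S f"
 using smap_compose[of K S f L "%x. x"] by (simp add: continuous_on_id)

lemma smap_cong: "(!!k. k:K ==> f k = g k) ==> smap K S f \<longleftrightarrow> smap K S g"
 unfolding smap_def by (simp cong: continuous_on_cong)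

lemma smap_support: "smap K S f ==> k:K ==> spt (f k):S"
 by (auto simp: smap_def realiz_def)

lemma smap_restrict: "smap K S f ==> (!!k. k:K ==> spt (f k):T) ==> smap K T f"
 by (auto simp: smap_def realiz_def)

lemma smap_const: "{z}:S ==> smap K S (%_. vpt z)"
 by (auto simp: smap_def realiz_def) (simp_all add: vpt_def)

lemma smap_pos: "smap K S f ==> k:K ==> v:spt (f k) \<longleftrightarrow> 0 < f k v"
 by (force simp: smap_def realiz_def spt_def less_le)

text \<open>The barycentric map of an unnormalised partition of unity: \<open>q\<close> pushes its
  weight onto the vertex \<open>nu q\<close>, and indices with the same vertex add up. The maps
  built below from grids and from layers have this form.\<close>

definition wmap :: "'q set => ('q => 'k => real) => ('q => 'v) => 'k => 'v => real" where
 "wmap Q w nu k = (%v. (\<Sum>q | q:Q & nu q = v. w q k) / (SUM q:Q. w q k))"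

lemma wmap_total_pos:
 assumes "finite Q" "!!q. q:Q ==> 0 <= w q k" "EX q:Q. 0 < (w q k::real)"
 shows "0 < (SUM q:Q. w q k)"
 using assms by (meson sum_pos2)

lemma spt_wmap:
 assumes "finite Q" "!!q. q:Q ==> 0 <= w q k" "EX q:Q. 0 < (w q k::real)"
 shows "spt (wmap Q w nu k) = nu`{q:Q. 0 < w q k}"
proof -
 have pos: "0 < (SUM q:Q. w q k)" by (rule wmap_total_pos[of Q w k, OF assms])
 have "(\<Sum>q | q:Q & nu q = v. w q k) ~= 0 \<longleftrightarrow> (EX q:Q. nu q = v & 0 < w q k)" for v
 proof -
  have "(\<Sum>q | q:Q & nu q = v. w q k) = 0 \<longleftrightarrow> (ALL q:{q. q:Q & nu q = v}. w q k = 0)"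
   by (rule sum_nonneg_eq_0_iff) (use assms in auto)
  thus ?thesis using assms(2) by (force simp: less_le)
 qed
 thus ?thesis
  using pos by (auto simp: spt_def wmap_def)
qed

lemma smap_wmap:
 assumes fin: "finite Q" and cont: "!!q. q:Q ==> continuous_on K (w q)"
  and nn: "!!q k. q:Q ==> k:K ==> 0 <= w q k"
  and pos: "!!k. k:K ==> EX q:Q. 0 < w q k"
  and S: "!!k. k:K ==> nu`{q:Q. 0 < w q k}:S"
 shows "smap K S (wmap Q w nu)"
proof -
 have tot: "0 < (SUM q:Q. w q k)" if "k:K" for k
  using wmap_total_pos[of Q w k] fin nn pos that by blast
 have sp: "spt (wmap Q w nu k) = nu`{q:Q. 0 < w q k}" if "k:K" for k
  using spt_wmap[of Q w k nu] fin nn pos that by blast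
 have "continuous_on K (wmap Q w nu)"
 proof (rule continuous_on_pointwise)
  fix v
  show "continuous_on K (%x. wmap Q w nu x v)"
   unfolding wmap_def using tot by (intro continuous_intros cont) (auto simp: less_le)
 qed
 moreover have "wmap Q w nu k:realiz S" if k: "k:K" for k
 proof -
  have "sum (wmap Q w nu k) (spt (wmap Q w nu k)) = sum (wmap Q w nu k) (nu`Q)"
  proof (rule sum.mono_neutral_left)
   show "spt (wmap Q w nu k) <= nu`Q" using sp[OF k] by auto
  qed (use fin in \<open>auto simp: spt_def\<close>)
  also have "\<dots> = (SUM v:nu`Q. (\<Sum>q | q:Q & nu q = v. w q k)) / (SUM q:Q. w q k)"
   by (simp add: wmap_def sum_divide_distrib)
  also have "(SUM v:nu`Q. (\<Sum>q | q:Q & nu q = v. w q k)) = (SUM q:Q. w q k)"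
   by (rule sum.image_gen[OF fin, symmetric])
  finally have "sum (wmap Q w nu k) (spt (wmap Q w nu k)) = 1"
   using tot[OF k] by simp
  moreover have "0 <= wmap Q w nu k v" for v
   unfolding wmap_def using tot[OF k] nn k by (intro divide_nonneg_nonneg sum_nonneg) (auto simp: less_le)
  ultimately show ?thesis
   using S[OF k] sp[OF k] by (auto simp: realiz_def)
 qed
 moreover have "(UN k:K. spt (wmap Q w nu k)) <= nu`Q"
  using sp by auto
 ultimately show ?thesis
  unfolding smap_def using fin finite_subset by blast
qed

section \<open>Homotopies between maps into realizations\<close>

definition shom :: "'k::topological_space set => 'v set set => ('k => 'v => real) => ('k => 'v => real) => bool" where
 "shom K S f g \<longleftrightarrow> (EX H. smap (cyl K) S H & (ALL k:K. H (k, 0) = f k & H (k, 1) = g k))"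

lemma shomI:
 "smap (cyl K) S H ==> (!!k. k:K ==> H (k, 0) = f k) ==>
  (!!k. k:K ==> H (k, 1) = g k) ==> shom K S f g"
 unfolding shom_def by blast

lemma shom_sym: assumes "shom K S f g" shows "shom K S g f"
proof -
 obtain H where H: "smap (cyl K) S H" "ALL k:K. H (k, 0) = f k & H (k, 1) = g k"
  using assms unfolding shom_def by blast
 have "smap (cyl K) S (%x. H (fst x, 1 - snd x))"
  by (rule smap_compose[OF H(1)]) (auto intro!: continuous_intros)
 thus ?thesis
  by (rule shomI) (use H in auto)
qed

lemma smap_cases_le:
 fixes p :: "'k::topological_space => real"
 assumes p: "continuous_on K p"
  and f: "smap {k:K. p k <= c} S f" and g: "smap {k:K. c <= p k} S g"
  and eq: "!!k. k:K ==> p k = c ==> f k = g k"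
 shows "smap K S (%k. if p k <= c then f k else g k)"
proof -
 have "continuous_on K (%k. if p k <= c then f k else g k)"
  by (rule continuous_on_cases_le) (use assms in \<open>auto simp: smap_def\<close>)
 moreover have "(UN k:K. spt (if p k <= c then f k else g k)) <=
   (UN k:{k:K. p k <= c}. spt (f k)) Un (UN k:{k:K. c <= p k}. spt (g k))"
  by (force split: if_splits)
 hence "finite (UN k:K. spt (if p k <= c then f k else g k))"
  by (rule finite_subset) (use f g in \<open>auto simp: smap_def\<close>)
 ultimately show ?thesis
  using f g by (auto simp: smap_def image_subset_iff)
qed

lemma shom_trans: assumes "shom K S f g" "shom K S g h" shows "shom K S f h"
proof -
 obtain H where H: "smap (cyl K) S H" "ALL k:K. H (k, 0) = f k & H (k, 1) = g k"
  using assms unfolding shom_def by blast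
 obtain J where J: "smap (cyl K) S J" "ALL k:K. J (k, 0) = g k & J (k, 1) = h k"
  using assms unfolding shom_def by blast
 have "smap (cyl K) S (%x. if snd x <= 1/2 then H (fst x, 2 * snd x) else J (fst x, 2 * snd x - 1))"
 proof (rule smap_cases_le)
  show "smap {k:cyl K. snd k <= 1/2} S (%x. H (fst x, 2 * snd x))"
   by (rule smap_compose[OF H(1)]) (auto intro!: continuous_intros)
  show "smap {k:cyl K. 1/2 <= snd k} S (%x. J (fst x, 2 * snd x - 1))"
   by (rule smap_compose[OF J(1)]) (auto intro!: continuous_intros)
  show "H (fst x, 2 * snd x) = J (fst x, 2 * snd x - 1)" if "x:cyl K" "snd x = 1/2" for x
  proof -
   have "2 * snd x = 1" "2 * snd x - 1 = 0" unfolding that(2) by simp_all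
   thus ?thesis using that(1) H(2) J(2) by auto
  qed
 qed (auto intro!: continuous_intros)
 thus ?thesis
  by (rule shomI) (use H J in auto)
qed

text \<open>Two points whose supports lie in a common simplex are joined by a segment there. The
  support of an intermediate point lies in the union of both supports, so the finiteness condition
  survives.\<close>

lemma smap_sline:
 assumes f: "smap K S f" and g: "smap K S g" and S: "scomplex S"
  and U: "!!k. k:K ==> EX si:S. spt (f k) Un spt (g k) <= si"
 shows "smap (cyl K) S (%x v. (1 - snd x) * f (fst x) v + snd x * g (fst x) v)"
  (is "smap _ _ ?H")
proof -
 have "continuous_on (cyl K) ?H"
 proof (rule continuous_on_pointwise)
  fix v
  have f': "continuous_on (cyl K) (%x. f (fst x) v)"
   by (rule continuous_on_compose2[OF continuous_on_coord'[of K f]])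
    (use f in \<open>auto simp: smap_def intro!: continuous_intros\<close>)
  have g': "continuous_on (cyl K) (%x. g (fst x) v)"
   by (rule continuous_on_compose2[OF continuous_on_coord'[of K g]])
    (use g in \<open>auto simp: smap_def intro!: continuous_intros\<close>)
  show "continuous_on (cyl K) (%x. ?H x v)"
   by (intro continuous_intros f' g')
 qed
 moreover have "?H x:realiz S" if x: "x:cyl K" for x
 proof -
  obtain k t where xk: "x = (k, t)" "k:K" "0 <= t" "t <= 1" using x by auto
  have fk: "!!v. 0 <= f k v" "sum (f k) (spt (f k)) = 1" "finite (spt (f k))"
   using f S xk by (auto simp: smap_def realiz_def scomplex_def)
  have gk: "!!v. 0 <= g k v" "sum (g k) (spt (g k)) = 1" "finite (spt (g k))"
   using g S xk by (auto simp: smap_def realiz_def scomplex_def)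
  let ?U = "spt (f k) Un spt (g k)"
  have "sum (f k) ?U = sum (f k) (spt (f k))" "sum (g k) ?U = sum (g k) (spt (g k))"
   by (rule sum.mono_neutral_right; use fk gk in \<open>auto simp: spt_def\<close>)+
  hence fU: "sum (f k) ?U = 1" and gU: "sum (g k) ?U = 1" using fk gk by simp_all
  have "sum (?H x) ?U = (1 - t) * sum (f k) ?U + t * sum (g k) ?U"
   by (simp only: xk fst_conv snd_conv sum.distrib sum_distrib_left)
  also have "\<dots> = 1" unfolding fU gU by simp
  finally have U1: "sum (?H x) ?U = 1" .
  have sub: "spt (?H x) <= ?U" by (auto simp: spt_def xk)
  have "sum (?H x) (spt (?H x)) = sum (?H x) ?U"
   by (rule sum.mono_neutral_left) (use fk gk sub in \<open>auto simp: spt_def\<close>)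
  hence one: "sum (?H x) (spt (?H x)) = 1" using U1 by simp
  hence "spt (?H x) ~= {}" by auto
  moreover obtain si where "si:S" "?U <= si" using U[OF xk(2)] by auto
  ultimately have "spt (?H x):S" using S sub by (meson order_trans scomplex_def)
  thus ?thesis using one fk gk xk by (auto simp: realiz_def)
 qed
 moreover have "(UN x:cyl K. spt (?H x)) <= (UN k:K. spt (f k)) Un (UN k:K. spt (g k))"
  by (auto simp: spt_def)
 hence "finite (UN x:cyl K. spt (?H x))"
  by (rule finite_subset) (use f g in \<open>auto simp: smap_def\<close>)
 ultimately show ?thesis by (auto simp: smap_def)
qed

lemma shom_sline:
 assumes "smap K S f" "smap K S g" "scomplex S"
  and "!!k. k:K ==> EX si:S. spt (f k) Un spt (g k) <= si"
 shows "shom K S f g"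
 by (rule shomI[OF smap_sline[OF assms]]) auto

text \<open>By the collar, solvability of the extension problem depends only on the homotopy class
  of the boundary map. Approximations may therefore move the boundary map, as long as a homotopy
  brings it back.\<close>

lemma shom_extend:
 assumes H: "shom (bd n) S f g" and G: "smap (cb n) S G" "!!x. x:bd n ==> G x = g x"
 shows "sfills n S f"
proof -
 obtain H where H: "smap (cyl (bd n)) S H" "ALL k:bd n. H (k, 0) = f k & H (k, 1) = g k"
  using assms unfolding shom_def by blast
 have "EX F. continuous_map (top_of_set (cb n)) euclidean F & (ALL x:bd n. F x = H (x, 0)) &
  F`cb n <= G`cb n Un H`cyl (bd n)"
 proof (rule collar)
  show "continuous_map (top_of_set (cyl (bd n))) euclidean H" "continuous_map (top_of_set (cb n)) euclidean G"
   using H(1) G(1) by (simp_all add: smap_def)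
  show "H (x, 1) = G x" if "x:bd n" for x using that G(2) H(2) by simp
 qed
 then obtain F where F: "continuous_map (top_of_set (cb n)) euclidean F" "ALL x:bd n. F x = H (x, 0)"
  "F`cb n <= G`cb n Un H`cyl (bd n)"
  by blast
 have "(UN k:cb n. spt (F k)) <= (UN k:cb n. spt (G k)) Un (UN x:cyl (bd n). spt (H x))"
 proof (rule UN_least)
  fix x assume "x:cb n"
  hence "F x:G`cb n Un H`cyl (bd n)" using F(3) by (meson image_eqI subsetD)
  thus "spt (F x) <= (UN k:cb n. spt (G k)) Un (UN x:cyl (bd n). spt (H x))" by auto
 qed
 hence "finite (UN k:cb n. spt (F k))"
  by (rule finite_subset) (use H G in \<open>auto simp: smap_def\<close>)
 moreover have "F`cb n <= realiz S"
  by (rule order_trans[OF F(3)]) (use H(1) G(1) in \<open>simp add: smap_def\<close>)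
 ultimately have "smap (cb n) S F" using F(1) by (simp add: smap_def)
 thus ?thesis using F(2) H(2) by auto
qed

section \<open>Grid approximation\<close>

text \<open>The weights below are positive on the open stars of the vertices \<open>p\<close> of the Kuhn triangulation
 of the lattice, scaled by \<open>1/N\<close>. Vertices of a common simplex are comparable for the product order
 and differ by at most 1 in each coordinate, so that the coordinate sum modulo \<open>d + 1\<close> is a proper
 colouring.\<close>

definition gw :: "nat => nat => (nat => int) => rseq => real" where
 "gw d N p t = (PROD i<d. max 0 (1 - (p i - N * t i))) * (PROD i<d. max 0 (1 + (p i - N * t i))) *
  (PROD i<d. PROD j<d. max 0 (1 - ((p i - N * t i) - (p j - N * t j))))"

lemma gw_nonneg: "0 <= gw d N p t"
 by (auto simp: gw_def intro!: mult_nonneg_nonneg prod_nonneg)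

lemma prod_max_pos_iff: "finite A ==> 0 < (PROD i:A. max 0 (f i)) \<longleftrightarrow> (ALL i:A. 0 < (f i::real))"
 by (metis (no_types, lifting) less_eq_real_def linorder_not_less max.cobounded1 max.commute max.strict_coboundedI2 max_def prod_pos prod_zero)

lemma gw_pos_iff:
 "0 < gw d N p t \<longleftrightarrow> (ALL i<d. \<bar>p i - N * t i\<bar> < 1) & (ALL i<d. ALL j<d. (p i - N * t i) - (p j - N * t j) < 1)"
proof -
 define A where "A = (PROD i<d. max 0 (1 - (p i - N * t i)))"
 define B where "B = (PROD i<d. max 0 (1 + (p i - N * t i)))"
 define C where "C = (PROD i<d. PROD j<d. max 0 (1 - ((p i - N * t i) - (p j - N * t j))))"
 have nn: "0 <= A" "0 <= B" "0 <= C" by (auto simp: A_def B_def C_def intro!: prod_nonneg)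
 have A: "0 < A \<longleftrightarrow> (ALL i<d. 0 < 1 - (p i - N * t i))" unfolding A_def by (subst prod_max_pos_iff) auto
 have B: "0 < B \<longleftrightarrow> (ALL i<d. 0 < 1 + (p i - N * t i))" unfolding B_def by (subst prod_max_pos_iff) auto
 have "C = (PROD i<d. max 0 (PROD j<d. max 0 (1 - ((p i - N * t i) - (p j - N * t j)))))"
  unfolding C_def by (rule prod.cong) (auto intro!: max_absorb2[symmetric] prod_nonneg)
 hence C: "0 < C \<longleftrightarrow> (ALL i<d. ALL j<d. 0 < 1 - ((p i - N * t i) - (p j - N * t j)))"
  by (simp add: prod_max_pos_iff) auto
 have "0 < gw d N p t \<longleftrightarrow> 0 < A & 0 < B & 0 < C"
  unfolding gw_def A_def[symmetric] B_def[symmetric] C_def[symmetric] using nn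
  by (auto simp: zero_less_mult_iff)
 thus ?thesis unfolding A B C by (auto simp: abs_less_iff algebra_simps)
qed

lemma continuous_on_gw: "continuous_on S (gw d N p)"
 unfolding gw_def by (intro continuous_intros continuous_on_coord)

text \<open>Rounding every coordinate down gives displacements in the interval (-1, 0], so no two of
  them differ by 1 or more.\<close>

lemma gw_covers: "0 < gw d N (%i. if i < d then \<lfloor>N * t i\<rfloor> else 0) t"
 unfolding gw_pos_iff
proof (intro conjI allI impI)
 fix i j assume "i < d" "j < d"
 have "\<lfloor>N * t i\<rfloor> - N * t i <= 0" "-1 < \<lfloor>N * t j\<rfloor> - N * t j"
  using floor_correct[of "N * t i"] floor_correct[of "N * t j"] by linarith+
 hence "\<lfloor>N * t i\<rfloor> - N * t i - (\<lfloor>N * t j\<rfloor> - N * t j) < 1" by linarith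
 thus "(if i < d then \<lfloor>N * t i\<rfloor> else 0) - N * t i - ((if j < d then \<lfloor>N * t j\<rfloor> else 0) - N * t j) < 1"
  using \<open>i < d\<close> \<open>j < d\<close> by simp
next
 fix i assume "i < d"
 thus "\<bar>(if i < d then \<lfloor>N * t i\<rfloor> else 0) - N * t i\<bar> < 1"
  using floor_correct[of "N * t i"] by simp linarith
qed

lemma gw_close:
 assumes "0 < gw d N p t" "0 < gw d N q t" "i < d" shows "\<bar>p i - q i\<bar> <= 1"
proof -
 have "\<bar>p i - N * t i\<bar> < 1" "\<bar>q i - N * t i\<bar> < 1"
  using assms by (auto simp: gw_pos_iff)
 thus ?thesis by linarith
qed

lemma gw_comparable:
 assumes p: "0 < gw d N p t" and q: "0 < gw d N q t"
 shows "(ALL i<d. p i <= q i) | (ALL i<d. q i <= p i)"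
proof (rule ccontr)
 assume "~ ?thesis"
 then obtain i j where ij: "i < d" "j < d" "q i < p i" "p j < q j" by (auto simp: not_le)
 have "(p i - N * t i) - (p j - N * t j) < 1" "(q j - N * t j) - (q i - N * t i) < 1"
  using p q ij by (auto simp: gw_pos_iff)
 moreover have "real_of_int (q i) + 1 <= p i" "real_of_int (p j) + 1 <= q j" using ij by linarith+
 ultimately show False by linarith
qed

definition gcol :: "nat => (nat => int) => nat" where
 "gcol d p = nat ((SUM i<d. p i) mod (int d + 1))"

lemma gcol_le: "gcol d p <= d"
 by (simp add: gcol_def nat_le_iff) (smt (verit) of_nat_0_le_iff pos_mod_bound)

text \<open>For comparable lattice points of one simplex every coordinate grows by 0 or 1, so the
  coordinate sums differ by at most \<open>d\<close>. Equal residues modulo \<open>d + 1\<close>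
  force equal sums, and a vanishing sum of nonnegative terms vanishes termwise.\<close>

lemma gcol_inj_aux:
 assumes p: "0 < gw d N p t" and q: "0 < gw d N q t" and le: "ALL i<d. p i <= q i"
  and c: "gcol d p = gcol d q" and i: "i < d"
 shows "p i = q i"
proof -
 have "(SUM i<d. p i) mod (int d + 1) = (SUM i<d. q i) mod (int d + 1)"
  using c unfolding gcol_def by (subst (asm) eq_nat_nat_iff) auto
 hence dv: "int d + 1 dvd (SUM i<d. q i) - (SUM i<d. p i)"
  by (metis mod_eq_dvd_iff)
 have eq: "(SUM i<d. q i) - (SUM i<d. p i) = (SUM i<d. q i - p i)" by (simp add: sum_subtractf)
 have "q i - p i <= 1" if "i < d" for i using gw_close[OF p q that] by linarith
 hence "(SUM i<d. q i - p i) <= (SUM i<d. 1)" by (intro sum_mono) auto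
 hence "(SUM i<d. q i - p i) <= int d" by simp
 moreover have nn: "0 <= (SUM i<d. q i - p i)" using le by (intro sum_nonneg) auto
 ultimately have "(SUM i<d. q i - p i) = 0"
  using dv unfolding eq by (smt (verit) zdvd_not_zless)
 hence "ALL i:{..<d}. q i - p i = 0"
  using le by (subst (asm) sum_nonneg_eq_0_iff) auto
 thus ?thesis using i by auto
qed

lemma gcol_inj:
 assumes "0 < gw d N p t" "0 < gw d N q t" "gcol d p = gcol d q" "i < d"
 shows "p i = q i"
 using gcol_inj_aux[of d N p t q i] gcol_inj_aux[of d N q t p i] gw_comparable[of d N p t q] assms by auto

text \<open>The metric on sequences weights the coordinates by powers of 1/2, whose sum is
  2.\<close>

lemma dist_fun_le:
 fixes x y :: "nat => real"
 assumes "!!i. \<bar>x i - y i\<bar> <= c"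
 shows "dist x y <= 2 * c"
proof -
 have sm: "summable (%n. (1/2::real)^n)" by (simp add: summable_geometric)
 have "dist x y <= (\<Sum>n. (1/2)^n * c)"
  unfolding dist_fun_def
 proof (rule suminf_le)
  fix n :: nat
  show "(1/2) ^ n * min (dist (x (from_nat n)) (y (from_nat n))) 1 <= (1/2) ^ n * c"
   using assms[of "from_nat n"] by (intro mult_left_mono) (auto simp: dist_real_def)
  show "summable (%n. (1/2) ^ n * min (dist (x (from_nat n)) (y (from_nat n))) 1)"
   by (rule summable_comparison_test'[OF sm, of 0]) auto
  show "summable (%n. (1/2) ^ n * c)" using sm by (rule summable_mult2)
 qed
 also have "\<dots> = 2 * c" by (subst suminf_mult2[symmetric, OF sm]) (simp add: suminf_geometric)
 finally show ?thesis .
qed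

text \<open>Uniform continuity of finitely many functions. Two grid steps is the most by which two
  points in the star of one lattice point can differ.\<close>

lemma uniform_grid:
 fixes g :: "'v => rseq => real"
 assumes K: "compact K" "K <= cb d" and F: "finite F" and g: "!!v. v:F ==> continuous_on K (g v)" and e: "0 < e"
 shows "EX N::nat>0. ALL v:F. ALL s:K. ALL t:K. (ALL i<d. \<bar>real N * s i - real N * t i\<bar> <= 2) --> \<bar>g v s - g v t\<bar> < e"
proof -
 have "ALL v:F. EX r>0. ALL s:K. ALL t:K. dist s t < r --> \<bar>g v s - g v t\<bar> < e"
 proof
  fix v assume "v:F"
  hence "uniformly_continuous_on K (g v)"
   using compact_uniformly_continuous g K(1) by blast
  thus "EX r>0. ALL s:K. ALL t:K. dist s t < r --> \<bar>g v s - g v t\<bar> < e"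
   unfolding uniformly_continuous_on_def using e by (metis dist_real_def dist_commute)
 qed
 then obtain r where r: "!!v. v:F ==> 0 < r v"
  "!!v s t. v:F ==> s:K ==> t:K ==> dist s t < r v ==> \<bar>g v s - g v t\<bar> < e"
  by metis
 define R where "R = Min (insert 1 (r`F))"
 have R: "0 < R" "!!v. v:F ==> R <= r v" using F r by (auto simp: R_def)
 \<comment> \<open>Two grid steps are \<open>2 / N\<close> in each coordinate, hence a distance of
   at most \<open>4 / N\<close>.\<close>
 obtain N :: nat where N: "4 / R < N" using reals_Archimedean2 by blast
 hence N0: "0 < N" using R by (smt (verit) divide_pos_pos of_nat_0_less_iff)
 have "\<bar>g v s - g v t\<bar> < e"
  if "v:F" "s:K" "t:K" and c: "ALL i<d. \<bar>real N * s i - real N * t i\<bar> <= 2" for v and s t :: "nat => real"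
 proof -
  have "\<bar>s i - t i\<bar> <= 2 / N" for i
  proof (cases "i < d")
   case True
   hence "\<bar>real N * (s i - t i)\<bar> <= 2" using c by (simp add: right_diff_distrib)
   hence "real N * \<bar>s i - t i\<bar> <= 2" by (simp add: abs_mult)
   thus ?thesis using N0 by (simp add: field_simps)
  next
   case False
   hence "s i = 0" "t i = 0" using that(2,3) K(2) by (auto simp: cb_def)
   thus ?thesis by simp
  qed
  hence "dist s t <= 2 * (2 / N)" by (rule dist_fun_le)
  also have "\<dots> < R" using N R N0 by (simp add: field_simps)
  also have "\<dots> <= r v" using R that by auto
  finally show ?thesis using r that by auto
 qed
 thus ?thesis using N0 by blast
qed

text \<open>Simplicial approximation without a triangulated domain: the weights \<open>w\<close>
  live on the stars of lattice points, and \<open>fi\<close> chooses for each star a vertex that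
  stays in the support of \<open>f k\<close> throughout the star. The colours limit the lattice
  points active at one point to \<open>d + 1\<close>; the last clause limits the stars meeting a
  given star.\<close>

lemma grid_approx:
 fixes f :: "rseq => 'v => real"
 assumes K: "compact K" "K <= cb d" and f: "smap K S f" and S: "scomplex S"
 obtains P :: "(nat => int) set" and w :: "(nat => int) => rseq => real"
  and fi :: "(nat => int) => 'v" and col :: "(nat => int) => nat" where
  "finite P" "!!p. p:P ==> continuous_on K (w p)"
  "!!p k. p:P ==> k:K ==> 0 <= w p k & w p k <= 1"
  "!!k. k:K ==> EX p:P. 0 < w p k"
  "!!p k. p:P ==> k:K ==> 0 < w p k ==> fi p:spt (f k)"
  "!!p. col p <= d" "!!k. k:K ==> inj_on col {p:P. 0 < w p k}"
  "!!p. p:P ==> card {q:P. EX k:K. 0 < w p k & 0 < w q k} <= 3 ^ d"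
proof -
 define F where "F = (UN k:K. spt (f k))"
 have F: "finite F" using f by (auto simp: F_def smap_def)
 \<comment> \<open>At each point the coordinates indexed by \<open>F\<close> add up to 1, so one of
   them is at least \<open>e\<close>.\<close>
 define e where "e = 1 / (1 + real (card F))"
 have e: "0 < e" by (simp add: e_def)
 have "!!v. v:F ==> continuous_on K (%k. f k v)"
  using f unfolding smap_def by (blast intro: continuous_on_coord')
 note cf = this
 obtain N :: nat where N: "N > 0"
  "!!v s t. v:F ==> s:K ==> t:K ==> (ALL i<d. \<bar>real N * s i - real N * t i\<bar> <= 2) ==> \<bar>f s v - f t v\<bar> < e"
  using uniform_grid[of K d F "%v k. f k v" e] K F cf e by (metis (no_types, lifting))
 define P where "P = {p::nat => int. ALL i. (i:{..<d} --> p i:{-1..int N + 1}) & (i ~: {..<d} --> p i = 0)}"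
 have finP: "finite P" unfolding P_def
  using finite_set_of_finite_funs[of "{..<d}" "{-1..int N + 1}" "0::int"] by simp
 define W where "W = (%k. SUM p:P. gw d N p k)"
 have cover: "EX p:P. 0 < gw d N p k" if "k:K" for k
 proof (rule bexI[where x = "%i. if i < d then \<lfloor>real N * k i\<rfloor> else 0"])
  show "0 < gw d N (%i. if i < d then \<lfloor>real N * k i\<rfloor> else 0) k" by (rule gw_covers)
  have fl: "0 <= \<lfloor>real N * k i\<rfloor> & \<lfloor>real N * k i\<rfloor> <= int N" if "i < d" for i
  proof -
   have "0 <= k i" "k i <= 1" using that \<open>k : K\<close> K(2) by (auto simp: cb_def)
   hence "0 <= real N * k i" "real N * k i <= real N" by (simp_all add: mult_left_le)
   thus ?thesis by (simp add: floor_le_iff)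
  qed
  have "-1 <= \<lfloor>real N * k i\<rfloor> & \<lfloor>real N * k i\<rfloor> <= int N + 1" if "i < d" for i
   using fl[OF that] by linarith
  thus "(%i. if i < d then \<lfloor>real N * k i\<rfloor> else 0):P"
   unfolding P_def by simp
 qed
 have W: "0 < W k" if "k:K" for k
  unfolding W_def using wmap_total_pos[of P "gw d N" k] finP gw_nonneg cover[OF that] by blast
 define w where "w = (%p k. gw d N p k / W k)"
 have wpos: "0 < w p k \<longleftrightarrow> 0 < gw d N p k" if "k:K" for p k
  using W[OF that] by (simp add: w_def zero_less_divide_iff)
 have ex: "EX v:F. e <= f k v" if k: "k:K" for k
 proof (rule ccontr)
  assume "~ ?thesis"
  hence lt: "!!v. v:F ==> f k v < e" by auto
  have fk: "f k:realiz S" using f k by (auto simp: smap_def)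
  have "1 = sum (f k) F"
  proof -
   have "sum (f k) (spt (f k)) = sum (f k) F"
    by (rule sum.mono_neutral_left[OF F]) (use k in \<open>auto simp: F_def spt_def\<close>)
   thus ?thesis using fk by (simp add: realiz_def)
  qed
  also have "\<dots> <= (SUM v:F. e)" by (intro sum_mono) (use lt less_imp_le in blast)
  also have "\<dots> < 1" by (simp add: e_def field_simps)
  finally show False by simp
 qed
 \<comment> \<open>\<open>tp p\<close> is a sample point in the star of \<open>p\<close>, and
   \<open>fi p\<close> a vertex with coordinate at least \<open>e\<close> there. Coordinates vary by
   less than \<open>e\<close> within the star, so this vertex never leaves the support.\<close>
 define tp where "tp = (%p. SOME k. k:K & 0 < gw d N p k)"
 define fi where "fi = (%p. SOME v. v:F & e <= f (tp p) v)"
 have tp: "tp p:K & 0 < gw d N p (tp p)" if "k:K" "0 < gw d N p k" for p k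
  unfolding tp_def
  using someI_ex[of "%k. k:K & 0 < gw d N p k"] that by blast
 have fi: "fi p:F & e <= f (tp p) (fi p)" if "k:K" "0 < gw d N p k" for p k
  unfolding fi_def
  using someI_ex[of "%v. v:F & e <= f (tp p) v"] ex tp[OF that] by blast
 show thesis
 proof (rule that[of P w fi "gcol d"])
  show "finite P" by (rule finP)
  show "continuous_on K (w p)" if "p:P" for p
   unfolding w_def W_def
  proof (intro continuous_on_divide continuous_on_sum continuous_on_gw ballI)
   show "(SUM p:P. gw d N p k) ~= 0" if "k:K" for k using W[OF that] by (simp add: W_def)
  qed
  show "0 <= w p k & w p k <= 1" if "p:P" "k:K" for p k
  proof -
   have "gw d N p k <= W k" unfolding W_def by (rule member_le_sum) (use that finP gw_nonneg in auto)
   thus ?thesis using W[OF that(2)] gw_nonneg by (simp add: w_def)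
  qed
  show "EX p:P. 0 < w p k" if "k:K" for k using cover[OF that] wpos[OF that] by auto
  show "fi p:spt (f k)" if "p:P" "k:K" "0 < w p k" for p k
  proof -
   have g: "0 < gw d N p k" using that wpos by auto
   note 1 = tp[OF that(2) g] and 2 = fi[OF that(2) g]
   have "\<bar>N * tp p i - N * k i\<bar> <= 2" if "i < d" for i
   proof -
    have "\<bar>p i - N * k i\<bar> < 1" "\<bar>p i - N * tp p i\<bar> < 1" using that g 1 by (auto simp: gw_pos_iff)
    thus ?thesis by linarith
   qed
   hence "\<bar>f (tp p) (fi p) - f k (fi p)\<bar> < e" using N(2) 1 2 that(2) by blast
   hence "f k (fi p) ~= 0" using 2 by auto
   thus ?thesis by (simp add: spt_def)
  qed
  show "gcol d p <= d" for p by (rule gcol_le)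
  show "inj_on (gcol d) {p:P. 0 < w p k}" if k: "k:K" for k
  proof (rule inj_onI)
   fix p q assume pq: "p:{p:P. 0 < w p k}" "q:{p:P. 0 < w p k}" "gcol d p = gcol d q"
   show "p = q"
   proof
    fix i show "p i = q i"
     using gcol_inj[of d N p k q i] pq wpos[OF k] by (cases "i < d") (auto simp: P_def)
   qed
  qed
  show "card {q:P. EX k:K. 0 < w p k & 0 < w q k} <= 3 ^ d" if "p:P" for p
  proof -
   let ?A = "{q:P. EX k:K. 0 < w p k & 0 < w q k}"
   let ?B = "{..<d} \<rightarrow>\<^sub>E {-1, 0, 1::int}"
   define h where "h = (%q. restrict (%i. q i - p i) {..<d})"
   have "inj_on h ?A"
   proof (rule inj_onI)
    fix q q' assume q: "q:?A" "q':?A" "h q = h q'"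
    show "q = q'"
    proof
     fix i
     show "q i = q' i"
     proof (cases "i < d")
      case True
      thus ?thesis using fun_cong[OF q(3), of i] by (simp add: h_def)
     next
      case False
      thus ?thesis using q by (auto simp: P_def)
     qed
    qed
   qed
   moreover have "h`?A <= ?B"
   proof (rule image_subsetI)
    fix q assume "q:?A"
    then obtain k where k: "k:K" "0 < w p k" "0 < w q k" by blast
    have "q i - p i:{-1, 0, 1}" if "i < d" for i
     using gw_close[of d N p k q i] wpos[OF k(1)] k that by auto
    thus "h q:?B" by (simp add: h_def)
   qed
   ultimately have "card ?A <= card ?B"
    by (intro card_inj_on_le) (auto intro!: finite_PiE)
   also have "\<dots> = 3 ^ d" by (simp add: card_PiE numeral_3_eq_3)
   finally show ?thesis .
  qed
 qed
qed

section \<open>Homotopies between maps into order complexes\<close>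

text \<open>The order complex of a preorder. Distinct elements that compare both ways may share a
  simplex, and the case \<open>x = y\<close> asks that each vertex compares with itself.\<close>

definition chains :: "('v => 'v => bool) => 'v set => 'v set set" where
 "chains lq D = {si. finite si & si ~= {} & si <= D & (ALL x:si. ALL y:si. lq x y | lq y x)}"

lemma scomplex_chains: "scomplex (chains lq D)"
 unfolding scomplex_def chains_def by (auto intro: finite_subset)

lemma chains_mono: "D <= D' ==> chains lq D <= chains lq D'"
 by (auto simp: chains_def)

lemma continuous_on_Min:
 assumes "finite A" "A ~= {}" "!!a. a:A ==> continuous_on K (f a)"
 shows "continuous_on K (%k. Min ((%a. f a k :: real)`A))"
 using assms
proof (induction A rule: finite_ne_induct)
 case (insert a A)
 hence "continuous_on K (%k. min (f a k) (Min ((%a. f a k)`A)))"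
  by (intro continuous_on_min) auto
 thus ?case using insert by simp
qed simp

lemma continuous_on_Max:
 assumes "finite A" "A ~= {}" "!!a. a:A ==> continuous_on K (f a)"
 shows "continuous_on K (%k. Max ((%a. f a k :: real)`A))"
 using assms
proof (induction A rule: finite_ne_induct)
 case (insert a A)
 hence "continuous_on K (%k. max (f a k) (Max ((%a. f a k)`A)))"
  by (intro continuous_on_max) auto
 thus ?case using insert by simp
qed simp

lemma continuous_on_Max_insert:
 assumes "finite A" "!!a. a:A ==> continuous_on K (f a)" "continuous_on K g"
 shows "continuous_on K (%k. Max (insert (g k) ((%a. f a k :: real)`A)))"
proof (cases "A = {}")
 case False
 hence "continuous_on K (%k. max (g k) (Max ((%a. f a k)`A)))"
  using assms by (intro continuous_on_max continuous_on_Max) auto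
 thus ?thesis using assms False by simp
qed (use assms in simp)

text \<open>The barycentric subdivision in terms of the layers \<open>{p. l p \<ge> th}\<close>: the set \<open>S\<close> gets the length
 of the interval of levels \<open>th\<close> whose layer is \<open>S\<close>. The two functions count the levels below
 and above \<open>ta\<close>.\<close>

definition layer_below :: "'p set => ('p => real) => real => 'p set => real" where
 "layer_below P l ta S = max 0 (min (Min (l`S)) ta - Max (insert 0 (l`(P - S))))"

definition layer_above :: "'p set => ('p => real) => real => 'p set => real" where
 "layer_above P l ta S = max 0 (Min (l`S) - Max (insert ta (l`(P - S))))"

lemma layer_below_pos:
 assumes "finite P" "S <= P" "S ~= {}"
 shows "0 < layer_below P l ta S \<longleftrightarrow> 0 < ta & (ALL q:P - S. l q < ta) & (ALL p:S. 0 < l p & (ALL q:P - S. l q < l p))"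
proof -
 have fin: "finite S" "finite (P - S)" using assms finite_subset by auto
 have "0 < layer_below P l ta S \<longleftrightarrow> Max (insert 0 (l`(P - S))) < min (Min (l`S)) ta"
  by (auto simp: layer_below_def)
 also have "\<dots> \<longleftrightarrow> (ALL x:insert 0 (l`(P - S)). x < min (Min (l`S)) ta)"
  using fin by (subst Max_less_iff) auto
 also have "\<dots> \<longleftrightarrow> (ALL x:insert 0 (l`(P - S)). x < ta & (ALL p:S. x < l p))"
  using fin assms by (auto simp: Min_gr_iff)
 finally show ?thesis by auto
qed

lemma layer_above_pos:
 assumes "finite P" "S <= P" "S ~= {}"
 shows "0 < layer_above P l ta S \<longleftrightarrow> (ALL p:S. ta < l p & (ALL q:P - S. l q < l p))"
proof -
 have fin: "finite S" "finite (P - S)" using assms finite_subset by auto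
 have "0 < layer_above P l ta S \<longleftrightarrow> Max (insert ta (l`(P - S))) < Min (l`S)"
  by (auto simp: layer_above_def)
 also have "\<dots> \<longleftrightarrow> (ALL x:insert ta (l`(P - S)). x < Min (l`S))"
  using fin by (subst Max_less_iff) auto
 also have "\<dots> \<longleftrightarrow> (ALL x:insert ta (l`(P - S)). ALL p:S. x < l p)"
  using fin assms by (auto simp: Min_gr_iff)
 finally show ?thesis by auto
qed

lemma layer_below_0: "finite P ==> layer_below P l 0 S = 0"
proof -
 assume "finite P"
 hence "0 <= Max (insert 0 (l`(P - S)))" by (intro Max_ge) auto
 thus ?thesis by (simp add: layer_below_def)
qed

lemma wmap_drop:
 assumes "finite Q" "Q' <= Q" "!!q. q:Q - Q' ==> w q k = 0"
 shows "wmap Q w nu k = wmap Q' w nu k"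
proof
 fix v
 have "(SUM q:Q. w q k) = (SUM q:Q'. w q k)"
  by (rule sum.mono_neutral_right) (use assms in auto)
 moreover have "(\<Sum>q | q:Q & nu q = v. w q k) = (\<Sum>q | q:Q' & nu q = v. w q k)"
  by (rule sum.mono_neutral_right) (use assms in auto)
 ultimately show "wmap Q w nu k v = wmap Q' w nu k v"
  by (simp add: wmap_def)
qed

lemma wmap_reindex:
 assumes "inj_on h Q"
 shows "wmap (h`Q) w nu k = wmap Q (%q. w (h q)) (%q. nu (h q)) k"
proof
 fix v
 have *: "{q. q:h`Q & nu q = v} = h`{q. q:Q & nu (h q) = v}" by auto
 have "(\<Sum>q | q:h`Q & nu q = v. w q k) = (\<Sum>q | q:Q & nu (h q) = v. w (h q) k)"
  unfolding * by (subst sum.reindex) (use assms in \<open>auto simp: inj_on_def o_def\<close>)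
 moreover have "(SUM q:h`Q. w q k) = (SUM q:Q. w (h q) k)"
  by (subst sum.reindex) (use assms in \<open>auto simp: o_def\<close>)
 ultimately show "wmap (h`Q) w nu k v = wmap Q (%q. w (h q)) (%q. nu (h q)) k v"
  by (simp add: wmap_def)
qed

lemma wmap_cong:
 assumes "!!q. q:Q ==> w q k = w' q k'"
 shows "wmap Q w nu k = wmap Q w' nu k'"
proof
 fix v
 have "(\<Sum>q | q:Q & nu q = v. w q k) = (\<Sum>q | q:Q & nu q = v. w' q k')"
  by (rule sum.cong) (use assms in auto)
 moreover have "(SUM q:Q. w q k) = (SUM q:Q. w' q k')"
  by (rule sum.cong) (use assms in auto)
 ultimately show "wmap Q w nu k v = wmap Q w' nu k' v"
  by (simp add: wmap_def)
qed

lemma wmap_const: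
 assumes "(SUM q:Q. w q k) ~= 0" "!!q. q:Q ==> 0 < w q k ==> nu q = z" "!!q. q:Q ==> 0 <= (w q k::real)"
 shows "wmap Q w nu k = vpt z"
proof
 fix v
 have fin: "finite Q" using assms(1) by (meson sum.infinite)
 have 0: "w q k = 0" if "q:Q" "nu q ~= z" for q using assms(2,3) that by (metis less_eq_real_def)
 show "wmap Q w nu k v = vpt z v"
 proof (cases "v = z")
  case True
  have "(\<Sum>q | q:Q & nu q = v. w q k) = (SUM q:Q. w q k)"
   by (rule sum.mono_neutral_left) (use fin 0 True in auto)
  thus ?thesis using assms(1) True by (simp add: wmap_def vpt_def)
 next
  case False
  have "(\<Sum>q | q:Q & nu q = v. w q k) = 0"
   by (rule sum.neutral) (use 0 False in auto)
  thus ?thesis using False by (simp add: wmap_def vpt_def)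
 qed
qed

text \<open>The map given by barycentric subdivision: the layers of \<open>l\<close> at a point form
  a chain of sets, and \<open>Ps\<close> sends them to vertices. With the cut at 1 all levels are
  counted as long as \<open>l\<close> is at most 1.\<close>

definition lc :: "'p set => ('p => 'k => real) => ('p set => 'v) => 'k => 'v => real" where
 "lc P l Ps = wmap (Pow P - {{}}) (%S k. layer_below P (%p. l p k) 1 S) Ps"

text \<open>The set where \<open>l\<close> attains its maximum is always a layer; this keeps the
  total weight positive.\<close>

lemma top_layer:
 assumes "finite P" "EX p:P. 0 < (l p::real)"
 shows "EX S. S <= P & S ~= {} & (ALL p:S. ALL q:P - S. l q < l p) & (ALL p:S. 0 < l p) &
  (ALL p:S. ALL q:S. l p = l q)"
proof -
 define m where "m = Max (l`P)"
 have ne: "P ~= {}" using assms by auto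
 have m: "m:l`P" "!!p. p:P ==> l p <= m" using assms ne by (auto simp: m_def)
 have "0 < m" using assms m by force
 thus ?thesis
  by (intro exI[of _ "{p:P. l p = m}"]) (use m in \<open>force simp: less_le\<close>)
qed

lemma lc_support:
 assumes "finite P" "EX p:P. 0 < l p k" "!!p. p:P ==> l p k <= 1"
 shows "spt (lc P l Ps k) = Ps`{S:Pow P - {{}}. 0 < layer_below P (%p. l p k) 1 S}"
  and "0 < (SUM S:Pow P - {{}}. layer_below P (%p. l p k) 1 S)"
  and "!!S. S:Pow P - {{}} ==> 0 < layer_below P (%p. l p k) 1 S ==> S <= {p:P. 0 < l p k}"
proof -
 obtain S where S: "S <= P" "S ~= {}" "ALL p:S. ALL q:P - S. l q k < l p k"
  "ALL p:S. 0 < l p k" "ALL p:S. ALL q:S. l p k = l q k"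
  using top_layer[of P "%p. l p k", OF assms(1,2)] by blast
 have lt: "l q k < 1" if "q:P - S" for q
 proof -
  obtain p where "p:S" using S(2) by auto
  hence "l q k < l p k" "l p k <= 1" using S(1,3) assms(3) that by auto
  thus ?thesis by simp
 qed
 have "0 < layer_below P (%p. l p k) 1 S"
  unfolding layer_below_pos[OF assms(1) S(1,2)] using S(3,4) lt zero_less_one by blast
 hence ex: "EX S:Pow P - {{}}. 0 < layer_below P (%p. l p k) 1 S" using S(1,2) by auto
 have nn: "0 <= layer_below P (%p. l p k) 1 S" for S by (simp add: layer_below_def)
 show "spt (lc P l Ps k) = Ps`{S:Pow P - {{}}. 0 < layer_below P (%p. l p k) 1 S}"
  unfolding lc_def by (rule spt_wmap) (use assms(1) nn ex in auto)
 show "0 < (SUM S:Pow P - {{}}. layer_below P (%p. l p k) 1 S)"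
  using wmap_total_pos[of "Pow P - {{}}" "%S k. layer_below P (%p. l p k) 1 S" k] assms(1) nn ex by auto
 show "S <= {p:P. 0 < l p k}" if "S:Pow P - {{}}" "0 < layer_below P (%p. l p k) 1 S" for S
  using that layer_below_pos[OF assms(1), of S] by auto
qed

text \<open>Comparable order-reversing vertex maps are homotopic. At time \<open>ta\<close> the
  levels below \<open>ta\<close> use \<open>Ps\<close> and the levels above use \<open>Ps'\<close>.
  If \<open>S'\<close> is a layer below \<open>ta\<close> and \<open>S\<close> one above, then
  \<open>S'\<close> contains \<open>S\<close>, so \<open>Ps S'\<close> is below \<open>Ps S\<close>,
  which is below \<open>Ps' S\<close>. Hence all vertices in use form a chain.\<close>

lemma lc_shom:
 fixes l :: "'p => 'k::topological_space => real"
 assumes P: "finite P" and cont: "!!p. p:P ==> continuous_on K (l p)"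
  and l01: "!!p k. p:P ==> k:K ==> 0 <= l p k & l p k <= 1"
  and lpos: "!!k. k:K ==> EX p:P. 0 < l p k"
  and trans: "!!x y z. x:D ==> y:D ==> z:D ==> lq x y ==> lq y z ==> lq x z"
  and D: "!!k S. k:K ==> S <= {p:P. 0 < l p k} ==> S ~= {} ==> Ps S:D & Ps' S:D & lq (Ps S) (Ps' S)"
  and anti: "!!k S S'. k:K ==> S' <= {p:P. 0 < l p k} ==> S ~= {} ==> S <= S' ==>
   lq (Ps S') (Ps S) & lq (Ps' S') (Ps' S)"
 shows "shom K (chains lq D) (lc P l Ps) (lc P l Ps')"
proof -
 define R where "R = Pow P - {{}}"
 have R: "finite R" using P by (simp add: R_def)
 define Q where "Q = R \<times> (UNIV :: bool set)"
 define w where "w = (%(S, b) (k, ta). if b then layer_below P (%p. l p k) ta S else layer_above P (%p. l p k) ta S)"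
 define nu where "nu = (%(S, b). if b then Ps S else Ps' S)"
 let ?K = "cyl K"
 have act: "S <= {p:P. 0 < l p k} & S ~= {} & (ALL p:S. ALL q:P - S. l q k < l p k)"
  if "(S, b):Q" "0 < w (S, b) (k, ta)" "0 <= ta" for S b k ta
  using that layer_below_pos[OF P, of S "%p. l p k" ta] layer_above_pos[OF P, of S "%p. l p k" ta]
  by (cases b) (force simp: Q_def R_def w_def)+
 have nest: "S <= S' | S' <= S"
  if "(S, b):Q" "0 < w (S, b) (k, ta)" "(S', b'):Q" "0 < w (S', b') (k, ta)" "0 <= ta" for S b S' b' k ta
 proof (rule ccontr)
  assume "~ ?thesis"
  then obtain p q where "p:S" "p ~: S'" "q:S'" "q ~: S" by auto
  moreover have "p:P" "q:P" using that(1,3) \<open>p : S\<close> \<open>q : S'\<close> by (auto simp: Q_def R_def)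
  ultimately have "l q k < l p k" "l p k < l q k" using act[OF that(1,2,5)] act[OF that(3,4,5)] by auto
  thus False by simp
 qed
 have mixed: "S' <= S"
  if "(S, True):Q" "0 < w (S, True) (k, ta)" "(S', False):Q" "0 < w (S', False) (k, ta)" "0 <= ta" for S S' k ta
 proof
  fix q assume q: "q:S'"
  have "ta < l q k" using that(3,4) q layer_above_pos[OF P, of S' "%p. l p k" ta]
   by (auto simp: Q_def R_def w_def)
  moreover have "l q k < ta" if "q ~: S"
   using that \<open>(S, True) : Q\<close> \<open>0 < w (S, True) (k, ta)\<close> q \<open>(S', False) : Q\<close>
    layer_below_pos[OF P, of S "%p. l p k" ta] by (auto simp: Q_def R_def w_def)
  ultimately show "q:S" by force
 qed
 have "smap ?K (chains lq D) (wmap Q w nu)"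
 proof (rule smap_wmap)
  show "finite Q" using R by (simp add: Q_def)
  show "continuous_on ?K (w q)" if q: "q:Q" for q
  proof -
   obtain S b where Sb: "q = (S, b)" "S <= P" "S ~= {}" using q by (auto simp: Q_def R_def)
   have c: "continuous_on ?K (%x. l p (fst x))" if "p:P" for p
    by (rule continuous_on_compose2[OF cont[OF that]]) (auto intro: ctn)
   have fin: "finite S" "finite (P - S)" using Sb P finite_subset by auto
   have m: "continuous_on ?K (%x. Min ((%p. l p (fst x))`S))"
    using continuous_on_Min[OF fin(1) Sb(3), of ?K "%p x. l p (fst x)"] c Sb by blast
   have M: "continuous_on ?K (%x. Max (insert (g x) ((%p. l p (fst x))`(P - S))))"
    if "continuous_on ?K g" for g
    using continuous_on_Max_insert[OF fin(2), of ?K "%p x. l p (fst x)" g] c that by blast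
   have t: "continuous_on ?K (%x. snd x)" by (intro continuous_intros)
   have "continuous_on ?K (%x. layer_below P (%p. l p (fst x)) (snd x) S)"
    unfolding layer_below_def
    by (rule continuous_on_max continuous_on_min ctn m M t)+
   moreover have "continuous_on ?K (%x. layer_above P (%p. l p (fst x)) (snd x) S)"
    unfolding layer_above_def
    by (rule continuous_on_max ctn m M t)+
   moreover have "w q = (%x. if b then layer_below P (%p. l p (fst x)) (snd x) S
     else layer_above P (%p. l p (fst x)) (snd x) S)"
    by (auto simp: w_def Sb fun_eq_iff)
   ultimately show ?thesis by (cases b) simp_all
  qed
  show "0 <= w q x" for q x
   by (auto simp: w_def layer_below_def layer_above_def split: prod.split)
  show "EX q:Q. 0 < w q x" if x: "x:?K" for x
  proof -
   obtain k ta where k: "x = (k, ta)" "k:K" "0 <= ta" using x by auto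
   obtain S where S: "S <= P" "S ~= {}" "ALL p:S. ALL q:P - S. l q k < l p k"
    "ALL p:S. 0 < l p k" "ALL p:S. ALL q:S. l p k = l q k"
    using top_layer[of P "%p. l p k", OF P lpos[OF k(2)]] by blast
   obtain p where p: "p:S" using S(2) by auto
   show ?thesis
   proof (cases "ta < l p k")
    case True
    hence "0 < layer_above P (%p. l p k) ta S"
     unfolding layer_above_pos[OF P S(1,2)] using S(3,5) p by fastforce
    thus ?thesis using S(1,2) by (intro bexI[of _ "(S, False)"]) (auto simp: w_def k Q_def R_def)
   next
    case False
    have "l q k < ta" if "q:P - S" for q
    proof -
     have "l q k < l p k" using S(3) p that by blast
     thus ?thesis using False by linarith
    qed
    moreover have "0 < ta"
    proof -
     have "0 < l p k" using S(4) p by blast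
     thus ?thesis using False by linarith
    qed
    ultimately have "0 < layer_below P (%p. l p k) ta S"
     unfolding layer_below_pos[OF P S(1,2)] using S(3,4) by blast
    thus ?thesis using S(1,2) by (intro bexI[of _ "(S, True)"]) (auto simp: w_def k Q_def R_def)
   qed
  qed
  hence ne: "{q:Q. 0 < w q x} ~= {}" if "x:?K" for x using that by blast
  show "nu`{q:Q. 0 < w q x}:chains lq D" if x: "x:?K" for x
  proof -
   obtain k ta where k: "x = (k, ta)" "k:K" "0 <= ta" using x by auto
   have inD: "nu q:D" if "q:Q" "0 < w q x" for q
    using that act[of "fst q" "snd q" k ta] D[OF k(2), of "fst q"] k by (auto simp: nu_def split: prod.split)
   have main: "lq (nu (S', b')) (nu (S, b)) | lq (nu (S, b)) (nu (S', b'))"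
    if *: "(S, b):Q" "0 < w (S, b) x" "(S', b'):Q" "0 < w (S', b') x" and sub: "S <= S'" for S b S' b'
   proof -
    note a = act[OF *(1) *(2)[unfolded k] k(3)] act[OF *(3) *(4)[unfolded k] k(3)]
    have an: "lq (Ps S') (Ps S)" "lq (Ps' S') (Ps' S)" using anti[OF k(2), of S' S] a sub by auto
    have d: "Ps S:D" "Ps' S:D" "lq (Ps S) (Ps' S)" "Ps S':D" "Ps' S':D" "lq (Ps S') (Ps' S')"
     using D[OF k(2)] a by auto
    show ?thesis
    proof (cases "b = b'")
     case True
     thus ?thesis using an by (cases b) (auto simp: nu_def)
    next
     case False
     show ?thesis
     proof (cases b)
      case True
      hence "S' <= S" using mixed[of S k ta S'] * k False by auto
      hence "S = S'" using sub by auto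
      thus ?thesis using d True False by (auto simp: nu_def)
     next
      case b: False
      hence "lq (Ps S') (Ps' S)" using trans[OF _ _ _ an(1) d(3)] d by blast
      thus ?thesis using b False by (auto simp: nu_def)
     qed
    qed
   qed
   have "lq (nu q) (nu q') | lq (nu q') (nu q)"
    if *: "q:Q" "0 < w q x" "q':Q" "0 < w q' x" for q q'
   proof -
    obtain S b S' b' where q: "q = (S, b)" "q' = (S', b')" by fastforce
    show ?thesis
     using nest[of S b k ta S' b'] main[of S b S' b'] main[of S' b' S b] * k unfolding q by blast
   qed
   moreover have "finite Q" using R by (simp add: Q_def)
   ultimately show ?thesis
    using inD ne[OF x] by (auto simp: chains_def)
  qed
 qed
 moreover have min1: "Min ((%p. l p k)`S) <= 1" if "k:K" "S:R" for k S
 proof -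
  have S: "finite S" "S ~= {}" "S <= P" using P finite_subset that(2) by (auto simp: R_def)
  then obtain p where p: "p:S" "p:P" by auto
  have "Min ((%p. l p k)`S) <= l p k" using S(1) p(1) by (intro Min_le) auto
  thus ?thesis using l01[OF p(2) that(1)] by linarith
 qed
 \<comment> \<open>At both ends of the time interval one of the two families of weights vanishes and
   the other counts all levels.\<close>
 have part: "wmap Q w nu (k, c) = lc P l Ps0 k"
  if w: "!!S. S:R ==> w (S, ~ b) (k, c) = 0" "!!S. S:R ==> w (S, b) (k, c) = layer_below P (%p. l p k) 1 S"
   and nu: "(%S. nu (S, b)) = Ps0" for k c b Ps0
 proof -
  have "w q (k, c) = 0" if "q:Q - (%S. (S, b))`R" for q
   using that w(1) by (cases q; cases "snd q"; cases b) (auto simp: Q_def)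
  hence "wmap Q w nu (k, c) = wmap ((%S. (S, b))`R) w nu (k, c)"
   by (intro wmap_drop) (use R in \<open>auto simp: Q_def\<close>)
  also have "\<dots> = wmap R (%S. w (S, b)) (%S. nu (S, b)) (k, c)"
   by (rule wmap_reindex) (simp add: inj_on_def)
  also have "\<dots> = wmap R (%S k. layer_below P (%p. l p k) 1 S) Ps0 k"
   unfolding nu by (rule wmap_cong) (rule w(2))
  finally show ?thesis by (simp add: lc_def R_def)
 qed
 have "wmap Q w nu (k, 0) = lc P l Ps' k" if k: "k:K" for k
  using min1[OF k] layer_below_0[OF P]
  by (intro part[where b = False]) (simp_all add: w_def nu_def layer_below_def layer_above_def min_absorb1)
 moreover have "wmap Q w nu (k, 1) = lc P l Ps k" if k: "k:K" for k
 proof (rule part[where b = True])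
  fix S assume "S:R"
  moreover have "1 <= Max (insert 1 ((%p. l p k)`(P - S)))" using P by (intro Max_ge) auto
  ultimately show "w (S, ~ True) (k, 1) = 0" using min1[OF k, of S] by (simp add: w_def layer_above_def)
 qed (simp_all add: w_def nu_def)
 ultimately have "shom K (chains lq D) (lc P l Ps') (lc P l Ps)"
  by (rule shomI)
 thus ?thesis by (rule shom_sym)
qed

lemma scomplexD: "scomplex S ==> si:S ==> ta <= si ==> ta ~= {} ==> ta:S"
 unfolding scomplex_def by blast

lemma chain_least:
 assumes "finite A" "A ~= {}" "!!x y. x:A ==> y:A ==> lq x y | lq y x"
  "!!x y z. x:A ==> y:A ==> z:A ==> lq x y ==> lq y z ==> lq x z"
 shows "EX m:A. ALL x:A. lq m x"
 using assms
proof (induction A rule: finite_ne_induct)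
 case (singleton x)
 thus ?case by blast
next
 case (insert a A)
 have "EX m:A. ALL x:A. lq m x"
 proof (rule insert.IH)
  show "lq x y | lq y x" if "x:A" "y:A" for x y using insert.prems(1)[of x y] that by simp
  show "lq x z" if "x:A" "y:A" "z:A" "lq x y" "lq y z" for x y z
   using insert.prems(2)[of x y z] that by simp
 qed
 then obtain m where m: "m:A" "ALL x:A. lq m x" by blast
 have aa: "lq a a" using insert.prems(1)[of a a] by simp
 show ?case
 proof (cases "lq m a")
  case True
  thus ?thesis using m by auto
 next
  case False
  hence am: "lq a m" using insert.prems(1)[of a m] m by auto
  have "lq a x" if "x:A" for x
   using insert.prems(2)[of a m x] am m that by simp
  thus ?thesis using aa by auto
 qed
qed

text \<open>Grounding argument: \<open>car y\<close> are the possible contractions below \<open>y\<close>, \<open>con S\<close> the result of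
 performing the contractions in \<open>S\<close>, and \<open>Sg\<close> a set of pairwise compatible contractions such that
 any few contractions are all compatible with some member of \<open>Sg\<close>.\<close>

lemma null_below:
 fixes f :: "rseq => 'v => real" and car :: "'v => 'e set"
 assumes K: "compact K" "K <= cb d" and f: "smap K (chains lq D) f"
  and trans: "!!x y z. x:D ==> y:D ==> z:D ==> lq x y ==> lq y z ==> lq x z"
  and refl: "!!x. x:D ==> lq x x"
  and car: "!!y. y:D ==> car y ~= {}"
  and car_mono: "!!y z. y:D ==> z:D ==> lq y z ==> car z <= car y"
  and car_con: "!!y S. y:D ==> S <= car y ==> finite S ==> S ~= {} ==> good S & lq y (con S)"
  and con: "!!S. good S ==> con S:D"
  and con_anti: "!!S S'. good S ==> good S' ==> S <= S' ==> lq (con S') (con S)"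
  and good_Un: "!!S T. good S ==> card S <= Suc d ==> T <= Sg ==> finite T ==> ALL s:T. ALL a:S. dis s a ==> good (S Un T)"
  and good_Sg: "!!T. T <= Sg ==> finite T ==> T ~= {} ==> good T"
  and ground: "!!A. finite A ==> card A <= 3 ^ d ==> A <= (UN y:D. car y) ==> EX s:Sg. ALL a:A. dis s a"
 shows "EX z:D. shom K (chains lq D) f (%_. vpt z)"
proof (cases "K = {}")
 case True
 obtain s where "s:Sg" using ground[of "{}"] by auto
 hence "con {s}:D" using good_Sg[of "{s}"] con by auto
 moreover have "shom K (chains lq D) f (%_. vpt (con {s}))"
  unfolding True by (rule shomI[where H = "%_. vpt (con {s})"]) (auto simp: smap_def)
 ultimately show ?thesis by blast
next
 case False
 show ?thesis
 proof (rule grid_approx[OF K f scomplex_chains])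
 fix P :: "(nat => int) set" and w :: "(nat => int) => rseq => real"
  and fi :: "(nat => int) => 'v" and col :: "(nat => int) => nat"
 assume P: "finite P" "!!p. p:P ==> continuous_on K (w p)"
  "!!p k. p:P ==> k:K ==> 0 <= w p k & w p k <= 1"
  "!!k. k:K ==> EX p:P. 0 < w p k"
  "!!p k. p:P ==> k:K ==> 0 < w p k ==> fi p:spt (f k)"
  "!!p. col p <= d" "!!k. k:K ==> inj_on col {p:P. 0 < w p k}"
  "!!p. p:P ==> card {q:P. EX k:K. 0 < w p k & 0 < w q k} <= 3 ^ d"
 define act where "act = (%k. {p:P. 0 < w p k})"
 define nbr where "nbr = (%p. {q:P. EX k:K. 0 < w p k & 0 < w q k})"
 define e where "e = (%p. SOME e. e:car (fi p))"
 have fD: "spt (f k) <= D" "finite (spt (f k))" "!!x y. x:spt (f k) ==> y:spt (f k) ==> lq x y | lq y x"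
  if "k:K" for k
  using smap_support[OF f that] unfolding chains_def by blast+
 have fi: "fi p:spt (f k)" if "k:K" "p:act k" for k p
  using P(5) that by (simp add: act_def)
 have fiD: "fi p:D" if "k:K" "p:act k" for k p
  using fi[OF that] fD(1)[OF that(1)] by blast
 have e: "e p:car (fi p)" if "k:K" "p:act k" for k p
  unfolding e_def by (rule someI_ex) (use car[OF fiD[OF that]] in blast)
 have nbr: "q:nbr p" if "k:K" "p:act k" "q:act k" for k p q
  using that unfolding nbr_def act_def by blast
 have finact: "finite (act k)" for k using P(1) by (simp add: act_def)
 have finsub: "finite S" if "S <= act k" for S k using finact that by (rule rev_finite_subset)
 \<comment> \<open>The contractions chosen at the at most \<open>3 ^ d\<close> neighbours of
   \<open>p\<close> leave a member of \<open>Sg\<close> compatible with all of them.\<close>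
 define s where "s = (%p. SOME s. s:Sg & (ALL a:e`nbr p. dis s a))"
 have s: "s p:Sg & (ALL a:e`nbr p. dis (s p) a)" if "p:P" for p
 proof -
  have "finite (nbr p)" using P(1) by (simp add: nbr_def)
  hence "card (e`nbr p) <= 3 ^ d" using P(8)[OF that] card_image_le order_trans unfolding nbr_def by blast
  moreover have "e`nbr p <= (UN y:D. car y)"
  proof (rule image_subsetI)
   fix q assume "q:nbr p"
   then obtain k where "k:K" "q:act k" unfolding nbr_def act_def by blast
   thus "e q:(UN y:D. car y)" using e fiD by blast
  qed
  ultimately have "EX s:Sg. ALL a:e`nbr p. dis s a" using ground \<open>finite (nbr p)\<close> by blast
  thus ?thesis
   unfolding s_def using someI_ex[of "%s. s:Sg & (ALL a:e`nbr p. dis s a)"] by blast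
 qed
 \<comment> \<open>The least vertex that \<open>fi\<close> takes on \<open>S\<close>. As
   \<open>car\<close> shrinks upwards, it admits the contractions of all these vertices at
   once.\<close>
 define Ps where "Ps = (%S. SOME y. y:fi`S & (ALL z:fi`S. lq y z))"
 define A where "A = (UN k:K. act k)"
 have A: "finite A" "A <= P" using P(1) finite_subset[of A P] by (auto simp: A_def act_def)
 have An: "A ~= {}" using False P(4) by (auto simp: A_def act_def)
 have actA: "S <= A" if "k:K" "S <= act k" for k S using that by (auto simp: A_def)
 have h1: "Ps S:fi`S & (ALL z:fi`S. lq (Ps S) z)" if k: "k:K" and S: "S <= act k" "S ~= {}" for k S
 proof -
  have sub: "fi`S <= spt (f k)" using fi[OF k] S by blast
  have "EX m:fi`S. ALL x:fi`S. lq m x"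
  proof (rule chain_least)
   show "finite (fi`S)" using finsub[OF S(1)] by simp
   show "fi`S ~= {}" using S by simp
   show "lq x y | lq y x" if "x:fi`S" "y:fi`S" for x y using fD(3)[OF k] sub that by blast
   show "lq x z" if "x:fi`S" "y:fi`S" "z:fi`S" "lq x y" "lq y z" for x y z
    using trans[of x y z] fD(1)[OF k] sub that by blast
  qed
  thus ?thesis
   unfolding Ps_def using someI_ex[of "%y. y:fi`S & (ALL z:fi`S. lq y z)"] by blast
 qed
 have h1D: "Ps S:D" if k: "k:K" and S: "S <= act k" "S ~= {}" for k S
  using h1[OF that] fiD[OF k] S(1) by auto
 have g2: "good (e`S) & lq (Ps S) (con (e`S))" if k: "k:K" and S: "S <= act k" "S ~= {}" for k S
 proof (rule car_con[OF h1D[OF that]])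
  show "e`S <= car (Ps S)"
  proof (rule image_subsetI)
   fix p assume p: "p:S"
   have "lq (Ps S) (fi p)" by (rule bspec[OF conjunct2[OF h1[OF that]] imageI[OF p]])
   moreover have pk: "p:act k" using p S(1) by (rule subsetD[rotated])
   ultimately have "car (fi p) <= car (Ps S)" by (intro car_mono[OF h1D[OF that] fiD[OF k]])
   thus "e p:car (Ps S)" by (rule subsetD) (rule e[OF k pk])
  qed
 qed (use finsub[OF S(1)] S in simp_all)
 have sS: "s`S <= Sg" "finite (s`S)" if "S <= A" for S
  using s A(2) that finite_subset[OF that A(1)] by auto
 have g3: "good (e`S Un s`S)" if k: "k:K" and S: "S <= act k" "S ~= {}" for k S
 proof (rule good_Un)
  show "good (e`S)" using g2[OF that] by blast
  \<comment> \<open>The colours are injective on the active lattice points, so at most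
    \<open>d + 1\<close> contractions are in use at one point.\<close>
  have "card (act k) <= card {..d}"
   unfolding act_def by (rule card_inj_on_le[OF P(7)[OF k]]) (use P(6) in auto)
  moreover have "card S <= card (act k)" by (rule card_mono[OF finact S(1)])
  moreover have "card (e`S) <= card S" by (rule card_image_le[OF finsub[OF S(1)]])
  ultimately show "card (e`S) <= Suc d" by simp
  show "s`S <= Sg" "finite (s`S)" using sS[OF actA[OF k S(1)]] by auto
  show "ALL x:s`S. ALL a:e`S. dis x a"
  proof (intro ballI)
   fix x a assume "x:s`S" "a:e`S"
   then obtain p q where pq: "p:S" "x = s p" "q:S" "a = e q" by blast
   hence act: "p:act k" "q:act k" using S(1) by (meson subsetD)+
   hence "q:nbr p" by (rule nbr[OF k])
   moreover have "p:P" using act(1) by (simp add: act_def)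
   ultimately show "dis x a" using s[of p] unfolding pq(2,4) by simp
  qed
 qed
 have g4: "good (s`S)" if "S <= A" "S ~= {}" for S
  using good_Sg[of "s`S"] sS[OF that(1)] that by simp
 have lpos: "EX p:P. 0 < w p k" if "k:K" for k by (rule P(4)[OF that])
 have hom: "shom K (chains lq D) (lc P w Ps) (lc P w Ps')"
  if "!!k S. k:K ==> S <= act k ==> S ~= {} ==> Ps S:D & Ps' S:D & lq (Ps S) (Ps' S)"
   "!!k S S'. k:K ==> S' <= act k ==> S ~= {} ==> S <= S' ==> lq (Ps S') (Ps S) & lq (Ps' S') (Ps' S)"
  for Ps Ps' :: "(nat => int) set => 'v"
  by (rule lc_shom[OF P(1) P(2) P(3) lpos trans that[unfolded act_def]])
 define gd where "gd E \<longleftrightarrow> mono E & (ALL k:K. ALL S. S <= act k --> S ~= {} --> good (E S))" for E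
 have gdD: "good (E S)" if "gd E" "k:K" "S <= act k" "S ~= {}" for E k S using that by (simp add: gd_def)
 have gdm: "lq (con (E S')) (con (E S))" if E: "gd E" and S: "k:K" "S' <= act k" "S ~= {}" "S <= S'" for E k S S'
  by (rule con_anti[OF gdD[OF E S(1) _ S(3)] gdD[OF E S(1,2)]]) (use E S in \<open>auto simp: gd_def mono_def\<close>)
 have gd: "gd (%S. e`S)" "gd (%S. e`S Un s`S)" "gd (%S. s`S)" "gd (%_. s`A)"
  using g2 g3 g4 An actA by (auto simp: gd_def mono_def)
 \<comment> \<open>A zigzag of comparisons: go up from \<open>Ps S\<close> by contracting along
   \<open>e\<close>, down by adding the contractions \<open>s\<close>, up by dropping those of
   \<open>e\<close>, and down by using \<open>s\<close> on all of \<open>A\<close>. The last vertex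
   does not depend on the point.\<close>
 have H1: "shom K (chains lq D) (lc P w Ps) (lc P w (%S. con (e`S)))"
 proof (rule hom)
  show "Ps S:D & con (e`S):D & lq (Ps S) (con (e`S))" if "k:K" "S <= act k" "S ~= {}" for k S
   using h1D[OF that] g2[OF that] con by blast
  fix k S S' assume S: "k:K" "S' <= act k" "S ~= {}" "S <= S'"
  have S': "S' ~= {}" "S <= act k" using S by auto
  have "Ps S:fi`S'"
   using conjunct1[OF h1[OF S(1) S'(2) S(3)]] image_mono[OF S(4)] by (meson subsetD)
  hence "lq (Ps S') (Ps S)" by (rule bspec[OF conjunct2[OF h1[OF S(1,2) S'(1)]]])
  thus "lq (Ps S') (Ps S) & lq (con (e`S')) (con (e`S))" using gdm[OF gd(1) S] by blast
 qed
 have con_hom: "shom K (chains lq D) (lc P w (%S. con (E S))) (lc P w (%S. con (E' S)))"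
  if E: "gd E" "gd E'" "!!S. S <= A ==> E' S <= E S" for E E'
 proof (rule hom)
  fix k S assume S: "k:K" "S <= act k" "S ~= {}"
  note g = gdD[OF E(1) S] gdD[OF E(2) S]
  show "con (E S):D & con (E' S):D & lq (con (E S)) (con (E' S))"
   using con g con_anti[OF g(2,1) E(3)[OF actA[OF S(1,2)]]] by blast
 qed (use gdm E(1,2) in blast)
 have H2: "shom K (chains lq D) (lc P w (%S. con (e`S Un s`S))) (lc P w (%S. con (e`S)))"
  by (rule con_hom[OF gd(2,1)]) simp
 have H3: "shom K (chains lq D) (lc P w (%S. con (e`S Un s`S))) (lc P w (%S. con (s`S)))"
  by (rule con_hom[OF gd(2,3)]) simp
 have H4: "shom K (chains lq D) (lc P w (%_. con (s`A))) (lc P w (%S. con (s`S)))"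
  by (rule con_hom[OF gd(4,3)]) (rule image_mono)
 have P3: "!!p. p:P ==> w p k <= 1" if "k:K" for k
  using P(3) that by simp
 have smap1: "smap K (chains lq D) (lc P w Ps)"
 proof -
  obtain H where H: "smap (cyl K) (chains lq D) H" "ALL k:K. H (k, 0) = lc P w Ps k"
   using H1 unfolding shom_def by blast
  have "smap K (chains lq D) (%k. H (k, 0))"
   by (rule smap_compose[OF H(1)]) (auto intro!: continuous_intros)
  thus ?thesis using H(2) by (subst smap_cong[of K _ "%k. H (k, 0)"]) auto
 qed
 \<comment> \<open>\<open>Ps S\<close> is one of the vertices \<open>fi p\<close> with
   \<open>p\<close> active, and these belong to the simplex carrying \<open>f k\<close>.\<close>
 have "shom K (chains lq D) f (lc P w Ps)"
 proof (rule shom_sline[OF f smap1 scomplex_chains])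
  fix k assume k: "k:K"
  note sup = lc_support[where l = w and k = k, OF P(1) P(4)[OF k] P3[OF k]]
  have spt_eq: "spt (lc P w Ps k) = Ps`{S:Pow P - {{}}. 0 < layer_below P (%p. w p k) 1 S}"
   by (rule sup(1))
  have "spt (lc P w Ps k) <= spt (f k)"
  proof
   fix v assume "v:spt (lc P w Ps k)"
   then obtain S where S: "v = Ps S" "S:Pow P - {{}}" "0 < layer_below P (%p. w p k) 1 S"
    unfolding spt_eq by blast
   have "S <= act k"
    unfolding act_def by (rule sup(3)[OF _ S(2,3)])
   moreover have "S ~= {}" using S(2) by simp
   ultimately obtain p where "Ps S = fi p" "p:act k"
    using conjunct1[OF h1[OF k, of S]] by (metis imageE subsetD)
   thus "v:spt (f k)" using fi[OF k, of p] S(1) by simp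
  qed
  thus "EX si:chains lq D. spt (f k) Un spt (lc P w Ps k) <= si"
   using smap_support[OF f k] by blast
 qed
 hence "shom K (chains lq D) f (lc P w (%_. con (s`A)))"
  using H1 shom_sym[OF H2] H3 shom_sym[OF H4] shom_trans by blast
 then obtain H where H: "smap (cyl K) (chains lq D) H"
   "ALL k:K. H (k, 0) = f k & H (k, 1) = lc P w (%_. con (s`A)) k"
  unfolding shom_def by blast
 have "lc P w (%_. con (s`A)) k = vpt (con (s`A))" if k: "k:K" for k
  unfolding lc_def
 proof (rule wmap_const)
  have "0 < (SUM S:Pow P - {{}}. layer_below P (%p. w p k) 1 S)"
   by (rule lc_support(2)[where l = w and k = k, OF P(1) P(4)[OF k] P3[OF k]])
  thus "(SUM S:Pow P - {{}}. layer_below P (%p. w p k) 1 S) ~= 0" by simp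
 qed (auto simp: layer_below_def)
 hence "shom K (chains lq D) f (%_. vpt (con (s`A)))"
  by (intro shomI[OF H(1)]) (use H(2) in auto)
 thus "EX z:D. shom K (chains lq D) f (%_. vpt z)" using con[OF g4[OF order_refl An]] by blast
 qed
qed

text \<open>\<open>n\<close> bounds the number of vertices, so this is the skeleton of dimension
  \<open>n - 1\<close>.\<close>

definition skel :: "nat => 'v set set => 'v set set" where
 "skel n S = {si:S. card si <= n}"

lemma skel_subset: "skel n S <= S"
 by (auto simp: skel_def)

lemma skel_mono: "S <= T ==> skel n S <= skel n T"
 by (auto simp: skel_def)

lemma skel_mono': "n <= m ==> skel n S <= skel m S"
 by (auto simp: skel_def)

lemma scomplex_skel: assumes "scomplex S" shows "scomplex (skel n S)"
 unfolding scomplex_def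
proof (intro ballI conjI allI impI)
 fix si ta assume s: "si:skel n S" and t: "ta <= si" "ta ~= {}"
 have sS: "si:S" "finite si" using s assms by (auto simp: skel_def scomplex_def)
 hence "card ta <= card si" using t by (intro card_mono)
 thus "ta:skel n S" using s scomplexD[OF assms sS(1) t] by (simp add: skel_def)
qed (use assms in \<open>auto simp: skel_def scomplex_def\<close>)

text \<open>At most \<open>d + 1\<close> lattice points are active at a time, so the approximation
  of \<open>G\<close> uses small simplices only. On the boundary its support lies in that of
  \<open>f\<close>, and a straight homotopy followed by homotopy extension restores \<open>f\<close>
  there.\<close>

lemma skel_approx:
 assumes S: "scomplex S" and G: "smap (cb d) S G" and Gf: "!!x. x:bd d ==> G x = f x"
  and f: "smap (bd d) (skel n S) f" and n: "n <= m" "Suc d <= m"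
 shows "EX G'. smap (cb d) (skel m S) G' & (ALL x:bd d. G' x = f x)"
proof (rule grid_approx[OF compact_cb subset_refl G S])
 fix P :: "(nat => int) set" and w :: "(nat => int) => rseq => real"
  and fi :: "(nat => int) => 'a" and col :: "(nat => int) => nat"
 assume P: "finite P" "!!p. p:P ==> continuous_on (cb d) (w p)"
  "!!p k. p:P ==> k:cb d ==> 0 <= w p k & w p k <= 1"
  "!!k. k:cb d ==> EX p:P. 0 < w p k"
  "!!p k. p:P ==> k:cb d ==> 0 < w p k ==> fi p:spt (G k)"
  "!!p. col p <= d" "!!k. k:cb d ==> inj_on col {p:P. 0 < w p k}"
  "!!p. p:P ==> card {q:P. EX k:cb d. 0 < w p k & 0 < w q k} <= 3 ^ d"
 define Fi where "Fi = wmap P w fi"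
 have wnn: "!!p. p:P ==> 0 <= w p k" if "k:cb d" for k using P(3) that by simp
 have sub: "fi`{p:P. 0 < w p k} <= spt (G k)" if "k:cb d" for k using P(5) that by blast
 have Phi: "smap (cb d) (skel m S) Fi"
  unfolding Fi_def
 proof (rule smap_wmap[OF P(1,2) wnn P(4)])
  fix k assume k: "k:cb d"
  let ?A = "{p:P. 0 < w p k}"
  have "fi`?A:S"
   by (rule scomplexD[OF S smap_support[OF G k] sub[OF k]]) (use P(4)[OF k] in blast)
  moreover have "card (fi`?A) <= Suc d"
  proof -
   have "card ?A <= card {..d}"
    by (rule card_inj_on_le[OF P(7)[OF k]]) (use P(6) in auto)
   moreover have "card (fi`?A) <= card ?A" by (rule card_image_le) (use P(1) in simp)
   ultimately show ?thesis by simp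
  qed
  ultimately show "fi`?A:skel m S" using n(2) by (simp add: skel_def)
 qed
 have fd: "smap (bd d) (skel m S) f" by (rule smap_mono[OF f skel_mono'[OF n(1)]])
 have "shom (bd d) (skel m S) f Fi"
 proof (rule shom_sline[OF fd smap_subset[OF Phi bd_subset] scomplex_skel[OF S]])
  fix x assume x: "x:bd d"
  hence xc: "x:cb d" using bd_subset by blast
  have "spt (Fi x) = fi`{p:P. 0 < w p x}"
   unfolding Fi_def using spt_wmap[of P w x fi] P(1) wnn[OF xc] P(4)[OF xc] by blast
  hence "spt (f x) Un spt (Fi x) <= spt (f x)" using sub[OF xc] Gf[OF x] by simp
  thus "EX si:skel m S. spt (f x) Un spt (Fi x) <= si" using smap_support[OF fd x] by blast
 qed
 from shom_extend[OF this Phi] show "EX G'. smap (cb d) (skel m S) G' & (ALL x:bd d. G' x = f x)" by blast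
qed

text \<open>A directed preorder filtered by levels, in which comparable elements of one level are
  equivalent. \<open>null\<close> is the connectivity of the strict lower part of an element, with a
  threshold depending on \<open>d\<close>. It is required for all compact \<open>K\<close> in the
  cube, since it is applied to closed pieces of the cube.\<close>

locale lev_poset =
 fixes V :: "'v set" and lq :: "'v => 'v => bool" and lev :: "'v => nat"
 assumes lq_refl: "x:V ==> lq x x"
  and lq_trans: "x:V ==> y:V ==> z:V ==> lq x y ==> lq y z ==> lq x z"
  and lev_mono: "x:V ==> y:V ==> lq x y ==> lev x <= lev y"
  and lev_eq: "x:V ==> y:V ==> lq x y ==> lev x = lev y ==> lq y x"
  and directed: "finite A ==> A <= V ==> EX z:V. ALL x:A. lq x z"
  and null: "EX s. ALL x:V. s < lev x --> (ALL K f. compact K & K <= cb d &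
   smap K (chains lq {y:V. lq y x & lev y < lev x}) f -->
   (EX z:{y:V. lq y x & lev y < lev x}.
    shom K (chains lq {y:V. lq y x & lev y < lev x}) f (%_. vpt z)))"
begin

abbreviation "below x == {y:V. lq y x & lev y < lev x}"

abbreviation "dlk x == chains lq (below x)"

definition Ex :: "nat => 'v set set" where
 "Ex m = chains lq {x:V. lev x <= m}"

lemma Ex_mono: "m <= m' ==> Ex m <= Ex m'"
 unfolding Ex_def by (rule chains_mono) auto

text \<open>Let \<open>c\<close> be the class of elements equivalent to \<open>x\<close>. Where
  \<open>f\<close> gives weight to \<open>c\<close>, its other vertices lie strictly below
  \<open>x\<close>. So the weight on \<open>c\<close> can be forgotten while enough other weight is
  left; near the rest of the domain the remaining part is contracted to a vertex inside the lower
  part of \<open>x\<close>.\<close>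

lemma push_class:
 fixes K :: "rseq set"
 assumes K: "compact K" and f: "smap K (Ex (lev x)) f" and x: "x:V"
  and nul: "!!L g. compact L ==> L <= K ==> smap L (dlk x) g ==>
   EX z:below x. shom L (dlk x) g (%_. vpt z)"
 shows "EX f'. smap K (Ex (lev x)) f' & (ALL k:K. x ~: spt (f' k)) &
  (ALL k:K. spt (f' k) <= spt (f k) Un {y:V. lev y < lev x}) &
  (ALL k:K. spt (f k) <= {y. lev y < lev x} --> f' k = f k)"
proof -
 define c where "c = {y:V. lq x y & lq y x}"
 define D where "D = below x"
 define F where "F = (UN k:K. spt (f k))"
 have F: "finite F" using f by (simp add: F_def smap_def)
 define T where "T = (%k. SUM v:F Int c. f k v)"
 have contT: "continuous_on K T"
  unfolding T_def by (rule continuous_on_sum, rule continuous_on_coord') (use f in \<open>simp add: smap_def\<close>)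
 have lev_c: "lev y = lev x" if "y:c" for y
  using that lev_mono[of x y] lev_mono[of y x] x by (auto simp: c_def)
 have fk: "finite (spt (f k))" "spt (f k) <= {y:V. lev y <= lev x}"
  "!!u v. u:spt (f k) ==> v:spt (f k) ==> lq u v | lq v u" "!!v. 0 <= f k v" "sum (f k) (spt (f k)) = 1"
  if "k:K" for k
 proof -
  have "f k:realiz (Ex (lev x))" using f that by (auto simp: smap_def)
  thus "finite (spt (f k))" "spt (f k) <= {y:V. lev y <= lev x}"
   "!!u v. u:spt (f k) ==> v:spt (f k) ==> lq u v | lq v u" "!!v. 0 <= f k v" "sum (f k) (spt (f k)) = 1"
   unfolding realiz_def Ex_def chains_def by blast+
 qed
 have T0: "0 <= T k" if "k:K" for k unfolding T_def by (intro sum_nonneg fk(4) that)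
 have sumF: "sum (f k) F = 1" if "k:K" for k
 proof -
  have "sum (f k) F = sum (f k) (spt (f k))"
   by (rule sum.mono_neutral_right[OF F]) (use that in \<open>auto simp: F_def spt_def\<close>)
  thus ?thesis using fk(5)[OF that] by simp
 qed
 have rest: "(SUM v:F - c. f k v) = 1 - T k" if "k:K" for k
  using sumF[OF that] sum.Int_Diff[OF F, of "f k" c] by (simp add: T_def)
 have T_zero: "T k = 0 \<longleftrightarrow> spt (f k) Int c = {}" if k: "k:K" for k
 proof -
  have "T k = 0 \<longleftrightarrow> (ALL v:F Int c. f k v = 0)"
   unfolding T_def by (rule sum_nonneg_eq_0_iff) (use F fk(4)[OF k] in auto)
  thus ?thesis using k by (auto simp: F_def spt_def)
 qed
 define g where "g = wmap (F - c) (%v k. f k v) (%v. v)"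
 have ex_pos: "EX v:F - c. 0 < f k v" if "k:K" "T k < 1" for k
 proof (rule ccontr)
  assume *: "~ ?thesis"
  have 0: "f k v = 0" if "v:F - c" for v
  proof -
   have "~ 0 < f k v" using * that by blast
   thus ?thesis using fk(4)[OF \<open>k : K\<close>, of v] by linarith
  qed
  have "(SUM v:F - c. f k v) = 0" by (rule sum.neutral) (use 0 in blast)
  thus False using rest[OF that(1)] that(2) by simp
 qed
 have posF: "{v:F - c. 0 < f k v} = spt (f k) - c" if "k:K" for k
  using smap_pos[OF f that] that by (auto simp: F_def)
 have sptg: "spt (g k) = spt (f k) - c" if "k:K" "T k < 1" for k
  unfolding g_def using spt_wmap[of "F - c" "%v k. f k v" k "%v. v"] F fk(4)[OF that(1)] ex_pos[OF that]
   posF[OF that(1)] by simp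
 \<comment> \<open>A vertex above an element of the class has no larger level than \<open>x\<close>,
   hence belongs to the class. A vertex outside the class is therefore below it, and on a different
   level.\<close>
 have low: "spt (f k) - c <= D" if k: "k:K" "T k ~= 0" for k
 proof
  fix v assume v: "v:spt (f k) - c"
  obtain y where y: "y:spt (f k)" "y:c" using T_zero[OF k(1)] k(2) by blast
  have vV: "v:V" "lev v <= lev x" and yV: "y:V" using fk(2)[OF k(1)] v y by auto
  have yx: "lq x y" "lq y x" using y by (auto simp: c_def)
  have up: "v:c" if "lq y v"
  proof -
   have "lev v = lev y" using lev_mono[OF yV vV(1) that] vV(2) lev_c[OF y(2)] by simp
   hence "lq v y" using lev_eq[OF yV vV(1) that] by simp
   thus ?thesis using lq_trans[OF x yV vV(1) yx(1) that] lq_trans[OF vV(1) yV x _ yx(2)] vV by (simp add: c_def)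
  qed
  hence vy: "lq v y" "~ lq y v" using fk(3)[OF k(1), of v y] v y by blast+
  have vx: "lq v x" by (rule lq_trans[OF vV(1) yV x vy(1) yx(2)])
  have "lev v ~= lev x"
  proof
   assume "lev v = lev x"
   hence "lq y v" using lev_eq[OF vV(1) yV vy(1)] lev_c[OF y(2)] by simp
   thus False using vy by simp
  qed
  thus "v:D" using vx vV by (simp add: D_def)
 qed
 have g: "smap {k:K. T k < 1} (Ex (lev x)) g"
  unfolding g_def
 proof (rule smap_wmap)
  show "finite (F - c)" using F by simp
  show "continuous_on {k:K. T k < 1} (%k. f k v)" for v
   by (rule continuous_on_coord', rule continuous_on_subset[of K]) (use f in \<open>auto simp: smap_def\<close>)
  fix k assume k: "k:{k:K. T k < 1}"
  show "0 <= f k v" for v using fk(4) k by blast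
  show "EX v:F - c. 0 < f k v" using ex_pos k by blast
  have "spt (f k) - c ~= {}" using posF[of k] ex_pos[of k] k by blast
  moreover have "spt (f k):Ex (lev x)" using smap_support[OF f, of k] k by simp
  ultimately have "spt (f k) - c:Ex (lev x)"
   unfolding Ex_def by (intro scomplexD[OF scomplex_chains _ Diff_subset])
  thus "(%v. v)`{v:F - c. 0 < f k v}:Ex (lev x)"
   using posF[of k] k by simp
 qed
 \<comment> \<open>Up to weight 1/2 the rest is normalised, between 1/2 and 3/4 the null-homotopy
   runs, and beyond 3/4 the constant vertex takes over. Thus no division by a vanishing weight
   occurs.\<close>
 define K1 where "K1 = {k:K. 1/2 <= T k & T k <= 3/4}"
 have K1_eq: "K1 = K Int T -` {1/2..3/4}" by (auto simp: K1_def)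
 have "closed (K Int T -` {1/2..3/4})"
  by (rule continuous_closed_preimage[OF contT compact_imp_closed[OF K] closed_atLeastAtMost])
 hence "compact (K Int (K Int T -` {1/2..3/4}))" by (rule compact_Int_closed[OF K])
 hence K1: "compact K1" "K1 <= K" unfolding K1_eq by (simp_all add: Int_absorb1 flip: Int_assoc)
 have "smap K1 (chains lq D) g"
 proof (rule smap_restrict)
  show "smap K1 (Ex (lev x)) g" by (rule smap_subset[OF g]) (auto simp: K1_def)
  fix k assume k: "k:K1"
  hence kK: "k:K" "T k < 1" "T k ~= 0" by (auto simp: K1_def)
  have "spt (g k):Ex (lev x)" using smap_support[OF g, of k] kK by simp
  moreover have "spt (g k) <= D" using sptg[OF kK(1,2)] low[OF kK(1,3)] by simp
  ultimately show "spt (g k):chains lq D" unfolding Ex_def chains_def by blast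
 qed
 then obtain z where z: "z:D" "shom K1 (chains lq D) g (%_. vpt z)"
  using nul[OF K1] unfolding D_def by blast
 then obtain H where H: "smap (cyl K1) (chains lq D) H"
  "!!k. k:K1 ==> H (k, 0) = g k" "!!k. k:K1 ==> H (k, 1) = vpt z"
  unfolding shom_def by blast
 have DEx: "chains lq D <= Ex (lev x)" unfolding Ex_def D_def by (rule chains_mono) auto
 have zx: "{z}:chains lq D" using z(1) lq_refl by (auto simp: chains_def D_def)
 define h where "h = (%k. if T k <= 3/4 then H (k, 4 * T k - 2) else vpt z)"
 define f' where "f' = (%k. if T k <= 1/2 then g k else h k)"
 have h: "smap {k:K. 1/2 <= T k} (chains lq D) h"
  unfolding h_def
 proof (rule smap_cases_le)
  show "continuous_on {k:K. 1/2 <= T k} T" by (rule continuous_on_subset[OF contT]) auto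
  have "continuous_on K1 T" by (rule continuous_on_subset[OF contT K1(2)])
  thus "smap {k:{k:K. 1/2 <= T k}. T k <= 3/4} (chains lq D) (%k. H (k, 4 * T k - 2))"
   by (intro smap_compose[OF H(1)] ctn) (auto simp: K1_def)
  show "smap {k:{k:K. 1/2 <= T k}. 3/4 <= T k} (chains lq D) (%k. vpt z)"
   by (rule smap_const[OF zx])
  fix k assume "k:{k:K. 1/2 <= T k}" "T k = 3/4"
  hence "k:K1" "4 * T k - 2 = 1" by (auto simp: K1_def)
  thus "H (k, 4 * T k - 2) = vpt z" using H(3) by simp
 qed
 have f': "smap K (Ex (lev x)) f'"
  unfolding f'_def
 proof (rule smap_cases_le[OF contT])
  show "smap {k:K. T k <= 1/2} (Ex (lev x)) g" by (rule smap_subset[OF g]) auto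
  show "smap {k:K. 1/2 <= T k} (Ex (lev x)) h" by (rule smap_mono[OF h DEx])
  fix k assume k: "k:K" "T k = 1/2"
  have "k:K1" using k by (simp add: K1_def)
  moreover have "h k = H (k, 0)" unfolding h_def k(2) by simp
  ultimately show "g k = h k" using H(2) by simp
 qed
 have cases: "spt (f' k) = spt (f k) - c | spt (f' k) <= D" if k: "k:K" for k
 proof (cases "T k <= 1/2")
  case True
  thus ?thesis using sptg[OF k] by (simp add: f'_def)
 next
  case False
  hence "spt (h k):chains lq D" using smap_support[OF h, of k] k by simp
  thus ?thesis using False by (auto simp: f'_def chains_def)
 qed
 have xc: "x:c" using x lq_refl by (simp add: c_def)
 have xD: "x ~: D" by (simp add: D_def)
 have "f' k = f k" if k: "k:K" and sub: "spt (f k) <= {y. lev y < lev x}" for k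
 proof -
  have "spt (f k) Int c = {}" using sub lev_c by fastforce
  hence T: "T k = 0" using T_zero[OF k] by simp
  hence f'g: "f' k = g k" by (simp add: f'_def)
  have "(SUM v:F - c. f k v) = 1" using rest[OF k] T by simp
  moreover have "(\<Sum>q | q:F - c & q = v. f k q) = f k v" for v
  proof (cases "v:F - c")
   case True
   hence "{q. q:F - c & q = v} = {v}" by auto
   thus ?thesis by simp
  next
   case False
   hence "{q. q:F - c & q = v} = {}" by auto
   moreover have "f k v = 0" using False \<open>spt (f k) Int c = {}\<close> k by (auto simp: F_def spt_def)
   ultimately show ?thesis by simp
  qed
  ultimately have "g k = f k" by (simp add: g_def wmap_def fun_eq_iff)
  thus ?thesis using f'g by simp
 qed
 moreover have "x ~: spt (f' k)" if "k:K" for k using cases[OF that] xc xD by blast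
 moreover have "spt (f' k) <= spt (f k) Un {y:V. lev y < lev x}" if "k:K" for k
  using cases[OF that] unfolding D_def by blast
 ultimately show ?thesis using f' by blast
qed

text \<open>Each push removes a vertex of level \<open>M\<close> from the finite support and adds
  only vertices of smaller level, so the number of vertices of level \<open>M\<close>
  decreases.\<close>

lemma push_level:
 fixes K :: "rseq set"
 assumes K: "compact K" and M: "0 < M" and f: "smap K (Ex M) f"
  and nul: "!!x L g. x:V ==> lev x = M ==> compact L ==> L <= K ==>
   smap L (dlk x) g ==>
   EX z:below x. shom L (dlk x) g (%_. vpt z)"
 shows "EX f'. smap K (Ex (M - 1)) f' & (ALL k:K. spt (f k) <= {y. lev y < M} --> f' k = f k)"
 using f
proof (induction "card {v:(UN k:K. spt (f k)). lev v = M}" arbitrary: f rule: less_induct)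
 case less
 let ?T = "%f. {v:(UN k:K. spt (f k)). lev v = M}"
 have "finite (UN k:K. spt (f k))" using less.prems by (simp add: smap_def)
 hence fin: "finite (?T f)" by (rule rev_finite_subset) blast
 have chain: "spt (f k) <= {x:V. lev x <= M}" if "k:K" for k
  using smap_support[OF less.prems that] by (simp add: Ex_def chains_def)
 show ?case
 proof (cases "?T f = {}")
  case True
  have "smap K (Ex (M - 1)) f"
  proof (rule smap_restrict[OF less.prems])
   fix k assume k: "k:K"
   have "lev v <= M - 1" if "v:spt (f k)" for v
   proof -
    have "lev v ~= M" using True that k by blast
    moreover have "lev v <= M" using chain[OF k] that by blast
    ultimately show ?thesis by linarith
   qed
   thus "spt (f k):Ex (M - 1)"
    using smap_support[OF less.prems k] by (auto simp: Ex_def chains_def)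
  qed
  thus ?thesis by blast
 next
  case False
  then obtain x where x: "x:?T f" by blast
  hence xV: "x:V" and lx: "lev x = M" using chain by blast+
  have fx: "smap K (Ex (lev x)) f" using less.prems lx by simp
  obtain f1 where f1: "smap K (Ex M) f1" "ALL k:K. x ~: spt (f1 k)"
   "ALL k:K. spt (f1 k) <= spt (f k) Un {y:V. lev y < M}"
   "ALL k:K. spt (f k) <= {y. lev y < M} --> f1 k = f k"
   using push_class[OF K fx xV nul[OF xV lx]] unfolding lx by blast
  have "?T f1 <= ?T f"
  proof
   fix v assume "v:?T f1"
   then obtain k where k: "k:K" "v:spt (f1 k)" "lev v = M" by blast
   hence "v:spt (f k)" using f1(3) by fastforce
   thus "v:?T f" using k by blast
  qed
  moreover have "x ~: ?T f1" using f1(2) by blast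
  ultimately have "?T f1 \<subset> ?T f" using x by blast
  hence "card (?T f1) < card (?T f)" by (rule psubset_card_mono[OF fin])
  from less.hyps[OF this f1(1)] obtain f2 where f2: "smap K (Ex (M - 1)) f2"
   "ALL k:K. spt (f1 k) <= {y. lev y < M} --> f2 k = f1 k" by blast
  have "f2 k = f k" if "k:K" "spt (f k) <= {y. lev y < M}" for k
  proof -
   have "f1 k = f k" using f1(4) that by blast
   thus ?thesis using f2(2) that by simp
  qed
  thus ?thesis using f2(1) by blast
 qed
qed

lemma push_all:
 fixes K :: "rseq set"
 assumes nul: "ALL x:V. s < lev x --> (ALL K f. compact K & K <= cb d &
   smap K (dlk x) f -->
   (EX z:below x.
    shom K (dlk x) f (%_. vpt z)))"
  and K: "compact K" "K <= cb d" and m: "s <= m" and f: "smap K (Ex (m + j)) f"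
 shows "EX f'. smap K (Ex m) f' & (ALL k:K. spt (f k) <= {y. lev y <= m} --> f' k = f k)"
 using f
proof (induction j arbitrary: f)
 case 0
 thus ?case by auto
next
 case (Suc j)
 have "EX f'. smap K (Ex (m + Suc j - 1)) f' & (ALL k:K. spt (f k) <= {y. lev y < m + Suc j} --> f' k = f k)"
 proof (rule push_level[OF K(1) _ Suc.prems])
  fix x L g
  assume x: "x:V" "lev x = m + Suc j" and L: "compact L" "L <= K"
   and g: "smap L (dlk x) g"
  have "s < lev x" using x m by simp
  moreover have "L <= cb d" using L K by blast
  ultimately show "EX z:below x.
    shom L (dlk x) g (%_. vpt z)"
   using nul x(1) L(1) g by blast
 qed simp
 then obtain f1 where f1: "smap K (Ex (m + j)) f1"
  "ALL k:K. spt (f k) <= {y. lev y < m + Suc j} --> f1 k = f k" by auto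
 obtain f2 where f2: "smap K (Ex m) f2" "ALL k:K. spt (f1 k) <= {y. lev y <= m} --> f2 k = f1 k"
  using Suc.IH[OF f1(1)] by blast
 have "f2 k = f k" if "k:K" "spt (f k) <= {y. lev y <= m}" for k
 proof -
  have "spt (f k) <= {y. lev y < m + Suc j}" using that(2) by fastforce
  hence "f1 k = f k" using f1(2) that(1) by blast
  thus ?thesis using f2(2) that by simp
 qed
 thus ?case using f2(1) by blast
qed

lemma scomplex_Ex: "scomplex (Ex m)"
 unfolding Ex_def by (rule scomplex_chains)

text \<open>The finite support of \<open>f\<close> has an upper bound \<open>z\<close>, so
  \<open>f\<close> can be coned off at a possibly much higher level \<open>M\<close>. Pushing down
  one level at a time returns to level \<open>m\<close> and never moves the boundary, whose support
  is already there.\<close>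

lemma Ex_connected:
 "EX s. ALL m>=s. ALL f. smap (bd d) (Ex m) f --> sfills d (Ex m) f"
proof -
 obtain s where s: "ALL x:V. s < lev x --> (ALL K f. compact K & K <= cb d &
   smap K (dlk x) f -->
   (EX z:below x.
    shom K (dlk x) f (%_. vpt z)))"
  using null by blast
 have "sfills d (Ex m) f"
  if m: "s <= m" and f: "smap (bd d) (Ex m) f" for m f
 proof -
  define F0 where "F0 = (UN x:bd d. spt (f x))"
  have fx: "finite (spt (f x))" "spt (f x) <= V" "spt (f x) <= {y. lev y <= m}" "spt (f x):Ex m"
   "!!u v. u:spt (f x) ==> v:spt (f x) ==> lq u v | lq v u" if "x:bd d" for x
  proof -
   show e: "spt (f x):Ex m" by (rule smap_support[OF f that])
   show "finite (spt (f x))" "spt (f x) <= V" "spt (f x) <= {y. lev y <= m}"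
    "!!u v. u:spt (f x) ==> v:spt (f x) ==> lq u v | lq v u"
    using e unfolding Ex_def chains_def by blast+
  qed
  have "finite F0" using f by (simp add: F0_def smap_def)
  moreover have "F0 <= V" unfolding F0_def using fx(2) by blast
  ultimately obtain z where z: "z:V" "ALL x:F0. lq x z" using directed by blast
  define M where "M = max m (lev z)"
  have mM: "Ex m <= Ex M" by (rule Ex_mono) (simp add: M_def)
  have sing: "{z}:Ex M" using z(1) lq_refl by (auto simp: Ex_def chains_def M_def)
  have "shom (bd d) (Ex M) f (%_. vpt z)"
  proof (rule shom_sline[OF smap_mono[OF f mM] smap_const[OF sing] scomplex_Ex])
   fix x assume x: "x:bd d"
   have zx: "lq u z" if "u:spt (f x)" for u using z(2) x that by (auto simp: F0_def)
   have "insert z (spt (f x)):Ex M"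
    unfolding Ex_def chains_def
   proof (intro CollectI conjI ballI)
    show "finite (insert z (spt (f x)))" using fx(1)[OF x] by simp
    show "insert z (spt (f x)) <= {x:V. lev x <= M}"
     using fx(2,3)[OF x] z(1) by (fastforce simp: M_def)
    show "lq u v | lq v u" if "u:insert z (spt (f x))" "v:insert z (spt (f x))" for u v
     using that zx fx(5)[OF x, of u v] lq_refl[OF z(1)] by blast
   qed simp
   thus "EX si:Ex M. spt (f x) Un spt (vpt z) <= si" by (intro bexI) auto
  qed
  from shom_extend[OF this smap_const[OF sing]] obtain F where F: "smap (cb d) (Ex M) F" "ALL x:bd d. F x = f x"
   by blast
  have "smap (cb d) (Ex (m + (M - m))) F" using F(1) by (simp add: M_def)
  from push_all[OF s compact_cb subset_refl m this] obtain F' where F': "smap (cb d) (Ex m) F'"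
   "ALL k:cb d. spt (F k) <= {y. lev y <= m} --> F' k = F k" by blast
  have "F' x = f x" if x: "x:bd d" for x
  proof -
   have Fx: "F x = f x" using F(2) x by blast
   have "x:cb d" using x bd_subset by blast
   thus ?thesis using F'(2) fx(3)[OF x] Fx by simp
  qed
  thus ?thesis using F'(1) by blast
 qed
 thus ?thesis by blast
qed

text \<open>The second component of a vertex is a colour. Distinct colours in each simplex ensure that no
  simplex is mapped to itself by a nontrivial automorphism that acts on the first component only and
  freely.\<close>

definition Cx :: "nat => ('v \<times> nat) set set" where
 "Cx r = {si. finite si & si ~= {} & snd`si <= {..<r} & inj_on snd si & fst`si:Ex r}"

lemma CxI:
 "finite si ==> si ~= {} ==> snd`si <= {..<r} ==> inj_on snd si ==> fst`si:Ex r ==> si:Cx r"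
 by (simp add: Cx_def)

lemma scomplex_Cx: "scomplex (Cx r)"
 unfolding scomplex_def
proof (intro ballI conjI allI impI)
 fix si ta assume s: "si:Cx r" and t: "ta <= si" "ta ~= {}"
 have "fst`ta:Ex r"
  by (rule scomplexD[OF scomplex_Ex, of "fst`si"]) (use s t in \<open>auto simp: Cx_def\<close>)
 moreover have "finite ta" "snd`ta <= {..<r}" "inj_on snd ta"
  using s t finite_subset inj_on_subset unfolding Cx_def by blast+
 ultimately show "ta:Cx r" using t(2) by (simp add: Cx_def)
qed (auto simp: Cx_def)

lemma Cx_mono: "r <= s ==> Cx r <= Cx s"
 using Ex_mono[of r s] by (fastforce simp: Cx_def)

text \<open>After forgetting colours the boundary map is filled, and the filling is coloured anew
  through the grid. The new colours run from \<open>r\<close> to \<open>r + d\<close> and differ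
  from those of \<open>f\<close>, so old and new vertices over a common chain form a coloured
  simplex, and a straight homotopy exists on the boundary.\<close>

lemma Cx_fill_dim:
 assumes "d <= n"
 shows "EX s>=r. ALL f. smap (bd d) (skel n (Cx r)) f -->
  sfills d (skel (Suc n) (Cx s)) f"
proof -
 obtain s0 where s0: "ALL m>=s0. ALL f. smap (bd d) (Ex m) f -->
   sfills d (Ex m) f"
  using Ex_connected by blast
 define m where "m = max r s0"
 define s where "s = m + r + d + 1"
 have "sfills d (skel (Suc n) (Cx s)) f"
  if f: "smap (bd d) (skel n (Cx r)) f" for f
 proof -
  have f': "smap (bd d) (Cx r) f" by (rule smap_mono[OF f skel_subset])
  have Cr: "Cx r <= Cx s" by (rule Cx_mono) (simp add: s_def m_def)
  have Em: "Ex r <= Ex m" "Ex m <= Ex s" by (rule Ex_mono; simp add: s_def m_def)+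
  define Q where "Q = (UN x:bd d. spt (f x))"
  have Q: "finite Q" using f by (simp add: Q_def smap_def)
  have act: "{q:Q. 0 < f x q} = spt (f x)" if "x:bd d" for x
   using smap_pos[OF f' that] that by (auto simp: Q_def)
  have fx: "spt (f x):Cx r" if "x:bd d" for x by (rule smap_support[OF f' that])
  have nn: "0 <= f x q" if "x:bd d" for x q
  proof -
   have "f x:realiz (Cx r)" using f' that by (auto simp: smap_def)
   thus ?thesis unfolding realiz_def by blast
  qed
  have ex: "EX q:Q. 0 < f x q" if "x:bd d" for x
  proof -
   have "spt (f x) ~= {}" using fx[OF that] by (simp add: Cx_def)
   thus ?thesis using act[OF that] by blast
  qed
  define fb where "fb = wmap Q (%q x. f x q) fst"
  have fb: "smap (bd d) (Ex m) fb"
   unfolding fb_def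
  proof (rule smap_wmap[OF Q])
   show "continuous_on (bd d) (%x. f x q)" for q
    by (rule continuous_on_coord') (use f in \<open>simp add: smap_def\<close>)
   show "fst`{q:Q. 0 < f x q}:Ex m" if "x:bd d" for x
    using fx[OF that] Em unfolding act[OF that] Cx_def by blast
  qed (use nn ex in auto)
  have spt_fb: "spt (fb x) = fst`spt (f x)" if "x:bd d" for x
   using spt_wmap[of Q "%q x. f x q" x fst] Q nn[OF that] ex[OF that] act[OF that]
   by (simp add: fb_def)
  have "s0 <= m" by (simp add: m_def)
  then obtain F where F: "smap (cb d) (Ex m) F" "ALL x:bd d. F x = fb x" using s0 fb by blast
  have "EX G. smap (cb d) (Cx s) G & (ALL x:bd d. G x = f x)"
  proof (rule grid_approx[OF compact_cb subset_refl F(1) scomplex_Ex])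
   fix P :: "(nat => int) set" and w :: "(nat => int) => rseq => real"
    and fi :: "(nat => int) => 'v" and col :: "(nat => int) => nat"
   assume P: "finite P" "!!p. p:P ==> continuous_on (cb d) (w p)"
    "!!p k. p:P ==> k:cb d ==> 0 <= w p k & w p k <= 1"
    "!!k. k:cb d ==> EX p:P. 0 < w p k"
    "!!p k. p:P ==> k:cb d ==> 0 < w p k ==> fi p:spt (F k)"
    "!!p. col p <= d" "!!k. k:cb d ==> inj_on col {p:P. 0 < w p k}"
    "!!p. p:P ==> card {q:P. EX k:cb d. 0 < w p k & 0 < w q k} <= 3 ^ d"
   define nu where "nu = (%p. (fi p, r + col p))"
   define Fi where "Fi = wmap P w nu"
   have wnn: "!!p. p:P ==> 0 <= w p k" if "k:cb d" for k using P(3) that by simp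
   have spt_Phi: "spt (Fi k) = nu`{p:P. 0 < w p k}" if "k:cb d" for k
    unfolding Fi_def using spt_wmap[of P w k nu] P(1) wnn[OF that] P(4)[OF that] by blast
   have inj: "inj_on snd (nu`{p:P. 0 < w p k})" if "k:cb d" for k
    using P(7)[OF that] by (auto simp: inj_on_def nu_def)
   have sub: "fst`nu`{p:P. 0 < w p k} <= spt (F k)" if "k:cb d" for k
    using P(5) that by (auto simp: nu_def)
   have snd_s: "snd`nu`A <= {r..<s}" for A
   proof
    fix i assume "i:snd`nu`A"
    then obtain p where "i = r + col p" by (auto simp: nu_def)
    thus "i:{r..<s}" using P(6)[of p] by (simp add: s_def)
   qed
   have Phi: "smap (cb d) (Cx s) Fi"
    unfolding Fi_def
   proof (rule smap_wmap[OF P(1,2) wnn P(4)])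
    fix k assume k: "k:cb d"
    let ?A = "nu`{p:P. 0 < w p k}"
    have ne: "?A ~= {}" using P(4)[OF k] by blast
    have "fst`?A:Ex m"
     by (rule scomplexD[OF scomplex_Ex smap_support[OF F(1) k] sub[OF k]]) (use ne in simp)
    hence "fst`?A:Ex s" using Em(2) by (rule subsetD[rotated])
    moreover have "snd`?A <= {..<s}"
     by (rule order_trans[OF snd_s]) auto
    moreover have "finite ?A" using P(1) by simp
    ultimately show "?A:Cx s" using inj[OF k] ne by (intro CxI)
   qed
   have "shom (bd d) (Cx s) f Fi"
   proof (rule shom_sline[OF smap_mono[OF f' Cr] smap_subset[OF Phi bd_subset] scomplex_Cx])
    fix x assume x: "x:bd d"
    hence xc: "x:cb d" using bd_subset by blast
    let ?A = "nu`{p:P. 0 < w p x}"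
    have "fst`(spt (f x) Un ?A) <= spt (F x)"
     using sub[OF xc] F(2) x spt_fb[OF x] by (simp add: image_Un)
    hence "fst`(spt (f x) Un ?A):Ex m"
     by (rule scomplexD[OF scomplex_Ex smap_support[OF F(1) xc]]) (use fx[OF x] in \<open>simp add: Cx_def\<close>)
    moreover have f1: "finite (spt (f x))" "spt (f x) ~= {}" "snd`spt (f x) <= {..<r}" "inj_on snd (spt (f x))"
     using fx[OF x] by (simp_all add: Cx_def)
    moreover have "inj_on snd (spt (f x) Un ?A)"
    proof -
     have "snd`spt (f x) Int snd`?A = {}" using f1(3) snd_s[of "{p:P. 0 < w p x}"] by force
     thus ?thesis unfolding inj_on_Un using f1(4) inj[OF xc] by blast
    qed
    moreover have "snd`(spt (f x) Un ?A) <= {..<s}"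
    proof -
     have "snd`?A <= {..<s}" by (rule order_trans[OF snd_s]) auto
     moreover have "{..<r} <= {..<s}" by (simp add: s_def)
     ultimately show ?thesis unfolding image_Un using f1(3) by (meson Un_least order_trans)
    qed
    moreover have "finite (spt (f x) Un ?A)" using f1(1) P(1) by simp
    moreover have "spt (f x) Un ?A ~= {}" using f1(2) by simp
    ultimately have "spt (f x) Un ?A:Cx s"
     using subsetD[OF Em(2)] by (intro CxI)
    thus "EX si:Cx s. spt (f x) Un spt (Fi x) <= si"
     unfolding spt_Phi[OF xc] by blast
   qed
   from shom_extend[OF this Phi] show "EX G. smap (cb d) (Cx s) G & (ALL x:bd d. G x = f x)" by blast
  qed
  then obtain G where G: "smap (cb d) (Cx s) G" "ALL x:bd d. G x = f x" by blast
  have "smap (bd d) (skel n (Cx s)) f" by (rule smap_mono[OF f skel_mono[OF Cr]])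
  from skel_approx[OF scomplex_Cx G(1) _ this] G(2) assms show ?thesis by simp
 qed
 moreover have "r <= s" by (simp add: s_def)
 ultimately show ?thesis by blast
qed

lemma Cx_fill:
 "EX s>=r. ALL d<=n. ALL f. smap (bd d) (skel n (Cx r)) f -->
  sfills d (skel (Suc n) (Cx s)) f"
proof -
 have "EX s. ALL d. d <= n --> r <= s d & (ALL f. smap (bd d) (skel n (Cx r)) f -->
  (EX F. smap (cb d) (skel (Suc n) (Cx (s d))) F & (ALL x:bd d. F x = f x)))"
  using Cx_fill_dim[of _ n r] by (intro choice) blast
 then obtain s where s: "!!d. d <= n ==> r <= s d"
  "!!d f. d <= n ==> smap (bd d) (skel n (Cx r)) f ==>
  EX F. smap (cb d) (skel (Suc n) (Cx (s d))) F & (ALL x:bd d. F x = f x)" by blast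
 define t where "t = Max (s`{..n})"
 have t: "s d <= t" if "d <= n" for d using that by (auto simp: t_def)
 have "sfills d (skel (Suc n) (Cx t)) f"
  if d: "d <= n" and f: "smap (bd d) (skel n (Cx r)) f" for d f
 proof -
  obtain F where F: "smap (cb d) (skel (Suc n) (Cx (s d))) F" "ALL x:bd d. F x = f x"
   using s(2)[OF d f] by blast
  show ?thesis using smap_mono[OF F(1) skel_mono[OF Cx_mono[OF t[OF d]]]] F(2) by blast
 qed
 moreover have "r <= t" using s(1)[of 0] t[of 0] by simp
 ultimately show ?thesis by blast
qed

end

type_synonym vmap = "vertex => vertex"

section \<open>Ends and quasi-automorphisms\<close>

lemma less_fun_total: "f ~= g ==> less_fun f g | less_fun g (f :: nat => bool)"
proof -
 assume "f ~= g"
 then obtain i where "f i ~= g i" by blast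
 hence k: "f (LEAST i. f i ~= g i) ~= g (LEAST i. f i ~= g i)" by (rule LeastI)
 have "f j = g j" if "j < (LEAST i. f i ~= g i)" for j using not_less_Least[OF that] by simp
 thus ?thesis using k unfolding less_fun_def
  by (smt (verit, best) le_bool_def order_less_le)
qed

lemma end_less_total: "a ~= b ==> end_less a b | end_less b a"
 using less_fun_total[of "snd a" "snd b"] by (auto simp: end_less_def prod_eq_iff)

lemma end_less_asym: "end_less a b ==> ~ end_less b a"
 using less_fun_asym by (auto simp: end_less_def)

lemma end_less_trans: "end_less a b ==> end_less b c ==> end_less a c"
 using less_fun_trans by (auto simp: end_less_def)

lemma end_less_irrefl: "~ end_less a a"
 using less_fun_irrefl by (auto simp: end_less_def)

lemma end_cyclic_asym: "end_cyclic a b c ==> ~ end_cyclic a c b"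
 unfolding end_cyclic_def using end_less_asym by blast

lemma end_cyclic_total: "a ~= b ==> b ~= c ==> a ~= c ==> end_cyclic a b c | end_cyclic a c b"
 unfolding end_cyclic_def using end_less_total[of a b] end_less_total[of b c] end_less_total[of a c] by blast

lemma end_cyclic_distinct: "end_cyclic a b c ==> a ~= b & b ~= c & a ~= c"
 unfolding end_cyclic_def using end_less_asym end_less_irrefl by blast

lemma ray_eq: "ray e m = ray e' p ==> fst e = fst e' & m = p & (ALL i<m. snd e i = snd e' i)"
proof -
 assume "ray e m = ray e' p"
 hence f: "fst e = fst e'" and m: "map (snd e) [0..<m] = map (snd e') [0..<p]"
  by (simp_all only: ray_def vertex.inject)
 from arg_cong[OF m, of length] have mp: "m = p" by simp
 have "snd e i = snd e' i" if "i < m" for i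
  using arg_cong[OF m, of "%xs. xs ! i"] that mp by simp
 thus ?thesis using f mp by blast
qed

lemma ray_determines:
 assumes "!!N. EX m>=N. ray e m:range (ray e')"
 shows "e = e'"
proof -
 have "fst e = fst e' & snd e i = snd e' i" for i
 proof -
  obtain m p where "Suc i <= m" "ray e m = ray e' p" using assms[of "Suc i"] by blast
  thus ?thesis using ray_eq[of e m e' p] by auto
 qed
 thus ?thesis by (auto simp: prod_eq_iff)
qed

lemma end_mapI:
 assumes h: "!!m. h (ray e (N + m)) = ray e' (N' + m)"
 shows "end_map h e = e'"
 unfolding end_map_def
proof (rule the_equality)
 show "\<forall>\<^sub>F n in sequentially. h (ray e n):range (ray e')"
  unfolding eventually_sequentially using h by (metis le_add_diff_inverse rangeI)
 fix e'' assume "\<forall>\<^sub>F n in sequentially. h (ray e n):range (ray e'')"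
 then obtain M where M: "!!n. M <= n ==> h (ray e n):range (ray e'')"
  unfolding eventually_sequentially by blast
 have "e' = e''"
 proof (rule ray_determines)
  fix j
  have "ray e' (N' + (M + j)):range (ray e'')" using M[of "N + (M + j)"] h[of "M + j"] by simp
  thus "EX m>=j. ray e' m:range (ray e'')" by (intro exI[of _ "N' + (M + j)"]) simp
 qed
 thus "e'' = e'" by simp
qed

text \<open>Source and target forest may differ, so that bases of all levels are covered along with
  the group elements.\<close>

definition quasi :: "nat => nat => nat => nat => vmap => bool" where
 "quasi k l k' l' h \<longleftrightarrow> bij_betw h (forest k l) (forest k' l') &
  finite {v:forest k l. ~ respects_children_at h v}"

lemma ray_in_forest: "e:ends k ==> ray e n:forest k l"
 by (auto simp: ends_def forest_def ray_def)

text \<open>Only finitely many vertices of the ray are exceptional. After them each step of the ray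
  appends the same letter to the image, which is therefore a shifted ray.\<close>

lemma ends_shift:
 assumes q: "quasi k l k' l' h" and e: "e:ends k"
 shows "EX e':ends k'. EX N N'. ALL m. h (ray e (N + m)) = ray e' (N' + m)"
proof -
 let ?B = "{v:forest k l. ~ respects_children_at h v}"
 have "finite (ray e -` ?B)"
  by (rule finite_vimageI[OF _ ray_inj]) (use q in \<open>simp add: quasi_def\<close>)
 then obtain N where N: "!!n. n:ray e -` ?B ==> n < N"
  by (meson finite_nat_set_iff_bounded)
 have good: "respects_children_at h (ray e n)" if "n >= N" for n
  using N[of n] that ray_in_forest[OF e, of n l] by auto
 have step: "is_child (snd e n) (h (ray e (Suc n))) (h (ray e n))" if "n >= N" for n
  using good[OF that] by (auto simp: respects_children_at_def is_child_def ray_def)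
 obtain j w where jw: "h (ray e N) = Node j w"
  using step[of N] by (auto simp: is_child_def)
 have path: "h (ray e (N + m)) = Node j (w @ map (%i. snd e (N + i)) [0..<m])" for m
 proof (induction m)
  case 0 thus ?case by (simp add: jw)
 next
  case (Suc m) thus ?case
   using step[of "N + m"] by (auto simp: is_child_def)
 qed
 define x where "x = (%i. if i < length w then w ! i else snd e (N + (i - length w)))"
 have on_ray: "h (ray e (N + m)) = ray (j, x) (length w + m)" for m
  unfolding path by (auto intro!: nth_equalityI simp: ray_def x_def nth_append)
 have "h (ray e N):forest k' l'"
  using q ray_in_forest[OF e] by (auto simp: quasi_def bij_betw_def)
 hence "(j, x):ends k'" using jw by (auto simp: forest_def ends_def)
 thus ?thesis using on_ray by blast
qed

lemma end_map_in_ends: "quasi k l k' l' h ==> e:ends k ==> end_map h e:ends k'"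
 using ends_shift[of k l k' l' h e] end_mapI[of h e] by metis

lemma end_map_comp:
 assumes h: "quasi k l k' l' h" and g: "quasi k' l' k'' l'' g" and e: "e:ends k"
  and f: "!!v. v:forest k l ==> f v = g (h v)"
 shows "end_map f e = end_map g (end_map h e)"
proof -
 obtain e' N N' where e': "e':ends k'" "!!m. h (ray e (N + m)) = ray e' (N' + m)"
  using ends_shift[OF h e] by blast
 obtain e'' M M' where e'': "!!m. g (ray e' (M + m)) = ray e'' (M' + m)"
  using ends_shift[OF g e'(1)] by blast
 have "f (ray e ((N + M) + m)) = ray e'' ((M' + N') + m)" for m
 proof -
  have "f (ray e ((N + M) + m)) = g (h (ray e (N + (M + m))))"
   using f[OF ray_in_forest[OF e]] by (simp add: add.assoc)
  also have "\<dots> = g (ray e' (M + (N' + m)))" using e'(2)[of "M + m"] by (simp add: add.left_commute)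
  also have "\<dots> = ray e'' (M' + (N' + m))" by (rule e'')
  finally show ?thesis by (simp add: add.assoc)
 qed
 hence "end_map f e = e''" by (rule end_mapI)
 moreover have "end_map h e = e'" by (rule end_mapI[OF e'(2)])
 moreover have "end_map g e' = e''" by (rule end_mapI[OF e''])
 ultimately show ?thesis by simp
qed

lemma end_map_id:
 assumes "e:ends k" "!!v. v:forest k l ==> f v = v"
 shows "end_map f e = e"
 by (rule end_mapI[of f e 0 e 0]) (use assms ray_in_forest in auto)

lemma respects_comp:
 assumes "respects_children_at h v" "respects_children_at g (h v)"
  and "!!u d. is_child d u v ==> f u = g (h u)" "f v = g (h v)"
 shows "respects_children_at f v"
 using assms unfolding respects_children_at_def by simp

lemma child_in_forest: "is_child d u v ==> v:forest k l ==> u:forest k l"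
 by (auto simp: is_child_def forest_def)

lemma quasi_comp:
 assumes h: "quasi k l k' l' h" and g: "quasi k' l' k'' l'' g"
  and f: "!!v. v:forest k l ==> f v = g (h v)"
 shows "quasi k l k'' l'' f"
proof -
 have bh: "bij_betw h (forest k l) (forest k' l')" and bg: "bij_betw g (forest k' l') (forest k'' l'')"
  using h g by (simp_all add: quasi_def)
 have "bij_betw (g \<circ> h) (forest k l) (forest k'' l'')" by (rule bij_betw_trans[OF bh bg])
 hence b: "bij_betw f (forest k l) (forest k'' l'')"
  using f by (subst bij_betw_cong[of _ f "g \<circ> h"]) auto
 let ?Bh = "{v:forest k l. ~ respects_children_at h v}" and ?Bg = "{v:forest k' l'. ~ respects_children_at g v}"
 have "{v:forest k l. ~ respects_children_at f v} <= ?Bh Un (h -` ?Bg Int forest k l)"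
 proof
  fix v assume v: "v:{v:forest k l. ~ respects_children_at f v}"
  have hv: "h v:forest k' l'" using v bh by (auto simp: bij_betw_def)
  have "~ (respects_children_at h v & respects_children_at g (h v))"
   using respects_comp[of h v g f] f child_in_forest[of _ _ v k l] v by blast
  thus "v:?Bh Un (h -` ?Bg Int forest k l)" using v hv by blast
 qed
 moreover have "finite (h -` ?Bg Int forest k l)"
  by (rule finite_vimage_IntI) (use g bh in \<open>auto simp: quasi_def bij_betw_def\<close>)
 moreover have "finite ?Bh" using h by (simp add: quasi_def)
 ultimately show ?thesis using b by (simp add: quasi_def finite_subset)
qed

lemma quasi_inv:
 assumes h: "quasi k l k' l' h" and g: "!!v. v:forest k l ==> g (h v) = v"
 shows "quasi k' l' k l g"
proof -
 have bh: "bij_betw h (forest k l) (forest k' l')" using h by (simp add: quasi_def)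
 have im: "h`forest k l = forest k' l'" using bh by (simp add: bij_betw_def)
 have gf: "g v:forest k l" "h (g v) = v" if "v:forest k' l'" for v
  using that g unfolding im[symmetric] by auto
 have b: "bij_betw g (forest k' l') (forest k l)"
  by (rule bij_betw_byWitness[of _ h]) (use g gf im in auto)
 let ?Bh = "{v:forest k l. ~ respects_children_at h v}"
 \<comment> \<open>An isolated vertex respects its children vacuously, while its image may have
   children; so the isolated vertices are added to the exceptional set.\<close>
 have "{v:forest k' l'. ~ respects_children_at g v} <= h`(?Bh Un Isolated`{..<l})"
 proof
  fix v assume v: "v:{v:forest k' l'. ~ respects_children_at g v}"
  have vh: "v = h (g v)" and gv: "g v:forest k l" using gf v by auto
  have "g v:?Bh Un Isolated`{..<l}"
  proof (rule ccontr)
   assume n: "~ ?thesis"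
   hence r: "respects_children_at h (g v)" using gv by blast
   obtain i w where iw: "g v = Node i w" using n gv by (auto simp: forest_def)
   have "is_child d (g u) (g v)" if u: "is_child d u v" for d u
   proof -
    let ?c = "Node i (w @ [d])"
    have c: "is_child d ?c (g v)" using iw by (simp add: is_child_def)
    hence cf: "?c:forest k l" using child_in_forest gv by blast
    have "is_child d (h ?c) v" using r c vh unfolding respects_children_at_def by metis
    hence "h ?c = u" using u by (auto simp: is_child_def)
    hence "g u = ?c" using g[OF cf] by simp
    thus ?thesis using c by simp
   qed
   hence "respects_children_at g v" by (simp add: respects_children_at_def)
   thus False using v by simp
  qed
  thus "v:h`(?Bh Un Isolated`{..<l})" using vh by blast
 qed
 moreover have "finite (h`(?Bh Un Isolated`{..<l}))" using h by (simp add: quasi_def)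
 ultimately show ?thesis using b by (simp add: quasi_def finite_subset)
qed

datatype mode = MF | MT | MV

definition pres :: "mode => nat => vmap => bool" where
 "pres m k h \<longleftrightarrow> (case m of
  MF => ALL a:ends k. ALL b:ends k. end_less a b --> end_less (end_map h a) (end_map h b)
 | MT => ALL a:ends k. ALL b:ends k. ALL c:ends k. end_cyclic a b c -->
    end_cyclic (end_map h a) (end_map h b) (end_map h c)
 | MV => True)"

lemma pres_MF_imp: "pres MF k h ==> pres m k h"
 by (cases m) (auto simp: pres_def end_cyclic_def)

lemma pres_comp:
 assumes h: "quasi k l k' l' h" and g: "quasi k' l' k'' l'' g"
  and f: "!!v. v:forest k l ==> f v = g (h v)" and ph: "pres m k h" and pg: "pres m k' g"
 shows "pres m k f"
proof -
 have e: "end_map f a = end_map g (end_map h a)" "end_map h a:ends k'" if "a:ends k" for a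
  using end_map_comp[OF h g that f] end_map_in_ends[OF h that] by auto
 show ?thesis using ph pg e by (cases m) (simp_all add: pres_def)
qed

text \<open>A bijection preserving a total and asymmetric relation also reflects it: if the inverse
  broke the relation, the opposite relation would hold and be carried back.\<close>

lemma pres_inv:
 assumes h: "quasi k l k' l' h" and g: "!!v. v:forest k l ==> g (h v) = v" and ph: "pres m k h"
 shows "pres m k' g"
proof -
 have q: "quasi k' l' k l g" by (rule quasi_inv[OF h g])
 have im: "h`forest k l = forest k' l'" using h by (simp add: quasi_def bij_betw_def)
 have hg: "h (g v) = v" if "v:forest k' l'" for v
  using that g unfolding im[symmetric] by auto
 have e: "end_map h (end_map g a) = a" "end_map g a:ends k" if "a:ends k'" for a
 proof -
  have "end_map (%v. h (g v)) a = end_map h (end_map g a)"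
   by (rule end_map_comp[OF q h that]) simp
  moreover have "end_map (%v. h (g v)) a = a" by (rule end_map_id[OF that hg])
  ultimately show "end_map h (end_map g a) = a" by simp
  show "end_map g a:ends k" by (rule end_map_in_ends[OF q that])
 qed
 show ?thesis
 proof (cases m)
  case MF
  have "end_less (end_map g a) (end_map g b)" if ab: "a:ends k'" "b:ends k'" "end_less a b" for a b
  proof (rule ccontr)
   assume "~ ?thesis"
   hence "end_map g a = end_map g b | end_less (end_map g b) (end_map g a)" using end_less_total by blast
   moreover have "end_less b a" if "end_less (end_map g b) (end_map g a)"
   proof -
    have "end_less (end_map h (end_map g b)) (end_map h (end_map g a))"
     using ph that e(2)[OF ab(1)] e(2)[OF ab(2)] by (simp add: MF pres_def)
    thus ?thesis using e(1)[OF ab(1)] e(1)[OF ab(2)] by simp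
   qed
   moreover have "a = b" if "end_map g a = end_map g b"
    by (metis that e(1)[OF ab(1)] e(1)[OF ab(2)])
   ultimately have "a = b | end_less b a" by blast
   thus False using ab end_less_asym end_less_irrefl by blast
  qed
  thus ?thesis using MF by (simp add: pres_def)
 next
  case MT
  have "end_cyclic (end_map g a) (end_map g b) (end_map g c)"
   if ab: "a:ends k'" "b:ends k'" "c:ends k'" "end_cyclic a b c" for a b c
  proof (rule ccontr)
   assume n: "~ ?thesis"
   have "end_map g a ~= end_map g b" "end_map g b ~= end_map g c" "end_map g a ~= end_map g c"
    using end_cyclic_distinct[OF ab(4)] by (metis e(1)[OF ab(1)] e(1)[OF ab(2)] e(1)[OF ab(3)])+
   hence "end_cyclic (end_map g a) (end_map g c) (end_map g b)" using end_cyclic_total n by blast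
   hence "end_cyclic (end_map h (end_map g a)) (end_map h (end_map g c)) (end_map h (end_map g b))"
    using ph e(2)[OF ab(1)] e(2)[OF ab(2)] e(2)[OF ab(3)] by (simp add: MT pres_def)
   hence "end_cyclic a c b" using e(1)[OF ab(1)] e(1)[OF ab(2)] e(1)[OF ab(3)] by simp
   thus False using ab end_cyclic_asym by blast
  qed
  thus ?thesis using MT by (simp add: pres_def)
 qed (simp add: pres_def)
qed

section \<open>Contraction of a caret\<close>

lemma Node_in_forest [simp]: "Node i w:forest k l \<longleftrightarrow> i < k"
 by (auto simp: forest_def)

lemma Isolated_in_forest [simp]: "Isolated j:forest k l \<longleftrightarrow> j < l"
 by (auto simp: forest_def)

text \<open>Contraction in standard position: trees \<open>i\<close> and \<open>Suc i\<close> become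
  the left and right subtree of a tree rooted at the former isolated vertex \<open>L\<close>.
  \<open>kinv\<close> is the corresponding expansion.\<close>

definition kap :: "nat => nat => vertex => vertex" where
 "kap i L v = (case v of
  Node j w => if j < i then Node j w else if j = i then Node i (False # w)
   else if j = Suc i then Node i (True # w) else Node (j - 1) w
 | Isolated j => if j = L then Node i [] else Isolated j)"

definition kinv :: "nat => nat => vertex => vertex" where
 "kinv i L v = (case v of
  Node j w => if j < i then Node j w else if j = i then
   (case w of [] => Isolated L | d # w' => Node (if d then Suc i else i) w') else Node (Suc j) w
 | Isolated j => Isolated j)"

lemma kinv_kap: "v:forest (Suc K) (Suc L) ==> kinv i L (kap i L v) = v"
 by (cases v) (auto simp: kap_def kinv_def)

lemma kap_kinv: "v:forest K L ==> kap i L (kinv i L v) = v"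
 by (cases v) (auto simp: kap_def kinv_def split: list.splits)

lemma kap_in: "i < K ==> v:forest (Suc K) (Suc L) ==> kap i L v:forest K L"
 by (cases v) (auto simp: kap_def)

lemma kinv_in: "i < K ==> v:forest K L ==> kinv i L v:forest (Suc K) (Suc L)"
 by (cases v) (auto simp: kinv_def split: list.splits)

lemma is_child_kap:
 assumes "u:forest (Suc K) (Suc L)" "v:forest (Suc K) (Suc L)"
 shows "is_child d (kap i L u) (kap i L v) \<longleftrightarrow>
  is_child d u v | (v = Isolated L & u = Node (if d then Suc i else i) [])"
proof (cases v)
 case v: (Node j w)
 show ?thesis
 proof (cases u)
  case (Node j' w')
  thus ?thesis using v by (auto simp: kap_def is_child_def)
 next
  case (Isolated j')
  thus ?thesis using v by (auto simp: kap_def is_child_def)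
 qed
next
 case v: (Isolated j)
 show ?thesis
 proof (cases u)
  case (Node j' w')
  thus ?thesis using v by (auto simp: kap_def is_child_def)
 next
  case (Isolated j')
  thus ?thesis using v by (auto simp: kap_def is_child_def)
 qed
qed

lemma is_child_kinv:
 assumes u: "u:forest K L" and v: "v:forest K L" and i: "i < K"
 shows "is_child d (kinv i L u) (kinv i L v) \<longleftrightarrow> is_child d u v & v ~= Node i []"
proof -
 let ?u = "kinv i L u" and ?v = "kinv i L v"
 have "is_child d u v \<longleftrightarrow> is_child d ?u ?v | (?v = Isolated L & ?u = Node (if d then Suc i else i) [])"
  using is_child_kap[of ?u K L ?v d i] kinv_in[OF i u] kinv_in[OF i v] kap_kinv[OF u] kap_kinv[OF v] by simp
 moreover have "?v = Isolated L \<longleftrightarrow> v = Node i []"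
  using v by (cases v) (auto simp: kinv_def split: list.splits)
 moreover have "~ is_child d ?u (Isolated L)" by (simp add: is_child_def)
 ultimately show ?thesis by metis
qed

lemma quasi_kap: assumes i: "i < K" shows "quasi (Suc K) (Suc L) K L (kap i L)"
proof -
 have "bij_betw (kap i L) (forest (Suc K) (Suc L)) (forest K L)"
  by (rule bij_betw_byWitness[of _ "kinv i L"])
   (use kinv_kap kap_kinv kap_in[OF i] kinv_in[OF i] in blast)+
 moreover have "respects_children_at (kap i L) v" if "v:forest (Suc K) (Suc L)" for v
  unfolding respects_children_at_def using is_child_kap[OF child_in_forest[OF _ that] that] by blast
 hence "{v:forest (Suc K) (Suc L). ~ respects_children_at (kap i L) v} = {}" by blast
 ultimately show ?thesis by (simp only: quasi_def) simp
qed

lemma quasi_kinv: assumes i: "i < K" shows "quasi K L (Suc K) (Suc L) (kinv i L)"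
 by (rule quasi_inv[OF quasi_kap[OF i]]) (rule kinv_kap)

lemma Node_ray: "Node j (d # map s [0..<m]) = ray (j, case_nat d s) (Suc m)"
proof -
 have "map (case_nat d s) [0..<Suc m] = d # map s [0..<m]"
  by (simp only: upt_conv_Cons[of 0 "Suc m"] zero_less_Suc list.map nat.case)
   (simp add: map_Suc_upt[symmetric] del: upt_Suc)
 thus ?thesis by (simp add: ray_def del: upt_Suc)
qed

lemma end_map_kap:
 "end_map (kap i L) (j, s) = (if j < i then (j, s) else if j = i then (i, case_nat False s)
  else if j = Suc i then (i, case_nat True s) else (j - 1, s))"
proof -
 consider "j < i" | "j = i" | "j = Suc i" | "Suc i < j" by linarith
 thus ?thesis
 proof cases
  case 1
  thus ?thesis by (intro end_mapI[of _ _ 0 _ 0]) (simp add: kap_def ray_def)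
 next
  case 2
  have "end_map (kap i L) (j, s) = (i, case_nat False s)"
   by (rule end_mapI[of _ _ 0 _ 1]) (simp add: kap_def 2 ray_def[of "(i, s)"] Node_ray)
  thus ?thesis using 2 by simp
 next
  case 3
  have "end_map (kap i L) (j, s) = (i, case_nat True s)"
   by (rule end_mapI[of _ _ 0 _ 1]) (simp add: kap_def 3 ray_def[of "(Suc i, s)"] Node_ray)
  thus ?thesis using 3 by simp
 next
  case 4
  thus ?thesis by (intro end_mapI[of _ _ 0 _ 0]) (simp add: kap_def ray_def)
 qed
qed

lemma less_fun_case_nat: "less_fun s t ==> less_fun (case_nat d s) (case_nat d t)"
proof -
 assume "less_fun s t"
 then obtain k where k: "s k < t k" "ALL k'<k. s k' = t k'" unfolding less_fun_def by blast
 have "case_nat d s k' = case_nat d t k'" if "k' < Suc k" for k' using that k(2) by (cases k') auto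
 thus ?thesis unfolding less_fun_def using k(1) by (intro exI[of _ "Suc k"]) simp
qed

lemma less_fun_False_True: "less_fun (case_nat False s) (case_nat True t)"
 unfolding less_fun_def by (intro exI[of _ 0]) simp

text \<open>Joining neighbouring trees keeps the linear order of the ends, so the contraction is
  available in all three modes.\<close>

lemma pres_kap: "pres m k (kap i L)"
proof (rule pres_MF_imp)
 have "end_less (end_map (kap i L) (j, s)) (end_map (kap i L) (j', s'))" if "end_less (j, s) (j', s')" for j s j' s'
  using that less_fun_case_nat less_fun_False_True unfolding end_map_kap
  by (auto simp: end_less_def split: if_splits)
 thus "pres MF k (kap i L)" by (auto simp: pres_def)
qed

lemma pres_kinv: "i < K ==> pres m K (kinv i L)"
 using pres_inv[of "Suc K" "Suc L" K L "kap i L" "kinv i L" m, OF quasi_kap _ pres_kap] kinv_kap by blast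

text \<open>Permutes whole trees and isolated vertices; used to bring a caret into the position
  required by \<open>kap\<close>.\<close>

definition relab :: "(nat => nat) => (nat => nat) => vertex => vertex" where
 "relab pr si v = (case v of Node j w => Node (pr j) w | Isolated j => Isolated (si j))"

lemma is_child_relab:
 assumes "bij_betw pr {..<K} {..<K}" "u:forest K L" "v:forest K L"
 shows "is_child d (relab pr si u) (relab pr si v) \<longleftrightarrow> is_child d u v"
proof -
 have "pr i = pr j \<longleftrightarrow> i = j" if "i < K" "j < K" for i j
  using assms(1) that by (auto simp: bij_betw_def inj_on_def)
 thus ?thesis using assms(2,3) by (auto simp: relab_def is_child_def forest_def)
qed

lemma quasi_relab:
 assumes p: "bij_betw pr {..<K} {..<K}" and s: "bij_betw si {..<L} {..<L}"
 shows "quasi K L K L (relab pr si)"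
proof -
 have "inj_on (relab pr si) (forest K L)"
 proof (rule inj_onI)
  fix u v assume "u:forest K L" "v:forest K L" "relab pr si u = relab pr si v"
  thus "u = v" using p s by (auto simp: forest_def relab_def bij_betw_def inj_on_def)
 qed
 moreover have "relab pr si`forest K L = forest K L"
 proof (intro equalityI subsetI)
  fix v assume "v:relab pr si`forest K L"
  thus "v:forest K L" using p s by (auto simp: forest_def relab_def bij_betw_def)
 next
  fix v assume v: "v:forest K L"
  show "v:relab pr si`forest K L"
  proof (cases v)
   case (Node j w)
   hence "j:pr`{..<K}" using v p by (auto simp: forest_def bij_betw_def)
   then obtain i where "i < K" "j = pr i" by blast
   hence "v = relab pr si (Node i w)" "Node i w:forest K L" using Node by (auto simp: relab_def forest_def)
   thus ?thesis by (rule image_eqI)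
  next
   case (Isolated j)
   hence "j:si`{..<L}" using v s by (auto simp: forest_def bij_betw_def)
   then obtain i where "i < L" "j = si i" by blast
   hence "v = relab pr si (Isolated i)" "Isolated i:forest K L" using Isolated by (auto simp: relab_def forest_def)
   thus ?thesis by (rule image_eqI)
  qed
 qed
 ultimately have "bij_betw (relab pr si) (forest K L) (forest K L)" by (simp add: bij_betw_def)
 moreover have "respects_children_at (relab pr si) v" if "v:forest K L" for v
  unfolding respects_children_at_def using is_child_relab[OF p child_in_forest[OF _ that] that] by blast
 hence "{v:forest K L. ~ respects_children_at (relab pr si) v} = {}" by blast
 ultimately show ?thesis by (simp only: quasi_def) simp
qed

lemma end_map_relab: "end_map (relab pr si) (j, s) = (pr j, s)"
 by (rule end_mapI[of _ _ 0 _ 0]) (simp add: relab_def ray_def)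

lemma pres_relab_id: "(!!j. j < K ==> pr j = j) ==> pres m K (relab pr si)"
 by (rule pres_MF_imp) (auto simp: pres_def end_map_relab ends_def end_less_def)

text \<open>The first tree, an initial block of the linear order, becomes the last one, and the
  other trees move down by one. Moving an initial block to the end does not change the cyclic
  order.\<close>

lemma pres_relab_rot: "pres MT K (relab (%j. (j + (K - 1)) mod K) si)"
proof -
 let ?r = "%e::nat \<times> (nat => bool). ((fst e + (K - 1)) mod K, snd e)"
 have rot: "(j + (K - 1)) mod K = (if j = 0 then K - 1 else j - 1)" if "j < K" for j
 proof (cases j)
  case 0
  thus ?thesis using that by simp
 next
  case (Suc i)
  hence "j + (K - 1) = i + K" using that by simp
  thus ?thesis using Suc that by simp
 qed
 have le: "end_less (?r a) (?r b) \<longleftrightarrow> (if fst a = 0 & fst b ~= 0 then False else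
   if fst a ~= 0 & fst b = 0 then True else end_less a b)"
  if "a:ends K" "b:ends K" for a b
  using that rot[of "fst a"] rot[of "fst b"] by (auto simp: end_less_def ends_def)
 have z: "end_less a b" if "fst a = 0" "fst b ~= 0" for a b using that by (simp add: end_less_def)
 have "end_cyclic (?r a) (?r b) (?r c)"
  if abc: "a:ends K" "b:ends K" "c:ends K" "end_cyclic a b c" for a b c
  using abc(4) unfolding end_cyclic_def le[OF abc(1,2)] le[OF abc(2,3)] le[OF abc(3,1)]
  using z[of a b] z[of b a] z[of b c] z[of c b] z[of a c] z[of c a]
   end_less_asym[of a b] end_less_asym[of b c] end_less_asym[of c a] by (auto split: if_splits)
 thus ?thesis by (auto simp: pres_def end_map_relab)
qed

section \<open>The poset of labelled bases\<close>

locale labelled =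
 fixes m :: mode and k l :: nat
begin

definition Om :: "vertex set" where "Om = forest k l"

text \<open>A labelled base of level \<open>n\<close> identifies \<open>forest k l\<close> with \<open>forest (k + n) (l + n)\<close>. Its relation
 \<open>Rl\<close> is the pulled back child relation, and \<open>y\<close> is an expansion of \<open>x\<close> if its relation is smaller.\<close>

definition LV :: "(nat \<times> vmap) set" where
 "LV = {x. snd x:extensional Om & quasi k l (k + fst x) (l + fst x) (snd x) & pres m k (snd x)}"

definition Rl :: "nat \<times> vmap => (bool \<times> vertex \<times> vertex) set" where
 "Rl x = {(d, u, v). u:Om & v:Om & is_child d (snd x u) (snd x v)}"

definition ble :: "nat \<times> vmap => nat \<times> vmap => bool" where
 "ble x y \<longleftrightarrow> Rl y <= Rl x"

definition isos :: "nat \<times> vmap => vertex set" where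
 "isos x = {v:Om. EX j. snd x v = Isolated j}"

definition rts :: "nat \<times> vmap => vertex set" where
 "rts x = {v:Om. EX i. snd x v = Node i []}"

lemma LV_quasi: "x:LV ==> quasi k l (k + fst x) (l + fst x) (snd x)"
 by (simp add: LV_def)

lemma LV_pres: "x:LV ==> pres m k (snd x)"
 by (simp add: LV_def)

lemma LV_bij: "x:LV ==> bij_betw (snd x) Om (forest (k + fst x) (l + fst x))"
 by (simp add: LV_def quasi_def Om_def)

lemma LV_in: "x:LV ==> v:Om ==> snd x v:forest (k + fst x) (l + fst x)"
 using LV_bij by (rule bij_betw_apply)

lemma LV_inj: "x:LV ==> u:Om ==> v:Om ==> snd x u = snd x v ==> u = v"
 using LV_bij by (auto simp: bij_betw_def inj_on_def)

lemma LV_surj: "x:LV ==> a:forest (k + fst x) (l + fst x) ==> EX v:Om. snd x v = a"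
 using bij_betw_imp_surj_on[OF LV_bij[of x]] by (metis imageE)

lemma Rl_iff: "(d, u, v):Rl x \<longleftrightarrow> u:Om & v:Om & is_child d (snd x u) (snd x v)"
 by (simp add: Rl_def)

lemma is_child_iff: "is_child d u v \<longleftrightarrow> (EX i w. v = Node i w & u = Node i (w @ [d]))"
 by (simp add: is_child_def)

lemma Rl_child_unique: "x:LV ==> (d, u, v):Rl x ==> (d, u', v):Rl x ==> u = u'"
 using LV_inj[of x u u'] by (auto simp: Rl_iff is_child_iff)

lemma Rl_parent_unique: "x:LV ==> (d, u, v):Rl x ==> (d', u, v'):Rl x ==> d = d' & v = v'"
 using LV_inj[of x v v'] by (auto simp: Rl_iff is_child_iff)

lemma not_iso_iff: "x:LV ==> v:Om ==> v ~: isos x \<longleftrightarrow> (EX i w. snd x v = Node i w)"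
 using LV_in[of x v] by (cases "snd x v") (auto simp: isos_def)

lemma Rl_child_ex: assumes "x:LV" "v:Om" "v ~: isos x" shows "EX u. (d, u, v):Rl x"
proof -
 obtain i w where iw: "snd x v = Node i w" using assms not_iso_iff by blast
 hence "Node i (w @ [d]):forest (k + fst x) (l + fst x)" using LV_in[OF assms(1,2)] by simp
 then obtain u where "u:Om" "snd x u = Node i (w @ [d])" using LV_surj[OF assms(1)] by blast
 thus ?thesis using iw assms(2) by (auto simp: Rl_iff is_child_iff)
qed

lemma Rl_not_iso: "(d, u, v):Rl x ==> v ~: isos x & u ~: isos x & u ~: rts x"
 by (auto simp: Rl_iff is_child_iff isos_def rts_def)

lemma Rl_parent_ex:
 assumes "x:LV" "u:Om" "u ~: isos x" "u ~: rts x" shows "EX d v. (d, u, v):Rl x"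
proof -
 obtain i w where iw: "snd x u = Node i w" using assms not_iso_iff by blast
 hence "w ~= []" using assms by (auto simp: rts_def)
 then obtain w' d where w: "w = w' @ [d]" by (metis rev_exhaust)
 have "Node i w':forest (k + fst x) (l + fst x)" using LV_in[OF assms(1,2)] iw by simp
 then obtain v where "v:Om" "snd x v = Node i w'" using LV_surj[OF assms(1)] by blast
 thus ?thesis using iw w assms(2) by (auto simp: Rl_iff is_child_iff)
qed

lemma bij_isos: "x:LV ==> bij_betw (snd x) (isos x) (Isolated`{..<l + fst x})"
proof (rule bij_betw_subset[OF LV_bij])
 assume x: "x:LV"
 show "snd x`isos x = Isolated`{..<l + fst x}"
 proof (intro equalityI subsetI)
  fix a assume "a:snd x`isos x"
  then obtain v j where "v:Om" "a = snd x v" "snd x v = Isolated j" by (auto simp: isos_def)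
  thus "a:Isolated`{..<l + fst x}" using LV_in[OF x, of v] by auto
 next
  fix a assume "a:Isolated`{..<l + fst x}"
  then obtain j where j: "a = Isolated j" "j < l + fst x" by auto
  then obtain v where v: "v:Om" "snd x v = a" using LV_surj[OF x, of a] by auto
  hence "v:isos x" using j by (simp add: isos_def)
  moreover have "a = snd x v" using v by simp
  ultimately show "a:snd x`isos x" by blast
 qed
qed (auto simp: isos_def)

text \<open>The number of childless vertices determines the level; this is what makes the level
  monotone in the order.\<close>

lemma card_isos: assumes "x:LV" shows "finite (isos x)" "card (isos x) = l + fst x"
proof -
 have "inj_on Isolated {..<l + fst x}" by (simp add: inj_on_def)
 hence "card (Isolated`{..<l + fst x}) = l + fst x" by (simp add: card_image)
 thus "card (isos x) = l + fst x" using bij_betw_same_card[OF bij_isos[OF assms]] by simp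
 show "finite (isos x)" using bij_betw_finite[OF bij_isos[OF assms]] by simp
qed

lemma finite_rts: assumes "x:LV" shows "finite (rts x)"
proof -
 have "inj_on (snd x) (rts x)" using LV_inj[OF assms] by (auto simp: inj_on_def rts_def)
 moreover have "snd x`rts x <= (%i. Node i [])`{..<k + fst x}"
 proof (rule image_subsetI)
  fix v assume "v:rts x"
  then obtain i where "v:Om" "snd x v = Node i []" by (auto simp: rts_def)
  thus "snd x v:(%i. Node i [])`{..<k + fst x}" using LV_in[OF assms, of v] by auto
 qed
 hence "finite (snd x`rts x)" by (rule finite_subset) simp
 ultimately show ?thesis by (simp add: finite_image_iff)
qed

lemma ble_refl: "ble x x" by (simp add: ble_def)

lemma ble_trans: "ble x y ==> ble y z ==> ble x z" by (auto simp: ble_def)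

lemma ble_isos: assumes "x:LV" "y:LV" "ble x y" shows "isos x <= isos y"
proof
 fix v assume v: "v:isos x"
 show "v:isos y"
 proof (rule ccontr)
  assume vy: "v ~: isos y"
  have "v:Om" using v by (simp add: isos_def)
  then obtain u where "(True, u, v):Rl y" using Rl_child_ex[OF assms(2) _ vy] by blast
  hence "(True, u, v):Rl x" using assms(3) by (auto simp: ble_def)
  thus False using Rl_not_iso v by blast
 qed
qed

lemma ble_lev: assumes "x:LV" "y:LV" "ble x y" shows "fst x <= fst y"
 using card_mono[OF card_isos(1)[OF assms(2)] ble_isos[OF assms]] card_isos(2) assms by simp

text \<open>On equal levels the childless vertices coincide, so a vertex with a child for
  \<open>x\<close> has one for \<open>y\<close>. That child is also one for \<open>x\<close>, and
  children are unique.\<close>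

lemma ble_lev_eq: assumes x: "x:LV" and y: "y:LV" and le: "ble x y" and eq: "fst x = fst y" shows "ble y x"
proof -
 have iso: "isos x = isos y"
  by (rule card_subset_eq[OF card_isos(1)[OF y] ble_isos[OF x y le]]) (use card_isos(2) x y eq in simp)
 have "t:Rl y" if "t:Rl x" for t
 proof -
  obtain d u v where t: "t = (d, u, v)" by (cases t)
  have "(d, u, v):Rl x" using that t by simp
  hence "v:Om" "v ~: isos y" using Rl_not_iso[of d u v x] iso by (simp_all add: Rl_iff)
  then obtain u' where u': "(d, u', v):Rl y" using Rl_child_ex[OF y] by blast
  hence "(d, u', v):Rl x" using le by (auto simp: ble_def)
  hence "u' = u" using Rl_child_unique[OF x] that t by blast
  thus ?thesis using u' t by simp
 qed
 thus ?thesis by (auto simp: ble_def)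
qed

section \<open>Relabelling and expansion of bases\<close>

definition lab :: "vmap => nat => nat \<times> vmap => nat \<times> vmap" where
 "lab g n x = (n, \<lambda>v\<in>Om. g (snd x v))"

lemma lab_LV:
 assumes x: "x:LV" and g: "quasi (k + fst x) (l + fst x) (k + n) (l + n) g" "pres m (k + fst x) g"
 shows "lab g n x:LV"
proof -
 have f: "!!v. v:forest k l ==> (\<lambda>v\<in>Om. g (snd x v)) v = g (snd x v)" by (simp add: Om_def)
 have "quasi k l (k + n) (l + n) (\<lambda>v\<in>Om. g (snd x v))"
  by (rule quasi_comp[OF LV_quasi[OF x] g(1) f])
 moreover have "pres m k (\<lambda>v\<in>Om. g (snd x v))"
  by (rule pres_comp[OF LV_quasi[OF x] g(1) f LV_pres[OF x] g(2)])
 ultimately show ?thesis by (simp add: LV_def lab_def)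
qed

lemma Rl_lab: "(d, u, v):Rl (lab g n x) \<longleftrightarrow> u:Om & v:Om & is_child d (g (snd x u)) (g (snd x v))"
 by (auto simp: Rl_iff lab_def)

definition base :: "nat \<times> vmap" where
 "base = (0, \<lambda>v\<in>Om. v)"

lemma base_LV: "base:LV"
proof -
 let ?f = "\<lambda>v\<in>Om. v"
 have f: "!!v. v:forest k l ==> ?f v = v" by (simp add: Om_def)
 have "bij_betw ?f (forest k l) (forest k l)"
  by (subst bij_betw_cong[of _ ?f "%v. v"]) (use f in \<open>auto simp: bij_betw_def inj_on_def\<close>)
 moreover have "respects_children_at ?f v" if "v:forest k l" for v
  unfolding respects_children_at_def using f child_in_forest[OF _ that] that by simp
 hence "{v:forest k l. ~ respects_children_at ?f v} = {}" by blast
 ultimately have "quasi k l k l ?f" by (simp only: quasi_def) simp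
 moreover have "end_map ?f e = e" if "e:ends k" for e by (rule end_map_id[OF that f])
 hence "pres m k ?f" by (cases m) (simp_all add: pres_def)
 ultimately show ?thesis by (simp add: LV_def base_def)
qed

lemma Rl_base: "(d, u, v):Rl base \<longleftrightarrow> u:Om & v:Om & is_child d u v"
 by (auto simp: Rl_iff base_def)

lemma expand:
 assumes x: "x:LV" and v: "v:Om" "snd x v = Node i []"
 shows "EX y:LV. Rl y = {t:Rl x. snd (snd t) ~= v} &
  (ALL u:Om. snd y u = kinv i (l + fst x) (snd x u))"
proof -
 have i: "i < k + fst x" using LV_in[OF x v(1)] v(2) by simp
 let ?y = "lab (kinv i (l + fst x)) (Suc (fst x)) x"
 have "?y:LV"
  by (rule lab_LV[OF x]) (use quasi_kinv[OF i] pres_kinv[OF i] in simp_all)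
 moreover have "Rl ?y = {t:Rl x. snd (snd t) ~= v}"
 proof -
  have "(d, a, b):Rl ?y \<longleftrightarrow> (d, a, b):Rl x & b ~= v" for d a b
  proof -
   have "snd x b = Node i [] \<longleftrightarrow> b = v" if "b:Om" using LV_inj[OF x that v(1)] v(2) by auto
   thus ?thesis
    using is_child_kinv[OF LV_in[OF x, of a] LV_in[OF x, of b] i, of d] unfolding Rl_lab unfolding Rl_iff by blast
  qed
  thus ?thesis by auto
 qed
 moreover have "ALL u:Om. snd ?y u = kinv i (l + fst x) (snd x u)" by (simp add: lab_def)
 ultimately show ?thesis by blast
qed

text \<open>Expanding at the root of the tree containing \<open>v\<close> removes the first letter
  of the address of \<open>v\<close>. After finitely many expansions \<open>v\<close> is a root, and
  one more makes it childless.\<close>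

lemma expand_to_iso:
 assumes "x:LV" "v:Om" shows "EX y:LV. ble x y & v:isos y"
proof (cases "v:isos x")
 case True
 thus ?thesis using assms ble_refl by blast
next
 case False
 have "EX y:LV. ble x y & v:isos y" if "x:LV" "snd x v = Node j w" for x j w
  using that
 proof (induction w arbitrary: x j)
  case Nil
  obtain y where y: "y:LV" "Rl y = {t:Rl x. snd (snd t) ~= v}" using expand[OF Nil(1) assms(2) Nil(2)] by blast
  have "v:isos y"
  proof (rule ccontr)
   assume "v ~: isos y"
   then obtain u where "(True, u, v):Rl y" using Rl_child_ex[OF y(1) assms(2)] by blast
   thus False using y(2) by simp
  qed
  moreover have "ble x y" using y(2) by (auto simp: ble_def)
  ultimately show ?case using y(1) by blast
 next
  case (Cons d w)
  have "j < k + fst x" using LV_in[OF Cons(2) assms(2)] Cons(3) by simp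
  then obtain r where r: "r:Om" "snd x r = Node j []" using LV_surj[OF Cons(2), of "Node j []"] by auto
  obtain y where y: "y:LV" "Rl y = {t:Rl x. snd (snd t) ~= r}"
   "ALL u:Om. snd y u = kinv j (l + fst x) (snd x u)" using expand[OF Cons(2) r] by blast
  have "snd y v = Node (if d then Suc j else j) w" using y(3) assms(2) Cons(3) by (simp add: kinv_def)
  from Cons.IH[OF y(1) this] obtain z where z: "z:LV" "ble y z" "v:isos z" by blast
  have "ble x y" using y(2) by (auto simp: ble_def)
  thus ?case using z ble_trans by blast
 qed
 thus ?thesis using False assms not_iso_iff by blast
qed

lemma expand_finite:
 assumes "finite B" "B <= Om" shows "EX y:LV. ble base y & B <= isos y"
 using assms
proof (induction B)
 case empty
 thus ?case using base_LV ble_refl by blast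
next
 case (insert b B)
 then obtain y where y: "y:LV" "ble base y" "B <= isos y" by auto
 obtain z where z: "z:LV" "ble y z" "b:isos z" using expand_to_iso[OF y(1), of b] insert by auto
 thus ?case using y ble_trans ble_isos[OF y(1) z(1,2)] by blast
qed

text \<open>Outside a finite set \<open>B\<close> all the given bases respect the edges of the
  standard base. Expanding the standard base until the vertices of \<open>B\<close> are childless
  leaves only edges that belong to all of them.\<close>

lemma directed_LV: assumes A: "finite A" "A <= LV" shows "EX z:LV. ALL x:A. ble x z"
proof -
 define B where "B = (UN x:A. {v:Om. ~ respects_children_at (snd x) v})"
 have "finite B" using A by (auto simp: B_def LV_def quasi_def Om_def)
 moreover have "B <= Om" by (auto simp: B_def)
 ultimately obtain y where y: "y:LV" "ble base y" "B <= isos y" using expand_finite by blast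
 have "ble x y" if x: "x:A" for x
  unfolding ble_def
 proof
  fix t assume t: "t:Rl y"
  obtain d u v where duv: "t = (d, u, v)" by (cases t)
  have "t:Rl base" using t y(2) unfolding ble_def by (rule subsetD[rotated])
  hence b: "u:Om" "v:Om" "is_child d u v" unfolding duv by (simp_all add: Rl_base)
  have "v ~: isos y" using t Rl_not_iso unfolding duv by blast
  hence "respects_children_at (snd x) v" using y(3) x b(2) unfolding B_def by blast
  thus "t:Rl x" using b unfolding duv Rl_iff respects_children_at_def by blast
 qed
 thus ?thesis using y(1) by blast
qed

section \<open>Contraction of a base along disjoint carets\<close>

definition tri :: "(vertex \<times> vertex \<times> vertex) set => (bool \<times> vertex \<times> vertex) set" where
 "tri S = (\<Union>(a, b, c)\<in>S. {(False, a, c), (True, b, c)})"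

text \<open>The roots that may become siblings: neighbours in the linear order, neighbours in the
  cyclic order, or any two. If there is one tree, the inequality keeps it from being its own cyclic
  neighbour.\<close>

definition adj :: "nat => nat => nat => bool" where
 "adj K i j \<longleftrightarrow> (case m of MF => j = Suc i | MT => i ~= j & j = Suc i mod K | MV => i ~= j)"

text \<open>In \<open>(a, b, c)\<close> the roots \<open>a\<close> and \<open>b\<close> are the
  future left and right child, and the childless vertex \<open>c\<close> is their future
  parent.\<close>

definition adm :: "nat \<times> vmap => vertex \<times> vertex \<times> vertex => bool" where
 "adm x e \<longleftrightarrow> (case e of (a, b, c) => a:Om & b:Om & c:isos x &
  (EX i j. snd x a = Node i [] & snd x b = Node j [] & adj (k + fst x) i j))"

definition dis :: "vertex \<times> vertex \<times> vertex => vertex \<times> vertex \<times> vertex => bool" where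
 "dis e e' \<longleftrightarrow> (case e of (a, b, c) => case e' of (a', b', c') => {a, b} Int {a', b'} = {} & c ~= c')"

lemma contract_std:
 assumes x: "x:LV" "fst x = Suc n" and a: "a:Om" "snd x a = Node i []" and b: "b:Om" "snd x b = Node (Suc i) []"
  and c: "c:Om" "snd x c = Isolated (l + n)"
 shows "EX z:LV. fst z = n & Rl z = Rl x Un tri {(a, b, c)} & (ALL e. adm x e & dis (a, b, c) e --> adm z e)"
proof -
 let ?K = "k + n" and ?L = "l + n"
 have i: "i < ?K" using LV_in[OF x(1) b(1)] b(2) x(2) by simp
 have fr: "forest (k + fst x) (l + fst x) = forest (Suc ?K) (Suc ?L)" by (simp add: x(2))
 let ?z = "lab (kap i ?L) n x"
 have z: "?z:LV"
  by (rule lab_LV[OF x(1)]) (use quasi_kap[OF i] pres_kap x(2) in simp_all)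
 have "(d, u, v):Rl ?z \<longleftrightarrow> (d, u, v):Rl x Un tri {(a, b, c)}" for d u v
 proof (cases "u:Om & v:Om")
  case True
  hence uv: "u:Om" "v:Om" by auto
  have 1: "snd x v = Isolated ?L \<longleftrightarrow> v = c" using LV_inj[OF x(1) uv(2) c(1)] c(2) by auto
  have 2: "snd x u = Node (if d then Suc i else i) [] \<longleftrightarrow> u = (if d then b else a)"
   using LV_inj[OF x(1) uv(1) a(1)] LV_inj[OF x(1) uv(1) b(1)] a(2) b(2) by auto
  have "(d, u, v):Rl ?z \<longleftrightarrow> is_child d (snd x u) (snd x v) | (v = c & u = (if d then b else a))"
   unfolding Rl_lab using uv is_child_kap[of "snd x u" ?K ?L "snd x v" d i] LV_in[OF x(1)] 1 2
   unfolding fr by simp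
  thus ?thesis using uv by (auto simp: Rl_iff tri_def)
 next
  case False
  thus ?thesis using a(1) b(1) c(1) by (auto simp: Rl_iff tri_def)
 qed
 hence R: "Rl ?z = Rl x Un tri {(a, b, c)}" by auto
 have "adm ?z e" if e: "adm x e" "dis (a, b, c) e" for e
 proof -
  obtain a' b' c' where e': "e = (a', b', c')" by (cases e)
  obtain p q where pq: "a':Om" "b':Om" "c':isos x" "snd x a' = Node p []" "snd x b' = Node q []"
   "adj (Suc ?K) p q" using e(1) x(2) unfolding e' adm_def by auto
  have ne: "p ~= i" "p ~= Suc i" "q ~= i" "q ~= Suc i" "c' ~= c"
   using e(2) pq a b LV_inj[OF x(1)] unfolding e' dis_def by auto
  have lt: "p < Suc ?K" "q < Suc ?K" using LV_in[OF x(1) pq(1)] LV_in[OF x(1) pq(2)] pq(4,5) x(2) by simp_all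
  let ?f = "%p. if p < i then p else p - 1"
  have "snd ?z a' = Node (?f p) []" "snd ?z b' = Node (?f q) []"
   using pq ne by (auto simp: lab_def kap_def)
  moreover have "c':isos ?z"
  proof -
   obtain j where j: "snd x c' = Isolated j" "c':Om" using pq(3) by (auto simp: isos_def)
   hence "j ~= ?L" using ne(5) LV_inj[OF x(1) j(2) c(1)] c(2) by auto
   thus ?thesis using j by (simp add: isos_def lab_def kap_def)
  qed
  moreover have "adj ?K (?f p) (?f q)"
  proof (cases m)
   case MF
   hence "q = Suc p" using pq(6) by (simp add: labelled.adj_def)
   thus ?thesis using MF ne by (auto simp: labelled.adj_def)
  next
   case MV
   hence "p ~= q" using pq(6) by (simp add: labelled.adj_def)
   thus ?thesis using MV ne by (auto simp: labelled.adj_def)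
  next
   case MT
   hence q: "q = Suc p mod Suc ?K" "p ~= q" using pq(6) by (simp_all add: labelled.adj_def)
   show ?thesis
   \<comment> \<open>Here the last tree is followed by the first one; the pair wraps around before
     and after the contraction.\<close>
   proof (cases "p = ?K")
    case True
    hence "q = 0" using q by simp
    moreover have "?f p = ?K - 1" using True ne i by auto
    moreover have "Suc (?K - 1) = ?K" using i by simp
    ultimately show ?thesis using MT ne i True by (auto simp: labelled.adj_def)
   next
    case False
    hence qp: "q = Suc p" using q lt by simp
    define r where "r = ?f p"
    have "?f q = Suc r" unfolding r_def using ne qp by auto
    moreover have "Suc r < ?K" unfolding r_def using ne lt qp i by auto
    ultimately show ?thesis unfolding r_def[symmetric] using MT by (simp add: labelled.adj_def)
   qed
  qed
  moreover have "fst ?z = n" by (simp add: lab_def)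
  ultimately show ?thesis using pq(1,2) unfolding e' adm_def by auto
 qed
 thus ?thesis using z R by (intro bexI[of _ ?z]) (auto simp: lab_def)
qed

definition tr :: "nat => nat => nat => nat" where
 "tr a b j = (if j = a then b else if j = b then a else j)"

lemma bij_tr: "a < K ==> b < K ==> bij_betw (tr a b) {..<K} {..<K}"
 by (rule bij_betw_byWitness[of _ "tr a b"]) (auto simp: tr_def)

text \<open>The two roots are brought side by side by a permutation that the mode allows: none for
  \<open>MF\<close>, two transpositions for \<open>MV\<close>, and for \<open>MT\<close> a rotation
  by one if the pair wraps around.\<close>

lemma perm_ex:
 assumes adj: "adj K p q" and p: "p < K" and q: "q < K"
 shows "EX pr i. bij_betw pr {..<K} {..<K} & (ALL si. pres m K (relab pr si)) & pr p = i & pr q = Suc i &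
  (ALL p'<K. ALL q'<K. adj K p' q' --> adj K (pr p') (pr q'))"
proof -
 have idc: "?thesis" if "q = Suc p"
  by (rule exI[of _ "%j. j"], rule exI[of _ p])
   (use that pres_relab_id[of K "%j. j"] in \<open>auto simp: bij_betw_def inj_on_def\<close>)
 show ?thesis
 proof (cases m)
  case MF
  thus ?thesis using idc adj by (simp add: labelled.adj_def)
 next
  case MV
  \<comment> \<open>The position of \<open>q\<close> after \<open>p\<close> has been swapped with
    0.\<close>
  define t where "t = tr p 0 q"
  define pr where "pr = tr t 1 \<circ> tr p 0"
  have pq: "p ~= q" using adj MV by (simp add: labelled.adj_def)
  hence t: "t < K" "t ~= 0" using p q by (auto simp: t_def tr_def)
  have "1 < K" using p q pq by linarith
  hence b: "bij_betw pr {..<K} {..<K}"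
   unfolding pr_def using bij_tr[of p K 0] bij_tr[of t K 1] p t by (intro bij_betw_trans) auto
  hence inj: "pr a = pr b \<longleftrightarrow> a = b" if "a < K" "b < K" for a b
   using that by (auto simp: bij_betw_def inj_on_def)
  have "pr p = 0" "pr q = Suc 0" using t by (auto simp: pr_def tr_def t_def)
  moreover have "pres m K (relab pr si)" for si using MV by (simp add: pres_def)
  moreover have "adj K (pr p') (pr q')" if "p' < K" "q' < K" "adj K p' q'" for p' q'
   using that inj MV by (simp add: labelled.adj_def)
  ultimately show ?thesis using b by blast
 next
  case MT
  hence q': "q = Suc p mod K" "p ~= q" using adj by (simp_all add: labelled.adj_def)
  show ?thesis
  proof (cases "Suc p < K")
   case True
   thus ?thesis using idc q' by simp
  next
   case False
   hence pK: "p = K - 1" "Suc p = K" using p by auto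
   hence q0: "q = 0" using q' by simp
   hence K2: "2 <= K" using q' pK by linarith
   let ?pr = "%j. (j + (K - 1)) mod K"
   have bck: "Suc (?pr j) mod K = j" if "j < K" for j
   proof -
    have "Suc (?pr j) mod K = Suc (j + (K - 1)) mod K" by (rule mod_Suc_eq)
    also have "Suc (j + (K - 1)) = j + K" using K2 by simp
    finally show ?thesis using that by simp
   qed
   have fwd: "?pr (Suc j mod K) = j" if "j < K" for j
   proof -
    have "?pr (Suc j mod K) = (Suc j + (K - 1)) mod K" by (rule mod_add_left_eq)
    also have "Suc j + (K - 1) = j + K" using K2 by simp
    finally show ?thesis using that by simp
   qed
   have b: "bij_betw ?pr {..<K} {..<K}"
    by (rule bij_betw_byWitness[of _ "%j. Suc j mod K"]) (use bck fwd K2 in auto)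
   have inj: "?pr a = ?pr b \<longleftrightarrow> a = b" if "a < K" "b < K" for a b
    using inj_on_eq_iff[OF bij_betw_imp_inj_on[OF b], of a b] that by simp
   have "pres m K (relab ?pr si)" for si unfolding MT by (rule pres_relab_rot)
   moreover have "?pr p = K - 2"
   proof -
    have "p + (K - 1) = (K - 2) + K" using pK K2 by simp
    hence "?pr p = ((K - 2) + K) mod K" by (simp only:)
    also have "\<dots> = (K - 2) mod K" by (rule mod_add_self2)
    also have "\<dots> = K - 2" by (rule mod_less) (use K2 in simp)
    finally show ?thesis .
   qed
   moreover have "?pr q = Suc (K - 2)" using q0 K2 by simp
   moreover have "adj K (?pr p') (?pr q')" if "p' < K" "q' < K" "adj K p' q'" for p' q'
   proof -
    have "q' = Suc p' mod K" "p' ~= q'" using that(3) MT by (simp_all add: labelled.adj_def)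
    hence "?pr q' = Suc (?pr p') mod K" "?pr p' ~= ?pr q'"
     using fwd[OF that(1)] bck[OF that(1)] inj[OF that(1,2)] by simp_all
    thus ?thesis using MT by (simp add: labelled.adj_def)
   qed
   ultimately show ?thesis using b by (intro exI[of _ ?pr] exI[of _ "K - 2"]) blast
  qed
 qed
qed

lemma contract_one:
 assumes x: "x:LV" "fst x = Suc n" and e: "adm x (a, b, c)"
 shows "EX z:LV. fst z = n & Rl z = Rl x Un tri {(a, b, c)} & (ALL e. adm x e & dis (a, b, c) e --> adm z e)"
proof -
 let ?K = "k + fst x" and ?L = "l + fst x"
 obtain p q where pq: "a:Om" "b:Om" "c:isos x" "snd x a = Node p []" "snd x b = Node q []" "adj ?K p q"
  using e by (auto simp: adm_def)
 obtain j where j: "c:Om" "snd x c = Isolated j" using pq(3) by (auto simp: isos_def)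
 have lt: "p < ?K" "q < ?K" "j < ?L"
  using LV_in[OF x(1) pq(1)] LV_in[OF x(1) pq(2)] LV_in[OF x(1) j(1)] pq(4,5) j(2) by simp_all
 obtain pr i where pi: "bij_betw pr {..<?K} {..<?K}" "!!si. pres m ?K (relab pr si)" "pr p = i" "pr q = Suc i"
  "ALL p'<?K. ALL q'<?K. adj ?K p' q' --> adj ?K (pr p') (pr q')"
  using perm_ex[OF pq(6) lt(1,2)] by blast
 define si where "si = tr j (l + n)"
 have sg: "bij_betw si {..<?L} {..<?L}" unfolding si_def by (rule bij_tr[OF lt(3)]) (simp add: x(2))
 define x' where "x' = lab (relab pr si) (fst x) x"
 have x': "x':LV" unfolding x'_def by (rule lab_LV[OF x(1) quasi_relab[OF pi(1) sg] pi(2)])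
 have sx': "snd x' v = relab pr si (snd x v)" if "v:Om" for v using that by (simp add: x'_def lab_def)
 have fx': "fst x' = fst x" by (simp add: x'_def lab_def)
 have R: "Rl x' = Rl x"
 proof -
  have "(d, u, v):Rl x' \<longleftrightarrow> (d, u, v):Rl x" for d u v
   using is_child_relab[OF pi(1) LV_in[OF x(1), of u] LV_in[OF x(1), of v], of d si]
   unfolding Rl_iff by (auto simp: sx')
  thus ?thesis by auto
 qed
 have adm': "adm x' e" if e: "adm x e" for e
 proof -
  obtain a' b' c' where e': "e = (a', b', c')" by (cases e)
  obtain p' q' where a: "a':Om" "b':Om" "c':isos x" "snd x a' = Node p' []" "snd x b' = Node q' []"
   "adj ?K p' q'" using e unfolding e' adm_def by auto
  have "p' < ?K" "q' < ?K" using LV_in[OF x(1) a(1)] LV_in[OF x(1) a(2)] a(4,5) by simp_all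
  hence "adj ?K (pr p') (pr q')" using pi(5) a(6) by blast
  moreover have "c':isos x'" using a(3) sx' by (auto simp: isos_def relab_def)
  moreover have "snd x' a' = Node (pr p') []" "snd x' b' = Node (pr q') []"
   using sx' a by (simp_all add: relab_def)
  ultimately show ?thesis using a(1,2) unfolding e' adm_def fx' by auto
 qed
 have "snd x' a = Node i []" "snd x' b = Node (Suc i) []" "snd x' c = Isolated (l + n)"
  using sx'[OF pq(1)] sx'[OF pq(2)] sx'[OF j(1)] pq(4,5) j(2) pi(3,4) by (simp_all add: relab_def si_def tr_def)
 then obtain z where z: "z:LV" "fst z = n" "Rl z = Rl x' Un tri {(a, b, c)}"
  "ALL e. adm x' e & dis (a, b, c) e --> adm z e"
  using contract_std[OF x' _ pq(1) _ pq(2) _ j(1), of n i] fx' x(2) by auto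
 thus ?thesis using R adm' by (intro bexI[of _ z]) auto
qed

text \<open>Contracting one caret keeps every caret disjoint from it admissible, so pairwise
  disjoint carets can be contracted in turn. Each contraction costs one level, whence the bound on
  the cardinality.\<close>

lemma contract_set:
 assumes x: "x:LV" and S: "finite S" "ALL e:S. adm x e" "ALL e:S. ALL e':S. e ~= e' --> dis e e'" "card S <= fst x"
 shows "EX z:LV. fst z + card S = fst x & Rl z = Rl x Un tri S &
  (ALL e. adm x e & (ALL e':S. dis e' e) --> adm z e)"
 using S
proof (induction S)
 case empty
 thus ?case using x by (intro bexI[of _ x]) (auto simp: tri_def)
next
 case (insert e S)
 have 1: "ALL e:S. adm x e" and 2: "ALL e:S. ALL e':S. e ~= e' --> dis e e'" and 3: "card S <= fst x"
  using insert.prems insert.hyps by simp_all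
 from insert.IH[OF 1 2 3] obtain z0 where zin: "z0:LV" and zz: "fst z0 + card S = fst x & Rl z0 = Rl x Un tri S &
  (ALL e. adm x e & (ALL e':S. dis e' e) --> adm z0 e)" by (rule bexE)
 note z0 = zin conjunct1[OF zz] conjunct1[OF conjunct2[OF zz]] conjunct2[OF conjunct2[OF zz]]
 have dS: "dis e' e" if "e':S" for e'
 proof -
  have "e' ~= e" using insert.hyps(2) that by auto
  thus ?thesis using bspec[OF bspec[OF insert.prems(2), of e'], of e] that by simp
 qed
 have "adm x e" using insert.prems(1) by simp
 hence ae: "adm z0 e" using spec[OF z0(4), of e] dS by blast
 obtain n where n: "fst z0 = Suc n" using z0(2) insert.prems(3) insert.hyps
  by (cases "fst z0") auto
 obtain a b c where e: "e = (a, b, c)" by (cases e)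
 from contract_one[OF z0(1) n ae[unfolded e]] obtain z where zi: "z:LV"
  and zy: "fst z = n & Rl z = Rl z0 Un tri {e} & (ALL e'. adm z0 e' & dis e e' --> adm z e')"
  unfolding e by (rule bexE)
 note z = zi conjunct1[OF zy] conjunct1[OF conjunct2[OF zy]] conjunct2[OF conjunct2[OF zy]]
 have "tri (insert e S) = tri S Un tri {e}" by (auto simp: tri_def)
 hence "Rl z = Rl x Un tri (insert e S)" using z(3) z0(3) by auto
 moreover have "fst z + card (insert e S) = fst x" using z(2) n z0(2) insert.hyps by simp
 moreover have "adm z e'" if "adm x e'" "ALL e'':insert e S. dis e'' e'" for e'
 proof -
  have "ALL e'':S. dis e'' e'" using that(2) by simp
  hence "adm z0 e'" using spec[OF z0(4), of e'] that(1) by blast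
  moreover have "dis e e'" using that(2) by simp
  ultimately show ?thesis using spec[OF z(4), of e'] by blast
 qed
 ultimately show ?case by (intro bexI[OF _ z(1)]) simp
qed

subsection \<open>Admissibility of carets\<close>

definition cat :: "bool list => (nat => bool) => nat => bool" where
 "cat w s i = (if i < length w then w ! i else s (i - length w))"

lemma ray_cat: "ray (p, cat w s) (length w + n) = Node p (w @ map s [0..<n])"
 by (auto intro!: nth_equalityI simp: ray_def cat_def nth_append)

lemma cat_less: "less_fun (cat (v @ [False]) s) (cat (v @ [True]) t)"
 unfolding less_fun_def by (intro exI[of _ "length v"]) (auto simp: cat_def nth_append)

text \<open>These are the last end below the left child and the first end below the right child of
  \<open>v\<close>. Both first differences would occur no later than index \<open>length v\<close>,
  and the earlier one contradicts the other comparison.\<close>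

lemma cat_gap:
 assumes "less_fun (cat (v @ [False]) (%_. True)) z" "less_fun z (cat (v @ [True]) (%_. False))"
 shows False
proof -
 obtain n1 where n1: "~ cat (v @ [False]) (%_. True) n1" "z n1"
  "ALL k<n1. cat (v @ [False]) (%_. True) k = z k"
  using assms(1) unfolding less_fun_def by (auto simp: less_bool_def)
 obtain n2 where n2: "~ z n2" "cat (v @ [True]) (%_. False) n2"
  "ALL k<n2. z k = cat (v @ [True]) (%_. False) k"
  using assms(2) unfolding less_fun_def by (auto simp: less_bool_def)
 have l1: "n1 <= length v" using n1(1) by (auto simp: cat_def split: if_splits)
 have l2: "n2 <= length v" using n2(2) by (auto simp: cat_def split: if_splits)
 have A: "cat (v @ [False]) (%_. True) k = v ! k" "cat (v @ [True]) (%_. False) k = v ! k" if "k < length v" for k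
  using that by (auto simp: cat_def nth_append)
 have B: "cat (v @ [True]) (%_. False) (length v)" "~ cat (v @ [False]) (%_. True) (length v)"
  by (auto simp: cat_def nth_append)
 consider "n1 < n2" | "n1 = n2" | "n2 < n1" by linarith
 thus False
 proof cases
  case 1
  hence "n1 < length v" using l2 by simp
  thus False using A[of n1] n1(1,2) n2(3) 1 by auto
 next
  case 2
  thus False using n1(2) n2(1) by simp
 next
  case 3
  hence "n2 < length v" using l1 by simp
  thus False using A[of n2] n2(1,2) n1(3) 3 by auto
 qed
qed

text \<open>After the change of labels \<open>th\<close> the ends of the trees rooted at
  \<open>a\<close> and \<open>b\<close> fill the two halves below \<open>c\<close>, and no end lies
  between the halves. If a different tree followed that of \<open>a\<close>, one of its ends would
  have to be mapped into this gap.\<close>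

lemma caret_adm:
 assumes x: "x:LV" and y: "y:LV" and le: "ble y x" and a: "a:rts x" and b: "b:rts x" and c: "c:isos x"
  and ac: "(False, a, c):Rl y" and bc: "(True, b, c):Rl y"
 shows "adm x (a, b, c)"
proof -
 let ?K = "k + fst x" and ?L = "l + fst x"
 obtain i j where ij: "a:Om" "b:Om" "snd x a = Node i []" "snd x b = Node j []"
  using a b by (auto simp: rts_def)
 have lt: "i < ?K" "j < ?K" using LV_in[OF x ij(1)] LV_in[OF x ij(2)] ij(3,4) by simp_all
 have "a ~= b" using Rl_parent_unique[OF y ac, of True c] bc by auto
 hence ne: "i ~= j" using LV_inj[OF x ij(1,2)] ij(3,4) by auto
 obtain p v where pv: "snd y c = Node p v" "snd y a = Node p (v @ [False])" "snd y b = Node p (v @ [True])"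
  using ac bc by (auto simp: Rl_iff is_child_iff)
 define g where "g = inv_into Om (snd x)"
 have g: "g (snd x u) = u" if "u:Om" for u
  unfolding g_def using bij_betw_inv_into_left[OF LV_bij[OF x] that] .
 have gq: "quasi ?K ?L k l g" by (rule quasi_inv[OF LV_quasi[OF x]]) (simp add: g flip: Om_def)
 have gp: "pres m ?K g" by (rule pres_inv[OF LV_quasi[OF x] _ LV_pres[OF x]]) (simp add: g flip: Om_def)
 define th where "th = (%u. snd y (g u))"
 have tp: "pres m ?K th" by (rule pres_comp[OF gq LV_quasi[OF y] _ gp LV_pres[OF y]]) (simp add: th_def)
 have tq: "quasi ?K ?L (k + fst y) (l + fst y) th"
  by (rule quasi_comp[OF gq LV_quasi[OF y]]) (simp add: th_def)
 have tree: "th (Node i' w) = Node p (v' @ w)"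
  if r: "r:Om" "snd x r = Node i' []" "snd y r = Node p v'" for r i' v' w
 proof (induction w rule: rev_induct)
  case Nil
  thus ?case using g[OF r(1)] r by (simp add: th_def)
 next
  case (snoc d w)
  have i': "i' < ?K" using LV_in[OF x r(1)] r(2) by simp
  obtain u where u: "u:Om" "snd x u = Node i' w" using LV_surj[OF x, of "Node i' w"] i' by auto
  obtain u' where u': "u':Om" "snd x u' = Node i' (w @ [d])" using LV_surj[OF x, of "Node i' (w @ [d])"] i' by auto
  have "(d, u', u):Rl x" using u u' by (simp add: Rl_iff is_child_iff)
  hence "(d, u', u):Rl y" using le unfolding ble_def by blast
  hence "is_child d (snd y u') (snd y u)" by (simp add: Rl_iff)
  moreover have "snd y u = Node p (v' @ w)" using snoc g[OF u(1)] u(2) by (simp add: th_def)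
  ultimately show ?case using g[OF u'(1)] u'(2) by (simp add: th_def is_child_iff)
 qed
 have em: "end_map th (i', s) = (p, cat v' s)"
  if r: "r:Om" "snd x r = Node i' []" "snd y r = Node p v'" for r i' v' s
 proof (rule end_mapI[of _ _ 0 _ "length v'"])
  fix n
  have "th (ray (i', s) (0 + n)) = th (Node i' (map s [0..<n]))" by (simp add: ray_def)
  also have "\<dots> = Node p (v' @ map s [0..<n])" by (rule tree[OF r])
  also have "\<dots> = ray (p, cat v' s) (length v' + n)" by (rule ray_cat[symmetric])
  finally show "th (ray (i', s) (0 + n)) = ray (p, cat v' s) (length v' + n)" .
 qed
 note ea = em[OF ij(1,3) pv(2)] and eb = em[OF ij(2,4) pv(3)]
 have AB: "end_less (end_map th (i, s)) (end_map th (j, t))" for s t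
  unfolding ea eb by (simp add: end_less_def cat_less)
 have gap: False if "end_less (end_map th (i, %_. True)) e" "end_less e (end_map th (j, %_. False))" for e
 proof -
  have "fst e = p" using that unfolding ea eb by (auto simp: end_less_def)
  thus False using that cat_gap[of v "snd e"] unfolding ea eb by (simp add: end_less_def)
 qed
 have en: "(q, s):ends ?K" if "q < ?K" for q s using that by (simp add: ends_def)
 have "adj ?K i j"
 proof (cases m)
  case MV
  thus ?thesis using ne by (simp add: labelled.adj_def)
 next
  case MF
  have P: "end_less (end_map th e) (end_map th e')" if "e:ends ?K" "e':ends ?K" "end_less e e'" for e e'
   using tp that MF by (simp add: pres_def)
  have "i < j"
  proof (rule ccontr)
   assume "~ i < j"
   hence "end_less (j, %_. False) (i, %_. True)" using ne by (simp add: end_less_def)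
   thus False using P[OF en[OF lt(2)] en[OF lt(1)]] AB end_less_asym by blast
  qed
  moreover have "~ Suc i < j"
  proof
   assume s: "Suc i < j"
   hence q: "Suc i < ?K" using lt by simp
   have "end_less (i, %_. True) (Suc i, %_. True)" "end_less (Suc i, %_. True) (j, %_. False)"
    using s by (simp_all add: end_less_def)
   thus False using P[OF en[OF lt(1)] en[OF q]] P[OF en[OF q] en[OF lt(2)]] gap by blast
  qed
  ultimately show ?thesis using MF by (simp add: labelled.adj_def)
 next
  case MT
  have P: "end_cyclic (end_map th e) (end_map th e') (end_map th e'')"
   if "e:ends ?K" "e':ends ?K" "e'':ends ?K" "end_cyclic e e' e''" for e e' e''
   using tp that MT by (simp add: pres_def)
  have "j = Suc i mod ?K"
  proof (rule ccontr)
   assume nj: "j ~= Suc i mod ?K"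
   define q where "q = Suc i mod ?K"
   have K0: "0 < ?K" using lt by linarith
   have q: "q < ?K" unfolding q_def by (rule mod_less_divisor[OF K0])
   have qq: "(Suc i < ?K & q = Suc i) | (Suc i = ?K & q = 0)"
   proof (cases "Suc i < ?K")
    case False
    hence "Suc i = ?K" using lt by linarith
    thus ?thesis unfolding q_def by (metis mod_self)
   qed (simp add: q_def)
   have "end_cyclic (i, %_. True) (q, %_. True) (j, %_. False)"
    using qq nj ne lt unfolding q_def[symmetric] end_cyclic_def end_less_def by auto
   hence "end_cyclic (end_map th (i, %_. True)) (end_map th (q, %_. True)) (end_map th (j, %_. False))"
    by (rule P[OF en[OF lt(1)] en[OF q] en[OF lt(2)]])
   thus False
    unfolding end_cyclic_def using gap AB end_less_asym end_less_trans by blast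
  qed
  thus ?thesis using MT ne by (simp add: labelled.adj_def)
 qed
 thus ?thesis using ij c by (auto simp: adm_def)
qed

text \<open>The carets of \<open>y\<close> that can be contracted starting from \<open>x\<close>;
  contracting them leads from \<open>x\<close> down towards \<open>y\<close>.\<close>

definition car :: "nat \<times> vmap => nat \<times> vmap => (vertex \<times> vertex \<times> vertex) set" where
 "car x y = {(a, b, c). a:rts x & b:rts x & c:isos x & (False, a, c):Rl y & (True, b, c):Rl y}"

text \<open>Among the vertices childless in \<open>x\<close> but not in \<open>y\<close> take one
  that is deepest for \<open>y\<close>. If a child of it were not a root of \<open>x\<close>, it
  would either be childless in \<open>x\<close>, hence a deeper choice, or have its parent in
  \<open>x\<close> already.\<close>

lemma car_nonempty:
 assumes x: "x:LV" and y: "y:LV" and le: "ble y x" and lt: "fst y < fst x"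
 shows "car x y ~= {}"
proof -
 define A where "A = isos x - isos y"
 have sub: "isos y <= isos x" by (rule ble_isos[OF y x le])
 have "isos x ~= isos y" using card_isos(2)[OF x] card_isos(2)[OF y] lt by auto
 hence A: "A ~= {}" "finite A" using sub card_isos(1)[OF x] by (auto simp: A_def)
 define len where "len = (%v. case snd y v of Node i w => length w | Isolated j => 0)"
 have "Max (len`A):len`A" using A by simp
 then obtain v where v: "v:A" "len v = Max (len`A)" by force
 have mx: "len u <= len v" if "u:A" for u using v(2) A(2) that by simp
 have vO: "v:Om" "v:isos x" "v ~: isos y" using v(1) by (auto simp: A_def isos_def)
 have ch: "EX u:rts x. (d, u, v):Rl y" for d
 proof -
  obtain u where u: "(d, u, v):Rl y" using Rl_child_ex[OF y vO(1,3)] by blast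
  hence uO: "u:Om" by (simp add: Rl_iff)
  have "u ~: isos x"
  proof
   assume "u:isos x"
   hence "u:A" using Rl_not_iso[OF u] by (simp add: A_def)
   moreover have "len u = Suc (len v)" using u by (auto simp: Rl_iff is_child_iff len_def)
   ultimately show False using mx by force
  qed
  moreover have "u:rts x"
  proof (rule ccontr)
   assume "u ~: rts x"
   then obtain d' v' where dv: "(d', u, v'):Rl x" using Rl_parent_ex[OF x uO] \<open>u ~: isos x\<close> by blast
   hence "(d', u, v'):Rl y" using le by (auto simp: ble_def)
   hence "v' = v" using Rl_parent_unique[OF y u] by blast
   thus False using Rl_not_iso[OF dv] vO(2) by blast
  qed
  ultimately show ?thesis using u by blast
 qed
 obtain a b where "a:rts x" "(False, a, v):Rl y" "b:rts x" "(True, b, v):Rl y"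
  using ch[of False] ch[of True] by blast
 hence "(a, b, v):car x y" using vO by (simp add: car_def)
 thus ?thesis by blast
qed

lemma car_disjoint:
 assumes y: "y:LV" and e: "e:car x y" "e':car x y" "e ~= e'" shows "dis e e'"
proof -
 obtain a b c a' b' c' where ee: "e = (a, b, c)" "e' = (a', b', c')" by (cases e; cases e')
 have R: "(False, a, c):Rl y" "(True, b, c):Rl y" "(False, a', c'):Rl y" "(True, b', c'):Rl y"
  using e unfolding ee car_def by auto
 have "c ~= c'"
 proof
  assume "c = c'"
  hence "a = a'" "b = b'" using Rl_child_unique[OF y] R by blast+
  thus False using \<open>c = c'\<close> e(3) ee by simp
 qed
 thus ?thesis using Rl_parent_unique[OF y] R unfolding ee dis_def by auto
qed

text \<open>Distinct carets of \<open>y\<close> have distinct parents, which are childless in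
  \<open>x\<close> but not in \<open>y\<close>; there are \<open>fst x - fst y\<close> such
  vertices.\<close>

lemma car_card:
 assumes x: "x:LV" and y: "y:LV" and le: "ble y x" and S: "S <= car x y"
 shows "card S <= fst x"
proof -
 let ?c = "%e::vertex \<times> vertex \<times> vertex. snd (snd e)"
 have "inj_on ?c S"
 proof (rule inj_onI)
  fix e e' assume e: "e:S" "e':S" "?c e = ?c e'"
  show "e = e'"
  proof (rule ccontr)
   assume "e ~= e'"
   hence "dis e e'" using car_disjoint[OF y] S e by blast
   thus False using e(3) by (auto simp: dis_def split: prod.splits)
  qed
 qed
 moreover have sub: "?c`S <= isos x - isos y"
 proof (rule image_subsetI)
  fix e assume "e:S"
  then obtain a b c where "e = (a, b, c)" "c:isos x" "(False, a, c):Rl y" using S by (auto simp: car_def)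
  thus "?c e:isos x - isos y" using Rl_not_iso[of False a c y] by simp
 qed
 ultimately have "card S <= card (isos x - isos y)"
  using card_isos(1)[OF x] by (intro card_inj_on_le) auto
 also have "\<dots> = card (isos x) - card (isos y)"
  by (rule card_Diff_subset[OF card_isos(1)[OF y] ble_isos[OF y x le]])
 also have "\<dots> <= fst x" using card_isos(2)[OF x] card_isos(2)[OF y] by simp
 finally show ?thesis .
qed

end

section \<open>Null-homotopies below a base of large level\<close>

context labelled
begin

lemma tri_mono: "S <= S' ==> tri S <= tri S'"
 by (auto simp: tri_def)

definition good :: "nat \<times> vmap => (vertex \<times> vertex \<times> vertex) set => bool" where
 "good x S \<longleftrightarrow> finite S & S ~= {} & (ALL e:S. adm x e) & (ALL e:S. ALL e':S. e ~= e' --> dis e e') & card S <= fst x"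

definition con :: "nat \<times> vmap => (vertex \<times> vertex \<times> vertex) set => nat \<times> vmap" where
 "con x S = (SOME z. z:LV & fst z + card S = fst x & Rl z = Rl x Un tri S)"

lemma con_spec:
 assumes "x:LV" "good x S"
 shows "con x S:LV" "fst (con x S) + card S = fst x" "Rl (con x S) = Rl x Un tri S"
proof -
 have "EX z. z:LV & fst z + card S = fst x & Rl z = Rl x Un tri S"
 proof -
  have "finite S" "ALL e:S. adm x e" "ALL e:S. ALL e':S. e ~= e' --> dis e e'" "card S <= fst x"
   using assms(2) by (simp_all add: good_def)
  from contract_set[OF assms(1) this] obtain z where "z:LV" "fst z + card S = fst x & Rl z = Rl x Un tri S &
   (ALL e. adm x e & (ALL e':S. dis e' e) --> adm z e)" by (elim bexE)
  thus ?thesis by (intro exI[of _ z]) (simp only:)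
 qed
 from someI_ex[OF this] show "con x S:LV" "fst (con x S) + card S = fst x" "Rl (con x S) = Rl x Un tri S"
  unfolding con_def by blast+
qed

lemma car_tri: "S <= car x y ==> tri S <= Rl y"
 by (fastforce simp: tri_def car_def)

lemma car_good:
 assumes x: "x:LV" and y: "y:LV" and le: "ble y x" and S: "S <= car x y" "finite S" "S ~= {}"
 shows "good x S & ble y (con x S)"
proof -
 have "adm x e" if "e:S" for e
 proof -
  obtain a b c where e: "e = (a, b, c)" by (cases e)
  hence "(a, b, c):car x y" using that S by blast
  thus ?thesis unfolding e by (intro caret_adm[OF x y le]) (simp_all add: car_def)
 qed
 moreover have "dis e e'" if "e:S" "e':S" "e ~= e'" for e e'
  using car_disjoint[OF y, of e x e'] S(1) that by blast
 ultimately have g: "good x S" using S car_card[OF x y le S(1)] by (simp add: good_def)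
 have "Rl x Un tri S <= Rl y" using le car_tri[OF S(1)] by (simp add: ble_def)
 thus ?thesis using g con_spec(3)[OF x g] by (simp add: ble_def)
qed

text \<open>A caret consists of two roots and one childless vertex, and each of these three occurs
  in at most one standard caret.\<close>

lemma ground_count:
 assumes x: "x:LV" and e: "adm x (a, b, c)"
  and f: "!!j. j < C ==> f j = (p (2 * j), p (Suc (2 * j)), q j)"
  and p: "!!i. i < 2 * C ==> snd x (p i) = Node i []" and q: "!!j. j < C ==> snd x (q j) = Isolated j"
 shows "card {j. j < C & ~ dis (f j) (a, b, c)} <= 3"
proof -
 obtain i i' where i: "snd x a = Node i []" "snd x b = Node i' []" and c: "c:isos x"
  using e by (auto simp: adm_def)
 obtain j' where j': "snd x c = Isolated j'" using c by (auto simp: isos_def)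
 have "{j. j < C & ~ dis (f j) (a, b, c)} <= {i div 2, i' div 2, j'}"
 proof
  fix j assume "j:{j. j < C & ~ dis (f j) (a, b, c)}"
  hence j: "j < C" "~ dis (p (2 * j), p (Suc (2 * j)), q j) (a, b, c)" using f by auto
  hence "p (2 * j) = a | p (2 * j) = b | p (Suc (2 * j)) = a | p (Suc (2 * j)) = b | q j = c"
   by (auto simp: dis_def)
  moreover have "snd x (p (2 * j)) = Node (2 * j) []" "snd x (p (Suc (2 * j))) = Node (Suc (2 * j)) []"
   "snd x (q j) = Isolated j" using p[of "2 * j"] p[of "Suc (2 * j)"] q[of j] j(1) by simp_all
  ultimately show "j:{i div 2, i' div 2, j'}" using i j' by auto
 qed
 hence "card {j. j < C & ~ dis (f j) (a, b, c)} <= card {i div 2, i' div 2, j'}"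
  by (rule card_mono[rotated]) simp
 also have "\<dots> <= 3" by (auto simp: card_insert_if)
 finally show ?thesis .
qed

text \<open>The \<open>C\<close> standard carets join the roots \<open>2 * j\<close> and
  \<open>2 * j + 1\<close> under the isolated vertex \<open>j\<close>. A family of
  \<open>3 ^ d\<close> carets meets at most \<open>3 * 3 ^ d\<close> of them, so one is left over.
  The level must also pay for up to \<open>d + 1\<close> further contractions at the same
  time.\<close>

lemma null_LV:
 assumes x: "x:LV" and big: "2 * (3 * 3 ^ d + 1) + d + 1 < fst x"
  and K: "compact K" "K <= cb d" and f: "smap K (chains ble {y:LV. ble y x & fst y < fst x}) f"
 shows "EX z:{y:LV. ble y x & fst y < fst x}. shom K (chains ble {y:LV. ble y x & fst y < fst x}) f (%_. vpt z)"
proof -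
 define C :: nat where "C = 3 * 3 ^ d + 1"
 define D where "D = {y:LV. ble y x & fst y < fst x}"
 define p where "p = (%i. SOME a. a:Om & snd x a = Node i [])"
 define q where "q = (%j. SOME c. c:Om & snd x c = Isolated j)"
 have C: "2 * C <= k + fst x" "C <= l + fst x" "C + Suc d <= fst x" using big by (simp_all add: C_def)
 have p: "p i:Om & snd x (p i) = Node i []" if "i < 2 * C" for i
  unfolding p_def by (rule someI_ex) (use LV_surj[OF x, of "Node i []"] that C in auto)
 have q: "q j:Om & snd x (q j) = Isolated j" if "j < C" for j
  unfolding q_def by (rule someI_ex) (use LV_surj[OF x, of "Isolated j"] that C in auto)
 define sg where "sg = (%j. (p (2 * j), p (Suc (2 * j)), q j))"
 have sg_adm: "adm x (sg j)" if "j < C" for j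
 proof -
  have "2 * j < 2 * C" "Suc (2 * j) < 2 * C" using that by simp_all
  hence pp: "p (2 * j):Om" "p (Suc (2 * j)):Om" "snd x (p (2 * j)) = Node (2 * j) []"
   "snd x (p (Suc (2 * j))) = Node (Suc (2 * j)) []" using p by blast+
  have "Suc (2 * j) < k + fst x" using \<open>Suc (2 * j) < 2 * C\<close> C by simp
  hence "adj (k + fst x) (2 * j) (Suc (2 * j))" by (cases m) (simp_all add: labelled.adj_def)
  moreover have "q j:isos x" using q[OF that] by (auto simp: isos_def)
  ultimately show ?thesis using pp by (auto simp: adm_def sg_def)
 qed
 have sg_dis: "dis (sg i) (sg j)" if "i < C" "j < C" "i ~= j" for i j
 proof -
  have "p a ~= p b" if "a < 2 * C" "b < 2 * C" "a ~= b" for a b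
   using p[OF that(1)] p[OF that(2)] that(3) by auto
  moreover have "q i ~= q j" using q[OF that(1)] q[OF that(2)] that(3) by auto
  moreover have "2 * i ~= Suc (2 * j)" "Suc (2 * i) ~= 2 * j" by presburger+
  ultimately show ?thesis using that by (auto simp: dis_def sg_def)
 qed
 define Sg where "Sg = sg`{..<C}"
 have Sg: "finite Sg" "card Sg <= C" using card_image_le[of "{..<C}" sg] by (simp_all add: Sg_def)
 have Sg_card: "card T <= C" if "T <= Sg" for T using card_mono[OF Sg(1) that] Sg(2) by simp
 have Sg_dis: "dis s s'" if "s:Sg" "s':Sg" "s ~= s'" for s s'
  using that sg_dis by (auto simp: Sg_def)
 have dis_sym: "dis e e' ==> dis e' e" for e e' by (auto simp: dis_def split: prod.splits)
 have conD: "con x S:D" if "good x S" for S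
 proof -
  have "0 < card S" using that by (auto simp: good_def card_gt_0_iff)
  hence "fst (con x S) < fst x" using con_spec(2)[OF x that] by linarith
  thus ?thesis using con_spec(1,3)[OF x that] by (simp add: D_def ble_def)
 qed
 have "EX z:D. shom K (chains ble D) f (%_. vpt z)"
 proof (rule null_below[where car = "car x" and con = "con x" and good = "good x" and Sg = Sg and dis = dis and d = d])
  show "compact K" "K <= cb d" by (rule K)+
  show "smap K (chains ble D) f" using f by (simp add: D_def)
  show "ble a c" if "ble a b" "ble b c" for a b c using that by (rule ble_trans)
  show "ble a a" for a by (rule ble_refl)
  show "car x y ~= {}" if "y:D" for y using that car_nonempty[OF x] by (simp add: D_def)
  show "car x z <= car x y" if "ble y z" for y z using that by (auto simp: car_def ble_def)
  show "good x S & ble y (con x S)" if "y:D" "S <= car x y" "finite S" "S ~= {}" for y S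
   using that car_good[OF x, of y S] by (simp add: D_def)
  show "con x S:D" if "good x S" for S by (rule conD[OF that])
  show "ble (con x S') (con x S)" if "good x S" "good x S'" "S <= S'" for S S'
   using con_spec(3)[OF x that(1)] con_spec(3)[OF x that(2)] tri_mono[OF that(3)] by (auto simp: ble_def)
  show "good x (S Un T)" if S: "good x S" "card S <= Suc d" and T: "T <= Sg" "finite T" and st: "ALL s:T. ALL a:S. dis s a" for S T
   unfolding good_def
  proof (intro conjI ballI impI)
   show "finite (S Un T)" "S Un T ~= {}" using S T by (simp_all add: good_def)
   show "adm x e" if "e:S Un T" for e
    using that S(1) T(1) sg_adm by (auto simp: good_def Sg_def)
   show "dis e e'" if "e:S Un T" "e':S Un T" "e ~= e'" for e e'
   proof -
    have "dis e e'" if "e:S" "e':S" using S(1) that \<open>e ~= e'\<close> unfolding good_def by blast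
    moreover have "dis e e'" if "e:T" "e':T" using Sg_dis T(1) that \<open>e ~= e'\<close> by blast
    ultimately show ?thesis using that(1,2) st dis_sym by blast
   qed
   have "card (S Un T) <= card S + card T" by (rule card_Un_le)
   thus "card (S Un T) <= fst x" using S(2) Sg_card[OF T(1)] C(3) by linarith
  qed
  show "good x T" if "T <= Sg" "finite T" "T ~= {}" for T
   unfolding good_def
  proof (intro conjI ballI impI)
   show "adm x e" if "e:T" for e using that \<open>T <= Sg\<close> sg_adm by (auto simp: Sg_def)
   show "dis e e'" if "e:T" "e':T" "e ~= e'" for e e' using that \<open>T <= Sg\<close> Sg_dis by blast
   show "card T <= fst x" using Sg_card[OF that(1)] C(3) by linarith
  qed (use that in auto)
  show "EX s:Sg. ALL a:A. dis s a" if A: "finite A" "card A <= 3 ^ d" "A <= (UN y:D. car x y)" for A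
  proof (rule ccontr)
   assume n: "~ ?thesis"
   define H where "H = (%e. {j. j < C & ~ dis (sg j) e})"
   have "{..<C} <= (UN e:A. H e)"
   proof
    fix j assume j: "j:{..<C}"
    hence "sg j:Sg" by (simp add: Sg_def)
    then obtain e where "e:A" "~ dis (sg j) e" using n by blast
    thus "j:(UN e:A. H e)" using j by (auto simp: H_def)
   qed
   moreover have "finite (UN e:A. H e)" using A(1) by (auto simp: H_def)
   ultimately have "card {..<C} <= card (UN e:A. H e)" by (rule card_mono[rotated])
   also have "\<dots> <= (SUM e:A. card (H e))" by (rule card_UN_le[OF A(1)])
   also have "\<dots> <= (SUM e:A. 3)"
   proof (rule sum_mono)
    fix e assume "e:A"
    then obtain y where y: "y:D" "e:car x y" using A(3) by blast
    obtain a b c where e: "e = (a, b, c)" by (cases e)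
    have "adm x (a, b, c)"
     using y(2) unfolding e by (intro caret_adm[OF x, of y]) (use y(1) in \<open>auto simp: car_def D_def\<close>)
    thus "card (H e) <= 3" unfolding H_def e
     by (rule ground_count[OF x, of a b c C sg p q]) (use p q in \<open>simp_all add: sg_def\<close>)
   qed
   also have "\<dots> <= 3 * 3 ^ d" using A(2) by simp
   finally show False by (simp add: C_def)
  qed
 qed
 thus ?thesis by (simp add: D_def)
qed

sublocale lev_poset LV ble fst
proof
 show "ble x x" for x by (rule ble_refl)
 show "ble x z" if "ble x y" "ble y z" for x y z using that by (rule ble_trans)
 show "fst x <= fst y" if "x:LV" "y:LV" "ble x y" for x y using that by (rule ble_lev)
 show "ble y x" if "x:LV" "y:LV" "ble x y" "fst x = fst y" for x y using that by (rule ble_lev_eq)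
 show "EX z:LV. ALL x:A. ble x z" if "finite A" "A <= LV" for A using that by (rule directed_LV)
 fix d
 show "EX s. ALL x:LV. s < fst x --> (ALL K f. compact K & K <= cb d &
   smap K (chains ble {y:LV. ble y x & fst y < fst x}) f -->
   (EX z:{y:LV. ble y x & fst y < fst x}.
    shom K (chains ble {y:LV. ble y x & fst y < fst x}) f (%_. vpt z)))"
  by (intro exI[of _ "2 * (3 * 3 ^ d + 1) + d + 1"] ballI impI allI, elim conjE) (rule null_LV)
qed

section \<open>The group and its action\<close>

text \<open>The group elements are the bases of level 0, so facts about bases yield the group
  laws.\<close>

definition GX :: "vmap monoid" where
 "GX = (BijGroup Om) \<lparr>carrier := {h. (0, h):LV}\<rparr>"

lemma carrier_GX: "g:carrier GX \<longleftrightarrow> g:extensional Om & quasi k l k l g & pres m k g"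
 by (simp add: GX_def LV_def)

lemma carrier_GX_Bij: "carrier GX <= Bij Om"
 by (auto simp: carrier_GX Bij_def quasi_def Om_def)

lemma mult_GX: "g:carrier GX ==> h:carrier GX ==> g \<otimes>\<^bsub>GX\<^esub> h = compose Om g h"
 using carrier_GX_Bij by (auto simp: GX_def BijGroup_def)

lemma one_GX: "\<one>\<^bsub>GX\<^esub> = (\<lambda>v\<in>Om. v)"
 by (simp add: GX_def BijGroup_def)

lemma inv_in_GX:
 assumes "x:LV" "y:LV" "fst x = fst y"
 shows "(\<lambda>v\<in>Om. inv_into Om (snd x) (snd y v)):carrier GX"
proof -
 let ?g = "inv_into Om (snd x)" and ?f = "\<lambda>v\<in>Om. inv_into Om (snd x) (snd y v)"
 have g: "?g (snd x u) = u" if "u:forest k l" for u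
  using bij_betw_inv_into_left[OF LV_bij[OF assms(1)]] that by (simp add: Om_def)
 have gq: "quasi (k + fst x) (l + fst x) k l ?g" by (rule quasi_inv[OF LV_quasi[OF assms(1)] g])
 have gp: "pres m (k + fst x) ?g" by (rule pres_inv[OF LV_quasi[OF assms(1)] g LV_pres[OF assms(1)]])
 have f: "!!v. v:forest k l ==> ?f v = ?g (snd y v)" by (simp add: Om_def)
 note yq = LV_quasi[OF assms(2)]
 have "quasi k l k l ?f" by (rule quasi_comp[OF yq gq[unfolded assms(3)] f])
 moreover have "pres m k ?f" by (rule pres_comp[OF yq gq[unfolded assms(3)] f LV_pres[OF assms(2)] gp[unfolded assms(3)]])
 ultimately show ?thesis by (simp add: carrier_GX)
qed

lemma GX_LV: "g:carrier GX \<longleftrightarrow> (0, g):LV"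
 by (simp add: GX_def)

lemma subgroup_GX: "subgroup (carrier GX) (BijGroup Om)"
proof (rule group.subgroupI[OF group_BijGroup])
 show "carrier GX <= carrier (BijGroup Om)" using carrier_GX_Bij by (simp add: BijGroup_def)
 show "carrier GX ~= {}" using base_LV by (auto simp: GX_LV base_def)
next
 fix g assume g: "g:carrier GX"
 hence gB: "g:Bij Om" using carrier_GX_Bij by blast
 have "(\<lambda>v\<in>Om. inv_into Om (snd (0::nat, g)) (snd base v)):carrier GX"
  by (rule inv_in_GX) (use g base_LV in \<open>simp_all add: GX_LV base_def\<close>)
 moreover have "(\<lambda>v\<in>Om. inv_into Om (snd (0::nat, g)) (snd base v)) = inv\<^bsub>BijGroup Om\<^esub> g"
  unfolding inv_BijGroup[OF gB] by (auto simp: base_def)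
 ultimately show "inv\<^bsub>BijGroup Om\<^esub> g:carrier GX" by simp
next
 fix g h assume gh: "g:carrier GX" "h:carrier GX"
 have "lab g 0 (0, h):LV"
  by (rule lab_LV) (use gh in \<open>simp_all add: GX_LV[of h] carrier_GX[of g]\<close>)
 moreover have "lab g 0 (0, h) = (0, compose Om g h)" by (auto simp: lab_def compose_def)
 ultimately have "compose Om g h:carrier GX" by (simp add: GX_LV)
 thus "g \<otimes>\<^bsub>BijGroup Om\<^esub> h:carrier GX"
  using gh carrier_GX_Bij by (auto simp: BijGroup_def)
qed

lemma group_GX: "group GX"
 using group.subgroup_imp_group[OF group_BijGroup subgroup_GX] by (simp add: GX_def)

text \<open>Precomposition with the inverse gives a left action. It moves vertices of the forest and
  leaves the labels alone.\<close>

definition act :: "vmap => nat \<times> vmap => nat \<times> vmap" where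
 "act g x = (fst x, compose Om (snd x) (inv\<^bsub>GX\<^esub> g))"

lemma inv_GX: "g:carrier GX ==> inv\<^bsub>GX\<^esub> g:carrier GX"
 by (rule group.inv_closed[OF group_GX])

lemma GX_funcset: "g:carrier GX ==> g:Om \<rightarrow> Om"
 using carrier_GX_Bij Bij_imp_funcset by blast

lemma act_LV: assumes "x:LV" "g:carrier GX" shows "act g x:LV"
proof -
 have i: "quasi k l k l (inv\<^bsub>GX\<^esub> g)" "pres m k (inv\<^bsub>GX\<^esub> g)"
  using inv_GX[OF assms(2)] by (simp_all add: carrier_GX)
 have f: "!!v. v:forest k l ==> compose Om (snd x) (inv\<^bsub>GX\<^esub> g) v = snd x ((inv\<^bsub>GX\<^esub> g) v)"
  by (simp add: Om_def compose_def)
 show ?thesis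
  using quasi_comp[OF i(1) LV_quasi[OF assms(1)] f] pres_comp[OF i(1) LV_quasi[OF assms(1)] f i(2) LV_pres[OF assms(1)]]
  by (simp add: LV_def act_def)
qed

lemma fst_act [simp]: "fst (act g x) = fst x"
 by (simp add: act_def)

lemma act_one: assumes "x:LV" shows "act \<one>\<^bsub>GX\<^esub> x = x"
proof -
 have "inv\<^bsub>GX\<^esub> \<one>\<^bsub>GX\<^esub> = \<one>\<^bsub>GX\<^esub>" by (simp add: group.is_monoid[OF group_GX] monoid.inv_one)
 moreover have "compose Om (snd x) (\<lambda>v\<in>Om. v) = snd x"
  using assms by (auto simp: compose_def LV_def extensional_def)
 ultimately show ?thesis by (simp add: act_def one_GX)
qed

lemma act_mult:
 assumes "g:carrier GX" "h:carrier GX" shows "act (g \<otimes>\<^bsub>GX\<^esub> h) x = act g (act h x)"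
proof -
 have "inv\<^bsub>GX\<^esub> (g \<otimes>\<^bsub>GX\<^esub> h) = inv\<^bsub>GX\<^esub> h \<otimes>\<^bsub>GX\<^esub> inv\<^bsub>GX\<^esub> g"
  by (rule group.inv_mult_group[OF group_GX assms])
 also have "\<dots> = compose Om (inv\<^bsub>GX\<^esub> h) (inv\<^bsub>GX\<^esub> g)" by (rule mult_GX) (use assms inv_GX in auto)
 finally have "inv\<^bsub>GX\<^esub> (g \<otimes>\<^bsub>GX\<^esub> h) = compose Om (inv\<^bsub>GX\<^esub> h) (inv\<^bsub>GX\<^esub> g)" .
 moreover have "(inv\<^bsub>GX\<^esub> g) v:Om" if "v:Om" for v using GX_funcset[OF inv_GX[OF assms(1)]] that by blast
 ultimately show ?thesis by (auto simp: act_def compose_def)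
qed

lemma act_free: assumes x: "x:LV" and g: "g:carrier GX" and eq: "act g x = x" shows "g = \<one>\<^bsub>GX\<^esub>"
proof -
 have i: "inv\<^bsub>GX\<^esub> g:carrier GX" by (rule inv_GX[OF g])
 have "(inv\<^bsub>GX\<^esub> g) v = v" if v: "v:Om" for v
 proof -
  have iv: "(inv\<^bsub>GX\<^esub> g) v:Om" using GX_funcset[OF i] v by blast
  have "snd (act g x) v = snd x v" using eq by simp
  hence "snd x ((inv\<^bsub>GX\<^esub> g) v) = snd x v" using v by (simp add: act_def compose_def)
  thus ?thesis by (rule LV_inj[OF x iv v])
 qed
 moreover have "inv\<^bsub>GX\<^esub> g:extensional Om" using i by (simp add: carrier_GX)
 ultimately have "inv\<^bsub>GX\<^esub> g = \<one>\<^bsub>GX\<^esub>" unfolding one_GX by (intro extensionalityI[of _ Om]) auto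
 hence "inv\<^bsub>GX\<^esub> (inv\<^bsub>GX\<^esub> g) = inv\<^bsub>GX\<^esub> \<one>\<^bsub>GX\<^esub>" by simp
 thus ?thesis using g by (simp add: group.inv_inv[OF group_GX] group.is_monoid[OF group_GX] monoid.inv_one)
qed

lemma act_ble: assumes "g:carrier GX" "ble x y" shows "ble (act g x) (act g y)"
proof -
 have "(inv\<^bsub>GX\<^esub> g) v:Om" if "v:Om" for v using GX_funcset[OF inv_GX[OF assms(1)]] that by blast
 hence *: "(d, u, v):Rl (act g z) \<longleftrightarrow> u:Om & v:Om & (d, (inv\<^bsub>GX\<^esub> g) u, (inv\<^bsub>GX\<^esub> g) v):Rl z" for d u v z
  by (auto simp: Rl_iff act_def compose_def)
 have "(d, u, v):Rl (act g x)" if "(d, u, v):Rl (act g y)" for d u v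
  using that assms(2) unfolding * ble_def by blast
 thus ?thesis by (auto simp: ble_def)
qed

text \<open>One labelling followed by the inverse of the other is a group element. Hence the bases
  of one level form a single orbit.\<close>

lemma act_transitive:
 assumes x: "x:LV" and y: "y:LV" and eq: "fst x = fst y"
 shows "EX g:carrier GX. act g x = y"
proof -
 define h where "h = (\<lambda>v\<in>Om. inv_into Om (snd x) (snd y v))"
 have h: "h:carrier GX" unfolding h_def by (rule inv_in_GX[OF assms])
 have "snd x (h v) = snd y v" if "v:Om" for v
  using bij_betw_inv_into_right[OF LV_bij[OF x]] LV_in[OF y that] that eq by (simp add: h_def)
 hence "compose Om (snd x) h = snd y"
  using y by (intro extensionalityI[of _ Om]) (auto simp: compose_def LV_def)
 hence "act (inv\<^bsub>GX\<^esub> h) x = y"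
  using h eq by (simp add: act_def group.inv_inv[OF group_GX] prod_eq_iff)
 thus ?thesis using inv_GX[OF h] by blast
qed

section \<open>Only finitely many bases lie below a given one\<close>

lemma below_prefix:
 assumes x: "x:LV" and y: "y:LV" and le: "ble y x" and p: "p:rts x Un isos x" "snd y p = Node j (w @ [d])"
 shows "EX q:rts x Un isos x. snd y q = Node j w"
proof -
 have pO: "p:Om" using p(1) by (auto simp: rts_def isos_def)
 have "j < k + fst y" using LV_in[OF y pO] p(2) by simp
 then obtain q where q: "q:Om" "snd y q = Node j w" using LV_surj[OF y, of "Node j w"] by auto
 have pq: "(d, p, q):Rl y" using q p(2) pO by (simp add: Rl_iff is_child_iff)
 have "q:isos x"
 proof (rule ccontr)
  assume "q ~: isos x"
  then obtain u where u: "(d, u, q):Rl x" using Rl_child_ex[OF x q(1)] by blast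
  hence "(d, u, q):Rl y" using le by (auto simp: ble_def)
  hence "u = p" using Rl_child_unique[OF y] pq by blast
  thus False using Rl_not_iso[OF u] p(1) by blast
 qed
 thus ?thesis using q(2) by blast
qed

text \<open>The addresses that \<open>y\<close> gives to the roots and childless vertices of
  \<open>x\<close> are closed under prefixes, so the prefixes of one address can be counted among
  them.\<close>

lemma below_length:
 assumes x: "x:LV" and y: "y:LV" and le: "ble y x" and p: "p:rts x Un isos x" "snd y p = Node j w"
 shows "length w <= card (rts x Un isos x)"
proof -
 let ?P = "rts x Un isos x"
 have fin: "finite ?P" using finite_rts[OF x] card_isos(1)[OF x] by simp
 have "(%i. Node j (take i w))`{..length w} <= snd y`?P"
  using p
 proof (induction w arbitrary: p rule: rev_induct)
  case Nil
  thus ?case by (metis (mono_tags, lifting) atMost_0 image_empty image_insert image_subset_iff insert_subset list.size(3) rev_image_eqI singletonD take_Nil empty_subsetI)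
 next
  case (snoc d w)
  obtain q where q: "q:?P" "snd y q = Node j w" using below_prefix[OF x y le snoc.prems] by blast
  note IH = snoc.IH[OF q]
  show ?case
  proof (rule image_subsetI)
   fix i assume i: "i:{..length (w @ [d])}"
   show "Node j (take i (w @ [d])):snd y`?P"
   proof (cases "i <= length w")
    case True
    hence "Node j (take i (w @ [d])) = Node j (take i w)" by simp
    thus ?thesis using IH True by (metis atMost_iff image_subset_iff)
   next
    case False
    hence "take i (w @ [d]) = w @ [d]" using i by simp
    thus ?thesis using snoc.prems by (metis image_eqI)
   qed
  qed
 qed
 hence "card ((%i. Node j (take i w))`{..length w}) <= card (snd y`?P)"
  using fin by (intro card_mono) auto
 moreover have "inj_on (%i. Node j (take i w)) {..length w}"
 proof (rule inj_onI)
  fix a b assume ab: "a:{..length w}" "b:{..length w}" "Node j (take a w) = Node j (take b w)"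
  hence "length (take a w) = length (take b w)" by simp
  thus "a = b" using ab by simp
 qed
 hence "card ((%i. Node j (take i w))`{..length w}) = Suc (length w)" by (simp add: card_image)
 moreover have "card (snd y`?P) <= card ?P" by (rule card_image_le[OF fin])
 ultimately show ?thesis by linarith
qed

text \<open>\<open>y\<close> keeps all edges of \<open>x\<close>, so it is determined by its values
  on the roots and childless vertices of \<open>x\<close>. These values have bounded indices and
  addresses of bounded length.\<close>

lemma finite_below: assumes x: "x:LV" shows "finite {y:LV. ble y x}"
proof -
 define P where "P = rts x Un isos x"
 have finP: "finite P" using finite_rts[OF x] card_isos(1)[OF x] by (simp add: P_def)
 define B where "B = (%(j, w). Node j w)`({..<k + fst x} \<times> {w::bool list. set w <= UNIV & length w <= card P}) Un Isolated`{..<l + fst x}"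
 have finB: "finite B"
  unfolding B_def by (intro finite_UnI finite_imageI finite_cartesian_product finite_lists_length_le) auto
 define rh where "rh = (%y::nat \<times> vmap. (fst y, restrict (snd y) P))"
 have PO: "P <= Om" by (auto simp: P_def rts_def isos_def)
 have "rh`{y:LV. ble y x} <= {..fst x} \<times> (P \<rightarrow>\<^sub>E B)"
 proof (rule image_subsetI)
  fix y assume "y:{y:LV. ble y x}"
  hence y: "y:LV" "ble y x" by auto
  have le: "fst y <= fst x" by (rule ble_lev[OF y(1) x y(2)])
  have "snd y p:B" if p: "p:P" for p
  proof (cases "snd y p")
   case (Node j w)
   have "length w <= card P" using below_length[OF x y _ Node] p by (simp add: P_def)
   moreover have "j < k + fst x" using LV_in[OF y(1), of p] p PO Node le by auto
   ultimately show ?thesis using Node unfolding B_def by force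
  next
   case (Isolated j)
   hence "j < l + fst x" using LV_in[OF y(1), of p] p PO le by auto
   thus ?thesis using Isolated by (simp add: B_def)
  qed
  thus "rh y:{..fst x} \<times> (P \<rightarrow>\<^sub>E B)" using le by (auto simp: rh_def)
 qed
 moreover have "finite ({..fst x} \<times> (P \<rightarrow>\<^sub>E B))" using finP finB by (intro finite_cartesian_product finite_PiE) auto
 ultimately have "finite (rh`{y:LV. ble y x})" by (rule finite_subset)
 moreover have "inj_on rh {y:LV. ble y x}"
 proof (rule inj_onI)
  fix y y' assume yy: "y:{y:LV. ble y x}" "y':{y:LV. ble y x}" "rh y = rh y'"
  have PP: "snd y p = snd y' p" if "p:P" for p
   using yy(3) that unfolding rh_def by (metis restrict_apply' snd_conv)
  have all: "snd y v = snd y' v" if "v:Om" "snd x v = Node j w" for v j w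
   using that
  proof (induction w arbitrary: v rule: rev_induct)
   case Nil
   hence "v:P" by (auto simp: P_def rts_def)
   thus ?case by (rule PP)
  next
   case (snoc d w)
   have "j < k + fst x" using LV_in[OF x snoc.prems(1)] snoc.prems(2) by simp
   then obtain u where u: "u:Om" "snd x u = Node j w" using LV_surj[OF x, of "Node j w"] by auto
   have "(d, v, u):Rl x" using u snoc.prems by (simp add: Rl_iff is_child_iff)
   hence "(d, v, u):Rl y" "(d, v, u):Rl y'" using yy by (auto simp: ble_def)
   thus ?case using snoc.IH[OF u] by (auto simp: Rl_iff is_child_iff)
  qed
  have "snd y v = snd y' v" if v: "v:Om" for v
  proof (cases "v:isos x")
   case True
   thus ?thesis using PP by (simp add: P_def)
  next
   case False
   thus ?thesis using all[OF v] not_iso_iff[OF x v] by blast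
  qed
  moreover have "snd y:extensional Om" "snd y':extensional Om" using yy by (auto simp: LV_def)
  ultimately have "snd y = snd y'" by (intro extensionalityI[of _ Om]) auto
  moreover have "fst y = fst y'" using yy(3) by (simp add: rh_def)
  ultimately show "y = y'" by (simp add: prod_eq_iff)
 qed
 ultimately show ?thesis by (simp add: finite_image_iff)
qed

end

section \<open>Cell complexes in spaces of real functions\<close>

lemma Hausdorff_fun: "Hausdorff_space (euclidean :: ('e => real) topology)"
 unfolding euclidean_product_topology[symmetric] Hausdorff_space_product_topology by simp

text \<open>The set is a finite union of projections of sets of pairs \<open>(k, x)\<close> with
  \<open>f k = p i x\<close>. These sets are closed by the Hausdorff property, hence
  compact.\<close>

lemma quot_closed:
 fixes f :: "'k::t2_space => 'y::topological_space" and p :: "'i => 'p::topological_space => 'y"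
 assumes Y: "Hausdorff_space (euclidean :: 'y topology)" and I: "finite I" and P: "!!i. i:I ==> compact (P i)" "!!i. i:I ==> continuous_on (P i) (p i)"
  and K: "compact K" "continuous_on K f" "f`K <= (UN i:I. p i`P i)"
  and A: "!!i. i:I ==> closedin (top_of_set (P i)) {x:P i. A (p i x)}"
 shows "closed {k:K. A (f k)}"
proof -
 have "compact (fst`{z:K \<times> {x:P i. A (p i x)}. f (fst z) = p i (snd z)})" (is "compact (fst`?Z)") if i: "i:I" for i
 proof -
  have c: "compact (K \<times> {x:P i. A (p i x)})"
   using K(1) closedin_compact[OF P(1)[OF i] A[OF i]] by (rule compact_Times)
  have "closedin (top_of_set (K \<times> {x:P i. A (p i x)})) {z:topspace (top_of_set (K \<times> {x:P i. A (p i x)})). (f \<circ> fst) z = (p i \<circ> snd) z}"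
  proof (rule closedin_continuous_maps_eq)
   show "Hausdorff_space (euclidean :: 'y topology)" by (rule Y)
   have "continuous_on (K \<times> {x:P i. A (p i x)}) (f \<circ> fst)"
    by (intro continuous_on_compose ctn) (rule continuous_on_subset[OF K(2)], auto)
   thus "continuous_map (top_of_set (K \<times> {x:P i. A (p i x)})) euclidean (f \<circ> fst)" by simp
   have "continuous_on (K \<times> {x:P i. A (p i x)}) (p i \<circ> snd)"
    by (intro continuous_on_compose ctn) (rule continuous_on_subset[OF P(2)[OF i]], auto)
   thus "continuous_map (top_of_set (K \<times> {x:P i. A (p i x)})) euclidean (p i \<circ> snd)" by simp
  qed
  hence "closedin (top_of_set (K \<times> {x:P i. A (p i x)})) ?Z" by simp
  hence "compact ?Z" by (rule closedin_compact[OF c])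
  thus ?thesis by (rule compact_continuous_image[OF continuous_on_fst[OF continuous_on_id]])
 qed
 hence "closed (UN i:I. fst`{z:K \<times> {x:P i. A (p i x)}. f (fst z) = p i (snd z)})"
  using I by (intro closed_UN) (auto intro: compact_imp_closed)
 moreover have "{k:K. A (f k)} = (UN i:I. fst`{z:K \<times> {x:P i. A (p i x)}. f (fst z) = p i (snd z)})" (is "?L = ?R")
 proof (intro equalityI subsetI)
  fix k assume k: "k:?L"
  then obtain i x where "i:I" "x:P i" "f k = p i x" using K(3) by blast
  thus "k:?R" using k by (intro UN_I[of i] image_eqI[of _ _ "(k, x)"]) auto
 qed auto
 ultimately show ?thesis by simp
qed

text \<open>Maps out of a space glued from finitely many compact pieces; the pieces may overlap and may be
  collapsed by \<open>p\<close>.\<close>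

lemma quot_continuous:
 fixes f :: "'k::t2_space => 'y::topological_space" and p :: "'i => 'p::topological_space => 'y" and fi :: "'y => 'z::topological_space"
 assumes Y: "Hausdorff_space (euclidean :: 'y topology)" and I: "finite I" "!!i. i:I ==> compact (P i)" "!!i. i:I ==> continuous_on (P i) (p i)"
  and K: "compact K" "continuous_on K f" "f`K <= (UN i:I. p i`P i)"
  and ph: "!!i. i:I ==> continuous_on (P i) (%x. fi (p i x))"
 shows "continuous_on K (%k. fi (f k))"
 unfolding continuous_on_closed_invariant
proof (intro allI impI)
 fix B :: "'z set" assume B: "closed B"
 have "closed {k:K. fi (f k):B}"
 proof (rule quot_closed[OF Y I K, where A = "%y. fi y:B"])
  fix i assume "i:I"
  from continuous_closedin_preimage[OF ph[OF this] B]
  show "closedin (top_of_set (P i)) {x:P i. fi (p i x):B}" by (simp add: vimage_def Int_def)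
 qed
 thus "EX A. closed A & A Int K = (%k. fi (f k)) -` B Int K"
  by (intro exI[of _ "{k:K. fi (f k):B}"]) auto
qed

text \<open>A cell \<open>(g, n, i)\<close> has dimension \<open>n\<close>. Each point of a complex is the function of its coordinates:
 the coordinates with index \<open>(c, _)\<close> are positive multiples of \<open>1\<close> and of the position inside the open
 cell \<open>c\<close>, and they are extended over the cells attached later by damping them radially.\<close>

type_synonym 'g cell = "'g \<times> nat \<times> nat"
type_synonym 'g pt = "('g \<times> nat \<times> nat) \<times> nat => real"

abbreviation dm :: "'g cell => nat" where "dm c == fst (snd c)"

text \<open>The damping factor vanishes on the inner half of the cube, which hides the discontinuity
  of the radial projection at the centre. On the boundary it is 1 while the cell's own coordinates
  vanish, so the attaching map reappears there.\<close>

definition chm :: "('g cell => rseq => 'g pt) => 'g cell => rseq => 'g pt" where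
 "chm a c x = (%(d, i). if d = c then (1 - nrm (dm c) x) * (case i of 0 => 1 | Suc i => x i)
  else max 0 (2 * nrm (dm c) x - 1) * a c (rho (dm c) x) (d, i))"

definition op :: "nat => rseq set" where
 "op n = cb n - bd n"

lemma mem_op_iff: "x:op n \<longleftrightarrow> x:cb n & nrm n x < 1"
 unfolding op_def by (auto simp: mem_cb_iff mem_bd_iff)

lemma op_bd: "x:cb n ==> x:op n | x:bd n"
 by (auto simp: op_def)

definition pts :: "('g cell => rseq => 'g pt) => 'g cell set => 'g pt set" where
 "pts a D = (UN c:D. chm a c`op (dm c))"

definition wf :: "'g cell set => ('g cell => rseq => 'g pt) => bool" where
 "wf C a \<longleftrightarrow> (ALL c:C. continuous_on (bd (dm c)) (a c) &
  (EX F. finite F & F <= C & (ALL d:F. dm d < dm c) & a c`bd (dm c) <= pts a F))"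

text \<open>Continuity into the product topology with image in finitely many open cells. For compact
  domains this will turn out to be continuity into the weak topology of the quotient
  complex.\<close>

definition cmap :: "'k::topological_space set => ('g cell => rseq => 'g pt) => 'g cell set => ('k => 'g pt) => bool" where
 "cmap K a D f \<longleftrightarrow> continuous_on K f & (EX F. finite F & F <= D & f`K <= pts a F)"

abbreviation cfills where
 "cfills d a D f == EX F. cmap (cb d) a D F & (ALL x:bd d. F x = f x)"

section \<open>Coordinates of points in open cells\<close>

lemma chm_self: "chm a c x (c, i) = (1 - nrm (dm c) x) * (case i of 0 => 1 | Suc i => x i)"
 by (simp add: chm_def)

lemma chm_other: "d ~= c ==> chm a c x (d, i) = max 0 (2 * nrm (dm c) x - 1) * a c (rho (dm c) x) (d, i)"
 by (simp add: chm_def)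

lemma chm_cong: "a c = b c ==> chm a c = chm b c"
 by (simp add: chm_def fun_eq_iff)

lemma pts_cong: "(!!c. c:D ==> a c = b c) ==> pts a D = pts b D"
 unfolding pts_def using chm_cong by (metis (no_types, lifting) SUP_cong)

lemma pts_mono: "D <= D' ==> pts a D <= pts a D'"
 unfolding pts_def by blast

lemma pts_Un: "pts a (D Un D') = pts a D Un pts a D'"
 unfolding pts_def by blast

lemma ptsI: "c:D ==> x:op (dm c) ==> chm a c x:pts a D"
 unfolding pts_def by blast

lemma ptsE: assumes "u:pts a D" obtains c x where "c:D" "x:op (dm c)" "u = chm a c x"
 using assms unfolding pts_def by blast

lemma wf_cont: "wf C a ==> c:C ==> continuous_on (bd (dm c)) (a c)"
 unfolding wf_def by (drule (1) bspec) (erule conjunct1)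

lemma wf_fin:
 assumes "wf C a" "c:C"
 obtains F where "finite F" "F <= C" "!!d. d:F ==> dm d < dm c" "!!x. x:bd (dm c) ==> a c x:pts a F"
proof -
 have "EX F. finite F & F <= C & (ALL d:F. dm d < dm c) & a c`bd (dm c) <= pts a F"
  using bspec[OF assms(1)[unfolded wf_def] assms(2)] by (rule conjunct2)
 then obtain F where F: "finite F" "F <= C" "ALL d:F. dm d < dm c" "a c`bd (dm c) <= pts a F" by (elim exE conjE)
 show ?thesis
 proof (rule that[of F])
  show "finite F" "F <= C" by (rule F)+
  show "dm d < dm c" if "d:F" for d using F(3) that by (rule bspec)
  show "a c x:pts a F" if "x:bd (dm c)" for x using F(4) imageI[OF that, of "a c"] by (rule subsetD)
 qed
qed

text \<open>Induction on the dimension: the foreign coordinates of a cell come from its boundary,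
  which lies in cells of smaller dimension.\<close>

lemma pts_zero:
 assumes "wf C a" "D <= C" "!!c. c:D ==> dm c < n" "u:pts a D" "d ~: C | n <= dm d"
 shows "u (d, i) = 0"
 using assms(2-)
proof (induction n arbitrary: u D rule: less_induct)
 case (less n)
 obtain c x where c: "c:D" "x:op (dm c)" "u = chm a c x" using less.prems(3) by (rule ptsE)
 have cC: "c:C" and cn: "dm c < n" using c(1) less.prems(1,2) by auto
 have dc: "d ~= c" using less.prems(4) cC cn by auto
 show ?case
 proof (cases "2 * nrm (dm c) x - 1 <= 0")
  case True
  thus ?thesis using c(3) chm_other[OF dc] by simp
 next
  case False
  hence "rho (dm c) x:bd (dm c)" by (intro rho_in_bd) simp
  obtain F where F: "finite F" "F <= C" "!!d. d:F ==> dm d < dm c" "!!x. x:bd (dm c) ==> a c x:pts a F"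
   by (rule wf_fin[OF assms(1) cC]) (rule that; blast)
  have "a c (rho (dm c) x) (d, i) = 0"
   by (rule less.IH[OF cn F(2,3) F(4)[OF \<open>rho (dm c) x : bd (dm c)\<close>]]) (use less.prems(4) cn in auto)
  thus ?thesis using c(3) chm_other[OF dc] by simp
 qed
qed

lemma chm_zero:
 assumes "wf C a" "c:C" "x:op (dm c)" "d ~= c" "d ~: C | dm c <= dm d"
 shows "chm a c x (d, i) = 0"
proof (cases "2 * nrm (dm c) x - 1 <= 0")
 case True
 thus ?thesis using chm_other[OF assms(4)] by simp
next
 case False
 hence r: "rho (dm c) x:bd (dm c)" by (intro rho_in_bd) simp
 obtain F where F: "finite F" "F <= C" "!!d. d:F ==> dm d < dm c" "!!x. x:bd (dm c) ==> a c x:pts a F"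
  by (rule wf_fin[OF assms(1,2)]) (rule that; blast)
 have "a c (rho (dm c) x) (d, i) = 0" by (rule pts_zero[OF assms(1) F(2,3) F(4)[OF r] assms(5)])
 thus ?thesis using chm_other[OF assms(4)] by simp
qed

lemma pts_zero_outside: "wf C a ==> D <= C ==> u:pts a D ==> d ~: C ==> u (d, i) = 0"
 by (elim ptsE) (metis chm_zero subsetD)

lemma pts_nonneg:
 assumes "wf C a" "D <= C" "u:pts a D"
 shows "0 <= u (d, 0)"
proof -
 have "ALL D u. D <= C & (ALL c:D. dm c < n) & u:pts a D --> 0 <= u (d, 0)" for n
 proof (induction n rule: less_induct)
  case (less n)
  show ?case
  proof (intro allI impI, elim conjE)
   fix D u assume D: "D <= C" "ALL c:D. dm c < n" and u: "u:pts a D"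
   obtain c x where c: "c:D" "x:op (dm c)" "u = chm a c x" using u by (rule ptsE)
   have cC: "c:C" and cn: "dm c < n" using c(1) D by auto
   show "0 <= u (d, 0)"
   proof (cases "d = c | 2 * nrm (dm c) x - 1 <= 0")
    case True
    thus ?thesis using c(2,3) by (cases "d = c") (simp_all add: chm_self chm_other mem_op_iff)
   next
    case False
    hence r: "rho (dm c) x:bd (dm c)" by (intro rho_in_bd) simp
    obtain F where F: "finite F" "F <= C" "!!d. d:F ==> dm d < dm c" "!!x. x:bd (dm c) ==> a c x:pts a F"
     by (rule wf_fin[OF assms(1) cC]) (rule that; blast)
    have "0 <= a c (rho (dm c) x) (d, 0)" using less.IH[OF cn] F(2,3) F(4)[OF r] by blast
    thus ?thesis using c(3) False by (simp add: chm_other)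
   qed
  qed
 qed
 moreover obtain c x where "c:D" "x:op (dm c)" "u = chm a c x" using assms(3) by (rule ptsE)
 hence "u:pts a {c}" "{c} <= C" "ALL d:{c}. dm d < Suc (dm c)" using assms(2) ptsI[of c "{c}"] by auto
 ultimately show ?thesis by blast
qed

lemma chm_pos: "x:op (dm c) ==> 0 < chm a c x (c, 0)"
 by (simp add: chm_self mem_op_iff)

lemma chm_inj:
 assumes "x:op (dm c)" "y:op (dm c)" "chm a c x = chm a c y" shows "x = y"
proof
 fix i
 have "nrm (dm c) x = nrm (dm c) y" using fun_cong[OF assms(3), of "(c, 0)"] by (simp add: chm_self)
 thus "x i = y i" using fun_cong[OF assms(3), of "(c, Suc i)"] assms(1) by (simp add: chm_self mem_op_iff)
qed

text \<open>Of two different open cells let \<open>d\<close> be one whose dimension is not the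
  smaller. The coordinate \<open>(d, 0)\<close> is positive on \<open>d\<close> and zero on the
  other cell.\<close>

lemma chm_unique:
 assumes "wf C a" "c:C" "d:C" "x:op (dm c)" "y:op (dm d)" "chm a c x = chm a d y"
 shows "c = d & x = y"
proof -
 have "c = d"
 proof (rule ccontr)
  assume "c ~= d"
  hence "dm c <= dm d ==> chm a c x (d, 0) = 0" "dm d <= dm c ==> chm a d y (c, 0) = 0"
   using chm_zero[OF assms(1,2,4), of d 0] chm_zero[OF assms(1,3,5), of c 0] by auto
  thus False using chm_pos[OF assms(4), of a] chm_pos[OF assms(5), of a] assms(6) by (metis less_irrefl linear)
 qed
 thus ?thesis using chm_inj assms(4-6) by blast
qed

lemma chm_in_pts_iff: "wf C a ==> D <= C ==> c:C ==> x:op (dm c) ==> chm a c x:pts a D \<longleftrightarrow> c:D"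
proof
 assume a: "wf C a" "D <= C" "c:C" "x:op (dm c)" and "chm a c x:pts a D"
 then obtain d y where d: "d:D" "y:op (dm d)" "chm a c x = chm a d y" by (elim ptsE)
 thus "c:D" using chm_unique[OF a(1) a(3) _ a(4) d(2,3)] a(2) by blast
qed (rule ptsI)

lemma chm_bd:
 assumes "wf C a" "c:C" "x:bd (dm c)" shows "chm a c x = a c x"
proof
 fix e :: "'a cell \<times> nat"
 obtain d i where e: "e = (d, i)" by (cases e)
 obtain F where F: "finite F" "F <= C" "!!d. d:F ==> dm d < dm c" "!!x. x:bd (dm c) ==> a c x:pts a F"
  by (rule wf_fin[OF assms(1,2)]) (rule that; blast)
 have n: "nrm (dm c) x = 1" using assms(3) by (simp add: mem_bd_iff)
 show "chm a c x e = a c x e"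
 proof (cases "d = c")
  case True
  thus ?thesis using pts_zero[OF assms(1) F(2,3) F(4)[OF assms(3)], of c i] n by (simp add: e chm_self)
 next
  case False
  thus ?thesis using n rho_bd[OF assms(3)] by (simp add: e chm_other)
 qed
qed

lemma chm_fin:
 assumes "wf C a" "c:C"
 obtains F where "finite F" "F <= C" "c:F" "!!d. d:F ==> dm d <= dm c" "!!d. d:F ==> d = c | dm d < dm c"
  "!!x. x:cb (dm c) ==> chm a c x:pts a F"
proof -
 obtain F where F: "finite F" "F <= C" "!!d. d:F ==> dm d < dm c" "!!x. x:bd (dm c) ==> a c x:pts a F"
  by (rule wf_fin[OF assms]) (rule that; blast)
 have "chm a c x:pts a (insert c F)" if "x:cb (dm c)" for x
  using op_bd[OF that]
 proof
  assume "x:op (dm c)" thus ?thesis by (intro ptsI) simp_all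
 next
  assume x: "x:bd (dm c)"
  thus ?thesis using chm_bd[OF assms x] F(4)[OF x] pts_mono[of F "insert c F"] by auto
 qed
 note in_F = this
 show ?thesis
 proof (rule that[of "insert c F"])
  show "finite (insert c F)" "insert c F <= C" "c:insert c F" using F(1,2) assms(2) by simp_all
  show le: "d = c | dm d < dm c" if "d:insert c F" for d using that F(3)[of d] by blast
  show "dm d <= dm c" if "d:insert c F" for d using le[OF that] by auto
  show "chm a c x:pts a (insert c F)" if "x:cb (dm c)" for x by (rule in_F[OF that])
 qed
qed

lemma chm_continuous:
 assumes a: "continuous_on (bd (dm c)) (a c)" shows "continuous_on (cb (dm c)) (chm a c)"
proof (rule continuous_on_pointwise)
 fix e :: "'a cell \<times> nat"
 obtain d i where e: "e = (d, i)" by (cases e)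
 define n where "n = dm c"
 note cn = continuous_on_nrm[OF continuous_on_id, of _ n]
 show "continuous_on (cb (dm c)) (%x. chm a c x e)"
 proof (cases "d = c")
  case True
  have "continuous_on (cb n) (%x. case i of 0 => 1 | Suc i => x i)"
   by (cases i) (simp_all add: continuous_on_coord)
  hence "continuous_on (cb n) (%x. (1 - nrm n x) * (case i of 0 => 1 | Suc i => x i))"
   using cn by (intro ctn) simp
  thus ?thesis using True by (simp add: e chm_self n_def)
 next
  case False
  define h where "h = (%x. max 0 (2 * nrm n x - 1) * a c (rho n x) (d, i))"
  define A where "A = {x:cb n. 1/2 <= nrm n x}"
  define B where "B = {x:cb n. nrm n x <= 1/2}"
  have cl: "closed A" "closed B" unfolding A_def B_def
   by (rule continuous_on_closed_Collect_le[OF _ _ compact_imp_closed[OF compact_cb]]; intro cn continuous_on_const)+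
  have "continuous_on A (%x. a c (rho n x))"
  proof (rule continuous_on_compose2[OF a[folded n_def]])
   show "continuous_on A (rho n)"
    by (intro continuous_on_scl ctn continuous_on_nrm continuous_on_id) (auto simp: A_def)
   show "rho n`A <= bd n" using rho_in_bd[of n] by (auto simp: A_def)
  qed
  from continuous_on_coord'[OF this] have "continuous_on A h"
   unfolding h_def by (intro continuous_on_mult continuous_on_max ctn continuous_on_nrm continuous_on_id)
  moreover have "h x = 0" if "x:B" for x using that by (simp add: h_def B_def)
  hence "continuous_on B h" by (simp cong: continuous_on_cong)
  ultimately have "continuous_on (A Un B) h" by (rule continuous_on_closed_Un[OF cl])
  moreover have "A Un B = cb n" by (auto simp: A_def B_def)
  ultimately show ?thesis using False by (simp add: e chm_other n_def h_def)
 qed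
qed

section \<open>Finite subcomplexes\<close>

definition subcx :: "('g cell => rseq => 'g pt) => 'g cell set => bool" where
 "subcx a F \<longleftrightarrow> finite F & (ALL c:F. chm a c`cb (dm c) <= pts a F)"

text \<open>Boundaries contribute only cells of smaller dimension, so closing up a finite set of
  cells ends after finitely many steps.\<close>

lemma subcx_ex:
 assumes wf: "wf C a" and F: "finite F" "F <= C"
 shows "EX F'. subcx a F' & F <= F' & F' <= C & (ALL n. (ALL c:F. dm c <= n) --> (ALL c:F'. dm c <= n))"
proof -
 have "ALL F. finite F & F <= C & (ALL c:F. dm c < m) -->
  (EX F'. subcx a F' & F <= F' & F' <= C & (ALL n. (ALL c:F. dm c <= n) --> (ALL c:F'. dm c <= n)))" for m
 proof (induction m)
  case 0
  have "subcx a {}" by (simp add: subcx_def)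
  thus ?case by (intro allI impI) (metis empty_iff empty_subsetI equals0I less_nat_zero_code)
 next
  case (Suc m)
  show ?case
  proof (intro allI impI, elim conjE)
   fix F assume F: "finite F" "F <= C" "ALL c:F. dm c < Suc m"
   have "EX E. ALL c. c:F --> finite (E c) & E c <= C & (ALL d:E c. dm d < dm c) & (ALL x:bd (dm c). a c x:pts a (E c))"
   proof (intro choice allI)
    fix c
    show "EX E. c:F --> finite E & E <= C & (ALL d:E. dm d < dm c) & (ALL x:bd (dm c). a c x:pts a E)"
    proof (cases "c:F")
     case True
     hence "c:C" using F(2) by blast
     from wf_fin[OF wf this] obtain E where "finite E" "E <= C" "!!d. d:E ==> dm d < dm c"
      "!!x. x:bd (dm c) ==> a c x:pts a E" by blast
     thus ?thesis by (intro exI[of _ E]) simp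
    qed simp
   qed
   then obtain E where E0: "ALL c. c:F --> finite (E c) & E c <= C & (ALL d:E c. dm d < dm c) & (ALL x:bd (dm c). a c x:pts a (E c))"
    by (elim exE)
   have E: "!!c. c:F ==> finite (E c)" "!!c. c:F ==> E c <= C" "!!c d. c:F ==> d:E c ==> dm d < dm c"
    "!!c x. c:F ==> x:bd (dm c) ==> a c x:pts a (E c)" using E0 by blast+
   define D where "D = (UN c:F. E c)"
   have "finite D" "D <= C" unfolding D_def using F(1) E(1,2) by blast+
   moreover have "dm d < m" if "d:D" for d
   proof -
    obtain c where c: "c:F" "d:E c" using \<open>d : D\<close> unfolding D_def by blast
    show ?thesis using E(3)[OF c] bspec[OF F(3) c(1)] by linarith
   qed
   ultimately have "finite D" "D <= C" "ALL d:D. dm d < m" by blast+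
   then obtain D' where D': "subcx a D'" "D <= D'" "D' <= C" "ALL n. (ALL c:D. dm c <= n) --> (ALL c:D'. dm c <= n)"
    using Suc.IH by meson
   have "subcx a (F Un D')"
    unfolding subcx_def
   proof (intro conjI ballI)
    show "finite (F Un D')" using F(1) D'(1) by (simp add: subcx_def)
    fix c assume c: "c:F Un D'"
    show "chm a c`cb (dm c) <= pts a (F Un D')"
    proof (cases "c:D'")
     case True
     thus ?thesis using D'(1) pts_mono[of D' "F Un D'" a] by (auto simp: subcx_def)
    next
     case False
     hence cF: "c:F" using c by simp
     hence cC: "c:C" using F(2) by blast
     show ?thesis
     proof (rule image_subsetI)
      fix x assume "x:cb (dm c)"
      from op_bd[OF this] show "chm a c x:pts a (F Un D')"
      proof
       assume "x:op (dm c)" thus ?thesis using c by (intro ptsI)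
      next
       assume x: "x:bd (dm c)"
       have "E c <= F Un D'" using cF D'(2) by (auto simp: D_def)
       thus ?thesis using E(4)[OF cF x] chm_bd[OF wf cC x] pts_mono[of "E c" "F Un D'" a] by auto
      qed
     qed
    qed
   qed
   moreover have "ALL c:F Un D'. dm c <= n" if n: "ALL c:F. dm c <= n" for n
   proof -
    have "dm d <= n" if "d:D" for d
    proof -
     obtain c where "c:F" "d:E c" using \<open>d : D\<close> unfolding D_def by blast
     thus ?thesis using E(3) n by (meson less_imp_le order_trans)
    qed
    thus ?thesis using D'(4) n by blast
   qed
   ultimately show "EX F'. subcx a F' & F <= F' & F' <= C & (ALL n. (ALL c:F. dm c <= n) --> (ALL c:F'. dm c <= n))"
    using F(2) D'(3) by (intro exI[of _ "F Un D'"]) blast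
  qed
 qed
 moreover have "ALL c:F. dm c < Suc (Max (dm`F))" using F(1) by (simp add: less_Suc_eq_le)
 ultimately show ?thesis using F by meson
qed

lemma subcx_pts: "subcx a F ==> pts a F = (UN c:F. chm a c`cb (dm c))"
 unfolding subcx_def pts_def op_def by blast

lemma subcx_compact: assumes "wf C a" "F <= C" "subcx a F" shows "compact (pts a F)"
 unfolding subcx_pts[OF assms(3)]
proof (intro compact_UN ballI)
 show "finite F" using assms(3) by (simp add: subcx_def)
 fix c assume "c:F"
 hence "c:C" using assms(2) by blast
 thus "compact (chm a c`cb (dm c))"
  by (intro compact_continuous_image[OF chm_continuous compact_cb] wf_cont[OF assms(1)])
qed

section \<open>Maps into finitely many cells\<close>

lemma cmapI: "continuous_on K f ==> finite F ==> F <= D ==> (!!k. k:K ==> f k:pts a F) ==> cmap K a D f"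
 unfolding cmap_def by blast

lemma cmapE:
 assumes "cmap K a D f"
 obtains F where "continuous_on K f" "finite F" "F <= D" "!!k. k:K ==> f k:pts a F"
proof -
 have c: "continuous_on K f" and "EX F. finite F & F <= D & f`K <= pts a F" using assms by (auto simp: cmap_def)
 then obtain F where F: "finite F" "F <= D" "f`K <= pts a F" by blast
 show ?thesis by (rule that[of F, OF c F(1,2)]) (use F(3) in blast)
qed

lemma cmap_in: "cmap K a D f ==> k:K ==> f k:pts a D"
 by (elim cmapE) (meson pts_mono subsetD)

lemma cmap_mono: "cmap K a D f ==> D <= D' ==> cmap K a D' f"
 unfolding cmap_def by (meson order_trans)

lemma cmap_compose: "cmap K a D f ==> continuous_on L h ==> h`L <= K ==> cmap L a D (%x. f (h x))"
 by (elim cmapE) (rule cmapI, erule (2) continuous_on_compose2, auto)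

lemma cmap_subset: "cmap K a D f ==> L <= K ==> cmap L a D f"
 using cmap_compose[of K a D f L "%x. x"] by (simp add: continuous_on_id)

lemma cmap_cong: "(!!k. k:K ==> f k = g k) ==> cmap K a D f \<longleftrightarrow> cmap K a D g"
 unfolding cmap_def by (simp cong: continuous_on_cong)

lemma cmap_cong_at: "(!!c. c:D ==> a c = b c) ==> cmap K a D f \<longleftrightarrow> cmap K b D f"
proof -
 assume "!!c. c:D ==> a c = b c"
 hence "F <= D ==> pts a F = pts b F" for F by (intro pts_cong) blast
 thus ?thesis unfolding cmap_def by (metis (no_types, lifting))
qed

lemma cmap_const: "u:pts a D ==> cmap K a D (%_. u)"
 by (elim ptsE, rule cmapI[of _ _ "{c}" for c]) (auto intro: ptsI)

lemma cmap_UN: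
 assumes I: "finite I" "!!i. i:I ==> closed (K i)" "!!i. i:I ==> cmap (K i) a D f"
 shows "cmap (UN i:I. K i) a D f"
proof -
 have "EX F. ALL i. i:I --> finite (F i) & F i <= D & f`K i <= pts a (F i)"
  using I(3) unfolding cmap_def by (intro choice) blast
 then obtain F where F: "!!i. i:I ==> finite (F i) & F i <= D & f`K i <= pts a (F i)" by blast
 show ?thesis
 proof (rule cmapI[of _ _ "UN i:I. F i"])
  show "continuous_on (UN i:I. K i) f"
   using I by (intro continuous_on_closed_Union) (auto simp: cmap_def)
  show "finite (UN i:I. F i)" "(UN i:I. F i) <= D" using I(1) F by auto
  fix k assume "k:(UN i:I. K i)"
  then obtain i where i: "i:I" "k:K i" by blast
  hence "f k:pts a (F i)" using F[OF i(1)] by blast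
  thus "f k:pts a (UN i:I. F i)" using pts_mono[of "F i" "UN i:I. F i" a] i(1) by blast
 qed
qed

lemma cmap_Un:
 assumes "closed A" "closed B" "cmap A a D f" "cmap B a D f" shows "cmap (A Un B) a D f"
 using cmap_UN[of UNIV "%b. if b then A else B" a D f] assms by (auto simp: UNIV_bool Un_commute)

lemma cmap_chm:
 assumes "wf C a" "c:C" shows "cmap (cb (dm c)) a C (chm a c)"
 by (rule chm_fin[OF assms]) (rule cmapI[OF chm_continuous[of c a, OF wf_cont[OF assms]]])

lemma cmap_continuous:
 fixes f :: "'k::t2_space => 'g pt"
 assumes wf: "wf C a" and K: "compact K" and f: "cmap K a C f"
  and ph: "!!c. c:C ==> continuous_on (cb (dm c)) (%x. fi (chm a c x))"
 shows "continuous_on K (%k. fi (f k))"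
proof -
 obtain F where F: "continuous_on K f" "finite F" "F <= C" "!!k. k:K ==> f k:pts a F" using f by (rule cmapE) (rule that; blast)
 show ?thesis
 proof (rule quot_continuous[OF Hausdorff_fun, where I = F and P = "%c. cb (dm c)" and p = "chm a" and fi = fi and f = f])
  show "finite F" "compact K" "continuous_on K f" by (rule F K)+
  show "compact (cb (dm c))" for c :: "'g cell" by (rule compact_cb)
  show "continuous_on (cb (dm c)) (chm a c)" if "c:F" for c
   using that F(3) by (intro chm_continuous wf_cont[OF wf]) blast
  show "f`K <= (UN c:F. chm a c`cb (dm c))"
   using F(4) unfolding pts_def op_def by blast
  show "continuous_on (cb (dm c)) (%x. fi (chm a c x))" if "c:F" for c
   using that F(3) by (intro ph) blast
 qed
qed

lemma quot_cmap:
 fixes f :: "'k::t2_space => 'y::topological_space" and p :: "'i => 'p::topological_space => 'y"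
 assumes Y: "Hausdorff_space (euclidean :: 'y topology)" and I: "finite I" "!!i. i:I ==> compact (P i)" "!!i. i:I ==> continuous_on (P i) (p i)"
  and K: "compact K" "continuous_on K f" "f`K <= (UN i:I. p i`P i)"
  and ph: "!!i. i:I ==> cmap (P i) a D (%x. fi (p i x))"
 shows "cmap K a D (%k. fi (f k))"
proof -
 have "ALL i:I. EX F. finite F & F <= D & (%x. fi (p i x))`P i <= pts a F" using ph unfolding cmap_def by blast
 from bchoice[OF this] obtain F where F: "ALL i:I. finite (F i) & F i <= D & (%x. fi (p i x))`P i <= pts a (F i)" ..
 show ?thesis
 proof (rule cmapI[of _ _ "UN i:I. F i"])
  show "continuous_on K (%k. fi (f k))" by (rule quot_continuous[OF Y I K]) (use ph in \<open>simp_all add: cmap_def\<close>)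
  show "finite (UN i:I. F i)" "(UN i:I. F i) <= D" using I(1) F by auto
  fix k assume "k:K"
  then obtain i x where i: "i:I" "x:P i" "f k = p i x" using K(3) by blast
  hence "fi (f k):pts a (F i)" using F by auto
  thus "fi (f k):pts a (UN i:I. F i)" using pts_mono[of "F i" "UN i:I. F i" a] i(1) by blast
 qed
qed

text \<open>Each point lies in exactly one open cell, so values on old points and on new open cells
  can be prescribed independently. Continuity is left to a later check on closed cells.\<close>

lemma ext_cells:
 assumes wf: "wf C a" and D: "D <= C"
 shows "EX ps. (ALL u:pts a D. ps u = fi u) & (ALL c:C - D. ALL x:op (dm c). ps (chm a c x) = F c x)"
proof -
 define ps where "ps = (%u. if u:pts a D then fi u else
  (case (SOME (c, x). c:C & x:op (dm c) & u = chm a c x) of (c, x) => F c x))"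
 have "ps (chm a c x) = F c x" if c: "c:C - D" and x: "x:op (dm c)" for c x
 proof -
  have "(SOME (d, y). d:C & y:op (dm d) & chm a c x = chm a d y) = (c, x)"
  proof (rule some_equality)
   fix z assume "case z of (d, y) => d:C & y:op (dm d) & chm a c x = chm a d y"
   thus "z = (c, x)" using chm_unique[OF wf, of c "fst z" x "snd z"] c x by (auto split: prod.splits)
  qed (use c x in simp)
  thus ?thesis using chm_in_pts_iff[OF wf D _ x] c by (simp add: ps_def)
 qed
 moreover have "ALL u:pts a D. ps u = fi u" by (simp add: ps_def)
 ultimately show ?thesis by blast
qed

subsection \<open>Complexes with a free group action\<close>

context group
begin

text \<open>Left translation of the group component of the index. Indices outside the group get the
  value 0, so the neutral element acts trivially only on functions that vanish there.\<close>

definition gx :: "'a => 'a pt => 'a pt" where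
 "gx g u = (%((h, j), i). if h:carrier G then u ((inv g \<otimes> h, j), i) else 0)"

text \<open>One attaching map is stored per orbit, that of the cell of the neutral element; the
  others are its translates.\<close>

definition aG :: "(nat \<times> nat => rseq => 'a pt) => 'a cell => rseq => 'a pt" where
 "aG a c x = gx (fst c) (a (snd c) x)"

lemma gx_mult: "g:carrier G ==> h:carrier G ==> gx (g \<otimes> h) u = gx g (gx h u)"
 by (auto simp: gx_def fun_eq_iff inv_mult_group m_assoc)

lemma gx_one: "(!!h j i. h ~: carrier G ==> u ((h, j), i) = 0) ==> gx \<one> u = u"
 by (auto simp: gx_def fun_eq_iff)

lemma gx_continuous: "continuous_on K f ==> continuous_on K (%k. gx g (f k))"
proof (rule continuous_on_pointwise)
 fix e :: "'a cell \<times> nat" assume f: "continuous_on K f"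
 obtain h j i where e: "e = ((h, j), i)" by (metis surj_pair)
 show "continuous_on K (%k. gx g (f k) e)"
  using continuous_on_coord'[OF f] by (cases "h:carrier G") (simp_all add: gx_def e)
qed

lemma chm_gx:
 assumes "g:carrier G" "h:carrier G" shows "chm (aG a) (g \<otimes> h, j) x = gx g (chm (aG a) (h, j) x)"
proof
 fix e :: "'a cell \<times> nat"
 obtain k j' i where e: "e = ((k, j'), i)" by (metis surj_pair)
 have gg: "aG a (g \<otimes> h, j) y = gx g (aG a (h, j) y)" for y using gx_mult[OF assms] by (simp add: aG_def)
 show "chm (aG a) (g \<otimes> h, j) x e = gx g (chm (aG a) (h, j) x) e"
 proof (cases "k:carrier G")
  case True
  hence "k = g \<otimes> h \<longleftrightarrow> inv g \<otimes> k = h" using assms by (metis inv_solve_left)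
  thus ?thesis using True unfolding chm_def e gg by (auto simp: gx_def)
 next
  case False
  hence "k ~= g \<otimes> h" using assms by auto
  thus ?thesis using False unfolding chm_def e gg by (auto simp: gx_def)
 qed
qed

lemma chm_gx1: "g:carrier G ==> chm (aG a) (g, j) x = gx g (chm (aG a) (\<one>, j) x)"
 using chm_gx[of g \<one> a j x] by simp

definition cel :: "(nat \<times> nat) set => 'a cell set" where
 "cel J = carrier G \<times> J"

abbreviation "gmap K a J == cmap K (aG a) (cel J)"
abbreviation "gfills d a J == cfills d (aG a) (cel J)"
abbreviation "gpts a J == pts (aG a) (cel J)"
abbreviation "gwf a J == wf (cel J) (aG a)"
abbreviation "gch a == chm (aG a)"
abbreviation "ch1 a j == gch a (\<one>, j)"

lemma cel_mono: "J <= J' ==> cel J <= cel J'"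
 by (auto simp: cel_def)

lemma gx_pts_sub:
 assumes g: "g:carrier G" and D: "D <= cel J" and u: "u:pts (aG a) D"
 shows "gx g u:pts (aG a) ((%c. (g \<otimes> fst c, snd c))`D)"
proof -
 obtain c x where c: "c:D" "x:op (dm c)" "u = chm (aG a) c x" using u by (rule ptsE)
 obtain h j where hj: "c = (h, j)" by (cases c)
 have "h:carrier G" using c(1) D by (auto simp: cel_def hj)
 hence "gx g u = chm (aG a) (g \<otimes> h, j) x" using chm_gx[OF g] c(3) hj by simp
 thus ?thesis using c(1,2) hj by (auto intro!: ptsI image_eqI[of _ _ "(h, j)"])
qed

lemma cel_shift: "g:carrier G ==> D <= cel J ==> (%c. (g \<otimes> fst c, snd c))`D <= cel J"
 by (auto simp: cel_def)

lemma gx_pts: "g:carrier G ==> u:pts (aG a) (cel J) ==> gx g u:pts (aG a) (cel J)"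
 using gx_pts_sub[of g "cel J" J u a] pts_mono[OF cel_shift[of g "cel J" J], of "aG a"] by blast

lemma cmap_gx:
 assumes g: "g:carrier G" and f: "cmap K (aG a) (cel J) f" shows "cmap K (aG a) (cel J) (%k. gx g (f k))"
proof -
 obtain F where F: "continuous_on K f" "finite F" "F <= cel J" "!!k. k:K ==> f k:pts (aG a) F" using f by (rule cmapE) (rule that; blast)
 show ?thesis
  by (rule cmapI[OF gx_continuous[OF F(1)] _ cel_shift[OF g F(3)] gx_pts_sub[OF g F(3) F(4)]]) (use F(2) in simp_all)
qed

lemma wf_aG:
 assumes "!!j. j:J ==> cmap (bd (fst j)) (aG a) (cel {i:J. fst i < fst j}) (a j)"
 shows "wf (cel J) (aG a)"
 unfolding wf_def
proof
 fix c assume "c:cel J"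
 then obtain g j where c: "c = (g, j)" "g:carrier G" "j:J" by (auto simp: cel_def)
 obtain F where F: "continuous_on (bd (fst j)) (%x. gx g (a j x))" "finite F" "F <= cel {i:J. fst i < fst j}"
  "!!x. x:bd (fst j) ==> gx g (a j x):pts (aG a) F"
  using cmap_gx[OF c(2) assms[OF c(3)]] by (rule cmapE) (rule that; blast)
 have "F <= cel J" "ALL d:F. dm d < fst j" using F(3) by (auto simp: cel_def)
 thus "continuous_on (bd (dm c)) (aG a c) &
  (EX F. finite F & F <= cel J & (ALL d:F. dm d < dm c) & aG a c`bd (dm c) <= pts (aG a) F)"
  using F(1,2,4) unfolding c(1) aG_def by (simp add: image_subset_iff) blast
qed

lemma gx_one_pts: "wf (cel J) (aG a) ==> u:pts (aG a) (cel J) ==> gx \<one> u = u"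
 by (rule gx_one) (erule pts_zero_outside[OF _ order_refl], auto simp: cel_def)

end

section \<open>Parametrising simplices by cubes\<close>

text \<open>Stick-breaking coordinates: a map from the cube onto the simplex that is injective on the interior and
  maps the boundary to the boundary.\<close>

definition sw :: "rseq => nat => real" where
 "sw x i = (PROD j<i. x j) * (1 - x i)"

definition eta :: "nat => (nat => 'v) => rseq => 'v => real" where
 "eta n e x = (%v. SUM i<=n. if e i = v then sw x i else 0)"

lemma sw_sum: "(SUM i<=n. sw x i) = 1 - (PROD j<=n. x j)"
proof (induction n)
 case (Suc n)
 have "(PROD j<Suc n. x j) = (PROD j<=n. x j)" by (simp add: lessThan_Suc_atMost)
 hence "sw x (Suc n) = (PROD j<=n. x j) * (1 - x (Suc n))" by (simp only: sw_def)
 thus ?case using Suc by (simp add: algebra_simps)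
qed (simp add: sw_def)

lemma sw_sum_cb: assumes "x:cb n" shows "(SUM i<=n. sw x i) = 1"
proof -
 have "(PROD j<=n. x j) = 0" using assms by (intro prod_zero) (auto simp: cb_def)
 thus ?thesis by (simp add: sw_sum)
qed

lemma cb_range: assumes "x:cb n" shows "0 <= x i" "x i <= 1"
 using assms by (cases "i < n"; simp add: cb_def)+

lemma sw_nonneg: "x:cb n ==> 0 <= sw x i"
 unfolding sw_def using cb_range[of x n] by (intro mult_nonneg_nonneg prod_nonneg) auto

lemma op_range: assumes "x:op n" "i < n" shows "0 < x i" "x i < 1"
 using assms by (auto simp: op_def bd_def cb_def less_le)

lemma op_in_cb: "x:op n ==> x:cb n"
 by (simp add: op_def)

lemma op_prod_pos: "x:op n ==> i <= n ==> 0 < (PROD j<i. x j)"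
 using op_range(1)[of x n] by (intro prod_pos) auto

lemma sw_pos: assumes "x:op n" "i <= n" shows "0 < sw x i"
proof -
 have "x i < 1"
 proof (cases "i < n")
  case True thus ?thesis using op_range(2)[OF assms(1)] by simp
 next
  case False thus ?thesis using assms(1) by (simp add: op_def cb_def)
 qed
 thus ?thesis using op_prod_pos[OF assms] by (simp add: sw_def)
qed

lemma sw_bd: assumes "x:bd n" shows "EX i<=n. sw x i = 0"
proof -
 obtain i where i: "i < n" "x i = 0 | x i = 1" using assms by (auto simp: bd_def)
 from i(2) show ?thesis
 proof
  assume "x i = 0"
  hence "(PROD j<n. x j) = 0" using i(1) by (intro prod_zero) auto
  thus ?thesis by (intro exI[of _ n]) (simp add: sw_def)
 next
  assume "x i = 1"
  thus ?thesis using i(1) by (intro exI[of _ i]) (simp add: sw_def)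
 qed
qed

lemma eta_apply: assumes "inj_on e {..n}" "i <= n" shows "eta n e x (e i) = sw x i"
proof -
 have "eta n e x (e i) = (SUM j<=n. if j = i then sw x j else 0)"
  unfolding eta_def by (rule sum.cong[OF refl]) (use assms in \<open>auto simp: inj_on_eq_iff\<close>)
 thus ?thesis using assms(2) by simp
qed

lemma eta_outside: "v ~: e`{..n} ==> eta n e x v = 0"
 unfolding eta_def by (rule sum.neutral) auto

lemma spt_eta: assumes "inj_on e {..n}" shows "spt (eta n e x) = e`{i:{..n}. sw x i ~= 0}"
proof (intro equalityI subsetI)
 fix v assume v: "v:spt (eta n e x)"
 hence "v:e`{..n}" using eta_outside by (force simp: spt_def)
 then obtain i where i: "i <= n" "v = e i" by auto
 thus "v:e`{i:{..n}. sw x i ~= 0}" using v eta_apply[OF assms i(1), of x] by (auto simp: spt_def)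
next
 fix v assume "v:e`{i:{..n}. sw x i ~= 0}"
 thus "v:spt (eta n e x)" using eta_apply[OF assms] by (auto simp: spt_def)
qed

lemma spt_eta_op: "inj_on e {..n} ==> x:op n ==> spt (eta n e x) = e`{..n}"
 unfolding spt_eta using sw_pos[of x n] by (intro arg_cong[of _ _ "image e"]) force

lemma spt_eta_bd: assumes "inj_on e {..n}" "x:bd n" shows "spt (eta n e x) \<subset> e`{..n}"
proof -
 obtain i where "i <= n" "sw x i = 0" using sw_bd[OF assms(2)] by blast
 hence "e i ~: spt (eta n e x)" using eta_apply[OF assms(1)] by (simp add: spt_def)
 thus ?thesis using \<open>i <= n\<close> spt_eta[OF assms(1), of x] by blast
qed

lemma eta_realiz:
 assumes e: "inj_on e {..n}" and x: "x:cb n" and T: "spt (eta n e x):T" shows "eta n e x:realiz T"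
proof -
 have "0 <= eta n e x v" for v unfolding eta_def using sw_nonneg[OF x] by (intro sum_nonneg) simp
 moreover have "sum (eta n e x) (spt (eta n e x)) = 1"
 proof -
  have "sum (eta n e x) (spt (eta n e x)) = sum (eta n e x) (e`{..n})"
  proof (rule sum.mono_neutral_left)
   show "spt (eta n e x) <= e`{..n}" unfolding spt_eta[OF e] by blast
   show "ALL i:e`{..n} - spt (eta n e x). eta n e x i = 0" by (simp add: spt_def)
  qed simp
  also have "\<dots> = (SUM i<=n. eta n e x (e i))" by (simp add: sum.reindex[OF e])
  also have "\<dots> = 1" using sw_sum_cb[OF x] eta_apply[OF e] by simp
  finally show ?thesis .
 qed
 ultimately show ?thesis using T by (simp add: realiz_def)
qed

lemma eta_spt_ne: assumes "inj_on e {..n}" "x:cb n" shows "spt (eta n e x) ~= {}"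
proof
 assume "spt (eta n e x) = {}"
 moreover have "eta n e x:realiz {spt (eta n e x)}" by (rule eta_realiz[OF assms]) simp
 ultimately show False by (simp add: realiz_def)
qed

lemma eta_continuous: "continuous_on X (eta n e)"
proof (rule continuous_on_pointwise)
 fix v
 have "continuous_on X (%x. if e i = v then sw x i else 0)" for i
  unfolding sw_def by (cases "e i = v")
   (simp_all add: continuous_on_coord continuous_on_mult continuous_on_prod continuous_on_diff)
 thus "continuous_on X (%x. eta n e x v)" unfolding eta_def by (intro continuous_on_sum)
qed

lemma smap_eta_gen:
 assumes "inj_on e {..n}" "X <= cb n" "!!x. x:X ==> spt (eta n e x):T" shows "smap X T (eta n e)"
 unfolding smap_def
proof (intro conjI)
 show "continuous_on X (eta n e)" by (rule eta_continuous)
 show "eta n e`X <= realiz T" using eta_realiz[OF assms(1)] assms(2,3) by blast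
 have "(UN k:X. spt (eta n e k)) <= e`{..n}" using spt_eta[OF assms(1)] by blast
 thus "finite (UN k:X. spt (eta n e k))" by (rule finite_subset) simp
qed

lemma smap_eta:
 assumes e: "bij_betw e {..n} si" and T: "scomplex T" "si:T" shows "smap (cb n) T (eta n e)"
proof (rule smap_eta_gen)
 show i: "inj_on e {..n}" using e by (rule bij_betw_imp_inj_on)
 fix x assume "x:cb n"
 hence "spt (eta n e x) ~= {}" by (rule eta_spt_ne[OF i])
 moreover have "spt (eta n e x) <= si" using spt_eta[OF i, of x] e unfolding bij_betw_def by blast
 ultimately show "spt (eta n e x):T" by (intro scomplexD[OF T])
qed simp

lemma smap_eta_bd:
 assumes e: "bij_betw e {..n} si" and T: "!!ta. ta \<subset> si ==> ta ~= {} ==> ta:T" shows "smap (bd n) T (eta n e)"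
proof (rule smap_eta_gen)
 show i: "inj_on e {..n}" using e by (rule bij_betw_imp_inj_on)
 fix x assume x: "x:bd n"
 thus "spt (eta n e x):T"
  using spt_eta_bd[OF i x] eta_spt_ne[OF i, of x] bd_subset[of n] e by (intro T) (auto simp: bij_betw_def)
qed (rule bd_subset)

lemma eta_inj:
 assumes e: "inj_on e {..n}" and x: "x:op n" and y: "y:op n" and eq: "eta n e x = eta n e y" shows "x = y"
proof
 have s: "sw x i = sw y i" if "i <= n" for i
  using fun_cong[OF eq, of "e i"] eta_apply[OF e that] by simp
 fix i
 show "x i = y i"
 proof (cases "i < n")
  case True
  thus ?thesis
  proof (induction i rule: less_induct)
   case (less i)
   have "(PROD j<i. x j) = (PROD j<i. y j)" using less by (intro prod.cong) auto
   moreover have "(PROD j<i. x j) * (1 - x i) = (PROD j<i. y j) * (1 - y i)" using s[of i] less.prems by (simp add: sw_def)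
   moreover have "(PROD j<i. x j) ~= 0" using op_prod_pos[OF x, of i] less.prems by linarith
   ultimately have "1 - x i = 1 - y i" by (metis mult_left_cancel)
   thus ?case by simp
  qed
 next
  case False
  thus ?thesis using x y by (simp add: op_def cb_def)
 qed
qed

lemma eta_surj:
 assumes e: "bij_betw e {..n} si" and u: "u:realiz T" "spt u = si"
 shows "EX x:op n. eta n e x = u"
proof -
 have i: "inj_on e {..n}" and im: "e`{..n} = si" using e by (auto simp: bij_betw_def)
 have pos: "0 < u (e j)" if "j <= n" for j
 proof -
  have "e j:spt u" using im u(2) that by auto
  thus ?thesis using u(1) by (auto simp: spt_def realiz_def less_le)
 qed
 \<comment> \<open>Tails of the barycentric coordinates; the stick-breaking ratios are the quotients
   of consecutive tails.\<close>
 define r where "r = (%i. SUM j:{i..n}. u (e j))"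
 have r0: "r 0 = 1"
 proof -
  have "sum u (e`{..n}) = 1" using u im by (auto simp: realiz_def)
  moreover have "sum u (e`{..n}) = (SUM j<=n. u (e j))" by (simp add: sum.reindex[OF i])
  ultimately show ?thesis by (simp add: r_def atMost_atLeast0)
 qed
 have rS: "r i = u (e i) + r (Suc i)" if "i <= n" for i
  unfolding r_def using that by (rule sum.atLeast_Suc_atMost)
 have rp: "0 < r i" if "i <= n" for i
  unfolding r_def using pos that by (intro sum_pos) auto
 define x where "x = (%i. if i < n then r (Suc i) / r i else 0)"
 have xr: "0 < x i & x i < 1" if "i < n" for i
  using rp[of i] rp[of "Suc i"] rS[of i] pos[of i] that by (simp add: x_def)
 have x0: "x i = 0" if "~ i < n" for i using that by (simp add: x_def)
 have "x:cb n" using xr x0 by (simp add: cb_def less_imp_le)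
 moreover have "x ~: bd n" using xr by (force simp: bd_def)
 ultimately have xo: "x:op n" by (simp add: op_def)
 have pr: "(PROD j<i. x j) = r i" if "i <= n" for i
  using that
 proof (induction i)
  case 0 thus ?case by (simp add: r0)
 next
  case (Suc i)
  thus ?case using rp[of i] by (simp add: x_def)
 qed
 have sw: "sw x i = u (e i)" if "i <= n" for i
 proof (cases "i < n")
  case True
  thus ?thesis using pr[of i] rp[of i] rS[of i] by (simp add: sw_def x_def field_simps)
 next
  case False
  hence "i = n" using that by simp
  thus ?thesis using pr[of n] by (simp add: sw_def x_def r_def)
 qed
 have "eta n e x v = u v" for v
 proof (cases "v:si")
  case True
  then obtain j where "j <= n" "v = e j" using im by auto
  thus ?thesis using eta_apply[OF i] sw by simp
 next
  case False
  thus ?thesis using eta_outside[of v e n x] im u(2) by (auto simp: spt_def)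
 qed
 thus ?thesis using xo by blast
qed

text \<open>Continuity of a map from a realization to a cell complex, tested on each simplex through
  one parametrisation by a cube.\<close>

definition bmap :: "('g cell => rseq => 'g pt) => 'g cell set => 'v set set => (('v => real) => 'g pt) => bool" where
 "bmap a D T bt \<longleftrightarrow> (ALL si:T. EX n e. bij_betw e {..n} si & cmap (cb n) a D (%x. bt (eta n e x)))"

lemma bmap_compose:
 fixes f :: "'k::t2_space => 'v => real"
 assumes b: "bmap a D T bt" and T: "scomplex T" and f: "smap K T f" and K: "compact K"
 shows "cmap K a D (%k. bt (f k))"
proof -
 define W where "W = (UN k:K. spt (f k))"
 define I where "I = {si:T. si <= W}"
 have "finite (Pow W)" using f by (simp add: W_def smap_def)
 hence I: "finite I" by (rule finite_subset[rotated]) (auto simp: I_def)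
 have "ALL si:T. EX z. bij_betw (snd z) {..fst z} si & cmap (cb (fst z)) a D (%x. bt (eta (fst z) (snd z) x))"
  using b unfolding bmap_def by simp
 from bchoice[OF this] obtain z where z: "ALL si:T. bij_betw (snd (z si)) {..fst (z si)} si &
  cmap (cb (fst (z si))) a D (%x. bt (eta (fst (z si)) (snd (z si)) x))" ..
 show ?thesis
 proof (rule quot_cmap[OF Hausdorff_fun I, where P = "%si. cb (fst (z si))" and p = "%si. eta (fst (z si)) (snd (z si))"])
  show "continuous_on K f" using f by (simp add: smap_def)
  show "f`K <= (UN si:I. eta (fst (z si)) (snd (z si))`cb (fst (z si)))"
  proof (rule image_subsetI)
   fix k assume k: "k:K"
   have s: "spt (f k):T" by (rule smap_support[OF f k])
   have "f k:realiz T" using f k by (auto simp: smap_def)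
   from eta_surj[OF _ this refl] obtain x where "x:op (fst (z (spt (f k))))" "eta (fst (z (spt (f k)))) (snd (z (spt (f k)))) x = f k"
    using z s by blast
   thus "f k:(UN si:I. eta (fst (z si)) (snd (z si))`cb (fst (z si)))"
    using s k by (intro UN_I[of "spt (f k)"] image_eqI[of _ _ x]) (auto simp: op_def I_def W_def)
  qed
 qed (use z in \<open>auto simp: I_def compact_cb eta_continuous K\<close>)
qed

section \<open>Free actions on filtered complexes\<close>

text \<open>A filtered complex with a free action and finitely many orbits of simplices in each
  stage. \<open>S_fill\<close> is essential connectivity: a filling may use a later stage and
  simplices of one dimension more.\<close>

locale brown = group G for G :: "('a, 'b) monoid_scheme" (structure) +
 fixes S :: "nat => 'v set set" and av :: "'a => 'v => 'v"
 assumes scomplex_S: "scomplex (S r)"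
  and S_mono: "r <= s ==> S r <= S s"
  and av_S: "g:carrier G ==> si:S r ==> av g`si:S r"
  and av_one: "{v}:S r ==> av \<one> v = v"
  and av_mult: "g:carrier G ==> h:carrier G ==> {v}:S r ==> av (g \<otimes> h) v = av g (av h v)"
  and av_free: "g:carrier G ==> si:S r ==> av g`si = si ==> g = \<one>"
  and S_fin: "EX R. finite R & R <= S r & (ALL si:S r. EX g:carrier G. EX rh:R. si = av g`rh)"
  and S_fill: "EX s>=r. ALL d<=n. ALL f. smap (bd d) (skel n (S r)) f -->
   sfills d (skel (Suc n) (S s)) f"
begin

section \<open>Invariant subcomplexes and representatives of orbits\<close>

definition SS :: "'v set set" where "SS = (UN r. S r)"
definition VS :: "'v set" where "VS = {v. {v}:SS}"

definition ginv :: "'v set set => bool" where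
 "ginv T \<longleftrightarrow> T <= SS & scomplex T & (ALL g:carrier G. ALL si:T. av g`si:T)"

definition rv :: "'a => ('v => real) => 'v => real" where
 "rv g u = (%v. if v:VS then u (av (inv g) v) else 0)"

lemma scomplex_SS: "scomplex SS"
 using scomplex_S unfolding scomplex_def SS_def by blast

lemma VS_sub: assumes "si:SS" shows "si <= VS"
proof
 fix v assume "v:si"
 hence "{v}:SS" by (intro scomplexD[OF scomplex_SS assms]) auto
 thus "v:VS" by (simp add: VS_def)
qed

lemma VS_S: "v:VS ==> EX r. {v}:S r"
 by (simp add: VS_def SS_def)

lemma av_VS: assumes "g:carrier G" "v:VS" shows "av g v:VS"
proof -
 obtain r where "{v}:S r" using VS_S[OF assms(2)] by blast
 from av_S[OF assms(1) this] show ?thesis by (auto simp: VS_def SS_def)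
qed

lemma av_1: "v:VS ==> av \<one> v = v"
 using VS_S av_one by blast

lemma av_m: "g:carrier G ==> h:carrier G ==> v:VS ==> av (g \<otimes> h) v = av g (av h v)"
 using VS_S av_mult by blast

lemma av_inv: assumes "g:carrier G" "v:VS" shows "av g (av (inv g) v) = v" "av (inv g) (av g v) = v"
 using av_m[of g "inv g" v] av_m[of "inv g" g v] assms av_1 by simp_all

lemma av_inj: "g:carrier G ==> inj_on (av g) VS"
 by (rule inj_on_inverseI[of _ "av (inv g)"]) (rule av_inv)

lemma av_inv_image: assumes "g:carrier G" "si <= VS" shows "av g`av (inv g)`si = si" "av (inv g)`av g`si = si"
 using av_inv[OF assms(1)] assms(2) by (force simp: image_image)+

lemma spt_rv: assumes g: "g:carrier G" and u: "spt u <= VS" shows "spt (rv g u) = av g`spt u"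
proof (intro equalityI subsetI)
 fix v assume "v:spt (rv g u)"
 hence v: "v:VS" "av (inv g) v:spt u" by (auto simp: spt_def rv_def split: if_splits)
 thus "v:av g`spt u" using av_inv(1)[OF g v(1)] by (metis imageI)
next
 fix v assume "v:av g`spt u"
 then obtain w where w: "w:spt u" "v = av g w" by blast
 thus "v:spt (rv g u)" using av_inv(2)[OF g, of w] av_VS[OF g, of w] u by (auto simp: spt_def rv_def)
qed

lemma rv_av: "g:carrier G ==> v:VS ==> rv g u (av g v) = u v"
 using av_VS av_inv(2) by (simp add: rv_def)

lemma rv_mult: "g:carrier G ==> h:carrier G ==> rv (g \<otimes> h) u = rv g (rv h u)"
 using av_m[of "inv h" "inv g"] av_VS[of "inv g"] by (auto simp: rv_def fun_eq_iff inv_mult_group)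

lemma rv_one: assumes "spt u <= VS" shows "rv \<one> u = u"
proof
 fix v show "rv \<one> u v = u v" using assms av_1[of v] by (cases "v:VS") (auto simp: rv_def spt_def)
qed

lemma rv_inv: "g:carrier G ==> spt u <= VS ==> rv g (rv (inv g) u) = u" "g:carrier G ==> spt u <= VS ==> rv (inv g) (rv g u) = u"
 using rv_mult[of g "inv g" u] rv_mult[of "inv g" g u] rv_one[of u] by simp_all

lemma ginvD: assumes "ginv T" shows "scomplex T" "g:carrier G ==> si:T ==> av g`si:T" "si:T ==> si:SS"
 using assms by (auto simp: ginv_def)

lemma realiz_VS: "ginv T ==> u:realiz T ==> spt u <= VS"
 using VS_sub ginvD(3) by (auto simp: realiz_def)

lemma rv_realiz: assumes T: "ginv T" and g: "g:carrier G" and u: "u:realiz T" shows "rv g u:realiz T"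
proof -
 have V: "spt u <= VS" by (rule realiz_VS[OF T u])
 have i: "inj_on (av g) (spt u)" using av_inj[OF g] V by (rule inj_on_subset)
 have "sum (rv g u) (av g`spt u) = sum u (spt u)"
  unfolding sum.reindex[OF i] using rv_av[OF g] V by (intro sum.cong) auto
 thus ?thesis using u ginvD(2)[OF T g] by (simp add: realiz_def spt_rv[OF g V]) (simp add: rv_def)
qed

lemma rv_continuous: "continuous_on K f ==> continuous_on K (%k. rv g (f k))"
proof (rule continuous_on_pointwise)
 fix v assume f: "continuous_on K f"
 show "continuous_on K (%k. rv g (f k) v)"
  using continuous_on_coord'[OF f] by (cases "v:VS") (simp_all add: rv_def)
qed

lemma smap_rv: assumes T: "ginv T" and g: "g:carrier G" and f: "smap K T f" shows "smap K T (%k. rv g (f k))"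
 unfolding smap_def
proof (intro conjI)
 have fr: "f k:realiz T" if "k:K" for k using f that by (auto simp: smap_def)
 show "continuous_on K (%k. rv g (f k))" using f by (intro rv_continuous) (simp add: smap_def)
 show "(%k. rv g (f k))`K <= realiz T" using rv_realiz[OF T g] fr by blast
 have "(UN k:K. spt (rv g (f k))) = av g`(UN k:K. spt (f k))"
  using spt_rv[OF g realiz_VS[OF T fr]] by auto
 thus "finite (UN k:K. spt (rv g (f k)))" using f by (simp add: smap_def)
qed

lemma eta_rv:
 assumes g: "g:carrier G" and e: "e`{..n} <= VS" shows "eta n (%i. av g (e i)) x = rv g (eta n e x)"
proof
 fix v
 have "(av g (e i) = v) = (e i = av (inv g) v)" if "v:VS" "i <= n" for i
  using av_inv[OF g, of v] av_inv[OF g, of "e i"] that e by auto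
 thus "eta n (%i. av g (e i)) x v = rv g (eta n e x) v"
 proof (cases "v:VS")
  case False
  hence "av g (e i) ~= v" if "i <= n" for i using av_VS[OF g, of "e i"] e that by auto
  thus ?thesis using False by (simp add: rv_def eta_def)
 next
  case True
  thus ?thesis using \<open>!!i. v : VS ==> i <= n ==> (av g (e i) = v) = (e i = av (inv g) v)\<close>
   by (simp add: rv_def eta_def)
 qed
qed

definition orb :: "'v set => 'v set set" where "orb si = (%g. av g`si)`carrier G"
text \<open>The choice is made from the set \<open>orb si\<close>, so it depends on the orbit only
  and each orbit has one representative.\<close>

definition rep :: "'v set => 'v set" where "rep si = (SOME rh. rh:orb si)"

lemma rep_orb: "EX g:carrier G. rep si = av g`si"
proof -
 have "av \<one>`si:orb si" by (auto simp: orb_def)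
 hence "rep si:orb si" unfolding rep_def by (rule someI)
 thus ?thesis by (auto simp: orb_def)
qed

lemma rep_ex: assumes "si:SS" shows "EX g:carrier G. si = av g`rep si"
proof -
 obtain g where g: "g:carrier G" "rep si = av g`si" using rep_orb by blast
 thus ?thesis using av_inv_image(2)[OF g(1) VS_sub[OF assms]] by (intro bexI[of _ "inv g"]) simp_all
qed

lemma av_image_mult: "g:carrier G ==> h:carrier G ==> si <= VS ==> av (g \<otimes> h)`si = av g`av h`si"
 using av_m by (auto simp: image_image intro!: image_cong)

lemma rep_av: assumes s: "si:SS" and g: "g:carrier G" shows "rep (av g`si) = rep si"
proof -
 have V: "si <= VS" by (rule VS_sub[OF s])
 have "orb (av g`si) = orb si"
 proof (intro equalityI subsetI)
  fix ta assume "ta:orb (av g`si)"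
  then obtain h where "h:carrier G" "ta = av h`av g`si" by (auto simp: orb_def)
  thus "ta:orb si" using av_image_mult[OF _ g V, of h] g unfolding orb_def by (intro image_eqI[of _ _ "h \<otimes> g"]) auto
 next
  fix ta assume "ta:orb si"
  then obtain h where h: "h:carrier G" "ta = av h`si" by (auto simp: orb_def)
  have "av (h \<otimes> inv g)`av g`si = av (h \<otimes> inv g \<otimes> g)`si"
   by (rule av_image_mult[symmetric]) (use h g V in auto)
  also have "\<dots> = ta" using h g by (simp add: m_assoc)
  finally show "ta:orb (av g`si)" using h g unfolding orb_def by (intro image_eqI[of _ _ "h \<otimes> inv g"]) auto
 qed
 thus ?thesis by (simp add: rep_def)
qed

lemma rep_rep: "si:SS ==> rep (rep si) = rep si"
 using rep_orb[of si] rep_av[of si] by auto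

lemma rep_in: "ginv T ==> si:T ==> rep si:T"
 using rep_orb[of si] ginvD(2) by auto

lemma ginv_S: "ginv (S r)"
 using scomplex_S av_S by (auto simp: ginv_def SS_def)

lemma ginv_SS: "ginv SS"
 using scomplex_SS av_S by (auto simp: ginv_def SS_def)

lemma ginv_skel: assumes "ginv T" shows "ginv (skel n T)"
 unfolding ginv_def
proof (intro conjI ballI)
 show "skel n T <= SS" using assms by (auto simp: skel_def ginv_def)
 show "scomplex (skel n T)" by (rule scomplex_skel[OF ginvD(1)[OF assms]])
 fix g si assume g: "g:carrier G" and s: "si:skel n T"
 hence "finite si" using ginvD(1)[OF assms] by (auto simp: skel_def scomplex_def)
 hence "card (av g`si) <= card si" by (rule card_image_le)
 thus "av g`si:skel n T" using s ginvD(2)[OF assms g] by (auto simp: skel_def)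
qed

lemma ginv_Un: assumes "ginv T" "ginv T'" shows "ginv (T Un T')"
 unfolding ginv_def
proof (intro conjI ballI)
 show "T Un T' <= SS" using assms by (simp add: ginv_def)
 show "scomplex (T Un T')"
  unfolding scomplex_def
 proof (intro ballI conjI allI impI)
  fix si assume s: "si:T Un T'"
  hence s': "si:SS" using assms ginvD(3) by (elim UnE)
  show "finite si" "si ~= {}" using s' scomplex_SS[unfolded scomplex_def] by simp_all
  fix ta assume "ta <= si" "ta ~= {}"
  thus "ta:T Un T'"
   using s scomplexD[OF ginvD(1)[OF assms(1)], of si ta] scomplexD[OF ginvD(1)[OF assms(2)], of si ta] by (elim UnE) simp_all
 qed
 fix g si assume "g:carrier G" "si:T Un T'"
 thus "av g`si:T Un T'" using ginvD(2)[OF assms(1)] ginvD(2)[OF assms(2)] by (elim UnE) simp_all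
qed

lemma finite_reps: "finite {rh:S r. rep rh = rh}"
proof -
 obtain R where R: "finite R" "R <= S r" "ALL si:S r. EX g:carrier G. EX rh:R. si = av g`rh" using S_fin[of r] by (elim exE conjE)
 have "{rh:S r. rep rh = rh} <= rep`R"
 proof
  fix si assume "si:{rh:S r. rep rh = rh}"
  hence s: "si:S r" "rep si = si" by auto
  from bspec[OF R(3) s(1)] obtain g rh where g: "g:carrier G" "rh:R" "si = av g`rh" by (elim bexE)
  have "rh:SS" using R(2) g(2) by (auto simp: SS_def)
  from rep_av[OF this g(1)] show "si:rep`R" using g s(2) by (metis imageI)
 qed
 thus ?thesis using R(1) by (meson finite_imageI finite_subset)
qed

text \<open>An equivariant map is prescribed on one simplex of each new orbit and translated.
  Freeness makes the translating element unique, so agreement on the boundary is the only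
  compatibility to be checked.\<close>

lemma ext_beta:
 assumes T0: "ginv T0" and T: "ginv T" and TT: "T0 <= T"
  and e: "!!si. si:T - T0 ==> bij_betw (e si) {..n} si"
  and faces: "!!si ta. si:T - T0 ==> ta \<subset> si ==> ta ~= {} ==> ta:T0"
  and wf: "gwf a J"
  and b: "bmap (aG a) (cel J) T0 bt" and be: "!!g u. g:carrier G ==> u:realiz T0 ==> bt (rv g u) = gx g (bt u)"
  and F: "!!rh. rh:T - T0 ==> rep rh = rh ==> gmap (cb n) a J (F rh)"
  and Fb: "!!rh x. rh:T - T0 ==> rep rh = rh ==> x:bd n ==> F rh x = bt (eta n (e rh) x)"
 shows "EX bt'. (ALL u:realiz T0. bt' u = bt u) &
  (ALL rh:T - T0. rep rh = rh --> (ALL x:cb n. bt' (eta n (e rh) x) = F rh x)) &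
  bmap (aG a) (cel J) T bt' & (ALL g:carrier G. ALL u:realiz T. bt' (rv g u) = gx g (bt' u))"
proof -
 \<comment> \<open>The address of a point outside \<open>T0\<close>: translating element,
   representative simplex, and position in the open cube.\<close>
 define ok where "ok = (%u (g, rh, x). g:carrier G & rh:T - T0 & rep rh = rh & x:op n & u = rv g (eta n (e rh) x))"
 define bt' where "bt' = (%u. if u:realiz T0 then bt u else (case SOME z. ok u z of (g, rh, x) => gx g (F rh x)))"
 have TV: "rh <= VS" if "rh:T" for rh by (rule VS_sub[OF ginvD(3)[OF T that]])
 have inj: "inj_on (e rh) {..n}" and im: "e rh`{..n} = rh" if "rh:T - T0" for rh
  using e[OF that] by (auto simp: bij_betw_def)
 have smT: "smap (cb n) T (eta n (e rh))" if "rh:T - T0" for rh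
  by (rule smap_eta[OF e[OF that] ginvD(1)[OF T]]) (use that in simp)
 have etaT: "eta n (e rh) x:realiz T" if "rh:T - T0" "x:cb n" for rh x
  using smT[OF that(1)] that(2) by (auto simp: smap_def)
 have etaT0: "eta n (e rh) x:realiz T0" if "rh:T - T0" "x:bd n" for rh x
  using smap_eta_bd[OF e[OF that(1)] faces[OF that(1)]] that(2) by (auto simp: smap_def)
 have spt_op: "spt (eta n (e rh) x) = rh" if "rh:T - T0" "x:op n" for rh x
  using spt_eta_op[OF inj[OF that(1)] that(2)] im[OF that(1)] by simp
 have ok_spt: "spt u = av g`rh" if "ok u (g, rh, x)" for u g rh x
 proof -
  have o: "g:carrier G" "rh:T - T0" "x:op n" "u = rv g (eta n (e rh) x)" using that by (auto simp: ok_def)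
  have "spt (eta n (e rh) x) = rh" by (rule spt_op[OF o(2,3)])
  thus ?thesis using spt_rv[OF o(1), of "eta n (e rh) x"] TV[of rh] o by simp
 qed
 have ok_ex: "EX z. ok u z" if u: "u:realiz T" "u ~: realiz T0" for u
 proof -
  define si where "si = spt u"
  have s: "si:T" "si ~: T0" using u by (auto simp: realiz_def si_def)
  obtain g where g: "g:carrier G" "si = av g`rep si" using rep_ex[OF ginvD(3)[OF T s(1)]] by blast
  have r: "rep si:T" "rep si ~: T0" using rep_in[OF T s(1)] ginvD(2)[OF T0 g(1), of "rep si"] g(2) s(2) by auto
  have uV: "spt u <= VS" by (rule realiz_VS[OF T u(1)])
  define u' where "u' = rv (inv g) u"
  have u': "u':realiz T" unfolding u'_def by (rule rv_realiz[OF T _ u(1)]) (use g in simp)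
  have "spt u' = av (inv g)`si" unfolding u'_def si_def by (rule spt_rv[OF _ uV]) (use g in simp)
  also have "\<dots> = av (inv g)`av g`rep si" using g(2) by simp
  also have "\<dots> = rep si" by (rule av_inv_image(2)[OF g(1) TV[OF r(1)]])
  finally have "spt u' = rep si" .
  moreover have rd: "rep si:T - T0" using r by simp
  ultimately obtain x where x: "x:op n" "eta n (e (rep si)) x = u'" using eta_surj[OF e[OF rd] u'] by blast
  have "u = rv g (eta n (e (rep si)) x)" unfolding x(2) u'_def by (rule rv_inv(1)[OF g(1) uV, symmetric])
  thus ?thesis
   using g(1) rd x(1) rep_rep[OF ginvD(3)[OF T s(1)]] by (intro exI[of _ "(g, rep si, x)"]) (simp add: ok_def)
 qed
 have ok_uniq: "g = g' & rh = rh' & x = x'" if o: "ok u (g, rh, x)" "ok u (g', rh', x')" for u g g' rh rh' x x'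
 proof -
  have o1: "g:carrier G" "rh:T - T0" "rep rh = rh" "x:op n" "u = rv g (eta n (e rh) x)"
   and o2: "g':carrier G" "rh':T - T0" "rep rh' = rh'" "x':op n" "u = rv g' (eta n (e rh') x')"
   using o by (auto simp: ok_def)
  have rT: "rh:T" "rh':T" using o1 o2 by auto
  have eq: "av g`rh = av g'`rh'" using ok_spt[OF o(1)] ok_spt[OF o(2)] by simp
  have rr: "rh = rh'" using rep_av[OF ginvD(3)[OF T rT(1)] o1(1)] rep_av[OF ginvD(3)[OF T rT(2)] o2(1)] eq o1(3) o2(3) by simp
  have "av (inv g' \<otimes> g)`rh = av (inv g')`av g`rh" by (rule av_image_mult) (use o1 o2 TV[OF rT(1)] in auto)
  also have "\<dots> = rh" using av_inv_image(2)[OF o2(1) TV[OF rT(2)]] eq rr by simp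
  finally have fx: "av (inv g' \<otimes> g)`rh = rh" .
  obtain r where "rh:S r" using ginvD(3)[OF T rT(1)] by (auto simp: SS_def)
  from av_free[OF _ this fx] have "inv g' \<otimes> g = \<one>" using o1 o2 by simp
  hence gg: "g = g'" using o1(1) o2(1) by (metis inv_closed inv_equality inv_inv)
  have V: "spt (eta n (e rh) y) <= VS" if "y:op n" for y using spt_op[OF o1(2) that] TV[OF rT(1)] by simp
  have "rv (inv g) (rv g (eta n (e rh) x)) = rv (inv g) (rv g (eta n (e rh) x'))"
   using o1(5) o2(5) gg rr by simp
  hence "eta n (e rh) x = eta n (e rh) x'" using rv_inv(2)[OF o1(1) V] o1(4) o2(4) by simp
  thus ?thesis using eta_inj[OF inj[OF o1(2)] o1(4) o2(4)] gg rr by simp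
 qed
 have ok_T0: "u ~: realiz T0" if o: "ok u (g, rh, x)" for u g rh x
 proof
  assume "u:realiz T0"
  hence a: "av g`rh:T0" using ok_spt[OF o] by (auto simp: realiz_def)
  have r: "g:carrier G" "rh:T" "rh ~: T0" using o by (auto simp: ok_def)
  have "av (inv g)`av g`rh:T0" by (rule ginvD(2)[OF T0 _ a]) (use r in simp)
  thus False using av_inv_image(2)[OF r(1) TV[OF r(2)]] r(3) by simp
 qed
 have val: "bt' u = gx g (F rh x)" if o: "ok u (g, rh, x)" for u g rh x
 proof -
  have "(SOME z. ok u z) = (g, rh, x)"
  proof (rule some_equality[of "ok u", OF o])
   fix z assume "ok u z"
   thus "z = (g, rh, x)" using ok_uniq[OF o, of "fst z" "fst (snd z)" "snd (snd z)"] by (simp add: prod_eq_iff)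
  qed
  thus ?thesis using ok_T0[OF o] by (simp add: bt'_def)
 qed
 have P1: "bt' u = bt u" if "u:realiz T0" for u using that by (simp add: bt'_def)
 have P2: "bt' (eta n (e rh) x) = F rh x" if r: "rh:T - T0" "rep rh = rh" and x: "x:cb n" for rh x
  using op_bd[OF x]
 proof
  assume xo: "x:op n"
  have "ok (eta n (e rh) x) (\<one>, rh, x)"
   using r xo rv_one[OF realiz_VS[OF T etaT[OF r(1) x]]] by (simp add: ok_def)
  from val[OF this] show ?thesis using gx_one_pts[OF wf cmap_in[OF F[OF r] x]] by simp
 next
  assume xb: "x:bd n"
  thus ?thesis using P1[OF etaT0[OF r(1) xb]] Fb[OF r xb] by simp
 qed
 have P4: "bt' (rv g u) = gx g (bt' u)" if g: "g:carrier G" and u: "u:realiz T" for g u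
 proof (cases "u:realiz T0")
  case True
  thus ?thesis using P1[OF True] P1[OF rv_realiz[OF T0 g True]] be[OF g True] by simp
 next
  case False
  obtain z where z: "ok u z" using ok_ex[OF u False] by blast
  obtain h rh x where hz: "z = (h, rh, x)" by (metis prod_cases3)
  have o: "ok u (h, rh, x)" using z hz by simp
  hence h: "h:carrier G" by (simp add: ok_def)
  have "ok (rv g u) (g \<otimes> h, rh, x)" using o g rv_mult[OF g h] by (auto simp: ok_def)
  thus ?thesis using val[OF o] val[of "rv g u" "g \<otimes> h" rh x] gx_mult[OF g h] by simp
 qed
 have "bmap (aG a) (cel J) T bt'"
  unfolding bmap_def
 proof
  fix si assume s: "si:T"
  show "EX n e. bij_betw e {..n} si & gmap (cb n) a J (%x. bt' (eta n e x))"
  proof (cases "si:T0")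
   case True
   then obtain m e' where m: "bij_betw e' {..m} si" "gmap (cb m) a J (%x. bt (eta m e' x))"
    using b unfolding bmap_def by blast
   have "eta m e' x:realiz T0" if "x:cb m" for x
    using smap_eta[OF m(1) ginvD(1)[OF T0] True] that by (auto simp: smap_def)
   hence "gmap (cb m) a J (%x. bt' (eta m e' x))"
    using m(2) P1 by (subst cmap_cong[where g = "%x. bt (eta m e' x)"]) simp_all
   thus ?thesis using m(1) by blast
  next
   case False
   obtain g where g: "g:carrier G" "si = av g`rep si" using rep_ex[OF ginvD(3)[OF T s]] by blast
   define rh where "rh = rep si"
   have r: "rh:T - T0" "rep rh = rh"
    using rep_in[OF T s] ginvD(2)[OF T0 g(1), of "rep si"] g(2) False rep_rep[OF ginvD(3)[OF T s]] by (auto simp: rh_def)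
   have rV: "rh <= VS" using TV r by blast
   have sg: "si = av g`rh" using g(2) by (simp add: rh_def)
   have "bij_betw (%i. av g (e rh i)) {..n} si"
    unfolding bij_betw_def
   proof
    show "inj_on (%i. av g (e rh i)) {..n}"
     using comp_inj_on[OF inj[OF r(1)], of "av g"] inj_on_subset[OF av_inj[OF g(1)] rV] im[OF r(1)] by (simp add: o_def)
    show "(%i. av g (e rh i))`{..n} = si" using im[OF r(1)] sg by (simp add: image_image[symmetric])
   qed
   moreover have "gmap (cb n) a J (%x. bt' (eta n (%i. av g (e rh i)) x))"
   proof (subst cmap_cong[where g = "%x. gx g (F rh x)"])
    show "gmap (cb n) a J (%x. gx g (F rh x))" by (rule cmap_gx[OF g(1) F[OF r]])
    fix x assume x: "x:cb n"
    have "eta n (%i. av g (e rh i)) x = rv g (eta n (e rh) x)" by (rule eta_rv[OF g(1)]) (use im[OF r(1)] rV in simp)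
    thus "bt' (eta n (%i. av g (e rh i)) x) = gx g (F rh x)"
     using P4[OF g(1) etaT[OF r(1) x]] P2[OF r x] by simp
   qed
   ultimately show ?thesis by blast
  qed
 qed
 thus ?thesis using P1 P2 P4 by (intro exI[of _ bt']) simp
qed

end

section \<open>Gluing of maps from cubes and their boundaries\<close>

lemma Hausdorff_fun_real: "Hausdorff_space (euclidean :: (('e => real) \<times> real) topology)"
 unfolding prod_topology_euclidean[symmetric] Hausdorff_space_prod_topology using Hausdorff_fun by simp

lemma bmap_mono: "bmap a D T bt ==> D <= D' ==> (!!c. c:D ==> a c = a' c) ==> bmap a' D' T bt"
 unfolding bmap_def using cmap_cong_at[of D a a'] cmap_mono[of _ a' D _ D'] by (intro ballI) (drule (1) bspec, blast)

lemma compact_bd: "compact (bd n)"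
proof -
 have "bd n = cb n Int {x:cb n. 1 <= nrm n x}" by (auto simp: mem_bd_iff mem_cb_iff)
 moreover have "closed {x:cb n. 1 <= nrm n x}"
  by (rule continuous_on_closed_Collect_le[OF continuous_on_const _ compact_imp_closed[OF compact_cb]])
   (intro continuous_on_nrm continuous_on_id)
 ultimately show ?thesis using compact_Int_closed[OF compact_cb] by metis
qed

lemma cmap_collar:
 assumes H: "cmap (cyl (bd n)) a D H" and F: "cmap (cb n) a D F" and HF: "!!x. x:bd n ==> H (x, 1) = F x"
 shows "EX f. cmap (cb n) a D f & (ALL x:bd n. f x = H (x, 0))"
proof -
 obtain A where A: "finite A" "A <= D" "!!k. k:cyl (bd n) ==> H k:pts a A" using H by (rule cmapE) (rule that; blast)
 obtain B where B: "finite B" "B <= D" "!!k. k:cb n ==> F k:pts a B" using F by (rule cmapE) (rule that; blast)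
 have "EX f. continuous_map (top_of_set (cb n)) euclidean f & (ALL x:bd n. f x = H (x, 0)) &
  f`cb n <= F`cb n Un H`cyl (bd n)"
  by (rule collar[where F = F and H = H]) (use H F HF in \<open>simp_all add: cmap_def\<close>)
 then obtain f where f: "continuous_on (cb n) f" "ALL x:bd n. f x = H (x, 0)" "f`cb n <= F`cb n Un H`cyl (bd n)" by auto
 have "cmap (cb n) a D f"
 proof (rule cmapI[OF f(1), of "A Un B"])
  fix k assume "k:cb n"
  hence "f k:F`cb n Un H`cyl (bd n)" using f(3) by blast
  moreover have "F`cb n <= pts a B" "H`cyl (bd n) <= pts a A" using A(3) B(3) by blast+
  ultimately show "f k:pts a (A Un B)" unfolding pts_Un by blast
 qed (use A B in auto)
 thus ?thesis using f(2) by blast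
qed

lemma cb_drop: "x:cb (Suc n) ==> x(n := 0):cb n"
 by (auto simp: cb_def)

lemma cb_put: "x:cb n ==> 0 <= t ==> t <= 1 ==> x(n := t):cb (Suc n)"
 by (auto simp: cb_def less_Suc_eq)

lemma cb_0n: "x:cb n ==> x n = 0"
 by (simp add: cb_def)

lemma bd_Suc_iff: "x:bd (Suc n) \<longleftrightarrow> x:cb (Suc n) & (x n = 0 | x n = 1 | x(n := 0):bd n)"
 using cb_drop[of x n] by (auto simp: bd_def less_Suc_eq)

text \<open>The boundary of the cube of dimension \<open>Suc n\<close> is the union of the bottom,
  the top and the sides over \<open>bd n\<close>, three closed pieces.\<close>

lemma cmap_box:
 assumes P: "cmap (cb n) a D P0" "cmap (cb n) a D P1" "cmap (cyl (bd n)) a D Q"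
  and F: "!!x. x:cb n ==> F x = P0 x & F (x(n := 1)) = P1 x" "!!x t. x:bd n ==> t:{0..1} ==> F (x(n := t)) = Q (x, t)"
 shows "cmap (bd (Suc n)) a D F"
proof -
 define d where "d = (%x::rseq. x(n := 0))"
 have dc: "continuous_on X d" for X unfolding d_def by (intro ctn)
 have upd: "(d x)(n := x n) = x" for x by (simp add: d_def)
 define A where "A i = cb (Suc n) Int (%x. x n) -` {i}" for i
 define B where "B = cb (Suc n) Int d -` bd n"
 have cl: "closed (A i)" "closed B" for i unfolding A_def B_def
  using compact_imp_closed[OF compact_cb] compact_imp_closed[OF compact_bd]
  by (intro continuous_closed_preimage continuous_on_coord dc closed_singleton; assumption?; simp)+
 have dA: "d x:cb n" if "x:A i" for x i using cb_drop[of x n] that by (simp add: A_def d_def)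
 hence dA': "d`A i <= cb n" for i by blast
 have "F x = P0 (d x)" if x: "x:A 0" for x
 proof -
  have "d x = x" using x by (auto simp: A_def d_def intro: fun_upd_idem)
  thus ?thesis using F(1)[OF dA[OF x]] by simp
 qed
 hence "cmap (A 0) a D F" by (rule cmap_cong[THEN iffD2, OF _ cmap_compose[OF P(1) dc dA']])
 moreover have "F x = P1 (d x)" if x: "x:A 1" for x
 proof -
  have "(d x)(n := 1) = x" using x upd[of x] by (simp add: A_def)
  thus ?thesis using F(1)[OF dA[OF x]] by simp
 qed
 hence "cmap (A 1) a D F" by (rule cmap_cong[THEN iffD2, OF _ cmap_compose[OF P(2) dc dA']])
 moreover have B: "(d x, x n):cyl (bd n)" if "x:B" for x using cb_range[of x "Suc n" n] that by (auto simp: B_def)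
 have "cmap B a D F"
 proof (rule cmap_cong[THEN iffD2, OF _ cmap_compose[OF P(3), of B "%x. (d x, x n)"]])
  show "F x = Q (d x, x n)" if "x:B" for x using F(2)[of "d x" "x n"] B[OF that] upd[of x] by simp
 qed (use B in \<open>auto intro!: continuous_on_Pair dc continuous_on_coord\<close>)
 ultimately have "cmap (A 0 Un A 1 Un B) a D F" by (intro cmap_Un closed_Un cl)
 moreover have "bd (Suc n) = A 0 Un A 1 Un B" unfolding A_def B_def d_def by (auto simp: bd_Suc_iff)
 ultimately show ?thesis by simp
qed

lemma cube_concat_arg: "0 < n ==> x:cb n ==> x 0 <= 1/2 ==> x(0 := 2 * x 0):cb n" "0 < n ==> x:cb n ==> 1/2 <= x 0 ==> x(0 := 2 * x 0 - 1):cb n"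
 by (auto simp: cb_def)

lemma cmap_concat:
 assumes h: "cmap (cb n) a D h" and k: "cmap (cb n) a D k" and n: "0 < n"
  and mid: "!!x. x:cb n ==> h (x(0 := 1)) = k (x(0 := 0))"
 shows "cmap (cb n) a D (cube_concat h k)"
proof -
 define A where "A = cb n Int (%x. x 0) -` {..1/2}"
 define B where "B = cb n Int (%x. x 0) -` {1/2..}"
 have cl: "closed A" "closed B" unfolding A_def B_def
  by (rule continuous_closed_preimage[OF continuous_on_coord compact_imp_closed[OF compact_cb]]; simp)+
 have "cmap A a D (cube_concat h k)"
 proof (rule cmap_cong[THEN iffD2, OF _ cmap_compose[OF h, of A "%x. x(0 := 2 * x 0)"]])
  show "continuous_on A (%x. x(0 := 2 * x 0))"
   by (intro ctn)
 qed (use cube_concat_arg[OF n] in \<open>auto simp: A_def cube_concat_def\<close>)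
 moreover have "cmap B a D (cube_concat h k)"
 proof (rule cmap_cong[THEN iffD2, OF _ cmap_compose[OF k, of B "%x. x(0 := 2 * x 0 - 1)"]])
  show "continuous_on B (%x. x(0 := 2 * x 0 - 1))"
   by (intro ctn)
  show "(%x. x(0 := 2 * x 0 - 1))`B <= cb n" using cube_concat_arg[OF n] by (auto simp: B_def)
  fix x assume "x:B"
  hence x: "x:cb n" "1/2 <= x 0" by (auto simp: B_def)
  have "h (x(0 := 2 * x 0)) = k (x(0 := 2 * x 0 - 1))" if "x 0 <= 1/2"
  proof -
   have "2 * x 0 = 1" "2 * x 0 - 1 = 0" using that x(2) by linarith+
   thus ?thesis using mid[OF x(1)] by (simp only:)
  qed
  thus "cube_concat h k x = k (x(0 := 2 * x 0 - 1))" unfolding cube_concat_def by (simp only: split: if_split) blast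
 qed
 ultimately have "cmap (A Un B) a D (cube_concat h k)" by (rule cmap_Un[OF cl])
 moreover have "A Un B = cb n" by (auto simp: A_def B_def)
 ultimately show ?thesis by simp
qed

text \<open>Indices of the orbits of cells of dimension below \<open>n\<close>, with
  \<open>N p\<close> orbits in dimension \<open>p\<close>.\<close>

definition JJ :: "(nat => nat) => nat => (nat \<times> nat) set" where
 "JJ N n = {(p, i). p < n & i < N p}"

lemma JJ_iff: "j:JJ N n \<longleftrightarrow> fst j < n & snd j < N (fst j)"
 by (cases j) (simp add: JJ_def)

lemma JJ_mono: "n <= m ==> JJ N n <= JJ N m"
 by (auto simp: JJ_iff)

lemma JJ_below: "j:JJ N n ==> {i:JJ N n. fst i < fst j} = JJ N (fst j)"
 by (auto simp: JJ_iff)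

lemma JJ_cong: "(!!p. p < n ==> N p = N' p) ==> JJ N n = JJ N' n"
 by (auto simp: JJ_iff)

section \<open>Equivariant maps and homotopies between cell complexes and realizations\<close>

context brown
begin

definition alp :: "(nat \<times> nat => rseq => 'a pt) => (nat \<times> nat) set => 'v set set => ('a pt => 'v => real) => bool" where
 "alp a J T ap \<longleftrightarrow> (ALL j:J. smap (cb (fst j)) T (%x. ap (ch1 a j x))) &
  (ALL g:carrier G. ALL u:gpts a J. ap (gx g u) = rv g (ap u))"

text \<open>An equivariant homotopy from the inclusion of \<open>J\<close> to \<open>fi\<close> that
  moves through the larger complex \<open>J'\<close>.\<close>

definition hom :: "(nat \<times> nat => rseq => 'a pt) => (nat \<times> nat) set => (nat \<times> nat) set =>
  ('a pt => real => 'a pt) => ('a pt => 'a pt) => bool" where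
 "hom a J J' H fi \<longleftrightarrow>
  (ALL j:J. gmap (cyl (cb (fst j))) a J' (%z. H (ch1 a j (fst z)) (snd z))) &
  (ALL u:gpts a J. H u 0 = u & H u 1 = fi u) &
  (ALL g:carrier G. ALL u:gpts a J. ALL t. H (gx g u) t = gx g (H u t))"

lemma chm_one_in: "gwf a J ==> j:J ==> x:cb (fst j) ==> ch1 a j x:gpts a J"
 using cmap_in[OF cmap_chm[of "cel J" "aG a" "(\<one>, j)"]] by (simp add: cel_def)

lemma alp_cell:
 assumes al: "alp a J T ap" and T: "ginv T" and wf: "gwf a J" and c: "c:cel J"
 shows "smap (cb (dm c)) T (%x. ap (gch a c x))"
proof -
 obtain g j where gj: "c = (g, j)" "g:carrier G" "j:J" using c by (auto simp: cel_def)
 have "smap (cb (fst j)) T (%x. rv g (ap (ch1 a j x)))"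
  by (rule smap_rv[OF T gj(2)]) (use al gj(3) in \<open>simp add: alp_def\<close>)
 moreover have "ap (gch a (g, j) x) = rv g (ap (ch1 a j x))" if "x:cb (fst j)" for x
  using al gj(2) chm_one_in[OF wf gj(3) that] unfolding chm_gx1[OF gj(2)] alp_def by simp
 ultimately show ?thesis using smap_cong[of "cb (fst j)" "%x. ap (gch a (g, j) x)"] gj(1) by simp
qed

lemma alp_compose:
 fixes f :: "'k::t2_space => 'a pt"
 assumes al: "alp a J T ap" and T: "ginv T" and wf: "gwf a J" and f: "gmap K a J f" and K: "compact K"
 shows "smap K T (%k. ap (f k))"
 unfolding smap_def
proof (intro conjI)
 note ac = alp_cell[OF al T wf, unfolded smap_def]
 show "continuous_on K (%k. ap (f k))"
  by (rule cmap_continuous[OF wf K f]) (use ac in simp)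
 obtain F where F: "finite F" "F <= cel J" "!!k. k:K ==> f k:pts (aG a) F" using f by (rule cmapE) (rule that; blast)
 have fk: "EX c:F. ap (f k):(%x. ap (gch a c x))`cb (dm c)" if "k:K" for k
 proof -
  from F(3)[OF that] obtain c x where "c:F" "x:op (dm c)" "f k = gch a c x" by (rule ptsE)
  thus ?thesis by (auto simp: op_def)
 qed
 have "(%x. ap (gch a c x))`cb (dm c) <= realiz T" if "c:F" for c using ac F(2) that by blast
 thus "(%k. ap (f k))`K <= realiz T" using fk by blast
 have "(UN k:K. spt (ap (f k))) <= (UN c:F. UN x:cb (dm c). spt (ap (gch a c x)))"
 proof (rule UN_least)
  fix k assume "k:K"
  from fk[OF this] obtain c x where "c:F" "x:cb (dm c)" "ap (f k) = ap (gch a c x)" by blast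
  thus "spt (ap (f k)) <= (UN c:F. UN x:cb (dm c). spt (ap (gch a c x)))" by auto
 qed
 moreover have "finite (UN x:cb (dm c). spt (ap (gch a c x)))" if "c:F" for c using ac[of c] F(2) that by blast
 ultimately show "finite (UN k:K. spt (ap (f k)))" using F(1) by (meson finite_UN_I finite_subset)
qed

lemma alp_in:
 assumes "alp a J T ap" "ginv T" "gwf a J" "u:gpts a J" shows "ap u:realiz T"
proof -
 have "smap {0::real} T (%_. ap u)"
  by (rule alp_compose[OF assms(1-3) cmap_const[OF assms(4)]]) simp
 thus ?thesis by (simp add: smap_def)
qed

lemma hom_cell:
 assumes h: "hom a J J' H fi" and wf: "gwf a J" and c: "c:cel J"
 shows "gmap (cyl (cb (dm c))) a J' (%z. H (gch a c (fst z)) (snd z))"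
proof -
 obtain g j where gj: "c = (g, j)" "g:carrier G" "j:J" using c by (auto simp: cel_def)
 have "gmap (cyl (cb (fst j))) a J' (%z. gx g (H (ch1 a j (fst z)) (snd z)))"
  by (rule cmap_gx[OF gj(2)]) (use h gj(3) in \<open>simp add: hom_def\<close>)
 moreover have "H (gch a (g, j) (fst z)) (snd z) = gx g (H (ch1 a j (fst z)) (snd z))"
  if "z:cyl (cb (fst j))" for z
  using h gj(2) chm_one_in[OF wf gj(3), of "fst z"] that unfolding chm_gx1[OF gj(2)] hom_def by auto
 ultimately show ?thesis
  using cmap_cong[of "cyl (cb (fst j))" "%z. H (gch a (g, j) (fst z)) (snd z)"] gj(1) by simp
qed

lemma hom_compose:
 fixes f :: "'k::t2_space => 'a pt"
 assumes h: "hom a J J' H fi" and wf: "gwf a J" and f: "gmap K a J f" and K: "compact K"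
 shows "gmap (cyl K) a J' (%z. H (f (fst z)) (snd z))"
proof -
 obtain F where F: "continuous_on K f" "finite F" "F <= cel J" "!!k. k:K ==> f k:pts (aG a) F" using f by (rule cmapE) (rule that; blast)
 have "gmap (cyl K) a J' (%k. (%z. H (fst z) (snd z)) (f (fst k), snd k))"
 proof (rule quot_cmap[OF Hausdorff_fun_real F(2), where P = "%c. cyl (cb (dm c))" and p = "%c z. (gch a c (fst z), snd z)"])
  show "compact (cyl (cb (dm c)))" for c :: "'a cell" by (intro compact_Times compact_cb) simp
  show "compact (cyl K)" by (intro compact_Times K) simp
  show "continuous_on (cyl (cb (dm c))) (%z. (gch a c (fst z), snd z))" if "c:F" for c
  proof -
   have "continuous_on (cb (dm c)) (gch a c)" using cmap_chm[OF wf, of c] F(3) that by (auto simp: cmap_def)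
   hence "continuous_on (cyl (cb (dm c))) (%z. gch a c (fst z))"
    by (rule continuous_on_compose2[OF _ continuous_on_fst[OF continuous_on_id]]) auto
   thus ?thesis by (intro ctn)
  qed
  have "continuous_on (cyl K) (%z. f (fst z))"
   by (rule continuous_on_compose2[OF F(1) continuous_on_fst[OF continuous_on_id]]) auto
  thus "continuous_on (cyl K) (%z. (f (fst z), snd z))"
   by (intro ctn)
  show "(%z. (f (fst z), snd z))`(cyl K) <= (UN c:F. (%z. (gch a c (fst z), snd z))`cyl (cb (dm c)))"
  proof (rule image_subsetI)
   fix z assume z: "z:cyl K"
   hence "f (fst z):pts (aG a) F" by (intro F(4)) auto
   then obtain c x where "c:F" "x:op (dm c)" "f (fst z) = gch a c x" by (rule ptsE)
   thus "(f (fst z), snd z):(UN c:F. (%z. (gch a c (fst z), snd z))`cyl (cb (dm c)))"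
    using z by (intro UN_I[of c] image_eqI[of _ _ "(x, snd z)"]) (auto simp: op_def)
  qed
  show "gmap (cyl (cb (dm c))) a J' (%x. H (fst (gch a c (fst x), snd x)) (snd (gch a c (fst x), snd x)))"
   if "c:F" for c
   using hom_cell[OF h wf, of c] F(3) that by auto
 qed
 thus ?thesis by simp
qed

end

text \<open>The state before the cells of dimension \<open>n\<close> are attached: \<open>ap\<close>
  maps the complex to stage \<open>r\<close>, \<open>bt\<close> maps a skeleton of the whole
  filtration back, and \<open>H\<close> deforms the cells of dimension below \<open>n - 1\<close> to
  the round trip. \<open>H\<close> lags one dimension behind, because the prisms over the cells of
  dimension \<open>n - 1\<close> are among the cells to be attached next.\<close>

locale stage = brown G S av for G :: "('a, 'b) monoid_scheme" (structure) and S :: "nat => 'v set set" and av +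
 fixes n :: nat and N :: "nat => nat" and a :: "nat \<times> nat => rseq => 'a pt"
  and r :: nat and ap :: "'a pt => 'v => real" and bt :: "('v => real) => 'a pt" and H :: "'a pt => real => 'a pt" and s :: nat
 assumes at: "!!j. j:JJ N n ==> gmap (bd (fst j)) a (JJ N (fst j)) (a j)"
  and al: "alp a (JJ N n) (skel n (S r)) ap"
  and be: "bmap (aG a) (cel (JJ N n)) (skel n SS) bt"
  and be_eq: "!!g u. g:carrier G ==> u:realiz (skel n SS) ==> bt (rv g u) = gx g (bt u)"
  and ho: "hom a (JJ N (n - 1)) (JJ N n) H (%u. bt (ap u))"
  and rs: "r <= s"
  and fi: "!!d f. d <= n ==> smap (bd d) (skel n (S r)) f ==> sfills d (skel (Suc n) (S s)) f"
begin

abbreviation "J == JJ N n"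

text \<open>One simplex of dimension \<open>n\<close> from each orbit in stage \<open>s\<close>;
  each receives a new cell.\<close>

definition "R = {rh:S s. rep rh = rh & card rh = Suc n}"
definition "M = card R"
definition "b = (SOME b. bij_betw b {..<M} R)"
definition e :: "'v set => nat => 'v" where "e si = (SOME e. bij_betw e {..n} si)"
text \<open>The number of prisms, one for each orbit of cells of dimension
  \<open>n - 1\<close>.\<close>

definition "B = (if n = 0 then 0 else N (n - 1))"
definition "N' = N(n := M + B)"
definition "J' = JJ N' (Suc n)"
text \<open>Attaching map of the prism over cell \<open>i\<close> of dimension \<open>n - 1\<close>:
  the cell itself at the bottom, its image under the round trip at the top, and the homotopy
  constructed so far on the sides.\<close>

definition hb :: "nat => rseq => 'a pt" where
 "hb i x = (let u = ch1 a (n - 1, i) (x(n - 1 := 0)) in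
  if x (n - 1) = 0 then u else if x (n - 1) = 1 then bt (ap u) else H u (x (n - 1)))"
definition a' :: "nat \<times> nat => rseq => 'a pt" where
 "a' j x = (if fst j = n then (if snd j < M then bt (eta n (e (b (snd j))) x) else hb (snd j - M) x) else a j x)"

section \<open>Attaching the cells of dimension \<open>n\<close>\<close>

lemma finite_R: "finite R"
 by (rule finite_subset[OF _ finite_reps[of s]]) (auto simp: R_def)

lemma bij_b: "bij_betw b {..<M} R"
proof -
 have "EX b. bij_betw b {..<M} R" by (rule finite_same_card_bij) (simp_all add: finite_R M_def)
 thus ?thesis unfolding b_def by (rule someI_ex)
qed

lemma bij_e: assumes "card si = Suc n" shows "bij_betw (e si) {..n} si"
proof -
 have "finite si" using assms by (intro card_ge_0_finite) simp
 hence "EX e. bij_betw e {..n} si" using assms by (intro finite_same_card_bij) simp_all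
 thus ?thesis unfolding e_def by (rule someI_ex)
qed

lemma J'_iff: "j:J' \<longleftrightarrow> j:J | fst j = n & snd j < M + B"
 by (auto simp: J'_def JJ_iff N'_def less_Suc_eq)

lemma J_sub: "J <= J'"
 by (auto simp: J'_iff)

lemma JN': "p <= n ==> JJ N' p = JJ N p"
 by (rule JJ_cong) (simp add: N'_def)

lemma wfJ: "gwf a J"
 by (rule wf_aG) (simp add: JJ_below at)

lemma J_fst: "j:J ==> fst j ~= n"
 by (simp add: JJ_iff)

lemma aG_old: "c:cel J ==> aG a' c = aG a c"
proof -
 assume "c:cel J"
 hence "fst (snd c) ~= n" using J_fst[of "snd c"] by (auto simp: cel_def)
 hence "a' (snd c) = a (snd c)" by (simp add: a'_def fun_eq_iff)
 thus ?thesis by (intro ext) (simp add: aG_def)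
qed

lemma chm_old: "c:cel J ==> gch a' c = gch a c"
 by (rule chm_cong) (rule aG_old)

lemma pts_old: "D <= cel J ==> pts (aG a') D = pts (aG a) D"
 using aG_old by (intro pts_cong) blast

lemma cmap_old: "D <= cel J ==> cmap K (aG a') D f \<longleftrightarrow> cmap K (aG a) D f"
 using aG_old by (intro cmap_cong_at) blast

lemma wfJ': "gwf a' J"
proof (rule wf_aG)
 fix j assume j: "j:J"
 have "cel (JJ N (fst j)) <= cel J" using j by (intro cel_mono JJ_mono) (simp add: JJ_iff)
 moreover have "a' j = a j" using J_fst[OF j] by (simp add: a'_def fun_eq_iff)
 ultimately show "gmap (bd (fst j)) a' {i:J. fst i < fst j} (a' j)"
  using at[OF j] by (simp add: JJ_below[OF j] cmap_old)
qed

abbreviation "T0 == skel n SS"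

lemma gT0: "ginv T0" by (rule ginv_skel[OF ginv_SS])
lemma gr: "ginv (skel n (S r))" by (rule ginv_skel[OF ginv_S])

lemma S_SS: "S q <= SS" by (auto simp: SS_def)

lemma be_comp: "smap K T0 f ==> compact K ==> gmap K a J (%k. bt (f k))" for f :: "'k::t2_space => 'v => real"
 by (rule bmap_compose[OF be ginvD(1)[OF gT0]])

lemma al_comp: "gmap K a J f ==> compact K ==> smap K (skel n (S r)) (%k. ap (f k))" for f :: "'k::t2_space => 'a pt"
 by (rule alp_compose[OF al gr wfJ])

lemma al_T0: "u:gpts a J ==> ap u:realiz T0"
 using alp_in[OF al gr wfJ] realiz_mono[OF skel_mono[OF S_SS]] by blast

lemma al_eq: "g:carrier G ==> u:gpts a J ==> ap (gx g u) = rv g (ap u)"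
 using al by (simp add: alp_def)

lemma beal_eq: "g:carrier G ==> u:gpts a J ==> bt (ap (gx g u)) = gx g (bt (ap u))"
 using al_eq be_eq al_T0 by simp

lemma faces: assumes "si:SS" "card si = Suc n" "ta \<subset> si" "ta ~= {}" shows "ta:T0"
proof -
 have "finite si" using assms(2) by (intro card_ge_0_finite) simp
 hence "card ta < Suc n" using psubset_card_mono[OF _ assms(3)] assms(2) by simp
 moreover have "ta:SS" using scomplexD[OF scomplex_SS assms(1) _ assms(4)] assms(3) by blast
 ultimately show ?thesis by (simp add: skel_def)
qed

lemma smap_eta_T0: "si:SS ==> card si = Suc n ==> smap (bd n) T0 (eta n (e si))"
 using faces by (intro smap_eta_bd[OF bij_e])

lemma att_simplex:
 assumes "i < M" shows "gmap (bd n) a J (a' (n, i))"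
proof -
 have "b i:R" using bij_b assms by (auto simp: bij_betw_def)
 hence "b i:SS" "card (b i) = Suc n" using S_SS by (auto simp: R_def)
 from be_comp[OF smap_eta_T0[OF this] compact_bd]
 have "gmap (bd n) a J (%x. bt (eta n (e (b i)) x))" .
 moreover have "a' (n, i) = (%x. bt (eta n (e (b i)) x))" using assms by (simp add: a'_def fun_eq_iff)
 ultimately show ?thesis by simp
qed

lemma bd_chm_low:
 assumes n: "n = Suc n'" and i: "i < N n'" and x: "x:bd n'"
 shows "ch1 a (n', i) x:gpts a (JJ N n')"
proof -
 have j: "(n', i):J" using i n by (simp add: JJ_iff)
 hence "ch1 a (n', i) x = gx \<one> (a (n', i) x)"
  using chm_bd[OF wfJ, of "(\<one>, (n', i))" x] x by (simp add: cel_def aG_def)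
 moreover have "gmap (bd n') a (JJ N n') (a (n', i))" using at[OF j] by simp
 ultimately show ?thesis using gx_pts[OF one_closed cmap_in[OF _ x]] by simp
qed

lemma hb_Suc:
 assumes n: "n = Suc n'"
 shows "hb i x = (if x n' = 0 then ch1 a (n', i) (x(n' := 0))
  else if x n' = 1 then bt (ap (ch1 a (n', i) (x(n' := 0)))) else H (ch1 a (n', i) (x(n' := 0))) (x n'))"
proof -
 have n1: "n - 1 = n'" by (simp add: n)
 show ?thesis unfolding hb_def n1 Let_def by (rule refl)
qed

lemma B_Suc: assumes n: "n = Suc n'" shows "B = N n'"
 unfolding B_def using n by simp

lemma hb_bd:
 assumes n: "n = Suc n'" and i: "i < N n'" and x: "x:bd n'" and t: "0 <= t" "t <= 1"
 shows "hb i (x(n' := t)) = H (ch1 a (n', i) x) t"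
proof -
 have "x n' = 0" using x bd_subset[of n'] by (intro cb_0n) blast
 hence "x(n' := 0) = x" by (rule fun_upd_idem)
 moreover have n1: "n - 1 = n'" by (simp add: n)
 moreover have "hom a (JJ N n') J H (%u. bt (ap u))" using ho unfolding n1 .
 ultimately show ?thesis using bd_chm_low[OF n i x] unfolding hom_def by (auto simp: hb_Suc[OF n])
qed

lemma att_homotopy:
 assumes n: "n = Suc n'" and i: "i < N n'" shows "gmap (bd n) a J (hb i)"
proof -
 let ?c = "(\<one>, (n', i)) :: 'a cell"
 have c: "?c:cel J" using i n by (simp add: cel_def JJ_iff)
 note cc = cmap_chm[OF wfJ c, simplified]
 have n1: "n - 1 = n'" by (simp add: n)
 have sm: "smap (cb n') T0 (%x. ap (gch a ?c x))"
  by (rule smap_mono[OF al_comp[OF cc compact_cb] skel_mono[OF S_SS]])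
 have wl: "gwf a (JJ N n')"
 proof (rule wf_aG)
  fix j assume j: "j:JJ N n'"
  hence "j:J" using n by (simp add: JJ_iff)
  thus "gmap (bd (fst j)) a {i:JJ N n'. fst i < fst j} (a j)" using at j by (simp add: JJ_below)
 qed
 have cl_low: "gmap (bd n') a (JJ N n') (gch a ?c)"
 proof -
  have j: "(n', i):J" using i n by (simp add: JJ_iff)
  have "gmap (bd n') a (JJ N n') (%x. gx \<one> (a (n', i) x))"
   by (rule cmap_gx[OF one_closed]) (use at[OF j] in simp)
  moreover have "gch a ?c x = gx \<one> (a (n', i) x)" if "x:bd n'" for x
   using chm_bd[OF wfJ c] that by (simp add: aG_def)
  ultimately show ?thesis using cmap_cong[of "bd n'" "gch a ?c"] by simp
 qed
 have "cmap (bd (Suc n')) (aG a) (cel J) (hb i)"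
 proof (rule cmap_box[OF cc be_comp[OF sm compact_cb] hom_compose[OF ho[unfolded n1] wl cl_low compact_bd], simplified])
  fix x assume "x:cb n'"
  hence "x(n' := 0) = x" by (intro fun_upd_idem cb_0n)
  thus "hb i x = gch a ?c x & hb i (x(n' := 1)) = bt (ap (gch a ?c x))"
   using cb_0n[OF \<open>x:cb n'\<close>] by (simp add: hb_Suc[OF n])
 next
  show "hb i (x(n' := t)) = H (gch a ?c x) t" if "x:bd n'" "0 <= t & t <= 1" for x t
   using hb_bd[OF n i] that by blast
 qed
 thus ?thesis by (simp add: n)
qed

lemma att: assumes "i < M + B" shows "gmap (bd n) a J (a' (n, i))"
proof (cases "i < M")
 case True thus ?thesis by (rule att_simplex)
next
 case False
 hence "n ~= 0" using assms by (auto simp: B_def split: if_splits)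
 then obtain n' where n: "n = Suc n'" by (cases n) auto
 have "i - M < N n'" using False assms unfolding B_Suc[OF n] by simp
 moreover have "a' (n, i) = hb (i - M)" using False by (simp add: a'_def fun_eq_iff)
 ultimately show ?thesis using att_homotopy[OF n] by simp
qed

lemma at': assumes j: "j:J'" shows "gmap (bd (fst j)) a' (JJ N' (fst j)) (a' j)"
proof (cases "j:J")
 case True
 hence f: "fst j < n" by (simp add: JJ_iff)
 have "cel (JJ N (fst j)) <= cel J" using f by (intro cel_mono JJ_mono) simp
 moreover have "a' j = a j" using f by (simp add: a'_def fun_eq_iff)
 ultimately show ?thesis using at[OF True] f by (simp add: JN' cmap_old)
next
 case False
 hence "fst j = n" "snd j < M + B" using j by (auto simp: J'_iff)
 thus ?thesis using att[of "snd j"] by (cases j) (simp add: JN' cmap_old)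
qed

lemma wf': "gwf a' J'"
proof (rule wf_aG)
 fix j assume j: "j:J'"
 show "gmap (bd (fst j)) a' {i:J'. fst i < fst j} (a' j)"
  using at'[OF j] JJ_below[of j N' "Suc n"] j by (simp add: J'_def)
qed

lemma new_bd:
 assumes "i < M + B" "x:bd n" "g:carrier G"
 shows "gch a' (g, (n, i)) x = gx g (a' (n, i) x)" "a' (n, i) x:gpts a J"
  "ch1 a' (n, i) x = a' (n, i) x"
proof -
 have c: "(h, (n, i)):cel J'" if "h:carrier G" for h using assms(1) that by (simp add: cel_def J'_iff)
 show "gch a' (g, (n, i)) x = gx g (a' (n, i) x)"
  using chm_bd[OF wf' c[OF assms(3)], of x] assms(2) by (simp add: aG_def)
 show p: "a' (n, i) x:gpts a J" by (rule cmap_in[OF att[OF assms(1)] assms(2)])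
 show "ch1 a' (n, i) x = a' (n, i) x"
  using chm_bd[OF wf' c[OF one_closed], of x] assms(2) gx_one_pts[OF wfJ p] by (simp add: aG_def)
qed

text \<open>\<open>ap\<close> sends the boundary of a new cell to a sphere in stage
  \<open>r\<close>, which bounds in stage \<open>s\<close>. Doing this for one cell per orbit and
  translating keeps the map equivariant.\<close>

lemma alpha_ex:
 "EX ap'. alp a' J' (skel (Suc n) (S s)) ap' & (ALL u:gpts a J. ap' u = ap u)"
proof -
 let ?Ts = "skel (Suc n) (S s)"
 have gTs: "ginv ?Ts" by (rule ginv_skel[OF ginv_S])
 have "ALL i. EX A. i < M + B --> smap (cb n) ?Ts A & (ALL x:bd n. A x = ap (a' (n, i) x))"
  using fi[OF order_refl al_comp[OF att compact_bd]] by blast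
 from choice[OF this] obtain A where A: "!!i. i < M + B ==> smap (cb n) ?Ts (A i)"
  "!!i x. i < M + B ==> x:bd n ==> A i x = ap (a' (n, i) x)" by blast
 obtain ap' where ext: "ALL u:gpts a' J. ap' u = ap u"
  "ALL c:cel J' - cel J. ALL x:op (dm c). ap' (gch a' c x) = rv (fst c) (A (snd (snd c)) x)"
  using ext_cells[OF wf' cel_mono[OF J_sub], of ap "%c x. rv (fst c) (A (snd (snd c)) x)"] by (elim exE conjE)
 have old: "ap' u = ap u" if "u:gpts a J" for u using ext(1) that pts_old[OF order_refl] by simp
 have AV: "spt (A i x) <= VS" if "i < M + B" "x:cb n" for i x
  using realiz_VS[OF gTs] A(1)[OF that(1)] that(2) by (auto simp: smap_def)
 have newo: "ap' (gch a' (g, (n, i)) x) = rv g (A i x)" if i: "i < M + B" and g: "g:carrier G" and x: "x:op n" for i g x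
 proof -
  have "(g, (n, i)):cel J' - cel J" using i g J_fst[of "(n, i)"] by (auto simp: cel_def J'_iff)
  from bspec[OF ext(2) this] x show ?thesis by simp
 qed
 have new: "ap' (gch a' (g, (n, i)) x) = rv g (A i x)" if i: "i < M + B" and g: "g:carrier G" and x: "x:cb n" for i g x
  using op_bd[OF x]
 proof
  assume "x:op n" thus ?thesis by (rule newo[OF i g])
 next
  assume xb: "x:bd n"
  note nb = new_bd[OF i xb g]
  show ?thesis unfolding nb(1) using old[OF gx_pts[OF g nb(2)]] al_eq[OF g nb(2)] A(2)[OF i xb] by simp
 qed
 have "alp a' J' ?Ts ap'"
  unfolding alp_def
 proof (intro conjI ballI)
  fix j assume j: "j:J'"
  show "smap (cb (fst j)) ?Ts (%x. ap' (ch1 a' j x))"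
  proof (cases "j:J")
   case True
   have "smap (cb (fst j)) (skel n (S r)) (%x. ap (ch1 a j x))" using al True by (simp add: alp_def)
   hence "smap (cb (fst j)) ?Ts (%x. ap (ch1 a j x))"
    by (rule smap_mono) (use S_mono[OF rs] in \<open>auto simp: skel_def\<close>)
   moreover have "ap' (ch1 a' j x) = ap (ch1 a j x)" if "x:cb (fst j)" for x
    using chm_old[of "(\<one>, j)"] True old[OF chm_one_in[OF wfJ True that]] by (simp add: cel_def)
   ultimately show ?thesis using smap_cong[of "cb (fst j)" "%x. ap' (ch1 a' j x)"] by simp
  next
   case False
   then obtain i where i: "j = (n, i)" "i < M + B" using j by (cases j) (auto simp: J'_iff)
   have "ap' (ch1 a' (n, i) x) = A i x" if "x:cb n" for x
    using new[OF i(2) one_closed that] rv_one[OF AV[OF i(2) that]] by simp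
   thus ?thesis using smap_cong[of "cb n" "%x. ap' (ch1 a' (n, i) x)" "A i"] A(1)[OF i(2)] i(1) by simp
  qed
 next
  fix g u assume g: "g:carrier G" and u: "u:gpts a' J'"
  obtain c x where c: "c:cel J'" "x:op (dm c)" "u = gch a' c x" using u by (rule ptsE)
  obtain h j where hj: "c = (h, j)" "h:carrier G" "j:J'" using c(1) by (auto simp: cel_def)
  show "ap' (gx g u) = rv g (ap' u)"
  proof (cases "j:J")
   case True
   hence "u:gpts a' J" using c hj by (auto simp: cel_def intro!: ptsI)
   hence "u:gpts a J" using pts_old[OF order_refl] by simp
   thus ?thesis using old[of u] old[OF gx_pts[OF g]] al_eq[OF g] by simp
  next
   case False
   then obtain i where i: "j = (n, i)" "i < M + B" using hj(3) by (cases j) (auto simp: J'_iff)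
   have "x:op n" using c(2) hj i by simp
   hence "x:cb n" by (rule op_in_cb)
   moreover have "gx g u = gch a' (g \<otimes> h, (n, i)) x" using chm_gx[OF g hj(2), of a' j x] c(3) hj(1) i(1) by simp
   ultimately show ?thesis
    using new[OF i(2) hj(2)] new[OF i(2) m_closed[OF g hj(2)]] rv_mult[OF g hj(2)] by (simp add: c(3) hj(1) i(1))
  qed
 qed
 thus ?thesis using old by blast
qed

text \<open>On a cell of dimension \<open>n - 1\<close> the homotopy climbs through the prism
  attached over it; the last coordinate of the prism is the time.\<close>

lemma hom_ex: "EX H'. hom a' J J' H' (%u. bt (ap u))"
proof (cases n)
 case 0
 hence "J = {}" by (auto simp: JJ_def)
 thus ?thesis by (intro exI[of _ H]) (simp add: hom_def cel_def pts_def)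
next
 case n: (Suc n')
 let ?J0 = "JJ N n'"
 define F where "F = (%(c::'a cell) x t. gch a' (fst c, (n, M + snd (snd c))) (x(n' := t)))"
 have n1: "n - 1 = n'" and n'_less: "n' < n" by (simp_all add: n)
 have J0: "?J0 <= J" by (rule JJ_mono) (simp add: n)
 have ho': "hom a ?J0 J H (%u. bt (ap u))" using ho unfolding n1 .
 obtain H' where ext: "ALL u:gpts a' ?J0. H' u = H u"
  "ALL c:cel J - cel ?J0. ALL x:op (dm c). H' (gch a' c x) = F c x"
  using ext_cells[OF wfJ' cel_mono[OF J0], of H F] by (elim exE conjE)
 have p0: "gpts a' ?J0 = gpts a ?J0" by (rule pts_old[OF cel_mono[OF J0]])
 have pJ: "gpts a' J = gpts a J" by (rule pts_old[OF order_refl])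
 have old: "H' u = H u" if "u:gpts a ?J0" for u using ext(1) that p0 by simp
 have idx: "M + i < M + B" if "i < N n'" for i using that unfolding B_Suc[OF n] by simp
 have a'new: "a' (n, M + i) x = hb i x" for i x by (simp add: a'_def)
 have newo: "H' (gch a (g, (n', i)) x) t = gx g (ch1 a' (n, M + i) (x(n' := t)))"
  if i: "i < N n'" and g: "g:carrier G" and x: "x:op n'" for i g x t
 proof -
  have c: "(g, (n', i)):cel J - cel ?J0" using i g n'_less by (auto simp: cel_def JJ_iff)
  from bspec[OF ext(2) c] x have "H' (gch a' (g, (n', i)) x) = F (g, (n', i)) x" by simp
  thus ?thesis using chm_old[of "(g, (n', i))"] c chm_gx1[OF g, of a' "(n, M + i)"] by (simp add: F_def)
 qed
 have new: "H' (ch1 a (n', i) x) t = ch1 a' (n, M + i) (x(n' := t))"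
  if i: "i < N n'" and x: "x:cb n'" and t: "0 <= t" "t <= 1" for i x t
 proof -
  have y: "x(n' := t):cb n" using cb_put[OF x t] n by simp
  have c: "(\<one>, (n, M + i)):cel J'" using idx[OF i] by (simp add: cel_def J'_iff)
  show ?thesis using op_bd[OF x]
  proof
   assume "x:op n'"
   from newo[OF i one_closed this, of t] show ?thesis
    using gx_one_pts[OF wf' cmap_in[OF cmap_chm[OF wf' c]]] y by simp
  next
   assume xb: "x:bd n'"
   have "(x(n' := t))(n' := 0) = x" using fun_upd_idem[of x n' 0] cb_0n[OF x] by simp
   hence "x(n' := t):bd n" using y xb n by (simp add: bd_Suc_iff)
   thus ?thesis
    using new_bd(3)[OF idx[OF i] _ one_closed] a'new hb_bd[OF n i xb t] old[OF bd_chm_low[OF n i xb]] by simp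
  qed
 qed
 have Jc: "j:?J0 | (EX i. j = (n', i) & i < N n')" if "j:J" for j
  using that by (cases j) (auto simp: JJ_iff n less_Suc_eq)
 have ends: "H' (ch1 a (n', i) x) 0 = ch1 a (n', i) x &
  H' (ch1 a (n', i) x) 1 = bt (ap (ch1 a (n', i) x))" if i: "i < N n'" and x: "x:cb n'" for i x
 proof -
  have x0: "x(n' := 0) = x" using cb_0n[OF x] by (rule fun_upd_idem)
  have b: "x(n' := t):bd n" if "t = 0 | t = 1" for t
   using cb_put[OF x, of t] that by (auto simp: n bd_Suc_iff)
  show ?thesis
   using new[OF i x, of 0] new[OF i x, of 1] new_bd(3)[OF idx[OF i] b one_closed, of 0] new_bd(3)[OF idx[OF i] b one_closed, of 1] a'new x0 cb_0n[OF x]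
   by (simp add: hb_Suc[OF n])
 qed
 have "hom a' J J' H' (%u. bt (ap u))"
  unfolding hom_def
 proof (intro conjI ballI allI)
  fix j assume j: "j:J"
  have eqc: "ch1 a' j = ch1 a j" by (rule chm_old) (use j in \<open>simp add: cel_def\<close>)
  from Jc[OF j] show "gmap (cyl (cb (fst j))) a' J' (%z. H' (ch1 a' j (fst z)) (snd z))"
  proof
   assume j0: "j:?J0"
   have "gmap (cyl (cb (fst j))) a J (%z. H (ch1 a j (fst z)) (snd z))"
    using ho' j0 by (simp add: hom_def)
   hence *: "gmap (cyl (cb (fst j))) a' J' (%z. H (ch1 a j (fst z)) (snd z))"
    using cmap_old[OF order_refl] cmap_mono[OF _ cel_mono[OF J_sub]] by blast
   have wl: "gwf a ?J0"
   proof (rule wf_aG)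
    fix j assume j: "j:?J0"
    hence "j:J" using J0 by blast
    thus "gmap (bd (fst j)) a {i:?J0. fst i < fst j} (a j)" using at j by (simp add: JJ_below)
   qed
   show ?thesis
    unfolding eqc by (rule cmap_cong[THEN iffD2, OF _ *]) (use old[OF chm_one_in[OF wl j0]] in auto)
  next
   assume "EX i. j = (n', i) & i < N n'"
   then obtain i where i: "j = (n', i)" "i < N n'" by blast
   have c: "(\<one>, (n, M + i)):cel J'" using idx[OF i(2)] by (simp add: cel_def J'_iff)
   have *: "gmap (cyl (cb n')) a' J' (%z. ch1 a' (n, M + i) ((fst z)(n' := snd z)))"
   proof (rule cmap_compose[of "cb n" "aG a'" "cel J'" "ch1 a' (n, M + i)"])
    show "gmap (cb n) a' J' (ch1 a' (n, M + i))" using cmap_chm[OF wf' c] by simp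
    show "continuous_on (cyl (cb n')) (%z. (fst z)(n' := snd z))"
     by (intro ctn)
    show "(%z. (fst z)(n' := snd z))`(cyl (cb n')) <= cb n" using cb_put[of _ n'] n by auto
   qed
   show ?thesis
    unfolding eqc unfolding i(1) fst_conv by (rule cmap_cong[THEN iffD2, OF _ *]) (use new[OF i(2)] in auto)
  qed
 next
  fix u assume "u:gpts a' J"
  hence u: "u:gpts a J" using pJ by simp
  obtain c x where c: "c:cel J" "x:op (dm c)" "u = gch a c x" using u by (rule ptsE)
  obtain h j where hj: "c = (h, j)" "h:carrier G" "j:J" using c(1) by (auto simp: cel_def)
  have eqg: "ALL g:carrier G. ALL t. H' (gx g u) t = gx g (H' u t)"
   and eqe: "H' u 0 = u & H' u 1 = bt (ap u)"
  proof -
   show "ALL g:carrier G. ALL t. H' (gx g u) t = gx g (H' u t)"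
    using Jc[OF hj(3)]
   proof
    assume "j:?J0"
    hence u0: "u:gpts a ?J0" using c hj by (auto simp: cel_def intro!: ptsI)
    thus ?thesis using old[OF u0] old[OF gx_pts[OF _ u0]] ho' by (simp add: hom_def)
   next
    assume "EX i. j = (n', i) & i < N n'"
    then obtain i where i: "j = (n', i)" "i < N n'" by blast
    have x: "x:op n'" using c(2) hj i by simp
    show ?thesis
     using newo[OF i(2) hj(2) x] newo[OF i(2) m_closed[OF _ hj(2)] x] chm_gx[OF _ hj(2), of _ a j x] gx_mult[OF _ hj(2)]
     by (simp add: c(3) hj(1) i(1))
   qed
   show "H' u 0 = u & H' u 1 = bt (ap u)"
    using Jc[OF hj(3)]
   proof
    assume "j:?J0"
    hence u0: "u:gpts a ?J0" using c hj by (auto simp: cel_def intro!: ptsI)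
    thus ?thesis using old[OF u0] ho' by (simp add: hom_def)
   next
    assume "EX i. j = (n', i) & i < N n'"
    then obtain i where i: "j = (n', i)" "i < N n'" by blast
    have x: "x:op n'" using c(2) hj i by simp
    let ?v = "ch1 a (n', i) x"
    have uv: "u = gx h ?v" using chm_gx1[OF hj(2), of a j x] c(3) hj(1) i(1) by simp
    have v: "?v:gpts a J" using hj(3) i(1) x by (intro ptsI) (simp_all add: cel_def)
    have t: "H' u t = gx h (H' ?v t)" for t
     using newo[OF i(2) hj(2) x] newo[OF i(2) one_closed x] gx_one_pts[OF wf' cmap_in[OF cmap_chm[OF wf']]]
      gx_mult[OF hj(2) one_closed] hj(2) by (simp add: c(3) hj(1) i(1))
    show ?thesis using t ends[OF i(2) op_in_cb[OF x]] uv beal_eq[OF hj(2) v] by simp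
   qed
  qed
  show "H' u 0 = u" "H' u 1 = bt (ap u)" using eqe by auto
  show "H' (gx g u) t = gx g (H' u t)" if "g:carrier G" for g t using eqg that by blast
 qed
 thus ?thesis by blast
qed

lemma be': "bmap (aG a') (cel J') T0 bt"
 by (rule bmap_mono[OF be cel_mono[OF J_sub]]) (simp add: aG_old)

text \<open>A representative simplex of stage \<open>s\<close> is sent to the cell that was attached
  for it.\<close>

lemma beta1_ex:
 "EX bt1. (ALL u:realiz T0. bt1 u = bt u) & bmap (aG a') (cel J') (T0 Un skel (Suc n) (S s)) bt1 &
  (ALL g:carrier G. ALL u:realiz (T0 Un skel (Suc n) (S s)). bt1 (rv g u) = gx g (bt1 u))"
proof -
 let ?T = "T0 Un skel (Suc n) (S s)"
 define F where "F = (%rh. ch1 a' (n, inv_into {..<M} b rh))"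
 have T: "rh:S s & rh:SS & card rh = Suc n" if "rh:?T - T0" for rh
  using that S_SS[of s] by (auto simp: skel_def)
 have ix: "inv_into {..<M} b rh < M & b (inv_into {..<M} b rh) = rh" if "rh:?T - T0" "rep rh = rh" for rh
 proof -
  have "rh:R" using T[OF that(1)] that(2) by (simp add: R_def)
  hence "rh:b`{..<M}" using bij_b by (simp add: bij_betw_def)
  thus ?thesis using inv_into_into[of rh b "{..<M}"] f_inv_into_f[of rh b "{..<M}"] by simp
 qed
 have "EX bt'. (ALL u:realiz T0. bt' u = bt u) &
  (ALL rh:?T - T0. rep rh = rh --> (ALL x:cb n. bt' (eta n (e rh) x) = F rh x)) &
  bmap (aG a') (cel J') ?T bt' & (ALL g:carrier G. ALL u:realiz ?T. bt' (rv g u) = gx g (bt' u))"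
 proof (rule ext_beta[OF gT0 ginv_Un[OF gT0 ginv_skel[OF ginv_S]] _ _ _ wf' be' be_eq])
  show "bij_betw (e si) {..n} si" if "si:?T - T0" for si using T[OF that] by (intro bij_e) simp
  show "ta:T0" if "si:?T - T0" "ta \<subset> si" "ta ~= {}" for si ta using T[OF that(1)] that(2,3) by (intro faces[of si]) simp_all
  fix rh assume r: "rh:?T - T0" "rep rh = rh"
  have i: "inv_into {..<M} b rh < M + B" using ix[OF r] by simp
  have "(\<one>, (n, inv_into {..<M} b rh)):cel J'" using i by (simp add: cel_def J'_iff)
  from cmap_chm[OF wf' this] show "gmap (cb n) a' J' (F rh)" by (simp add: F_def)
  show "F rh x = bt (eta n (e rh) x)" if "x:bd n" for x
   using new_bd(3)[OF i that one_closed] ix[OF r] by (simp add: F_def a'_def)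
 qed auto
 then obtain bt1 where "ALL u:realiz T0. bt1 u = bt u" "bmap (aG a') (cel J') ?T bt1"
  "ALL g:carrier G. ALL u:realiz ?T. bt1 (rv g u) = gx g (bt1 u)" by (elim exE conjE)
 thus ?thesis by (intro exI[of _ bt1] conjI)
qed

text \<open>The image of the sphere \<open>f\<close> under \<open>ap\<close> bounds in stage
  \<open>s\<close>, and \<open>bt1\<close> carries this filling back into the complex. The prisms
  connect its boundary with \<open>f\<close> itself.\<close>

lemma stage_fill:
 assumes b1: "ALL u:realiz T0. bt1 u = bt u" "bmap (aG a') (cel J') (T0 Un skel (Suc n) (S s)) bt1"
  and d: "d <= n" and f: "gmap (bd d) a J f"
 shows "gfills d a' J' f"
proof -
 let ?T = "T0 Un skel (Suc n) (S s)"
 have gT: "ginv ?T" by (rule ginv_Un[OF gT0 ginv_skel[OF ginv_S]])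
 obtain F where F: "smap (cb d) (skel (Suc n) (S s)) F" "ALL x:bd d. F x = ap (f x)"
  using fi[OF d al_comp[OF f compact_bd]] by (elim exE conjE)
 have b1F: "gmap (cb d) a' J' (%x. bt1 (F x))"
  by (rule bmap_compose[OF b1(2) ginvD(1)[OF gT] smap_mono[OF F(1)] compact_cb]) simp
 obtain H' where H': "hom a' J J' H' (%u. bt (ap u))" using hom_ex by (elim exE)
 have f': "gmap (bd d) a' J f" using f by (simp add: cmap_old)
 have ends: "H' (f x) 0 = f x & H' (f x) 1 = bt (ap (f x))" if "x:bd d" for x
  using H' cmap_in[OF f' that] by (simp add: hom_def)
 have "EX g. gmap (cb d) a' J' g & (ALL x:bd d. g x = (%z. H' (f (fst z)) (snd z)) (x, 0))"
 proof (rule cmap_collar[OF hom_compose[OF H' wfJ' f' compact_bd] b1F])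
  fix x assume x: "x:bd d"
  have "f x:gpts a J" by (rule cmap_in[OF f x])
  thus "H' (f (fst (x, 1::real))) (snd (x, 1::real)) = bt1 (F x)"
   using ends[OF x] F(2) x b1(1) al_T0 by simp
 qed
 thus ?thesis using ends by auto
qed

text \<open>To extend \<open>bt\<close> over a simplex beyond stage \<open>s\<close> no cell is
  attached: the image of its boundary is a sphere in the old complex, which bounds by
  \<open>stage_fill\<close>. This is why finitely many orbits suffice.\<close>

lemma step_ex:
 "EX ap' bt' H'. (ALL d<=n. ALL f. gmap (bd d) a J f --> gfills d a' J' f) &
  alp a' J' (skel (Suc n) (S s)) ap' & bmap (aG a') (cel J') (skel (Suc n) SS) bt' &
  (ALL g:carrier G. ALL u:realiz (skel (Suc n) SS). bt' (rv g u) = gx g (bt' u)) & hom a' J J' H' (%u. bt' (ap' u))"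
proof -
 obtain ap' where al': "alp a' J' (skel (Suc n) (S s)) ap'" "ALL u:gpts a J. ap' u = ap u" using alpha_ex by (elim exE conjE)
 obtain H' where H': "hom a' J J' H' (%u. bt (ap u))" using hom_ex by (elim exE)
 let ?T1 = "T0 Un skel (Suc n) (S s)" and ?T2 = "skel (Suc n) SS"
 obtain bt1 where b1: "ALL u:realiz T0. bt1 u = bt u" "bmap (aG a') (cel J') ?T1 bt1"
  "ALL g:carrier G. ALL u:realiz ?T1. bt1 (rv g u) = gx g (bt1 u)" using beta1_ex by (elim exE conjE)
 note fl = stage_fill[OF b1(1,2)]
 have T: "rh:SS & card rh = Suc n" if "rh:?T2 - ?T1" for rh using that by (auto simp: skel_def)
 have "ALL rh. EX F. rh:?T2 - ?T1 --> gmap (cb n) a' J' F & (ALL x:bd n. F x = bt1 (eta n (e rh) x))"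
 proof
  fix rh show "EX F. rh:?T2 - ?T1 --> gmap (cb n) a' J' F & (ALL x:bd n. F x = bt1 (eta n (e rh) x))"
  proof (cases "rh:?T2 - ?T1")
   case True
   hence r: "rh:SS" "card rh = Suc n" using T by auto
   have sm: "smap (bd n) T0 (eta n (e rh))" by (rule smap_eta_T0[OF r])
   obtain F where F: "gmap (cb n) a' J' F" "ALL x:bd n. F x = bt (eta n (e rh) x)"
    using fl[OF order_refl be_comp[OF sm compact_bd]] by (elim exE conjE)
   have "bt1 (eta n (e rh) x) = bt (eta n (e rh) x)" if "x:bd n" for x
    using b1(1) sm that by (auto simp: smap_def)
   thus ?thesis using F by (intro exI[of _ F]) simp
  next
   case False
   thus ?thesis by blast
  qed
 qed
 from choice[OF this] obtain F where F: "ALL rh. rh:?T2 - ?T1 --> gmap (cb n) a' J' (F rh) & (ALL x:bd n. F rh x = bt1 (eta n (e rh) x))"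
  by (elim exE)
 have gT1: "ginv ?T1" by (rule ginv_Un[OF gT0 ginv_skel[OF ginv_S]])
 have gT2: "ginv ?T2" by (rule ginv_skel[OF ginv_SS])
 have T12: "?T1 <= ?T2" using S_SS by (auto simp: skel_def)
 have "EX bt'. (ALL u:realiz ?T1. bt' u = bt1 u) &
  (ALL rh:?T2 - ?T1. rep rh = rh --> (ALL x:cb n. bt' (eta n (e rh) x) = F rh x)) &
  bmap (aG a') (cel J') ?T2 bt' & (ALL g:carrier G. ALL u:realiz ?T2. bt' (rv g u) = gx g (bt' u))"
 proof (rule ext_beta[OF gT1 gT2 T12 _ _ wf' b1(2)])
  show "bij_betw (e si) {..n} si" if "si:?T2 - ?T1" for si using T[OF that] by (intro bij_e) simp
  show "ta:?T1" if "si:?T2 - ?T1" "ta \<subset> si" "ta ~= {}" for si ta using T[OF that(1)] that(2,3) by (intro UnI1 faces[of si]) simp_all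
  show "bt1 (rv g u) = gx g (bt1 u)" if "g:carrier G" "u:realiz ?T1" for g u using b1(3) that by simp
  show "gmap (cb n) a' J' (F rh)" if "rh:?T2 - ?T1" for rh using spec[OF F, of rh] that by (elim impE conjE)
  show "F rh x = bt1 (eta n (e rh) x)" if "rh:?T2 - ?T1" "x:bd n" for rh x using conjunct2[OF mp[OF spec[OF F, of rh] that(1)]] that(2) by simp
 qed
 then obtain bt2 where b2: "ALL u:realiz ?T1. bt2 u = bt1 u" "bmap (aG a') (cel J') ?T2 bt2"
  "ALL g:carrier G. ALL u:realiz ?T2. bt2 (rv g u) = gx g (bt2 u)" by (elim exE conjE)
 have "bt2 (ap' u) = bt (ap u)" if "u:gpts a J" for u
 proof -
  have "ap u:realiz T0" by (rule al_T0[OF that])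
  moreover from this have "ap u:realiz ?T1" using realiz_mono[of T0 ?T1] by blast
  ultimately show ?thesis using al'(2) b2(1) b1(1) that by simp
 qed
 hence "hom a' J J' H' (%u. bt2 (ap' u))"
  using H' pts_old[OF order_refl] unfolding hom_def by simp
 thus ?thesis using fl al'(1) b2(2,3) by (intro exI[of _ ap'] exI[of _ bt2] exI[of _ H'] conjI allI impI)
qed

end

section \<open>The limit of all stages\<close>

context brown
begin

text \<open>Only the numbers of cells and the attaching maps are passed on; the maps to the
  filtration and back and the homotopy are merely asserted to exist at each stage.\<close>

definition Inv :: "nat => (nat => nat) \<times> (nat \<times> nat => rseq => 'a pt) => bool" where
 "Inv n z \<longleftrightarrow> (EX r ap bt H. stage G S av n (fst z) (snd z) r ap bt H
  (SOME s. r <= s & (ALL d<=n. ALL f. smap (bd d) (skel n (S r)) f --> sfills d (skel (Suc n) (S s)) f)))"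

lemma InvI:
 assumes "!!j. j:JJ N n ==> gmap (bd (fst j)) a (JJ N (fst j)) (a j)"
  "alp a (JJ N n) (skel n (S r)) ap" "bmap (aG a) (cel (JJ N n)) (skel n SS) bt"
  "!!g u. g:carrier G ==> u:realiz (skel n SS) ==> bt (rv g u) = gx g (bt u)"
  "hom a (JJ N (n - 1)) (JJ N n) H (%u. bt (ap u))"
 shows "Inv n (N, a)"
proof -
 define s where "s = (SOME s. r <= s & (ALL d<=n. ALL f. smap (bd d) (skel n (S r)) f --> sfills d (skel (Suc n) (S s)) f))"
 have s: "r <= s & (ALL d<=n. ALL f. smap (bd d) (skel n (S r)) f --> sfills d (skel (Suc n) (S s)) f)"
  using someI_ex[OF S_fill[of r n]] unfolding s_def by simp
 have "stage G S av n N a r ap bt H s"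
 proof unfold_locales
  show "r <= s" using s by (rule conjunct1)
  show "sfills d (skel (Suc n) (S s)) f" if "d <= n" "smap (bd d) (skel n (S r)) f" for d f
   using spec[OF conjunct2[OF s], of d] that by simp
 qed (fact assms)+
 thus ?thesis unfolding Inv_def s_def by auto
qed

lemma Inv_0: "Inv 0 (%_. 0, a)"
proof (rule InvI)
 have J0: "JJ (%_. 0) p = {}" for p by (auto simp: JJ_iff)
 show "gmap (bd (fst j)) a (JJ (%_. 0) (fst j)) (a j)" if "j:JJ (%_. 0) 0" for j using that by (simp add: JJ_iff)
 show "alp a (JJ (%_. 0) 0) (skel 0 (S 0)) undefined" by (simp add: alp_def J0 cel_def pts_def)
 have e: "skel 0 SS = {}" using scomplex_SS by (auto simp: skel_def scomplex_def)
 show "bmap (aG a) (cel (JJ (%_. 0) 0)) (skel 0 SS) undefined" by (simp add: bmap_def e)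
 show "undefined (rv g u) = gx g (undefined u)" if "g:carrier G" "u:realiz (skel 0 SS)" for g u using that by (simp add: e realiz_def)
 show "hom a (JJ (%_. 0) (0 - 1)) (JJ (%_. 0) 0) undefined (%u. undefined (undefined u))" by (simp add: hom_def J0 cel_def pts_def)
qed

lemma Inv_Suc:
 assumes "Inv n z"
 shows "EX z'. Inv (Suc n) z' & (ALL p<n. fst z' p = fst z p) & (ALL j. fst j < n --> snd z' j = snd z j) &
  (ALL j:JJ (fst z') (Suc n). gmap (bd (fst j)) (snd z') (JJ (fst z') (fst j)) (snd z' j)) &
  (ALL d<=n. ALL f. gmap (bd d) (snd z) (JJ (fst z) n) f -->
   gfills d (snd z') (JJ (fst z') (Suc n)) f)"
proof -
 obtain N a where z: "z = (N, a)" by (cases z)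
 obtain r ap bt H s where "stage G S av n N a r ap bt H s" using assms unfolding Inv_def z by auto
 then interpret st: stage G S av n N a r ap bt H s .
 obtain ap' bt' H' where st: "ALL d<=n. ALL f. gmap (bd d) a (JJ N n) f --> gfills d st.a' st.J' f"
  "alp st.a' st.J' (skel (Suc n) (S s)) ap'" "bmap (aG st.a') (cel st.J') (skel (Suc n) SS) bt'"
  "ALL g:carrier G. ALL u:realiz (skel (Suc n) SS). bt' (rv g u) = gx g (bt' u)" "hom st.a' (JJ N n) st.J' H' (%u. bt' (ap' u))"
  using st.step_ex by (elim exE conjE)
 have "Inv (Suc n) (st.N', st.a')"
 proof (rule InvI[OF _ _ _ _ ])
  show "gmap (bd (fst j)) st.a' (JJ st.N' (fst j)) (st.a' j)" if "j:JJ st.N' (Suc n)" for j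
   using st.at' that by (simp add: st.J'_def)
  show "alp st.a' (JJ st.N' (Suc n)) (skel (Suc n) (S s)) ap'" using st(2) by (simp add: st.J'_def)
  show "bmap (aG st.a') (cel (JJ st.N' (Suc n))) (skel (Suc n) SS) bt'" using st(3) by (simp add: st.J'_def)
  show "bt' (rv g u) = gx g (bt' u)" if "g:carrier G" "u:realiz (skel (Suc n) SS)" for g u using st(4) that by simp
  show "hom st.a' (JJ st.N' (Suc n - 1)) (JJ st.N' (Suc n)) H' (%u. bt' (ap' u))" using st(5) by (simp add: st.J'_def st.JN')
 qed
 moreover have "ALL p<n. st.N' p = N p" by (simp add: st.N'_def)
 moreover have "ALL j. fst j < n --> st.a' j = a j" by (simp add: st.a'_def fun_eq_iff)
 moreover have "ALL j:JJ st.N' (Suc n). gmap (bd (fst j)) st.a' (JJ st.N' (fst j)) (st.a' j)"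
  using st.at' by (simp add: st.J'_def)
 ultimately show ?thesis using st(1) unfolding st.J'_def z by (intro exI[of _ "(st.N', st.a')"]) simp
qed

text \<open>Later stages do not change the cells of smaller dimension, so the sequence given by
  dependent choice has a limit. A map on the boundary of a cube uses finitely many cells, so it
  lives in one stage and is filled in the next.\<close>

lemma brown_complex:
 obtains N a where "!!j. snd j < N (fst j) ==> gmap (bd (fst j)) a (JJ N (fst j)) (a j)"
  "!!d f. gmap (bd d) a {j. snd j < N (fst j)} f ==>
   gfills d a {j. snd j < N (fst j)} f"
proof -
 let ?Q = "%n z z'. (ALL p<n. fst z' p = fst z p) & (ALL j. fst j < n --> snd z' j = snd z j) &
  (ALL j:JJ (fst z') (Suc n). gmap (bd (fst j)) (snd z') (JJ (fst z') (fst j)) (snd z' j)) &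
  (ALL d<=n. ALL f. gmap (bd d) (snd z) (JJ (fst z) n) f -->
   gfills d (snd z') (JJ (fst z') (Suc n)) f)"
 have "EX Z. ALL n. Inv n (Z n) & ?Q n (Z n) (Z (Suc n))"
 proof (rule dependent_nat_choice)
  show "EX z. Inv 0 z" using Inv_0 by blast
  show "EX y. Inv (Suc n) y & ?Q n x y" if "Inv n x" for x n by (rule Inv_Suc[OF that])
 qed
 then obtain Z where Z: "ALL n. Inv n (Z n) & ?Q n (Z n) (Z (Suc n))" by (elim exE)
 have Z1: "p < n ==> fst (Z (Suc n)) p = fst (Z n) p" for n p using spec[OF Z, of n] by simp
 have Z2: "fst j < n ==> snd (Z (Suc n)) j = snd (Z n) j" for n j using spec[OF Z, of n] by (elim conjE) (drule spec[of _ j], erule mp)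
 have Z3: "j:JJ (fst (Z (Suc n))) (Suc n) ==> cmap (bd (fst j)) (aG (snd (Z (Suc n)))) (cel (JJ (fst (Z (Suc n))) (fst j))) (snd (Z (Suc n)) j)" for n j
  using spec[OF Z, of n] by (elim conjE) (drule (1) bspec)
 have Z4: "d <= n ==> gmap (bd d) (snd (Z n)) (JJ (fst (Z n)) n) f ==>
   EX F. cmap (cb d) (aG (snd (Z (Suc n)))) (cel (JJ (fst (Z (Suc n))) (Suc n))) F & (ALL x:bd d. F x = f x)" for n d f
  using spec[OF Z, of n] by (elim conjE) (drule spec[of _ d], drule (1) mp, drule spec[of _ f], erule (1) mp)
 define N where "N = (%p. fst (Z (Suc p)) p)"
 define a where "a = (%j. snd (Z (Suc (fst j))) j)"
 have N: "fst (Z n) p = N p" if "p < n" for n p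
  using that
 proof (induction n)
  case (Suc n)
  thus ?case using Z1[of p n] by (cases "p = n") (simp_all add: N_def)
 qed simp
 have a: "snd (Z n) j = a j" if "fst j < n" for n j
  using that
 proof (induction n)
  case (Suc n)
  thus ?case using Z2[of j n] by (cases "fst j = n") (simp_all add: a_def)
 qed simp
 have JN: "JJ (fst (Z n)) p = JJ N p" if "p <= n" for n p by (rule JJ_cong) (use N that in simp)
 have ca: "gmap K (snd (Z n)) (JJ N p) f = gmap K a (JJ N p) f" if "p <= n" for n p and K :: "rseq set" and f
 proof (rule cmap_cong_at)
  fix c assume "c:cel (JJ N p)"
  hence "fst (snd c) < n" using that by (auto simp: cel_def JJ_iff)
  from a[OF this] show "aG (snd (Z n)) c = aG a c" by (intro ext) (simp add: aG_def)
 qed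
 let ?J = "{j. snd j < N (fst j)}"
 show ?thesis
 proof (rule that[of N a])
  fix j :: "nat \<times> nat" assume j: "snd j < N (fst j)"
  let ?n = "fst j"
  have "j:JJ (fst (Z (Suc ?n))) (Suc ?n)" using j by (simp add: JN JJ_iff)
  from Z3[OF this] show "gmap (bd (fst j)) a (JJ N (fst j)) (a j)"
   using a[of j "Suc ?n"] ca[of ?n "Suc ?n"] JN[of ?n "Suc ?n"] by simp
 next
  fix d f assume f: "gmap (bd d) a ?J f"
  obtain F where F: "continuous_on (bd d) f" "finite F" "F <= cel ?J" "!!k. k:bd d ==> f k:pts (aG a) F"
   using f by (rule cmapE) (rule that; blast)
  define n where "n = Max (insert d ((%c. Suc (dm c))`F))"
  have dn: "d <= n" using F(2) by (simp add: n_def)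
  have "Suc (dm c) <= n" if "c:F" for c using F(2) that unfolding n_def by (intro Max_ge) auto
  hence "F <= cel (JJ N n)" using F(3) by (force simp: cel_def JJ_iff)
  hence "gmap (bd d) a (JJ N n) f" using F by (intro cmapI)
  hence "gmap (bd d) (snd (Z n)) (JJ (fst (Z n)) n) f" using ca[of n n] JN[of n n] by simp
  from Z4[OF dn this] obtain G where G: "cmap (cb d) (aG (snd (Z (Suc n)))) (cel (JJ (fst (Z (Suc n))) (Suc n))) G" "ALL x:bd d. G x = f x"
   by (elim exE conjE)
  have "gmap (cb d) a (JJ N (Suc n)) G" using G(1) ca[of "Suc n" "Suc n"] JN[of "Suc n" "Suc n"] by simp
  moreover have "cel (JJ N (Suc n)) <= cel ?J" by (intro cel_mono) (auto simp: JJ_iff)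
  ultimately show "gfills d a ?J f" using G(2) cmap_mono by blast
 qed
qed

end

section \<open>The quotient complex and its covering\<close>

text \<open>Coordinates reach a cell only from its boundary, so on a finite subcomplex only the
  coordinates of its own cells can be nonzero.\<close>

lemma supp_finite:
 assumes wf: "wf C a" and F: "finite F" "F <= C"
 shows "EX A. finite A & A <= C & (ALL u:pts a F. ALL d i. u (d, i) ~= 0 --> d:A)"
proof -
 obtain A where A: "subcx a A" "F <= A" "A <= C" using subcx_ex[OF wf F] by (elim exE conjE)
 have fin: "finite A" using A(1) by (simp add: subcx_def)
 have "ALL c:A. dm c < m --> (ALL x:op (dm c). ALL d i. chm a c x (d, i) ~= 0 --> d:A)" for m
 proof (induction m)
  case (Suc m)
  show ?case
  proof (intro ballI impI allI)
   fix c x d i assume c: "c:A" "dm c < Suc m" and x: "x:op (dm c)" and nz: "chm a c x (d, i) ~= 0"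
   have cC: "c:C" using c(1) A(3) by blast
   show "d:A"
   proof (cases "d = c")
    case False
    hence p: "0 < 2 * nrm (dm c) x - 1" "a c (rho (dm c) x) (d, i) ~= 0" using nz by (auto simp: chm_other)
    let ?y = "rho (dm c) x"
    have y: "?y:bd (dm c)" by (rule rho_in_bd) (use p in simp)
    hence "chm a c ?y:pts a A" using A(1) c(1) bd_subset[of "dm c"] unfolding subcx_def by blast
    then obtain d' z where d': "d':A" "z:op (dm d')" "chm a c ?y = chm a d' z" by (rule ptsE)
    obtain E where E: "finite E" "E <= C" "!!d. d:E ==> dm d < dm c" "!!x. x:bd (dm c) ==> a c x:pts a E"
     by (rule wf_fin[OF wf cC]) (rule that; blast)
    have eq: "a c ?y = chm a d' z" using chm_bd[OF wf cC y] d'(3) by simp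
    hence "chm a d' z:pts a E" using E(4)[OF y] by simp
    hence "d':E" using chm_in_pts_iff[OF wf E(2) _ d'(2)] d'(1) A(3) by blast
    hence "dm d' < m" using E(3)[of d'] c(2) by linarith
    moreover have "chm a d' z (d, i) ~= 0" using p(2) eq by simp
    ultimately show ?thesis using Suc.IH d'(1,2) by blast
   qed (use c(1) in simp)
  qed
 qed simp
 note supp = this
 have "d:A" if u: "u:pts a F" "u (d, i) ~= 0" for u d i
 proof -
  obtain c x where c: "c:F" "x:op (dm c)" "u = chm a c x" using u(1) by (rule ptsE)
  have "c:A" using c(1) A(2) by blast
  from bspec[OF supp[of "Suc (dm c)"] this] c(2,3) u(2) show ?thesis by blast
 qed
 thus ?thesis using fin A(3) by blast
qed

text \<open>The quotient map in coordinates: values are added over each orbit of cells. On points of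
  the complex these sums have finitely many nonzero terms.\<close>

definition qm :: "'g pt => unit pt" where
 "qm u = (%((_, j), i). SUM g:{g. u ((g, j), i) ~= 0}. u ((g, j), i))"

lemma qm_sum:
 assumes "finite A" "!!g. u ((g, j), i) ~= 0 ==> g:A" shows "qm u ((z, j), i) = (SUM g:A. u ((g, j), i))"
 unfolding qm_def prod.case by (rule sum.mono_neutral_left) (use assms in auto)

definition seg :: "rseq set => bool" where
 "seg K \<longleftrightarrow> (ALL x:K. ALL y:K. ALL t:{0..1::real}. (%i. (1 - t) * x i + t * y i):K)"

lemma line_continuous: "continuous_on X (%t::real. (%i::nat. (1 - t) * x i + t * y i))"
 by (rule continuous_on_pointwise) (intro ctn)

text \<open>The complex delivered by \<open>brown_complex\<close>, in which every sphere bounds. It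
  will serve as the universal cover of its quotient.\<close>

locale cover = group G for G :: "('a, 'b) monoid_scheme" (structure) +
 fixes N :: "nat => nat" and a :: "nat \<times> nat => rseq => 'a pt"
 assumes at: "!!j. snd j < N (fst j) ==> gmap (bd (fst j)) a (JJ N (fst j)) (a j)"
  and fill: "!!d f. gmap (bd d) a {j. snd j < N (fst j)} f ==>
   gfills d a {j. snd j < N (fst j)} f"
begin

definition JX :: "(nat \<times> nat) set" where "JX = {j. snd j < N (fst j)}"
definition CX :: "unit cell set" where "CX = UNIV \<times> JX"
definition aX :: "unit cell => rseq => unit pt" where "aX c x = qm (a (snd c) x)"
abbreviation CT where "CT == cel JX"
abbreviation PT where "PT == pts (aG a) CT"
abbreviation PX where "PX == pts aX CX"
abbreviation tmap where "tmap K f == cmap K (aG a) CT f"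
abbreviation xmap where "xmap K f == cmap K aX CX f"

lemma JX_below: "{i:JX. fst i < fst j} = JJ N (fst j)"
 by (auto simp: JX_def JJ_iff)

lemma wfT: "wf CT (aG a)"
 by (rule wf_aG) (simp add: JX_below, simp add: JX_def at)

lemma CT_iff: "(g, j):CT \<longleftrightarrow> g:carrier G & j:JX"
 by (simp add: cel_def)

lemma CX_iff: "c:CX \<longleftrightarrow> snd c:JX"
 by (cases c) (simp add: CX_def)

lemma gxT: "g:carrier G ==> u:PT ==> gx g u:PT"
 by (rule gx_pts)

lemma gx1: "u:PT ==> gx \<one> u = u"
 by (rule gx_one_pts[OF wfT])

lemma supp1:
 assumes "u:PT" shows "EX A. finite A & A <= CT & (ALL d i. u (d, i) ~= 0 --> d:A)"
proof -
 obtain c x where c: "c:CT" "x:op (dm c)" "u = gch a c x" using assms by (rule ptsE)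
 hence "u:pts (aG a) {c}" by (auto intro: ptsI)
 moreover have "EX A. finite A & A <= CT & (ALL u:pts (aG a) {c}. ALL d i. u (d, i) ~= 0 --> d:A)"
  by (rule supp_finite[OF wfT]) (use c(1) in simp_all)
 ultimately show ?thesis by blast
qed

lemma supp2:
 assumes "u:PT" shows "EX A. finite A & A <= carrier G & (ALL g j i. u ((g, j), i) ~= 0 --> g:A)"
proof -
 obtain A where A: "finite A" "A <= CT" "ALL d i. u (d, i) ~= 0 --> d:A" using supp1[OF assms] by (elim exE conjE)
 have "g:fst`A" if "u ((g, j), i) ~= 0" for g j i
  using A(3) that by (intro image_eqI[of _ _ "(g, j)"]) (simp, blast)
 moreover have "fst`A <= carrier G" using A(2) by (auto simp: cel_def)
 ultimately show ?thesis using A(1) by (intro exI[of _ "fst`A"]) blast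
qed

lemma qm_gx:
 assumes g: "g:carrier G" and u: "u:PT" shows "qm (gx g u) = qm u"
proof
 fix e :: "unit cell \<times> nat"
 obtain z j i where e: "e = ((z, j), i)" by (metis surj_pair)
 obtain A where A: "finite A" "A <= carrier G" "ALL g j i. u ((g, j), i) ~= 0 --> g:A" using supp2[OF u] by (elim exE conjE)
 have inj: "inj_on (%h. g \<otimes> h) A"
 proof (rule inj_onI)
  fix x y assume xy: "x:A" "y:A" "g \<otimes> x = g \<otimes> y"
  hence c: "x:carrier G" "y:carrier G" using A(2) by auto
  have "inv g \<otimes> (g \<otimes> x) = inv g \<otimes> (g \<otimes> y)" using xy(3) by simp
  thus "x = y" using c g by (simp add: m_assoc[symmetric])
 qed
 have "h:(%h. g \<otimes> h)`A" if nz: "gx g u ((h, j), i) ~= 0" for h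
 proof -
  have h: "h:carrier G" "u ((inv g \<otimes> h, j), i) ~= 0" using nz by (auto simp: gx_def split: if_splits)
  hence "inv g \<otimes> h:A" using A(3) by blast
  moreover have "h = g \<otimes> (inv g \<otimes> h)" using g h(1) by (simp add: m_assoc[symmetric])
  ultimately show ?thesis by blast
 qed
 hence "qm (gx g u) ((z, j), i) = (SUM h:(%h. g \<otimes> h)`A. gx g u ((h, j), i))"
  by (intro qm_sum) (use A(1) in simp)
 also have "\<dots> = (SUM h:A. gx g u ((g \<otimes> h, j), i))" by (simp add: sum.reindex[OF inj])
 also have "\<dots> = (SUM h:A. u ((h, j), i))"
 proof (rule sum.cong[OF refl])
  fix h assume "h:A"
  hence "h:carrier G" using A(2) by blast
  thus "gx g u ((g \<otimes> h, j), i) = u ((h, j), i)" using g by (simp add: gx_def m_assoc[symmetric])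
 qed
 also have "\<dots> = qm u ((z, j), i)" by (rule qm_sum[symmetric, OF A(1)]) (use A(3) in blast)
 finally show "qm (gx g u) e = qm u e" using e by simp
qed

lemma a_in: "j:JX ==> y:bd (fst j) ==> a j y:PT"
proof -
 assume j: "j:JX" and y: "y:bd (fst j)"
 have sub: "JJ N (fst j) <= JX" by (auto simp: JX_def JJ_iff)
 have "snd j < N (fst j)" using j by (simp add: JX_def)
 from subsetD[OF pts_mono[OF cel_mono[OF sub]] cmap_in[OF at[OF this] y]] show "a j y:PT" .
qed

text \<open>In the orbit of its own cell a point has one nonzero term. Its other coordinates are a
  multiple of those of a translated boundary point, and the sum over an orbit is invariant under
  translation.\<close>

lemma qm_chm:
 assumes c: "c:CT" and x: "x:op (dm c)" shows "qm (gch a c x) = chm aX ((), snd c) x"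
proof
 fix e :: "unit cell \<times> nat"
 obtain j' i where e: "e = (((), j'), i)" by (metis surj_pair unit.exhaust)
 obtain g j where gj: "c = (g, j)" "g:carrier G" "j:JX" using c by (auto simp: cel_def)
 let ?u = "gch a c x"
 have u: "?u:PT" by (rule ptsI[OF c x])
 show "qm ?u e = chm aX ((), snd c) x e"
 proof (cases "j' = j")
  case True
  have "h = g" if "?u ((h, j'), i) ~= 0" for h
  proof (rule ccontr)
   assume "h ~= g"
   hence "?u ((h, j'), i) = 0" by (intro chm_zero[OF wfT c x]) (auto simp: gj(1) True)
   thus False using that by simp
  qed
  hence "qm ?u (((), j'), i) = (SUM h:{g}. ?u ((h, j'), i))" by (intro qm_sum) auto
  thus ?thesis using True by (simp add: e gj(1) chm_self)
 next
  case False
  show ?thesis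
  proof (cases "2 * nrm (dm c) x - 1 <= 0")
   case True
   hence "?u ((h, j'), i) = 0" for h using False by (simp add: gj(1) chm_other)
   hence "qm ?u (((), j'), i) = 0" by (simp add: qm_def)
   thus ?thesis using True False by (simp add: e gj(1) chm_other)
  next
   case pos: False
   let ?y = "rho (dm c) x" and ?k = "2 * nrm (dm c) x - 1"
   have "?y:bd (dm c)" by (rule rho_in_bd) (use pos in simp)
   hence ay: "a j ?y:PT" using a_in[OF gj(3)] gj(1) by simp
   have uv: "?u ((h, j'), i) = ?k * gx g (a j ?y) ((h, j'), i)" for h
    using False pos by (simp add: gj(1) chm_other aG_def)
   obtain A where A: "finite A" "ALL h j' i. gx g (a j ?y) ((h, j'), i) ~= 0 --> h:A"
    using supp2[OF gxT[OF gj(2) ay]] by (elim exE conjE)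
   have "qm ?u (((), j'), i) = (SUM h:A. ?u ((h, j'), i))"
   proof (rule qm_sum[OF A(1)])
    show "h:A" if "?u ((h, j'), i) ~= 0" for h
    proof -
     have "gx g (a j ?y) ((h, j'), i) ~= 0" using that uv[of h] by auto
     thus ?thesis using A(2) by blast
    qed
   qed
   also have "\<dots> = ?k * (SUM h:A. gx g (a j ?y) ((h, j'), i))" unfolding uv by (rule sum_distrib_left[symmetric])
   also have "(SUM h:A. gx g (a j ?y) ((h, j'), i)) = qm (gx g (a j ?y)) (((), j'), i)"
    by (rule qm_sum[symmetric, OF A(1)]) (use A(2) in blast)
   also have "\<dots> = qm (a j ?y) (((), j'), i)" unfolding qm_gx[OF gj(2) ay] ..
   finally show ?thesis using False pos by (simp add: e gj(1) chm_other aX_def)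
  qed
 qed
qed

lemma qm_pts: assumes "F <= CT" "u:pts (aG a) F" shows "qm u:pts aX ((%c. ((), snd c))`F)"
proof -
 obtain c x where c: "c:F" "x:op (dm c)" "u = gch a c x" using assms(2) by (rule ptsE)
 have "c:CT" using c(1) assms(1) by blast
 thus ?thesis unfolding c(3) qm_chm[OF \<open>c : CT\<close> c(2)] using c(1,2) by (intro ptsI) auto
qed

lemma qm_continuous:
 assumes f: "tmap K f" shows "continuous_on K (%k. qm (f k))"
proof (rule continuous_on_pointwise)
 fix e :: "unit cell \<times> nat"
 obtain z j i where e: "e = ((z, j), i)" by (metis surj_pair)
 obtain F where F: "continuous_on K f" "finite F" "F <= CT" "!!k. k:K ==> f k:pts (aG a) F"
  using f by (rule cmapE) (rule that; blast)
 obtain A where A: "finite A" "A <= CT" "ALL u:pts (aG a) F. ALL d i. u (d, i) ~= 0 --> d:A"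
  using supp_finite[OF wfT F(2,3)] by (elim exE conjE)
 have "qm (f k) e = (SUM g:fst`A. f k ((g, j), i))" if k: "k:K" for k
  unfolding e
 proof (rule qm_sum)
  show "finite (fst`A)" using A(1) by simp
  show "g:fst`A" if "f k ((g, j), i) ~= 0" for g
   using bspec[OF A(3) F(4)[OF k]] that by (intro image_eqI[of _ _ "(g, j)"]) (simp, blast)
 qed
 moreover have "continuous_on K (%k. SUM g:fst`A. f k ((g, j), i))"
  by (intro continuous_on_sum) (rule continuous_on_coord'[OF F(1)])
 ultimately show "continuous_on K (%k. qm (f k) e)" by (simp cong: continuous_on_cong)
qed

lemma qm_cmap: assumes f: "gmap K a J f" and J: "J <= JX" shows "cmap K aX (UNIV \<times> J) (%k. qm (f k))"
proof -
 obtain F where F: "finite F" "F <= cel J" "!!k. k:K ==> f k:pts (aG a) F" using f by (rule cmapE) (rule that; blast)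
 have FC: "F <= CT" using F(2) cel_mono[OF J] by blast
 show ?thesis
  by (rule cmapI[OF qm_continuous[OF cmap_mono[OF f cel_mono[OF J]]] _ _ qm_pts[OF FC F(3)]])
   (use F(1,2) in \<open>auto simp: cel_def\<close>)
qed

lemma tmap_xmap: "tmap K f ==> xmap K (%k. qm (f k))"
 using qm_cmap[of K JX f] by (simp add: CX_def)

lemma wfX: "wf CX aX"
 unfolding wf_def
proof
 fix c assume c: "c:CX"
 obtain j where j: "c = ((), j)" "j:JX" using c by (cases c) (simp add: CX_def)
 have "cmap (bd (fst j)) aX (UNIV \<times> JJ N (fst j)) (%x. qm (a j x))"
  by (rule qm_cmap[OF at]) (use j(2) in \<open>auto simp: JX_def JJ_iff\<close>)
 moreover have "aX c = (%x. qm (a j x))" by (simp add: aX_def j(1) fun_eq_iff)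
 ultimately have m: "cmap (bd (fst j)) aX (UNIV \<times> JJ N (fst j)) (aX c)" by simp
 obtain F where F: "continuous_on (bd (fst j)) (aX c)" "finite F" "F <= UNIV \<times> JJ N (fst j)" "!!k. k:bd (fst j) ==> aX c k:pts aX F"
  using m by (rule cmapE) (rule that; blast)
 have "F <= CX" "ALL d:F. dm d < fst j" using F(3) by (auto simp: CX_def JX_def JJ_iff)
 thus "continuous_on (bd (dm c)) (aX c) &
  (EX F. finite F & F <= CX & (ALL d:F. dm d < dm c) & aX c`bd (dm c) <= pts aX F)"
  using F(1,2,4) unfolding j(1) by (simp add: image_subset_iff) blast
qed

lemma qm_in: assumes "u:PT" shows "qm u:PX"
proof -
 have "(%c. ((), snd c))`CT <= CX" by (auto simp: CX_def cel_def)
 from subsetD[OF pts_mono[OF this] qm_pts[OF order_refl assms]] show ?thesis .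
qed

lemma qm_surj: assumes "v:PX" shows "EX u:PT. qm u = v"
proof -
 obtain c x where c: "c:CX" "x:op (dm c)" "v = chm aX c x" using assms by (rule ptsE)
 have d: "(\<one>, snd c):CT" using c(1) by (simp add: CT_iff CX_iff)
 have "qm (gch a (\<one>, snd c) x) = v" using qm_chm[OF d] c(2,3) by (cases c) simp
 thus ?thesis using ptsI[OF d, of x "aG a"] c(2) by auto
qed

section \<open>Fibres, sheets and local sections of the covering\<close>

lemma fibre:
 assumes u: "u:PT" and u': "u':PT" and eq: "qm u = qm u'" shows "EX g:carrier G. u' = gx g u"
proof -
 obtain c x where c: "c:CT" "x:op (dm c)" "u = gch a c x" using u by (rule ptsE)
 obtain c' x' where c': "c':CT" "x':op (dm c')" "u' = gch a c' x'" using u' by (rule ptsE)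
 have "chm aX ((), snd c) x = chm aX ((), snd c') x'" using qm_chm[OF c(1,2)] qm_chm[OF c'(1,2)] c(3) c'(3) eq by simp
 moreover have "((), snd c):CX" "((), snd c'):CX" using c(1) c'(1) by (auto simp: cel_def CX_iff)
 ultimately have e: "((), snd c) = ((), snd c') & x = x'" using chm_unique[OF wfX, of "((), snd c)" "((), snd c')" x x'] c(2) c'(2) by simp
 obtain h j where hj: "c = (h, j)" "h:carrier G" using c(1) by (auto simp: cel_def)
 obtain h' j' where hj': "c' = (h', j')" "h':carrier G" using c'(1) by (auto simp: cel_def)
 have "gch a (h' \<otimes> inv h \<otimes> h, j) x = gx (h' \<otimes> inv h) u"
  unfolding c(3) hj(1) by (rule chm_gx) (use hj hj' in auto)
 hence "u' = gx (h' \<otimes> inv h) u" using e hj hj' c'(3) by (simp add: m_assoc)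
 thus ?thesis using hj(2) hj'(2) by blast
qed

text \<open>The points with \<open>u ((g, j), 0)\<close> positive form a neighbourhood of the open
  cell \<open>(g, j)\<close>; for varying \<open>g\<close> these are the sheets over an evenly
  covered set. On a cell of another orbit the coordinate is a multiple of its value at a boundary
  point, so disjointness passes up by induction on the dimension.\<close>

lemma sheets_disjoint:
 assumes u: "u:PT" and p: "0 < u ((g, j), 0)" "0 < u ((h, j), 0)" shows "g = h"
proof -
 have "ALL c:CT. ALL x:op (dm c). dm c < m --> 0 < gch a c x ((g, j), 0) --> 0 < gch a c x ((h, j), 0) --> g = h" for m
 proof (induction m)
  case (Suc m)
  show ?case
  proof (intro ballI impI)
   fix c x assume c: "c:CT" "x:op (dm c)" "dm c < Suc m"
    and p: "0 < gch a c x ((g, j), 0)" "0 < gch a c x ((h, j), 0)"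
   show "g = h"
   proof (cases "snd c = j")
    case True
    have "(k, j) = c" if "0 < gch a c x ((k, j), 0)" for k
    proof (rule ccontr)
     assume "(k, j) ~= c"
     hence "gch a c x ((k, j), 0) = 0" by (intro chm_zero[OF wfT c(1,2)]) (use True in auto)
     thus False using that by simp
    qed
    hence "(g, j) = c" "(h, j) = c" using p by blast+
    thus ?thesis by auto
   next
    case False
    hence nc: "(k, j) ~= c" for k by auto
    let ?y = "rho (dm c) x" and ?k = "2 * nrm (dm c) x - 1"
    have k: "0 < ?k"
    proof (rule ccontr)
     assume "~ 0 < ?k"
     hence z: "max 0 ?k = 0" by simp
     have "gch a c x ((g, j), 0) = 0" unfolding chm_other[OF nc] z by simp
     thus False using p(1) by simp
    qed
    have y: "?y:bd (dm c)" by (rule rho_in_bd) (use k in simp)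
    have pos: "0 < aG a c ?y ((g, j), 0)" "0 < aG a c ?y ((h, j), 0)"
     using p k nc by (simp_all add: chm_other zero_less_mult_iff)
    obtain E where E: "finite E" "E <= CT" "!!d. d:E ==> dm d < dm c" "!!x. x:bd (dm c) ==> aG a c x:pts (aG a) E"
     by (rule wf_fin[OF wfT c(1)]) (rule that; blast)
    obtain d z where d: "d:E" "z:op (dm d)" "aG a c ?y = gch a d z" using E(4)[OF y] by (rule ptsE)
    have "d:CT" using d(1) E(2) by blast
    moreover have "dm d < m" using E(3)[OF d(1)] c(3) by linarith
    ultimately show ?thesis using Suc.IH d(2,3) pos by auto
   qed
  qed
 qed simp
 note all = this
 obtain c x where c: "c:CT" "x:op (dm c)" "u = gch a c x" using u by (rule ptsE)
 show ?thesis using bspec[OF bspec[OF all[of "Suc (dm c)"] c(1)] c(2)] p c(3) by simp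
qed

lemma uT_nonneg: "u:PT ==> 0 <= u (d, 0)"
 by (rule pts_nonneg[OF wfT order_refl])

lemma qm_sheet: assumes u: "u:PT" and p: "0 < u ((g, j), 0)" shows "qm u (((), j), 0) = u ((g, j), 0)"
proof -
 have "h = g" if "u ((h, j), 0) ~= 0" for h
 proof -
  have "0 < u ((h, j), 0)" using uT_nonneg[OF u, of "(h, j)"] that by simp
  from sheets_disjoint[OF u p this] show ?thesis by (rule sym)
 qed
 hence "qm u (((), j), 0) = (SUM h:{g}. u ((h, j), 0))" by (intro qm_sum) auto
 thus ?thesis by simp
qed

lemma sheet_ex: assumes u: "u:PT" and p: "0 < qm u (((), j), 0)" shows "EX g:carrier G. 0 < u ((g, j), 0)"
proof -
 have "EX g. u ((g, j), 0) ~= 0"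
 proof (rule ccontr)
  assume "~ ?thesis"
  hence "qm u (((), j), 0) = 0" by (simp add: qm_def)
  thus False using p by simp
 qed
 then obtain g where g: "u ((g, j), 0) ~= 0" by blast
 have "g:carrier G"
 proof (rule ccontr)
  assume "g ~: carrier G"
  hence "u ((g, j), 0) = 0" by (intro pts_zero_outside[OF wfT order_refl u]) (simp add: CT_iff)
  thus False using g by simp
 qed
 thus ?thesis using g uT_nonneg[OF u, of "(g, j)"] by (intro bexI[of _ g]) simp_all
qed

text \<open>The two points differ by a translation and lie in the same sheet; as the sheets are
  disjoint, the translating element is neutral.\<close>

lemma sheet_inj:
 assumes u: "u:PT" "0 < u ((g, j), 0)" and u': "u':PT" "0 < u' ((g, j), 0)" and eq: "qm u = qm u'" and g: "g:carrier G"
 shows "u = u'"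
proof -
 obtain h where h: "h:carrier G" "u' = gx h u" using fibre[OF u(1) u'(1) eq] by blast
 have "0 < u ((inv h \<otimes> g, j), 0)" using u'(2) g by (simp add: h(2) gx_def)
 from sheets_disjoint[OF u(1) u(2) this] have e: "inv h \<otimes> g = g" by (rule sym)
 have "inv h = inv h \<otimes> g \<otimes> inv g" using g h(1) by (simp add: m_assoc)
 hence "inv h = \<one>" using e g by simp
 hence "inv (inv h) = inv \<one>" by simp
 hence "h = \<one>" using h(1) by simp
 thus ?thesis using h(2) gx1[OF u(1)] by simp
qed

lemma PX_pos: assumes "v:PX" shows "EX j:JX. 0 < v (((), j), 0)"
proof -
 obtain c x where c: "c:CX" "x:op (dm c)" "v = chm aX c x" using assms by (rule ptsE)
 thus ?thesis using chm_pos[OF c(2), of aX] by (cases c) (auto simp: CX_iff)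
qed

text \<open>Over each point of the image there is exactly one point in the sheet of
  \<open>g\<close>, so only continuity needs an argument. The lifted values stay in a finite
  subcomplex, and their coordinate \<open>((g, j), 0)\<close> is at least the minimum
  \<open>ep\<close>. They lie in a compact set \<open>P\<close> on which \<open>qm\<close> is
  injective and therefore has a continuous inverse.\<close>

lemma local_section:
 fixes f :: "'k::t2_space => unit pt"
 assumes K: "compact K" and f: "xmap K f" and p: "!!k. k:K ==> 0 < f k (((), j), 0)" and g: "g:carrier G"
 shows "EX L. tmap K L & (ALL k:K. qm (L k) = f k & 0 < L k ((g, j), 0))"
proof -
 define fi where "fi = (%v. SOME u. u:PT & qm u = v & 0 < u ((g, j), 0))"
 have ex: "EX u. u:PT & qm u = v & 0 < u ((g, j), 0)" if v: "v:PX" "0 < v (((), j), 0)" for v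
 proof -
  obtain u0 where u0: "u0:PT" "qm u0 = v" using qm_surj[OF v(1)] by blast
  obtain h where h: "h:carrier G" "0 < u0 ((h, j), 0)" using sheet_ex[OF u0(1), of j] u0(2) v(2) by blast
  let ?u = "gx (g \<otimes> inv h) u0"
  have "?u ((g, j), 0) = u0 ((inv (g \<otimes> inv h) \<otimes> g, j), 0)" using g by (simp add: gx_def)
  also have "inv (g \<otimes> inv h) \<otimes> g = h" using g h(1) by (simp add: inv_mult_group m_assoc)
  finally have "0 < ?u ((g, j), 0)" using h(2) by simp
  moreover have "?u:PT" by (rule gxT[OF _ u0(1)]) (use g h in simp)
  moreover have "qm ?u = v" using qm_gx[OF _ u0(1), of "g \<otimes> inv h"] g h u0(2) by simp
  ultimately show ?thesis by blast
 qed
 have ph: "fi v:PT & qm (fi v) = v & 0 < fi v ((g, j), 0)" if "v:PX" "0 < v (((), j), 0)" for v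
  unfolding fi_def by (rule someI_ex[OF ex[OF that]])
 have ph_eq: "fi (qm u) = u" if u: "u:PT" "0 < u ((g, j), 0)" for u
 proof -
  have "0 < qm u (((), j), 0)" using qm_sheet[OF u] u(2) by simp
  from ph[OF qm_in[OF u(1)] this] show ?thesis using sheet_inj[of "fi (qm u)" g j u] u g by simp
 qed
 obtain F where F: "continuous_on K f" "finite F" "F <= CX" "!!k. k:K ==> f k:pts aX F" using f by (rule cmapE) (rule that; blast)
 have fPX: "f k:PX" if "k:K" for k by (rule cmap_in[OF f that])
 \<comment> \<open>The translates of cell \<open>i\<close> that meet the sheet of \<open>g\<close>.
   They are finitely many, since only finitely many coordinates are nonzero on the untranslated
   cell.\<close>
 define Fi where "Fi = (%i. {h. EX x:op (fst i). h:carrier G & 0 < gch a (h, i) x ((g, j), 0)})"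
 have Fi: "finite (Fi i)" if i: "i:JX" for i
 proof -
  have "EX A. finite A & A <= CT & (ALL u:pts (aG a) {(\<one>, i)}. ALL d k. u (d, k) ~= 0 --> d:A)"
   by (rule supp_finite[OF wfT]) (use i in \<open>simp_all add: CT_iff\<close>)
  then obtain A where A: "finite A" "ALL u:pts (aG a) {(\<one>, i)}. ALL d k. u (d, k) ~= 0 --> d:A" by (elim exE conjE)
  have "Fi i <= (%d. g \<otimes> inv (fst d))`A"
  proof
   fix h assume "h:Fi i"
   then obtain x where x: "x:op (fst i)" "h:carrier G" "0 < gch a (h, i) x ((g, j), 0)" by (auto simp: Fi_def)
   have "ch1 a i x ((inv h \<otimes> g, j), 0) ~= 0"
    using x(3) g unfolding chm_gx1[OF x(2)] by (simp add: gx_def)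
   moreover have "ch1 a i x:pts (aG a) {(\<one>, i)}" using x(1) by (intro ptsI) simp_all
   ultimately have "(inv h \<otimes> g, j):A" using A(2) by blast
   moreover have "h = g \<otimes> inv (inv h \<otimes> g)" using g x(2) by (simp add: inv_mult_group m_assoc[symmetric])
   ultimately show "h:(%d. g \<otimes> inv (fst d))`A" by (intro image_eqI[of _ _ "(inv h \<otimes> g, j)"]) simp_all
  qed
  thus ?thesis using A(1) by (meson finite_imageI finite_subset)
 qed
 define E where "E = (UN i:snd`F. Fi i \<times> {i})"
 have JF: "i:JX" if "i:snd`F" for i using that F(3) by (auto simp: CX_def)
 have E: "finite E" "E <= CT"
 proof -
  show "finite E" unfolding E_def using F(2) Fi JF by (intro finite_UN_I finite_imageI finite_cartesian_product) auto
  show "E <= CT"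
  proof
   fix d assume "d:E"
   then obtain i h where i: "i:snd`F" "h:Fi i" "d = (h, i)" unfolding E_def by blast
   thus "d:CT" using JF[OF i(1)] by (auto simp: Fi_def CT_iff)
  qed
 qed
 obtain E' where E': "subcx (aG a) E'" "E <= E'" "E' <= CT" using subcx_ex[OF wfT E] by (elim exE conjE)
 have lift_in: "fi (f k):pts (aG a) E'" if k: "k:K" for k
 proof -
  have l: "fi (f k):PT" "qm (fi (f k)) = f k" "0 < fi (f k) ((g, j), 0)" using ph[OF fPX[OF k] p[OF k]] by auto
  obtain c x where c: "c:CT" "x:op (dm c)" "fi (f k) = gch a c x" using l(1) by (rule ptsE)
  obtain h i where hi: "c = (h, i)" "h:carrier G" "i:JX" using c(1) by (auto simp: cel_def)
  have "f k = chm aX ((), i) x" using l(2) qm_chm[OF c(1,2)] c(3) hi(1) by simp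
  hence "chm aX ((), i) x:pts aX F" using F(4)[OF k] by simp
  hence "((), i):F" using chm_in_pts_iff[OF wfX F(3), of "((), i)" x] hi c(2) by (simp add: CX_iff)
  hence "i:snd`F" by force
  moreover have "h:Fi i" using hi c(2,3) l(3) by (auto simp: Fi_def)
  ultimately have "c:E'" using E'(2) hi(1) by (auto simp: E_def)
  thus ?thesis using c(2,3) by (simp add: ptsI)
 qed
 have "continuous_on K (%k. fi (f k))"
 proof (cases "K = {}")
  case False
  have "continuous_on K (%k. f k (((), j), 0))" by (rule continuous_on_coord'[OF F(1)])
  from continuous_attains_inf[OF K False this] obtain k0 where k0: "k0:K" "ALL k:K. f k0 (((), j), 0) <= f k (((), j), 0)" by blast
  define ep where "ep = f k0 (((), j), 0)"
  have e: "0 < ep" using p[OF k0(1)] by (simp add: ep_def)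
  define P where "P = {u:pts (aG a) E'. ep <= u ((g, j), 0)}"
  have PP: "u:PT & 0 < u ((g, j), 0)" if "u:P" for u
   using that e pts_mono[OF E'(3), of "aG a"] by (auto simp: P_def)
  have "compact P"
  proof -
   have "closed {u :: 'a pt. ep <= u ((g, j), 0)}"
    by (rule closed_Collect_le[OF continuous_on_const]) (rule continuous_on_product_coordinates)
   moreover have "P = pts (aG a) E' Int {u. ep <= u ((g, j), 0)}" by (auto simp: P_def)
   ultimately show ?thesis using compact_Int_closed[OF subcx_compact[OF wfT E'(3,1)]] by simp
  qed
  have tP: "tmap P (%u. u)"
   by (rule cmapI[OF continuous_on_id _ E'(3)]) (use E'(1) in \<open>auto simp: subcx_def P_def\<close>)
  show ?thesis
  proof (rule quot_continuous[OF Hausdorff_fun, where I = "{()}" and P = "%_. P" and p = "%_. qm"])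
   show "compact P" by fact
   show "continuous_on P qm" using qm_continuous[OF tP] by simp
   show "continuous_on P (%u. fi (qm u))" using ph_eq PP by (simp cong: continuous_on_cong)
   show "f`K <= (UN i:{()}. qm`P)"
   proof (rule image_subsetI)
    fix k assume k: "k:K"
    note l = ph[OF fPX[OF k] p[OF k]]
    have "fi (f k) ((g, j), 0) = f k (((), j), 0)" using qm_sheet[of "fi (f k)" g j] l by simp
    hence "fi (f k):P" using lift_in[OF k] k0(2) k by (simp add: P_def ep_def)
    thus "f k:(UN i:{()}. qm`P)" using l by (simp add: image_iff) metis
   qed
  qed (use K F(1) in simp_all)
 qed simp
 hence "tmap K (%k. fi (f k))"
  using E' lift_in by (intro cmapI[of _ _ E']) (auto simp: subcx_def)
 thus ?thesis using ph[OF fPX p] by (intro exI[of _ "%k. fi (f k)"]) simp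
qed

text \<open>On \<open>Oc g h j\<close> the two lifts lie in the sheets of \<open>g\<close> and of
  \<open>h\<close>. They agree where \<open>g = h\<close> and differ otherwise; both sets of
  parameters are open, and the interval is connected.\<close>

lemma path_unique:
 assumes L: "tmap {0..1::real} L" "tmap {0..1::real} L'" and eq: "!!t. t:{0..1} ==> qm (L t) = qm (L' t)"
  and L0: "L 0 = L' 0" and t: "t:{0..1}"
 shows "L t = L' t"
proof -
 define I where "I = {0..1::real}"
 have LI: "continuous_on I L" "continuous_on I L'" using L by (simp_all add: cmap_def I_def)
 have Lc: "continuous_on I (%t. L t d)" "continuous_on I (%t. L' t d)" for d
  by (rule continuous_on_coord'[OF LI(1)], rule continuous_on_coord'[OF LI(2)])
 have LP: "L t:PT" "L' t:PT" if "t:I" for t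
  by (rule cmap_in[OF L(1) that[unfolded I_def]], rule cmap_in[OF L(2) that[unfolded I_def]])
 define Oc where "Oc = (%g h j. {t:I. 0 < L t ((g, j), 0) & 0 < L' t ((h, j), 0)})"
 have op: "openin (top_of_set I) (Oc g h j)" for g h j
 proof -
  have "openin (top_of_set I) (I Int (%t. L t ((g, j), 0)) -` {0<..})" "openin (top_of_set I) (I Int (%t. L' t ((h, j), 0)) -` {0<..})"
   using Lc by (intro continuous_openin_preimage_gen; simp)+
  from openin_Int[OF this] show ?thesis by (rule back_subst[of "openin (top_of_set I)"]) (auto simp: Oc_def)
 qed
 have cov: "EX g:carrier G. EX h:carrier G. EX j. t:Oc g h j" if t: "t:I" for t
 proof -
  obtain j where j: "0 < qm (L t) (((), j), 0)" using PX_pos[OF qm_in[OF LP(1)[OF t]]] by blast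
  hence "0 < qm (L' t) (((), j), 0)" using eq t by (simp add: I_def)
  then obtain h where h: "h:carrier G" "0 < L' t ((h, j), 0)" using sheet_ex[OF LP(2)[OF t]] by blast
  obtain g where g: "g:carrier G" "0 < L t ((g, j), 0)" using sheet_ex[OF LP(1)[OF t] j] by blast
  have "t:Oc g h j" using t g h by (simp add: Oc_def)
  thus ?thesis using g(1) h(1) by blast
 qed
 define E where "E = (UN g:carrier G. UN j. Oc g g j)"
 define D where "D = (UN g:carrier G. UN h:carrier G - {g}. UN j. Oc g h j)"
 have oE: "openin (top_of_set I) E" unfolding E_def by (auto intro!: openin_Union op)
 have oD: "openin (top_of_set I) D" unfolding D_def by (auto intro!: openin_Union op)
 have cE: "L t = L' t" if tE: "t:E" for t
 proof -
  obtain g j where g: "g:carrier G" "t:Oc g g j" using tE unfolding E_def by (elim UN_E)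
  hence t: "t:I" "0 < L t ((g, j), 0)" "0 < L' t ((g, j), 0)" by (auto simp: Oc_def)
  show ?thesis by (rule sheet_inj[OF LP(1)[OF t(1)] t(2) LP(2)[OF t(1)] t(3) _ g(1)]) (use eq t(1) in \<open>simp add: I_def\<close>)
 qed
 have cD: "L t ~= L' t" if tD: "t:D" for t
 proof
  assume e: "L t = L' t"
  obtain g h j where "h:carrier G - {g}" and g2: "t:Oc g h j" using tD unfolding D_def by (elim UN_E)
  hence g: "g ~= h" "t:Oc g h j" by auto
  hence "t:I" "0 < L t ((g, j), 0)" "0 < L t ((h, j), 0)" using e by (auto simp: Oc_def)
  thus False using sheets_disjoint[OF LP(1)[OF \<open>t : I\<close>], of g j h] g(1) by simp
 qed
 have "I <= E Un D"
 proof
  fix t assume "t:I"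
  from cov[OF this] obtain g h j where g: "g:carrier G" "h:carrier G" "t:Oc g h j" by (elim bexE exE)
  show "t:E Un D"
  proof (cases "g = h")
   case True
   hence "t:E" using g unfolding E_def by (intro UN_I[of g] UN_I[of j]) simp_all
   thus ?thesis by simp
  next
   case False
   hence "t:D" using g unfolding D_def by (intro UN_I[of g] UN_I[of h] UN_I[of j]) simp_all
   thus ?thesis by simp
  qed
 qed
 moreover have "E Int D = {}" using cE cD by blast
 moreover have "connected I" unfolding I_def by simp
 ultimately have "E = {} | D = {}" using oE oD unfolding connected_openin by blast
 moreover have "0:I" by (simp add: I_def)
 hence "0 ~: D" using cD L0 by blast
 hence "0:E" using \<open>I <= E Un D\<close> \<open>0 : I\<close> by blast
 ultimately have "D = {}" by blast
 hence "t:E" using \<open>I <= E Un D\<close> t by (auto simp: I_def)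
 thus ?thesis by (rule cE)
qed

section \<open>Lifting of maps on cubes\<close>

lemma seg_unique:
 assumes K: "seg K" and L: "tmap K L" "tmap K L'" and eq: "!!x. x:K ==> qm (L x) = qm (L' x)"
  and b: "b:K" "L b = L' b" and x: "x:K"
 shows "L x = L' x"
proof -
 define l where "l = (%t::real. (%i. (1 - t) * b i + t * x i))"
 have lc: "continuous_on {0..1} l" unfolding l_def by (rule line_continuous)
 have lK: "l`{0..1} <= K" using K b(1) x by (auto simp: seg_def l_def)
 have l01: "l 0 = b" "l 1 = x" by (simp_all add: l_def)
 have "L (l 1) = L' (l 1)"
 proof (rule path_unique[of "%t. L (l t)" "%t. L' (l t)"])
  show "tmap {0..1} (%t. L (l t))" "tmap {0..1} (%t. L' (l t))"
   by (rule cmap_compose[OF L(1) lc lK], rule cmap_compose[OF L(2) lc lK])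
  show "qm (L (l t)) = qm (L' (l t))" if "t:{0..1}" for t using eq lK that by blast
 qed (use b l01 in simp_all)
 thus ?thesis using l01 by simp
qed

text \<open>The value of the lift may be prescribed at any point of \<open>K\<close>, which allows
  pieces to be joined at a common point in either order.\<close>

definition liftable :: "rseq set => (rseq => unit pt) => bool" where
 "liftable K f \<longleftrightarrow> (ALL b:K. ALL u:PT. qm u = f b --> (EX L. tmap K L & (ALL x:K. qm (L x) = f x) & L b = u))"

text \<open>The lift on one piece is continued from a common point over the other piece. The overlap
  is convex, so the two lifts agree on all of it.\<close>

lemma liftable_Un:
 assumes A: "liftable A f" "closed A" "seg A" and B: "liftable B f" "closed B" "seg B" and AB: "A ~= {} ==> B ~= {} ==> A Int B ~= {}"
 shows "liftable (A Un B) f"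
proof -
 have half: "EX L. tmap (A Un B) L & (ALL x:A Un B. qm (L x) = f x) & L b = u"
  if A: "liftable A f" "closed A" "seg A" and B: "liftable B f" "closed B" "seg B" and AB: "A ~= {} ==> B ~= {} ==> A Int B ~= {}"
   and b: "b:A" and u: "u:PT" "qm u = f b" for A B b u
 proof -
  obtain L where L: "tmap A L" "ALL x:A. qm (L x) = f x" "L b = u" using A(1) b u unfolding liftable_def by blast
  show ?thesis
  proof (cases "B = {}")
   case True
   thus ?thesis using L by (intro exI[of _ L]) simp
  next
   case False
   then obtain c where c: "c:A" "c:B" using AB b by blast
   have "L c:PT" by (rule cmap_in[OF L(1) c(1)])
   moreover have "qm (L c) = f c" using L(2) c(1) by blast
   ultimately obtain L' where L': "tmap B L'" "ALL x:B. qm (L' x) = f x" "L' c = L c" using B(1) c(2) unfolding liftable_def by blast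
   have AB: "seg (A Int B)" using A(3) B(3) by (simp add: seg_def)
   have agree: "L x = L' x" if "x:A Int B" for x
   proof (rule seg_unique[OF AB _ _ _ _ _ that])
    show "tmap (A Int B) L" "tmap (A Int B) L'" using cmap_subset[OF L(1)] cmap_subset[OF L'(1)] by auto
    show "qm (L x) = qm (L' x)" if "x:A Int B" for x using L(2) L'(2) that by simp
    show "c:A Int B" "L c = L' c" using c L'(3) by simp_all
   qed
   define M where "M = (%x. if x:A then L x else L' x)"
   have MB: "M x = L' x" if "x:B" for x using agree that by (simp add: M_def)
   have "tmap A M" using L(1) cmap_cong[of A M L] by (simp add: M_def)
   moreover have "tmap B M" using L'(1) cmap_cong[of B M L'] MB by simp
   ultimately have "tmap (A Un B) M" by (rule cmap_Un[OF A(2) B(2)])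
   moreover have "ALL x:A Un B. qm (M x) = f x" using L(2) L'(2) by (auto simp: M_def)
   ultimately show ?thesis using L(3) b by (intro exI[of _ M]) (simp add: M_def)
  qed
 qed
 show ?thesis
  unfolding liftable_def
 proof (intro ballI impI)
  fix b u assume b: "b:A Un B" and u: "u:PT" "qm u = f b"
  show "EX L. tmap (A Un B) L & (ALL x:A Un B. qm (L x) = f x) & L b = u"
  proof (cases "b:A")
   case True
   thus ?thesis using half[OF A B AB True u] by simp
  next
   case False
   hence "b:B" using b by simp
   from half[OF B A _ this u] AB show ?thesis by (auto simp: Un_commute Int_commute)
  qed
 qed
qed

definition bx :: "nat => rseq => rseq => rseq set" where
 "bx n l h = {x:cb n. ALL i<n. l i <= x i & x i <= h i}"

lemma bx_seg: "seg (bx n l h)"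
 unfolding seg_def
proof (intro ballI)
 fix x y and t :: real assume x: "x:bx n l h" and y: "y:bx n l h" and t: "t:{0..1}"
 have t': "0 <= 1 - t" "0 <= t" using t by auto
 have c: "c <= (1 - t) * p + t * q & (1 - t) * p + t * q <= d" if "c <= p" "p <= d" "c <= q" "q <= d" for p q c d :: real
 proof
  have "(1 - t) * c + t * c <= (1 - t) * p + t * q" using that t' by (intro add_mono mult_left_mono) auto
  thus "c <= (1 - t) * p + t * q" by (simp add: algebra_simps)
  have "(1 - t) * p + t * q <= (1 - t) * d + t * d" using that t' by (intro add_mono mult_left_mono) auto
  thus "(1 - t) * p + t * q <= d" by (simp add: algebra_simps)
 qed
 show "(%i. (1 - t) * x i + t * y i):bx n l h"
  unfolding bx_def cb_def mem_Collect_eq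
 proof (intro conjI allI impI)
  fix i assume i: "i < n"
  have xi: "0 <= x i" "x i <= 1" "l i <= x i" "x i <= h i" and yi: "0 <= y i" "y i <= 1" "l i <= y i" "y i <= h i"
   using x y i by (auto simp: bx_def cb_def)
  show "0 <= (1 - t) * x i + t * y i" "(1 - t) * x i + t * y i <= 1" using c[of 0 "x i" 1 "y i"] xi yi by auto
  show "l i <= (1 - t) * x i + t * y i" "(1 - t) * x i + t * y i <= h i" using c[of "l i" "x i" "h i" "y i"] xi yi by auto
 next
  fix i assume "n <= i"
  thus "(1 - t) * x i + t * y i = 0" using x y by (simp add: bx_def cb_def)
 qed
qed

lemma bx_compact: "compact (bx n l h)"
proof -
 have "bx n l h = cb n Int (\<Inter>i\<in>{..<n}. {x. l i <= x i} Int {x. x i <= h i})" by (auto simp: bx_def)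
 moreover have "closed {x. l i <= x i}" "closed {x::nat => real. x i <= h i}" for i
  by (intro closed_Collect_le continuous_on_const continuous_on_product_coordinates)+
 ultimately show ?thesis using compact_Int_closed[OF compact_cb] by (simp add: closed_INT closed_Int)
qed

text \<open>Boxes smaller than a Lebesgue number of the cover by the sets \<open>V j\<close> lift
  into one sheet. Larger boxes are cut into slabs of width \<open>1 / M\<close>, one coordinate
  after the other.\<close>

lemma cb_liftable: assumes f: "xmap (cb n) f" shows "liftable (cb n) f"
proof -
 have fc: "continuous_on (cb n) f" using f by (simp add: cmap_def)
 define V where "V = (%j. {x:cb n. 0 < f x (((), j), 0)})"
 have "ALL j. EX W. open W & V j = cb n Int W"
 proof
  fix j
  have "openin (top_of_set (cb n)) (cb n Int (%x. f x (((), j), 0)) -` {0<..})"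
   using continuous_on_coord'[OF fc] by (intro continuous_openin_preimage_gen) auto
  moreover have "cb n Int (%x. f x (((), j), 0)) -` {0<..} = V j" by (auto simp: V_def)
  ultimately show "EX W. open W & V j = cb n Int W" by (simp add: openin_open)
 qed
 from choice[OF this] obtain W where W: "ALL j. open (W j) & V j = cb n Int W j" by (elim exE)
 have "cb n <= Union (range W)"
 proof
  fix x assume x: "x:cb n"
  then obtain j where "0 < f x (((), j), 0)" using PX_pos[OF cmap_in[OF f x]] by blast
  hence "x:V j" using x by (simp add: V_def)
  thus "x:Union (range W)" using W by blast
 qed
 then obtain e where e: "0 < e" "ALL x:cb n. EX B:range W. ball x e <= B"
  using Heine_Borel_lemma[OF compact_cb, of n "range W"] W by (metis rangeE)
 obtain M :: nat where M: "2 / e < M" using reals_Archimedean2 by blast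
 have M0: "0 < real M" using M e(1) by (smt (verit) divide_pos_pos)
 have M2: "2 * (1 / real M) < e" using M M0 e(1) by (simp add: field_simps)
 have small: "liftable (bx n l h) f" if lh: "ALL i<n. h i - l i <= 1 / M" for l h
  unfolding liftable_def
 proof (intro ballI impI)
  fix b u assume b: "b:bx n l h" and u: "u:PT" "qm u = f b"
  have bc: "b:cb n" using b by (simp add: bx_def)
  then obtain j where j: "ball b e <= W j" using e(2) by blast
  have pos: "0 < f x (((), j), 0)" if x: "x:bx n l h" for x
  proof -
   have xc: "x:cb n" using x by (simp add: bx_def)
   have "\<bar>b i - x i\<bar> <= 1 / M" for i
   proof (cases "i < n")
    case True
    hence "l i <= b i" "b i <= h i" "l i <= x i" "x i <= h i" "h i - l i <= 1 / M" using b x lh by (auto simp: bx_def)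
    thus ?thesis by linarith
   next
    case False
    thus ?thesis using bc xc by (simp add: cb_def)
   qed
   hence "dist b x <= 2 * (1 / M)" by (rule dist_fun_le)
   hence "x:W j" using j M2 by (auto simp: ball_def)
   hence "x:V j" using W xc by blast
   thus ?thesis by (simp add: V_def)
  qed
  obtain g where g: "g:carrier G" "0 < u ((g, j), 0)" using sheet_ex[OF u(1), of j] u(2) pos[OF b] by auto
  have sub: "bx n l h <= cb n" by (auto simp: bx_def)
  have "EX L. tmap (bx n l h) L & (ALL k:bx n l h. qm (L k) = f k & 0 < L k ((g, j), 0))"
   by (rule local_section[OF bx_compact cmap_subset[OF f sub] pos g(1)])
  then obtain L where L: "tmap (bx n l h) L" "ALL k:bx n l h. qm (L k) = f k & 0 < L k ((g, j), 0)" by (elim exE conjE)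
  have "L b = u"
   by (rule sheet_inj[OF cmap_in[OF L(1) b] _ u(1) g(2) _ g(1)]) (use L(2) b u(2) in auto)
  thus "EX L. tmap (bx n l h) L & (ALL x:bx n l h. qm (L x) = f x) & L b = u" using L by blast
 qed
 \<comment> \<open>Coordinates below \<open>k\<close> are unrestricted, the others have width at
   most \<open>1 / M\<close>. The inner induction on \<open>m\<close> cuts off slabs in coordinate
   \<open>k\<close>.\<close>
 have main: "ALL l h. (ALL i<n. k <= i --> h i - l i <= 1 / M) --> liftable (bx n l h) f" if "k <= n" for k
  using that
 proof (induction k)
  case 0
  thus ?case using small by simp
 next
  case (Suc k)
  hence IH: "!!l h. (ALL i<n. k <= i --> h i - l i <= 1 / M) ==> liftable (bx n l h) f" and kn: "k < n" by auto
  have "ALL l h. (ALL i<n. Suc k <= i --> h i - l i <= 1 / M) & h k - l k <= real m / M --> liftable (bx n l h) f" for m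
  proof (induction m)
   case 0
   show ?case
   proof (intro allI impI, elim conjE)
    fix l h :: "nat => real" assume a: "ALL i<n. Suc k <= i --> h i - l i <= 1 / M" "h k - l k <= real 0 / M"
    have "h k - l k <= 0" using a(2) by simp
    also have "0 <= 1 / real M" by simp
    finally have "ALL i<n. k <= i --> h i - l i <= 1 / M" using a(1) by (auto simp: le_eq_less_or_eq[of k])
    thus "liftable (bx n l h) f" by (rule IH)
   qed
  next
   case (Suc m)
   show ?case
   proof (intro allI impI, elim conjE)
    fix l h :: "nat => real" assume a: "ALL i<n. Suc k <= i --> h i - l i <= 1 / M" "h k - l k <= real (Suc m) / M"
    show "liftable (bx n l h) f"
    proof (cases "h k - l k <= 1 / M")
     case True
     hence "ALL i<n. k <= i --> h i - l i <= 1 / M" using a by (auto simp: le_eq_less_or_eq[of k])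
     thus ?thesis by (rule IH)
    next
     case False
     define c where "c = l k + 1 / M"
     let ?A = "bx n l (h(k := c))" and ?B = "bx n (l(k := c)) h"
     have c: "l k <= c" "c <= h k" using False M0 by (auto simp: c_def)
     have U: "bx n l h = ?A Un ?B"
     proof -
      have "?A = {x:bx n l h. x k <= c}" using c kn by (fastforce simp: bx_def split: if_splits)
      moreover have "?B = {x:bx n l h. c <= x k}" using c kn by (fastforce simp: bx_def split: if_splits)
      ultimately show ?thesis by auto
     qed
     have "liftable ?A f" by (rule IH) (use a in \<open>auto simp: c_def le_eq_less_or_eq[of k]\<close>)
     moreover have "h k - c <= real m / M" using a(2) by (simp add: c_def add_divide_distrib)
     hence "liftable ?B f" using Suc.IH a(1) by simp
     moreover have "?A Int ?B ~= {}" if ne: "?A ~= {}" "?B ~= {}"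
     proof -
      obtain x y where x: "x:?A" and y: "y:?B" using ne by blast
      have "x k <= c" "c <= y k" "0 <= x k" "y k <= 1" using x y kn by (auto simp: bx_def cb_def)
      hence "x(k := c):?A Int ?B" using x c kn by (auto simp: bx_def cb_def)
      thus ?thesis by blast
     qed
     ultimately show ?thesis unfolding U
      by (intro liftable_Un bx_seg compact_imp_closed[OF bx_compact])
    qed
   qed
  qed
  note inner = this
  show ?case
  proof (intro allI impI)
   fix l h :: "nat => real" assume a: "ALL i<n. Suc k <= i --> h i - l i <= 1 / M"
   obtain m :: nat where "(h k - l k) * M < m" using reals_Archimedean2 by blast
   hence "h k - l k <= real m / M" using M0 by (simp add: field_simps)
   thus "liftable (bx n l h) f" using inner[of m] a by blast
  qed
 qed
 have "liftable (bx n (%_. 0) (%_. 1)) f" using main[OF order_refl] by simp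
 moreover have "bx n (%_. 0) (%_. 1) = cb n" by (auto simp: bx_def cb_def)
 ultimately show ?thesis by simp
qed

lemma cb_seg: "seg (cb n)"
proof -
 have "bx n (%_. 0) (%_. 1) = cb n" by (auto simp: bx_def cb_def)
 thus ?thesis using bx_seg[of n "%_. 0" "%_. 1"] by simp
qed

lemma lift_ex:
 assumes "xmap (cb n) f" "b:cb n" "u:PT" "qm u = f b"
 obtains L where "tmap (cb n) L" "!!x. x:cb n ==> qm (L x) = f x" "L b = u"
 using cb_liftable[OF assms(1)] assms(2-4) unfolding liftable_def by blast

end

section \<open>Discs and cubes\<close>

definition dsc :: "nat => rseq set" where
 "dsc n = {v. (ALL i>=n. v i = 0) & (SUM i<n. v i ^ 2) <= 1}"

lemma disc_eq: "disc n = top_of_set (dsc n)"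
proof -
 have "{x::nat => real. ALL i>=n. x i = 0} Int {x. (SUM i<n. x i ^ 2) <= 1} = dsc n"
  by (auto simp: dsc_def)
 thus ?thesis
  unfolding disc_def Euclidean_space_def subtopology_subtopology euclidean_product_topology by simp
qed

definition l2 :: "nat => rseq => real" where
 "l2 n v = sqrt (SUM i<n. v i ^ 2)"

definition sh :: "nat => rseq => nat => real" where
 "sh n v = (%i. if i < n then (v i + 1) / 2 else 0)"

definition ush :: "nat => rseq => nat => real" where
 "ush n x = (%i. if i < n then 2 * x i - 1 else 0)"

text \<open>Both maps are radial. The denominators are chosen so that the two maps are inverse to each other
  and the Euclidean unit sphere corresponds to the boundary of the cube.\<close>

definition d2c :: "nat => rseq => nat => real" where
 "d2c n v = scl n (1 / (1 + nrm n (sh n v) - l2 n v)) (sh n v)"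

definition c2d :: "nat => rseq => nat => real" where
 "c2d n x = (%i. ush n x i / (1 + l2 n (ush n x) - nrm n x))"

lemma l2_scale: "l2 n (%i. v i / c) = l2 n v / \<bar>c\<bar>"
 by (simp add: l2_def power_divide sum_divide_distrib[symmetric] real_sqrt_divide)

lemma l2_cong: "(!!i. i < n ==> v i = w i) ==> l2 n v = l2 n w"
 unfolding l2_def by (intro arg_cong[of _ _ sqrt] sum.cong) auto

lemma abs_le_l2: assumes "i < n" shows "\<bar>v i\<bar> <= l2 n v"
proof -
 have "v i ^ 2 <= (SUM i<n. v i ^ 2)" using assms by (intro member_le_sum) auto
 hence "sqrt (v i ^ 2) <= l2 n v" unfolding l2_def by (rule real_sqrt_le_mono)
 thus ?thesis by simp
qed

lemma l2_nonneg: "0 <= l2 n v"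
 by (simp add: l2_def sum_nonneg)

lemma nrm_sh_le: "nrm n (sh n v) <= l2 n v"
 unfolding nrm_le_iff[OF l2_nonneg]
proof (intro allI impI)
 fix i assume i: "i < n"
 hence "2 * sh n v i - 1 = v i" by (simp add: sh_def field_simps)
 thus "\<bar>2 * sh n v i - 1\<bar> <= l2 n v" using abs_le_l2[OF i] by simp
qed

lemma sh_ush: "x:cb n ==> sh n (ush n x) = x"
 by (auto simp: sh_def ush_def cb_def)

lemma nrm_le_l2: "x:cb n ==> nrm n x <= l2 n (ush n x)"
 using nrm_sh_le[of n "ush n x"] by (simp add: sh_ush)

lemma l2_dsc: "v:dsc n ==> l2 n v <= 1"
 by (simp add: dsc_def l2_def)

text \<open>On the disc the denominator could vanish only if \<open>l2\<close> were 1 and the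
  maximum norm 0, but the two norms vanish together.\<close>

lemma d2c_den: assumes "v:dsc n" shows "0 < 1 + nrm n (sh n v) - l2 n v"
proof (cases "nrm n (sh n v) = 0")
 case True
 have "v i = 0" if "i < n" for i using nrm_ge[OF that, of "sh n v"] True that by (simp add: sh_def)
 hence "l2 n v = 0" by (simp add: l2_def)
 thus ?thesis using True by simp
next
 case False
 thus ?thesis using l2_dsc[OF assms] nrm_nonneg[of n "sh n v"] by linarith
qed

lemma nrm_d2c: "v:dsc n ==> nrm n (d2c n v) = nrm n (sh n v) / (1 + nrm n (sh n v) - l2 n v)"
 using d2c_den[of v n] by (simp add: d2c_def nrm_scl)

lemma d2c_cb: assumes "v:dsc n" shows "d2c n v:cb n"
 using nrm_d2c[OF assms] d2c_den[OF assms] l2_dsc[OF assms] by (simp add: mem_cb_iff) (simp add: d2c_def scl_def)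

lemma d2c_bd: assumes "v:dsc n" "(SUM i<n. v i ^ 2) = 1" shows "d2c n v:bd n"
proof -
 have "l2 n v = 1" using assms(2) by (simp add: l2_def)
 hence "nrm n (d2c n v) = 1" using nrm_d2c[OF assms(1)] d2c_den[OF assms(1)] by simp
 thus ?thesis using d2c_cb[OF assms(1)] by (simp add: mem_bd_iff mem_cb_iff)
qed

lemma d2c_op: assumes "v:dsc n" "(SUM i<n. v i ^ 2) < 1" shows "d2c n v:op n"
proof -
 have "l2 n v < 1" using assms(2) by (simp add: l2_def)
 hence "nrm n (d2c n v) < 1" using nrm_d2c[OF assms(1)] d2c_den[OF assms(1)] by simp
 thus ?thesis using d2c_cb[OF assms(1)] by (simp add: mem_op_iff)
qed

lemma d2c_continuous: "continuous_on (dsc n) (d2c n)"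
proof -
 have s: "continuous_on (dsc n) (sh n)"
 proof (rule continuous_on_pointwise)
  fix i
  have "continuous_on (dsc n) (%v. (v i + 1) / 2)"
   by (intro ctn) auto
  thus "continuous_on (dsc n) (%v. sh n v i)" by (cases "i < n") (simp_all add: sh_def)
 qed
 have l: "continuous_on (dsc n) (l2 n)"
  unfolding l2_def by (intro continuous_on_real_sqrt continuous_on_sum continuous_on_power continuous_on_coord)
 show ?thesis
  unfolding d2c_def
  by (intro continuous_on_scl ctn continuous_on_nrm s l)
   (use d2c_den in force)
qed

lemma c2d_den: "x:cb n ==> 1 <= 1 + l2 n (ush n x) - nrm n x"
 using nrm_le_l2[of x n] by simp

lemma c2d_continuous: "continuous_on (cb n) (c2d n)"
proof -
 have u: "continuous_on (cb n) (ush n)"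
 proof (rule continuous_on_pointwise)
  fix i
  have "continuous_on (cb n) (%v. 2 * v i - 1)"
   by (intro ctn)
  thus "continuous_on (cb n) (%v. ush n v i)" by (cases "i < n") (simp_all add: ush_def)
 qed
 have l: "continuous_on (cb n) (%x. l2 n (ush n x))"
  unfolding l2_def by (intro continuous_on_real_sqrt continuous_on_sum continuous_on_power continuous_on_coord'[OF u])
 show ?thesis
 proof (rule continuous_on_pointwise)
  fix i
  show "continuous_on (cb n) (%x. c2d n x i)"
   unfolding c2d_def
   by (intro continuous_on_divide continuous_on_coord'[OF u] ctn l continuous_on_nrm continuous_on_id)
    (use c2d_den in force)
 qed
qed

lemma c2d_d2c: assumes v: "v:dsc n" shows "c2d n (d2c n v) = v"
proof -
 define A where "A = 1 + nrm n (sh n v) - l2 n v"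
 have A: "0 < A" using d2c_den[OF v] by (simp add: A_def)
 have u: "ush n (d2c n v) i = v i / A" for i
 proof (cases "i < n")
  case True
  hence "d2c n v i = 1/2 + 1 / A * (sh n v i - 1/2)" by (simp only: d2c_def scl_def A_def if_True)
  thus ?thesis using True by (simp add: ush_def sh_def field_simps)
 next
  case False
  thus ?thesis using v by (simp add: ush_def dsc_def)
 qed
 have "l2 n (ush n (d2c n v)) = l2 n v / A" using l2_cong[of n "ush n (d2c n v)" "%i. v i / A"] u l2_scale[of n v A] A by simp
 hence "1 + l2 n (ush n (d2c n v)) - nrm n (d2c n v) = 1 + (l2 n v - nrm n (sh n v)) / A"
  using nrm_d2c[OF v] by (simp add: A_def diff_divide_distrib)
 also have "\<dots> = 1 / A" using A by (simp add: field_simps) (simp add: A_def)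
 finally show ?thesis using u A by (simp add: c2d_def fun_eq_iff)
qed

lemma d2c_c2d: assumes x: "x:cb n" shows "d2c n (c2d n x) = x" "c2d n x:dsc n" "nrm n x < 1 ==> (SUM i<n. c2d n x i ^ 2) < 1"
proof -
 define B where "B = 1 + l2 n (ush n x) - nrm n x"
 have B: "1 <= B" using c2d_den[OF x] by (simp add: B_def)
 have c: "c2d n x = (%i. ush n x i / B)" by (simp add: c2d_def B_def)
 have l: "l2 n (c2d n x) = l2 n (ush n x) / B" unfolding c l2_scale using B by simp
 have lB: "l2 n (ush n x) <= B" using x by (simp add: B_def mem_cb_iff)
 have "l2 n (c2d n x) <= 1" using l lB B by simp
 hence s1: "(SUM i<n. c2d n x i ^ 2) <= 1" by (simp add: l2_def)
 thus d: "c2d n x:dsc n" by (simp add: dsc_def c ush_def)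
 show "(SUM i<n. c2d n x i ^ 2) < 1" if "nrm n x < 1"
 proof -
  have "l2 n (ush n x) < B" using that by (simp add: B_def)
  hence "l2 n (c2d n x) < 1" using l B by simp
  thus ?thesis by (simp add: l2_def)
 qed
 have s: "sh n (c2d n x) = scl n (1 / B) x"
  using B by (auto simp: sh_def c ush_def scl_def fun_eq_iff field_simps)
 have "nrm n (sh n (c2d n x)) = nrm n x / B" unfolding s nrm_scl using B by simp
 hence "1 + nrm n (sh n (c2d n x)) - l2 n (c2d n x) = 1 + (nrm n x - l2 n (ush n x)) / B"
  using l by (simp add: diff_divide_distrib)
 also have "\<dots> = 1 / B" using B by (simp add: field_simps) (simp add: B_def)
 finally have "d2c n (c2d n x) = scl n B (scl n (1 / B) x)" unfolding d2c_def s by simp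
 also have "\<dots> = x" using B scl_1[OF x] by (simp add: scl_scl)
 finally show "d2c n (c2d n x) = x" .
qed

section \<open>The weak topology\<close>

text \<open>Characteristic maps with values in real functions. By \<open>read\<close> each cell has
  coordinates that give \<open>1 - nrm\<close> and its products with the position; dividing them
  recovers the position in the open cell.\<close>

locale cws =
 fixes C :: "(nat \<times> nat) set" and ph :: "nat \<times> nat => rseq => 'e => real"
 assumes cont: "c:C ==> continuous_on (cb (fst c)) (ph c)"
  and uniq: "c:C ==> c':C ==> x:op (fst c) ==> y:op (fst c') ==> ph c x = ph c' y ==> c = c' & x = y"
  and fin: "c:C ==> EX F. finite F & F <= C & (ALL d:F. fst d < fst c) & ph c`bd (fst c) <= (UN d:F. ph d`op (fst d))"
  and read: "c:C ==> EX e0 e. ALL x:cb (fst c). ph c x e0 = 1 - nrm (fst c) x & (ALL i. ph c x (e i) = (1 - nrm (fst c) x) * x i)"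
begin

definition pt :: "(nat \<times> nat) set => ('e => real) set" where
 "pt D = (UN c:D. ph c`op (fst c))"

text \<open>The weak topology, tested on closed cells; by \<open>id_map\<close> it refines the
  product topology.\<close>

definition wop :: "('e => real) set => bool" where
 "wop U \<longleftrightarrow> U <= pt C & (ALL c:C. openin (top_of_set (cb (fst c))) {x:cb (fst c). ph c x:U})"

definition wt :: "('e => real) topology" where "wt = topology wop"

lemma ph_fin:
 assumes c: "c:C" shows "EX F. finite F & F <= C & ph c`cb (fst c) <= pt F"
proof -
 obtain F where F: "finite F" "F <= C" "ph c`bd (fst c) <= pt F" using fin[OF c] by (auto simp: pt_def)
 have "ph c`cb (fst c) <= pt (insert c F)" using F(3) op_bd by (fastforce simp: pt_def)
 thus ?thesis using F c by (intro exI[of _ "insert c F"]) simp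
qed

lemma pt_mono: "D <= D' ==> pt D <= pt D'"
 unfolding pt_def by blast

lemma ph_in: assumes c: "c:C" "x:cb (fst c)" shows "ph c x:pt C"
 using ph_fin[OF c(1)] c(2) pt_mono by blast

lemma openin_wt: "openin wt U \<longleftrightarrow> wop U"
proof -
 have "istopology wop"
  unfolding istopology_def
 proof (intro conjI allI impI)
  fix U V assume U: "wop U" and V: "wop V"
  have "openin (top_of_set (cb (fst c))) {x:cb (fst c). ph c x:U Int V}" if "c:C" for c
  proof -
   have "{x:cb (fst c). ph c x:U Int V} = {x:cb (fst c). ph c x:U} Int {x:cb (fst c). ph c x:V}" by auto
   thus ?thesis using U V that by (simp add: wop_def openin_Int)
  qed
  thus "wop (U Int V)" using U by (auto simp: wop_def)
 next
  fix K assume K: "ALL U:K. wop U"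
  have "openin (top_of_set (cb (fst c))) {x:cb (fst c). ph c x:\<Union>K}" if "c:C" for c
  proof -
   have "{x:cb (fst c). ph c x:\<Union>K} = (UN U:K. {x:cb (fst c). ph c x:U})" by auto
   moreover have "openin (top_of_set (cb (fst c))) (UN U:K. {x:cb (fst c). ph c x:U})"
    using K that by (intro openin_Union) (auto simp: wop_def)
   ultimately show ?thesis by simp
  qed
  thus "wop (\<Union>K)" using K by (auto simp: wop_def)
 qed
 thus ?thesis by (simp add: wt_def topology_inverse')
qed

lemma topspace_wt: "topspace wt = pt C"
proof -
 have "{x:cb (fst c). ph c x:pt C} = cb (fst c)" if "c:C" for c using ph_in[OF that] by blast
 hence "wop (pt C)" by (simp add: wop_def)
 hence "pt C <= topspace wt" by (simp add: openin_wt openin_subset)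
 moreover have "topspace wt <= pt C" using openin_topspace[of wt] unfolding openin_wt wop_def by (rule conjunct1)
 ultimately show ?thesis by blast
qed

lemma closedin_wt: "closedin wt A \<longleftrightarrow> A <= pt C & (ALL c:C. closedin (top_of_set (cb (fst c))) {x:cb (fst c). ph c x:A})"
proof -
 have "cb (fst c) - {x:cb (fst c). ph c x:A} = {x:cb (fst c). ph c x:pt C - A}" if "c:C" for c
  using ph_in[OF that] by blast
 thus ?thesis by (auto simp: closedin_def topspace_wt openin_wt wop_def)
qed

lemma ph_map: "c:C ==> continuous_map (top_of_set (cb (fst c))) wt (ph c)"
 unfolding continuous_map_def using ph_in by (auto simp: topspace_wt openin_wt wop_def)

lemma id_map: "continuous_map wt euclidean (%u. u)"
 unfolding continuous_map_def
proof (intro conjI allI impI)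
 fix U :: "('e => real) set" assume "openin euclidean U"
 hence U: "open U" by simp
 have "openin (top_of_set (cb (fst c))) {x:cb (fst c). ph c x:{u:topspace wt. u:U}}" if "c:C" for c
 proof -
  have "{x:cb (fst c). ph c x:{u:topspace wt. u:U}} = cb (fst c) Int ph c -` U"
   using ph_in[OF that] by (auto simp: topspace_wt)
  thus ?thesis using continuous_openin_preimage_gen[OF cont[OF that] U] by simp
 qed
 thus "openin wt {u:topspace wt. u:U}" by (auto simp: openin_wt wop_def topspace_wt)
qed simp

lemma Hausdorff_wt: "Hausdorff_space wt"
 by (rule Hausdorff_space_injective_preimage[OF Hausdorff_fun id_map]) simp

text \<open>Choose a point of \<open>K\<close> in every open cell that \<open>K\<close> meets. A
  closed cell contains finitely many of these points, so each set of them is closed and they do not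
  accumulate; by compactness they are finitely many.\<close>

lemma compact_fin:
 assumes K: "compactin wt K" shows "EX F. finite F & F <= C & K <= pt F"
proof -
 define F where "F = {c:C. K Int ph c`op (fst c) ~= {}}"
 have "ALL c. EX u. c:F --> u:K Int ph c`op (fst c)" by (auto simp: F_def)
 from choice[OF this] obtain s where s: "ALL c. c:F --> s c:K Int ph c`op (fst c)" by (elim exE)
 have KC: "K <= pt C" using compactin_subset_topspace[OF K] by (simp add: topspace_wt)
 have inj: "inj_on s F"
 proof (rule inj_onI)
  fix c d assume cd: "c:F" "d:F" "s c = s d"
  obtain x where x: "x:op (fst c)" "s c = ph c x" using s cd(1) by blast
  obtain y where y: "y:op (fst d)" "s d = ph d y" using s cd(2) by blast
  have "c:C" "d:C" using cd(1,2) by (auto simp: F_def)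
  thus "c = d" using uniq[of c d x y] x y cd(3) by simp
 qed
 have cl: "closedin wt T" if T: "T <= s`F" for T
  unfolding closedin_wt
 proof (intro conjI ballI)
  show "T <= pt C" using T s KC by blast
  fix c assume c: "c:C"
  obtain E where E: "finite E" "E <= C" "ph c`cb (fst c) <= pt E" using ph_fin[OF c] by (elim exE conjE)
  have "T Int ph c`cb (fst c) <= s`(E Int F)"
  proof
   fix u assume u: "u:T Int ph c`cb (fst c)"
   then obtain d where d: "d:F" "u = s d" using T by blast
   obtain y where y: "y:op (fst d)" "s d = ph d y" using s d(1) by blast
   have "u:pt E" using u E(3) by blast
   then obtain d' z where d': "d':E" "z:op (fst d')" "u = ph d' z" by (auto simp: pt_def)
   have "d:C" "d':C" using d(1) d'(1) E(2) by (auto simp: F_def)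
   hence "d = d'" using uniq[of d d' y z] y d' d(2) by simp
   thus "u:s`(E Int F)" using d d' by blast
  qed
  hence "finite (T Int ph c`cb (fst c))" using E(1) by (meson finite_Int finite_imageI finite_subset)
  moreover have "t1_space (euclidean :: ('e => real) topology)" by (rule Hausdorff_imp_t1_space[OF Hausdorff_fun])
  ultimately have "closed (T Int ph c`cb (fst c))" unfolding t1_space_closedin_finite by simp
  from continuous_closedin_preimage[OF cont[OF c] this]
  have "closedin (top_of_set (cb (fst c))) (cb (fst c) Int ph c -` (T Int ph c`cb (fst c)))" .
  moreover have "cb (fst c) Int ph c -` (T Int ph c`cb (fst c)) = {x:cb (fst c). ph c x:T}" by auto
  ultimately show "closedin (top_of_set (cb (fst c))) {x:cb (fst c). ph c x:T}" by simp
 qed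
 have "finite (s`F)"
 proof (rule ccontr)
  assume inf: "infinite (s`F)"
  have "s`F <= K" using s by blast
  from compactin_imp_Bolzano_Weierstrass[OF K, of "s`F"] this inf have "K Int wt derived_set_of (s`F) ~= {}" by blast
  then obtain u where u: "u:wt derived_set_of (s`F)" by blast
  have "closedin wt (s`F - {u})" by (rule cl) blast
  hence o: "openin wt (topspace wt - (s`F - {u}))" by (simp add: closedin_def)
  have u1: "u:topspace wt - (s`F - {u})" using u by (simp add: in_derived_set_of)
  from conjunct2[OF u[unfolded in_derived_set_of]]
  have "u:topspace wt - (s`F - {u}) & openin wt (topspace wt - (s`F - {u})) -->
   (EX y. y ~= u & y:s`F & y:topspace wt - (s`F - {u}))" by (rule spec)
  then obtain y where "y ~= u" "y:s`F" "y:topspace wt - (s`F - {u})" using o u1 by (elim impE conjI exE conjE)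
  thus False by simp
 qed
 hence "finite F" using inj by (rule finite_imageD)
 moreover have "K <= pt F"
 proof
  fix u assume "u:K"
  then obtain c x where "c:C" "x:op (fst c)" "u = ph c x" using KC by (auto simp: pt_def)
  thus "u:pt F" using \<open>u : K\<close> unfolding pt_def F_def by blast
 qed
 ultimately show ?thesis by (intro exI[of _ F]) (auto simp: F_def)
qed

text \<open>The bridge to the notion of map used in the constructions: a compact image meets
  finitely many cells, and conversely preimages of closed sets can be tested on finitely many closed
  cells.\<close>

lemma continuous_map_wt:
 fixes f :: "'k::t2_space => 'e => real"
 assumes K: "compact K"
 shows "continuous_map (top_of_set K) wt f \<longleftrightarrow> continuous_on K f & (EX F. finite F & F <= C & f`K <= pt F)"
proof
 assume f: "continuous_map (top_of_set K) wt f"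
 have "continuous_map (top_of_set K) euclidean ((%u. u) \<circ> f)" by (rule continuous_map_compose[OF f id_map])
 moreover have "compactin wt (f`K)" by (rule image_compactin[OF _ f]) (use K in \<open>simp add: compactin_subtopology\<close>)
 ultimately show "continuous_on K f & (EX F. finite F & F <= C & f`K <= pt F)" using compact_fin by (auto simp: o_def)
next
 assume "continuous_on K f & (EX F. finite F & F <= C & f`K <= pt F)"
 then obtain F where f: "continuous_on K f" and F: "finite F" "F <= C" "f`K <= pt F" by (elim exE conjE)
 show "continuous_map (top_of_set K) wt f"
  unfolding continuous_map_closedin
 proof (intro conjI allI impI)
  have fC: "f`K <= pt C" using F(3) pt_mono[OF F(2)] by blast
  show "f:topspace (top_of_set K) \<rightarrow> topspace wt" using fC by (auto simp: topspace_wt)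
  fix A assume A: "closedin wt A"
  have "closed {k:K. f k:A}"
  proof (rule quot_closed[OF Hausdorff_fun F(1), where P = "%c. cb (fst c)" and p = ph])
   show "compact (cb (fst c))" for c :: "nat \<times> nat" by (rule compact_cb)
   show "continuous_on (cb (fst c)) (ph c)" if "c:F" for c using that F(2) by (intro cont) blast
   show "f`K <= (UN c:F. ph c`cb (fst c))" using F(3) op_in_cb unfolding pt_def by blast
   show "closedin (top_of_set (cb (fst c))) {x:cb (fst c). ph c x:A}" if "c:F" for c
    using A that F(2) unfolding closedin_wt by blast
  qed (use K f in simp_all)
  thus "closedin (top_of_set K) {x:topspace (top_of_set K). f x:A}" by (intro closed_subset) auto
 qed
qed

text \<open>Shrinking towards the centre moves every point into the open cube at all positive
  times.\<close>

lemma op_dense: "x:cb n ==> x:top_of_set (cb n) closure_of (op n)"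
proof -
 assume x: "x:cb n"
 define l where "l = (%t::real. scl n (1 - t) x)"
 have lc: "continuous_map (top_of_set {0..1}) (top_of_set (cb n)) l"
 proof -
  have "continuous_on {0..1} l" unfolding l_def
   by (intro continuous_on_scl ctn)
  moreover have "l t:cb n" if "t:{0..1}" for t
  proof -
   have "\<bar>1 - t\<bar> * nrm n x <= 1 * 1" using that x by (intro mult_mono) (auto simp: mem_cb_iff)
   thus ?thesis unfolding l_def by (intro scl_in_cb) simp
  qed
  ultimately show ?thesis by auto
 qed
 have "{0..1} Int {0<..1} = {0<..1::real}" by auto
 hence "(0::real):top_of_set {0..1} closure_of {0<..1}" by (simp add: closure_of_subtopology)
 hence "l 0:l`(top_of_set {0..1} closure_of {0<..1})" by blast
 also have "\<dots> <= top_of_set (cb n) closure_of (l`{0<..1})" by (rule continuous_map_image_closure_subset[OF lc])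
 also have "\<dots> <= top_of_set (cb n) closure_of (op n)"
 proof (rule closure_of_mono)
  show "l`{0<..1} <= op n"
  proof (rule image_subsetI)
   fix t :: real assume t: "t:{0<..1}"
   have "\<bar>1 - t\<bar> * nrm n x <= \<bar>1 - t\<bar> * 1" using x by (intro mult_left_mono) (auto simp: mem_cb_iff)
   hence "\<bar>1 - t\<bar> * nrm n x < 1" using t by auto
   thus "l t:op n" unfolding l_def mem_op_iff nrm_scl by (simp add: scl_in_cb)
  qed
 qed
 finally show ?thesis using scl_1[OF x] by (simp add: l_def)
qed

text \<open>Relates the closures in the definition of \<open>cw_complex\<close> to the closed cubes
  in the definition of the weak topology.\<close>

lemma cell_closure: assumes c: "c:C" shows "ph c`cb (fst c) <= wt closure_of (ph c`op (fst c))"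
proof -
 have "ph c`cb (fst c) <= ph c`(top_of_set (cb (fst c)) closure_of op (fst c))" using op_dense by blast
 also have "\<dots> <= wt closure_of (ph c`op (fst c))" by (rule continuous_map_image_closure_subset[OF ph_map[OF c]])
 finally show ?thesis .
qed

lemma disc_interior_eq: "disc_interior n = {v:dsc n. (SUM i<n. v i ^ 2) < 1}"
 by (simp add: disc_interior_def disc_eq)

lemma disc_boundary_eq: "disc_boundary n = {v:dsc n. (SUM i<n. v i ^ 2) = 1}"
 by (simp add: disc_boundary_def disc_eq)

lemma d2c_interior: "d2c n`disc_interior n = op n"
proof (intro equalityI subsetI)
 fix x assume "x:d2c n`disc_interior n"
 thus "x:op n" using d2c_op by (auto simp: disc_interior_eq)
next
 fix x assume x: "x:op n"
 hence xc: "x:cb n" "nrm n x < 1" by (simp_all add: mem_op_iff)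
 thus "x:d2c n`disc_interior n"
  using d2c_c2d[OF xc(1)] by (intro image_eqI[of _ _ "c2d n x"]) (simp_all add: disc_interior_eq)
qed

definition Ph :: "nat => nat => rseq => 'e => real" where
 "Ph n i v = ph (n, i) (d2c n v)"

lemma Ph_interior: "Ph n i`disc_interior n = ph (n, i)`op n"
 by (simp add: Ph_def image_image[symmetric] d2c_interior)

lemma Ph_map: assumes "(n, i):C" shows "continuous_map (disc n) wt (Ph n i)"
proof -
 have "continuous_map (disc n) (top_of_set (cb n)) (d2c n)"
  using d2c_continuous d2c_cb by (auto simp: disc_eq)
 from continuous_map_compose[OF this, of wt "ph (n, i)"] ph_map[OF assms] show ?thesis by (simp add: Ph_def[abs_def] o_def)
qed

text \<open>The inverse reads the position off the coordinates provided by \<open>read\<close>; it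
  is continuous already for the coarser product topology.\<close>

lemma Ph_embedding: assumes c: "(n, i):C" shows "embedding_map (subtopology (disc n) (disc_interior n)) wt (Ph n i)"
proof -
 obtain e0 e where e: "ALL x:cb n. ph (n, i) x e0 = 1 - nrm n x & (ALL k. ph (n, i) x (e k) = (1 - nrm n x) * x k)"
  using read[OF c] by auto
 define Rd where "Rd = (%u::'e => real. (%k::nat. u (e k) / u e0))"
 define I where "I = ph (n, i)`op n"
 have R: "Rd (ph (n, i) x) = x" if "x:op n" for x
  using e that by (auto simp: Rd_def mem_op_iff)
 have e0: "u e0 ~= 0" if "u:I" for u using e that by (auto simp: I_def mem_op_iff)
 have Rc: "continuous_on I Rd"
  unfolding Rd_def
 proof (rule continuous_on_pointwise)
  fix k
  have "continuous_on I (%u. u j)" for j by (rule continuous_on_subset[OF continuous_on_product_coordinates]) simp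
  thus "continuous_on I (%u. u (e k) / u e0)" using e0 by (intro continuous_on_divide) auto
 qed
 have RI: "Rd`I <= op n" using R by (auto simp: I_def)
 have gc: "continuous_on I (%u. c2d n (Rd u))"
  by (rule continuous_on_compose2[OF c2d_continuous Rc]) (use RI op_in_cb in blast)
 have in1: "subtopology (disc n) (disc_interior n) = top_of_set (disc_interior n)"
  unfolding disc_eq by (simp add: subtopology_subtopology disc_interior_eq Int_absorb1 Collect_mono Int_def)
 have gI: "c2d n (Rd u):disc_interior n" if "u:I" for u
  using d2c_c2d[of "Rd u" n] RI that by (auto simp: disc_interior_eq mem_op_iff)
 have "homeomorphic_maps (subtopology (disc n) (disc_interior n)) (subtopology wt I) (Ph n i) (%u. c2d n (Rd u))"
  unfolding homeomorphic_maps_def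
 proof (intro conjI ballI)
  show "continuous_map (subtopology (disc n) (disc_interior n)) (subtopology wt I) (Ph n i)"
   unfolding continuous_map_in_subtopology
  proof
   show "continuous_map (subtopology (disc n) (disc_interior n)) wt (Ph n i)" by (rule continuous_map_from_subtopology[OF Ph_map[OF c]])
   show "Ph n i:topspace (subtopology (disc n) (disc_interior n)) \<rightarrow> I" using Ph_interior[of n i] by (auto simp: I_def)
  qed
  have "continuous_map (subtopology wt I) (top_of_set I) (%u. u)"
   unfolding continuous_map_in_subtopology using continuous_map_from_subtopology[OF id_map, of I] by simp
  moreover have "continuous_map (top_of_set I) (top_of_set (disc_interior n)) (%u. c2d n (Rd u))" using gc gI by auto
  ultimately have "continuous_map (subtopology wt I) (top_of_set (disc_interior n)) ((%u. c2d n (Rd u)) \<circ> (%u. u))" by (rule continuous_map_compose)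
  thus "continuous_map (subtopology wt I) (subtopology (disc n) (disc_interior n)) (%u. c2d n (Rd u))" unfolding in1 by (simp add: o_def)
 next
  fix v assume "v:topspace (subtopology (disc n) (disc_interior n))"
  hence v: "v:dsc n" "(SUM i<n. v i ^ 2) < 1" unfolding in1 by (auto simp: disc_interior_eq)
  show "c2d n (Rd (Ph n i v)) = v" unfolding Ph_def using R[OF d2c_op[OF v]] c2d_d2c[OF v(1)] by simp
 next
  fix u assume "u:topspace (subtopology wt I)"
  then obtain x where x: "x:op n" "u = ph (n, i) x" by (auto simp: I_def)
  thus "Ph n i (c2d n (Rd u)) = u" using R[OF x(1)] d2c_c2d(1)[OF op_in_cb[OF x(1)]] by (simp add: Ph_def)
 qed
 hence "homeomorphic_map (subtopology (disc n) (disc_interior n)) (subtopology wt I) (Ph n i)" by (rule homeomorphic_maps_imp_map)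
 moreover have "Ph n i`topspace (subtopology (disc n) (disc_interior n)) = I" unfolding in1 using Ph_interior by (simp add: I_def)
 ultimately show ?thesis by (simp add: embedding_map_def)
qed

lemma cw: "cw_complex wt (%n. {i. (n, i):C}) Ph"
 unfolding cw_complex_def
proof (intro conjI allI ballI impI)
 show "Hausdorff_space wt" by (rule Hausdorff_wt)
 show "continuous_map (disc n) wt (Ph n i)" if "i:{i. (n, i):C}" for n i using that Ph_map by simp
 show "embedding_map (subtopology (disc n) (disc_interior n)) wt (Ph n i)" if "i:{i. (n, i):C}" for n i using that Ph_embedding by simp
 show "disjoint_family_on (%(n, i). Ph n i`disc_interior n) (SIGMA n:UNIV. {i. (n, i):C})"
  unfolding disjoint_family_on_def
 proof (intro ballI impI)
  fix c c' assume cc: "c:(SIGMA n:UNIV. {i. (n, i):C})" "c':(SIGMA n:UNIV. {i. (n, i):C})" "c ~= c'"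
  hence C: "c:C" "c':C" by auto
  have "ph c`op (fst c) Int ph c'`op (fst c') = {}"
   using uniq[OF C] cc(3) by blast
  thus "(case c of (n, i) => Ph n i`disc_interior n) Int (case c' of (n, i) => Ph n i`disc_interior n) = {}"
   by (cases c; cases c') (simp add: Ph_interior)
 qed
 show "topspace wt = (UN n. UN i:{i. (n, i):C}. Ph n i`disc_interior n)"
  unfolding topspace_wt Ph_interior
 proof (intro equalityI subsetI)
  fix u assume "u:pt C"
  then obtain c where c: "c:C" "u:ph c`op (fst c)" unfolding pt_def by (elim UN_E)
  thus "u:(UN n. UN i:{i. (n, i):C}. ph (n, i)`op n)"
   by (intro UN_I[of "fst c"] UN_I[of "snd c"]) simp_all
 next
  fix u assume "u:(UN n. UN i:{i. (n, i):C}. ph (n, i)`op n)"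
  then obtain n i where "i:{i. (n, i):C}" "u:ph (n, i)`op n" by (elim UN_E)
  thus "u:pt C" unfolding pt_def by (intro UN_I[of "(n, i)"]) simp_all
 qed
 show "EX F. finite F & F <= (SIGMA m:{..<n}. {i. (m, i):C}) & Ph n i`disc_boundary n <= (\<Union>(m, j)\<in>F. Ph m j`disc_interior m)"
  if "i:{i. (n, i):C}" for n i
 proof -
  have "(n, i):C" using that by simp
  from fin[OF this] obtain F where F: "finite F" "F <= C" "ALL d:F. fst d < n" "ph (n, i)`bd n <= (UN d:F. ph d`op (fst d))" by auto
  have "Ph n i`disc_boundary n <= ph (n, i)`bd n" using d2c_bd by (auto simp: Ph_def disc_boundary_eq)
  also have "\<dots> <= (\<Union>(m, j)\<in>F. Ph m j`disc_interior m)" using F(4) by (simp add: Ph_interior case_prod_unfold)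
  finally show ?thesis using F(1-3) by (intro exI[of _ F]) auto
 qed
 fix A assume A: "A <= topspace wt"
 show "closedin wt A = (ALL n. ALL i:{i. (n, i):C}. closedin wt (A Int wt closure_of (Ph n i`disc_interior n)))"
 proof
  assume "closedin wt A"
  thus "ALL n. ALL i:{i. (n, i):C}. closedin wt (A Int wt closure_of (Ph n i`disc_interior n))" by (simp add: closedin_Int)
 next
  assume H: "ALL n. ALL i:{i. (n, i):C}. closedin wt (A Int wt closure_of (Ph n i`disc_interior n))"
  show "closedin wt A"
   unfolding closedin_wt
  proof (intro conjI ballI)
   show "A <= pt C" using A by (simp add: topspace_wt)
   fix c assume c: "c:C"
   let ?A = "A Int wt closure_of (ph c`op (fst c))"
   have "snd c:{i. (fst c, i):C}" using c by simp
   from bspec[OF spec[OF H, of "fst c"] this] have "closedin wt ?A" unfolding Ph_interior by simp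
   hence "closedin (top_of_set (cb (fst c))) {x:cb (fst c). ph c x:?A}" using c by (simp only: closedin_wt)
   moreover have "{x:cb (fst c). ph c x:?A} = {x:cb (fst c). ph c x:A}" using cell_closure[OF c] by blast
   ultimately show "closedin (top_of_set (cb (fst c))) {x:cb (fst c). ph c x:A}" by simp
  qed
 qed
qed

end

section \<open>Homotopy groups of the quotient\<close>

definition e1 :: "nat => real" where "e1 = (%i. if i = 0 then 1 else 0)"

abbreviation z0 :: "nat => real" where "z0 == %_. 0"

lemma z0_bd: "0 < n ==> z0:bd n" "z0:cb n"
 by (auto simp: bd_def cb_def)

lemma e1_bd: "e1:bd 1" "e1:cb 1"
 by (auto simp: bd_def cb_def e1_def)

lemma bd_1: "bd (Suc 0) = {z0, e1}"
proof (intro equalityI subsetI)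
 fix x assume x: "x:bd (Suc 0)"
 have xi: "x i = 0" if "i ~= 0" for i using x that by (auto simp: bd_def cb_def)
 have "x 0 = 0 | x 0 = 1" using x by (auto simp: bd_def)
 thus "x:{z0, e1}"
 proof
  assume "x 0 = 0"
  hence "x i = z0 i" for i using xi[of i] by (cases "i = 0") simp_all
  hence "x = z0" by (rule ext)
  thus ?thesis by simp
 next
  assume "x 0 = 1"
  hence "x i = e1 i" for i using xi[of i] by (cases "i = 0") (simp_all add: e1_def)
  hence "x = e1" by (rule ext)
  thus ?thesis by simp
 qed
qed (use z0_bd[of 1] e1_bd in auto)

lemma cube_homotopic:
 "homotopic_with (%h. ALL t:cube_boundary n. h t = x) (cube n) X f g \<longleftrightarrow>
  (EX h. continuous_map (top_of_set ({0..1} \<times> cb n)) X h & (ALL y:cb n. h (0, y) = f y & h (1::real, y) = g y) &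
   (ALL t:{0..1}. ALL y:bd n. h (t, y) = x))"
proof -
 have "prod_topology (top_of_set {0..1::real}) (cube n) = top_of_set ({0..1} \<times> cb n)"
  unfolding cube_eq subtopology_Times[symmetric] prod_topology_euclidean ..
 moreover have "homotopic_with (%h. ALL t:cube_boundary n. h t = x) (cube n) X f g \<longleftrightarrow>
  (EX h. continuous_map (prod_topology (top_of_set {0..1::real}) (cube n)) X h & (ALL y:topspace (cube n). h (0, y) = f y) &
   (ALL y:topspace (cube n). h (1, y) = g y) & (ALL t:{0..1}. ALL y:cube_boundary n. h (t, y) = x))"
 proof (rule homotopic_with)
  fix h k :: "rseq => 'a" assume hk: "!!y. y:topspace (cube n) ==> h y = k y"
  have "h t = k t" if "t:bd n" for t using hk[of t] bd_subset[of n] that by (auto simp: cube_eq)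
  thus "(ALL t:cube_boundary n. h t = x) = (ALL t:cube_boundary n. k t = x)" by (simp add: cube_boundary_eq)
 qed
 ultimately show ?thesis by (auto simp: cube_eq cube_boundary_eq)
qed

section \<open>The projection onto the quotient and lifting of cubes\<close>

context cover
begin

text \<open>The definition of \<open>type_F_infinity\<close> asks for points that are functions of a
  natural number; the coordinates of the quotient have a countable index set and can be
  recoded.\<close>

definition iot :: "unit pt => nat => real" where "iot v = (%m. v (from_nat m))"
definition toi :: "rseq => unit pt" where "toi w = (%e. w (to_nat e))"
definition phX :: "nat \<times> nat => rseq => nat => real" where "phX j x = iot (chm aX ((), j) x)"

lemma toi_iot [simp]: "toi (iot v) = v"
 by (simp add: toi_def iot_def)

lemma iot_inj: "iot v = iot w ==> v = w"
 using toi_iot by metis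

lemma iot_continuous: "continuous_on K f ==> continuous_on K (%k. iot (f k))"
 unfolding iot_def by (rule continuous_on_pointwise) (rule continuous_on_coord')

lemma toi_continuous: "continuous_on K f ==> continuous_on K (%k. toi (f k))"
 unfolding toi_def by (rule continuous_on_pointwise) (rule continuous_on_coord')

lemma JC: "j:JX ==> ((), j):CX"
 by (simp add: CX_iff)

sublocale W: cws JX phX
proof
 show "continuous_on (cb (fst c)) (phX c)" if "c:JX" for c
  unfolding phX_def using chm_continuous[of "((), c)" aX, OF wf_cont[OF wfX JC[OF that]]] by (intro iot_continuous) simp
 show "c = c' & x = y" if "c:JX" "c':JX" "x:op (fst c)" "y:op (fst c')" "phX c x = phX c' y" for c c' x y
  using chm_unique[OF wfX JC[OF that(1)] JC[OF that(2)], of x y] that(3-5) iot_inj unfolding phX_def by auto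
next
 fix c assume c: "c:JX"
 obtain F where F: "finite F" "F <= CX" "!!d. d:F ==> dm d < dm ((), c)" "!!x. x:bd (dm ((), c)) ==> aX ((), c) x:pts aX F"
  by (rule wf_fin[OF wfX JC[OF c]]) (rule that; blast)
 have "phX c x:(UN d:snd`F. phX d`op (fst d))" if x: "x:bd (fst c)" for x
 proof -
  have "chm aX ((), c) x:pts aX F" using F(4)[of x] chm_bd[OF wfX JC[OF c], of x] x by simp
  then obtain d y where d: "d:F" "y:op (dm d)" "chm aX ((), c) x = chm aX d y" by (rule ptsE)
  have "((), snd d) = d" by (cases d) simp
  hence "phX c x = phX (snd d) y" using d(3) by (simp add: phX_def)
  thus ?thesis using d(1,2) by (intro UN_I[of "snd d"]) auto
 qed
 thus "EX F. finite F & F <= JX & (ALL d:F. fst d < fst c) & phX c`bd (fst c) <= (UN d:F. phX d`op (fst d))"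
  using F(1-3) by (intro exI[of _ "snd`F"]) (auto simp: CX_def)
next
 fix c assume c: "c:JX"
 show "EX e0 e. ALL x:cb (fst c). phX c x e0 = 1 - nrm (fst c) x & (ALL i. phX c x (e i) = (1 - nrm (fst c) x) * x i)"
  by (intro exI[of _ "to_nat (((), c), 0::nat)"] exI[of _ "%i. to_nat (((), c), Suc i)"]) (simp add: phX_def iot_def chm_self)
qed

abbreviation X where "X == W.wt"

lemma pt_eq: "W.pt D = iot`pts aX (UNIV \<times> D)"
proof (intro equalityI subsetI)
 fix w assume "w:W.pt D"
 then obtain c y where "c:D" "y:op (fst c)" "w = phX c y" unfolding W.pt_def by blast
 thus "w:iot`pts aX (UNIV \<times> D)" unfolding phX_def by (intro image_eqI[OF _ ptsI[of "((), c)"]]) auto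
next
 fix w assume "w:iot`pts aX (UNIV \<times> D)"
 then obtain v where v: "v:pts aX (UNIV \<times> D)" "w = iot v" by blast
 obtain c y where c: "c:UNIV \<times> D" "y:op (dm c)" "v = chm aX c y" using v(1) by (rule ptsE)
 have "((), snd c) = c" by (cases c) simp
 hence "w = phX (snd c) y" using c(3) v(2) by (simp add: phX_def)
 thus "w:W.pt D" unfolding W.pt_def using c(1,2) by auto
qed

lemma X_map:
 fixes f :: "'k::t2_space => nat => real"
 assumes K: "compact K"
 shows "continuous_map (top_of_set K) X f \<longleftrightarrow> (EX h. xmap K h & (ALL k:K. f k = iot (h k)))"
proof
 assume "continuous_map (top_of_set K) X f"
 then obtain F where F: "continuous_on K f" "finite F" "F <= JX" "f`K <= W.pt F" unfolding W.continuous_map_wt[OF K] by (elim conjE exE)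
 have fk: "EX v:pts aX (UNIV \<times> F). f k = iot v" if "k:K" for k using F(4) that unfolding pt_eq by blast
 have "xmap K (%k. toi (f k))"
 proof (rule cmapI[OF toi_continuous[OF F(1)], of "UNIV \<times> F"])
  show "finite (UNIV \<times> F :: unit cell set)" using F(2) by simp
  show "UNIV \<times> F <= CX" using F(3) by (auto simp: CX_def)
  show "toi (f k):pts aX (UNIV \<times> F)" if "k:K" for k using fk[OF that] by auto
 qed
 moreover have "f k = iot (toi (f k))" if "k:K" for k using fk[OF that] by auto
 ultimately show "EX h. xmap K h & (ALL k:K. f k = iot (h k))" by blast
next
 assume "EX h. xmap K h & (ALL k:K. f k = iot (h k))"
 then obtain h where h: "xmap K h" "ALL k:K. f k = iot (h k)" by blast
 obtain F where F: "continuous_on K h" "finite F" "F <= CX" "!!k. k:K ==> h k:pts aX F" using h(1) by (rule cmapE) (rule that; blast)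
 have "F <= UNIV \<times> snd`F" by force
 from pts_mono[OF this] have "h k:pts aX (UNIV \<times> snd`F)" if "k:K" for k using F(4)[OF that] by (rule subsetD)
 hence "f`K <= W.pt (snd`F)" unfolding pt_eq using h(2) by auto
 moreover have "continuous_on K f" using iot_continuous[OF F(1)] h(2) by (simp cong: continuous_on_cong)
 moreover have "snd`F <= JX" using F(3) by (auto simp: CX_def)
 ultimately show "continuous_map (top_of_set K) X f" unfolding W.continuous_map_wt[OF K] using F(2) by (intro conjI exI[of _ "snd`F"]) simp_all
qed

definition p :: "'a pt => nat => real" where "p u = iot (qm u)"

lemma p_eq: "p u = p u' \<longleftrightarrow> qm u = qm u'"
 using iot_inj by (auto simp: p_def)

lemma p_gx: "g:carrier G ==> u:PT ==> p (gx g u) = p u"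
 by (simp add: p_def qm_gx)

lemma p_map:
 fixes L :: "'k::t2_space => 'a pt"
 assumes "compact K" "tmap K L" "!!k. k:K ==> f k = p (L k)" shows "continuous_map (top_of_set K) X f"
 unfolding X_map[OF assms(1)] by (intro exI[of _ "%k. qm (L k)"]) (use tmap_xmap[OF assms(2)] assms(3) in \<open>simp add: p_def\<close>)

lemma topspace_X: "topspace X = p`PT"
proof -
 have "topspace X = iot`PX" by (simp add: W.topspace_wt pt_eq CX_def)
 also have "PX = qm`PT" using qm_in qm_surj by blast
 finally show ?thesis by (simp add: p_def image_image)
qed

lemma lift:
 assumes f: "continuous_map (cube n) X f" and b: "b:cb n" and u: "u:PT" "p u = f b"
 obtains L where "tmap (cb n) L" "!!x. x:cb n ==> p (L x) = f x" "L b = u"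
proof -
 obtain h where h: "xmap (cb n) h" "ALL x:cb n. f x = iot (h x)" using f unfolding cube_eq X_map[OF compact_cb] by (elim exE conjE)
 have "qm u = h b" using u(2) h(2) b iot_inj by (simp add: p_def)
 then obtain L where L: "tmap (cb n) L" "!!x. x:cb n ==> qm (L x) = h x" "L b = u" by (rule lift_ex[OF h(1) b u(1)]) (rule that, assumption, simp_all)
 show ?thesis by (rule that[OF L(1) _ L(3)]) (use L(2) h(2) in \<open>simp add: p_def\<close>)
qed

lemma lift_unique:
 assumes "tmap (cb n) L" "tmap (cb n) L'" "!!x. x:cb n ==> p (L x) = p (L' x)" "b:cb n" "L b = L' b" "x:cb n"
 shows "L x = L' x"
 by (rule seg_unique[OF cb_seg assms(1,2) _ assms(4-6)]) (use assms(3) in \<open>simp add: p_eq\<close>)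

text \<open>Along a path with constant projection the lift and the constant path are two lifts with
  the same start.\<close>

lemma lift_const_path:
 assumes L: "tmap K L" and l: "continuous_on {0..1} l" "!!t. t:{0..1} ==> l t:K" and c: "!!t. t:{0..1} ==> p (L (l t)) = y"
 shows "L (l (1::real)) = L (l 0)"
proof (rule path_unique[of "%t. L (l t)" "%_. L (l 0)"])
 show "tmap {0..1} (%t. L (l t))" by (rule cmap_compose[OF L l(1)]) (use l(2) in blast)
 show "tmap {0..1::real} (%_. L (l 0))" by (rule cmap_const[OF cmap_in[OF L l(2)]]) simp
 show "qm (L (l t)) = qm (L (l 0))" if "t:{0..1}" for t
 proof -
  have "p (L (l t)) = p (L (l 0))" using c[OF that] c[of 0] by simp
  thus ?thesis by (rule p_eq[THEN iffD1])
 qed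
qed simp_all

lemma act_freeT: assumes g: "g:carrier G" and u: "u:PT" and eq: "gx g u = u" shows "g = \<one>"
proof -
 obtain c x where c: "c:CT" "x:op (dm c)" "u = gch a c x" using u by (rule ptsE)
 obtain h j where hj: "c = (h, j)" "h:carrier G" "j:JX" using c(1) by (auto simp: cel_def)
 have "gch a (g \<otimes> h, j) x = gch a (h, j) x" using chm_gx[OF g hj(2), of a j x] eq c(3) hj(1) by simp
 moreover have "(g \<otimes> h, j):CT" "(h, j):CT" using g hj by (simp_all add: CT_iff)
 ultimately have "(g \<otimes> h, j) = (h, j)" using chm_unique[OF wfT, of "(g \<otimes> h, j)" "(h, j)" x x] c(2) hj(1) by simp
 hence "g \<otimes> h \<otimes> inv h = h \<otimes> inv h" by simp
 thus ?thesis using g hj(2) by (simp add: m_assoc)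
qed

lemma fillT: "tmap (bd d) f ==> EX F. tmap (cb d) F & (ALL x:bd d. F x = f x)"
 using fill unfolding JX_def .

text \<open>The boundary of the cube of dimension 0 is empty, and filling it yields a point.\<close>

lemma PT_ne: "PT ~= {}"
proof -
 have "tmap (bd 0) f" for f by (simp add: cmap_def) (rule exI[of _ "{}"], simp)
 from fillT[OF this] obtain F where "tmap (cb 0) F" by blast
 from cmap_in[OF this z0_bd(2)] show ?thesis by blast
qed

definition u0 :: "'a pt" where "u0 = (SOME u. u:PT)"
definition x0 :: "nat => real" where "x0 = p u0"

lemma u0: "u0:PT"
 unfolding u0_def using PT_ne by (simp add: some_in_eq)

text \<open>\<open>L\<close> at the bottom, \<open>L'\<close> at the top and stationary sides form a
  map on the boundary of the cube of dimension \<open>Suc n\<close>, which bounds upstairs.\<close>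

lemma join_lifts:
 assumes L: "tmap (cb n) L" "tmap (cb n) L'" and agree: "!!x. x:bd n ==> L x = L' x"
 shows "EX F. tmap (cb (Suc n)) F & (ALL x:cb n. F x = L x & F (x(n := 1)) = L' x) & (ALL x:bd n. ALL t:{0..1}. F (x(n := t)) = L x)"
proof -
 define F0 where "F0 = (%x. if x n = 1 then L' (x(n := 0)) else L (x(n := 0)))"
 have x0: "x n = 0" "x(n := 0) = x" if "x:cb n" for x
  using cb_0n[OF that] fun_upd_idem[of x n 0] by simp_all
 have F0: "F0 x = L x & F0 (x(n := 1)) = L' x" if "x:cb n" for x using x0[OF that] by (simp add: F0_def)
 have F0b: "F0 (x(n := t)) = L x" if "x:bd n" for x t
  using x0[of x] bd_subset[of n] agree[OF that] that by (auto simp: F0_def)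
 have "tmap (cyl (bd n)) (%z. L (fst z))"
  by (rule cmap_compose[OF L(1)]) (use bd_subset in \<open>auto intro!: ctn\<close>)
 hence "tmap (bd (Suc n)) F0" by (rule cmap_box[OF L _ F0]) (simp_all only: fst_conv F0b)
 from fillT[OF this] obtain F where F: "tmap (cb (Suc n)) F" "ALL x:bd (Suc n). F x = F0 x" by blast
 have b: "x:bd (Suc n)" "x(n := 1):bd (Suc n)" if x: "x:cb n" for x
  using cb_put[OF x, of 0] cb_put[OF x, of 1] x0[OF x] by (auto simp: bd_Suc_iff)
 have "x(n := t):bd (Suc n)" if x: "x:bd n" and t: "t:{0..1}" for x t
  using cb_put[of x n t] x0[of x] bd_subset[of n] t x by (auto simp: bd_Suc_iff)
 thus ?thesis using F b F0 F0b by (intro exI[of _ F]) auto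
qed
lemma homotopic_of_lifts:
 assumes L: "tmap (cb n) L" "tmap (cb n) L'" and agree: "!!x. x:bd n ==> L x = L' x"
  and f: "!!x. x:cb n ==> p (L x) = f x" "!!x. x:cb n ==> p (L' x) = g x" "!!x. x:bd n ==> f x = y"
 shows "homotopic_with (%h. ALL t:cube_boundary n. h t = y) (cube n) X f g"
proof -
 have "EX F. tmap (cb (Suc n)) F & (ALL x:cb n. F x = L x & F (x(n := 1)) = L' x) & (ALL x:bd n. ALL t:{0..1}. F (x(n := t)) = L x)"
  by (rule join_lifts[OF L agree])
 then obtain F where F: "tmap (cb (Suc n)) F" "ALL x:cb n. F x = L x & F (x(n := 1)) = L' x" "ALL x:bd n. ALL t:{0..1}. F (x(n := t)) = L x"
  by (elim exE conjE)
 define h where "h = (%z. p (F ((snd z)(n := fst z))))"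
 have "tmap ({0..1::real} \<times> cb n) (%z. F ((snd z)(n := fst z)))"
 proof (rule cmap_compose[OF F(1)])
  show "continuous_on ({0..1::real} \<times> cb n) (%z. (snd z)(n := fst z))"
   by (intro ctn)
  show "(%z. (snd z)(n := fst z))`({0..1::real} \<times> cb n) <= cb (Suc n)" using cb_put[of _ n] by auto
 qed
 hence "continuous_map (top_of_set ({0..1} \<times> cb n)) X h"
  by (rule p_map[rotated]) (auto simp: h_def intro: compact_Times compact_cb)
 moreover have "h (0, x) = f x & h (1, x) = g x" if x: "x:cb n" for x
 proof -
  have "x(n := 0) = x" using cb_0n[OF x] by (rule fun_upd_idem)
  thus ?thesis using F(2) f(1,2) x by (simp add: h_def)
 qed
 moreover have "h (t, x) = y" if "t:{0..1}" "x:bd n" for t x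
  using F(3) f(1)[of x] f(3)[OF that(2)] that bd_subset[of n] by (auto simp: h_def)
 ultimately show ?thesis unfolding cube_homotopic by (intro exI[of _ h]) blast
qed

section \<open>Spheroids and the higher homotopy groups\<close>

lemma spheroidD: assumes "f:spheroids n X x0" shows "continuous_map (cube n) X f" "!!x. x:bd n ==> f x = x0"
 using assms by (auto simp: spheroids_def cube_boundary_eq)

lemma spheroid_lift:
 assumes f: "f:spheroids n X x0" and n: "0 < n"
 obtains L where "tmap (cb n) L" "!!x. x:cb n ==> p (L x) = f x" "L z0 = u0"
 by (rule lift[OF spheroidD(1)[OF f] z0_bd(2) u0]) (use spheroidD(2)[OF f z0_bd(1)[OF n]] that in \<open>auto simp: x0_def\<close>)

lemma spheroid_concat:
 assumes f: "f:spheroids n X x0" and g: "g:spheroids n X x0" and n: "0 < n"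
 shows "cube_concat f g:spheroids n X x0"
proof -
 obtain h where h: "xmap (cb n) h" "ALL x:cb n. f x = iot (h x)" using spheroidD(1)[OF f] unfolding cube_eq X_map[OF compact_cb] by (elim exE conjE)
 obtain k where k: "xmap (cb n) k" "ALL x:cb n. g x = iot (k x)" using spheroidD(1)[OF g] unfolding cube_eq X_map[OF compact_cb] by (elim exE conjE)
 have "h (x(0 := 1)) = k (x(0 := 0))" if "x:cb n" for x
 proof -
  have c: "x(0 := 1):bd n" "x(0 := 0):bd n" using that n by (auto simp: bd_def cb_def)
  hence "x(0 := 1):cb n" "x(0 := 0):cb n" using bd_subset by blast+
  thus ?thesis using spheroidD(2)[OF f c(1)] spheroidD(2)[OF g c(2)] h(2) k(2) by (intro iot_inj) simp
 qed
 from cmap_concat[OF h(1) k(1) n this] have "xmap (cb n) (cube_concat h k)" .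
 moreover have "cube_concat f g x = iot (cube_concat h k x)" if "x:cb n" for x
  using cube_concat_arg[OF n that] h(2) k(2) by (simp add: cube_concat_def)
 ultimately have "continuous_map (cube n) X (cube_concat f g)" unfolding cube_eq X_map[OF compact_cb] by blast
 moreover have "cube_concat f g x = x0" if x: "x:bd n" for x
 proof -
  have xc: "x:cb n" using x bd_subset by blast
  obtain i where i: "i < n" "x i = 0 | x i = 1" using x by (auto simp: bd_def)
  have "x(0 := 2 * x 0):bd n" if "x 0 <= 1/2"
   using cube_concat_arg(1)[OF n xc that] i that unfolding bd_def by (intro CollectI conjI exI[of _ i]) auto
  moreover have "x(0 := 2 * x 0 - 1):bd n" if "~ x 0 <= 1/2"
   using cube_concat_arg(2)[OF n xc] i that unfolding bd_def by (intro CollectI conjI exI[of _ i]) auto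
  ultimately show ?thesis using spheroidD(2)[OF f] spheroidD(2)[OF g] by (simp add: cube_concat_def)
 qed
 ultimately show ?thesis by (simp add: spheroids_def cube_boundary_eq)
qed
lemma class_sub: assumes "g:homotopy_class n X x0 f" shows "g:spheroids n X x0"
proof -
 have h: "homotopic_with (%h. ALL t:cube_boundary n. h t = x0) (cube n) X f g" using assms by (simp add: homotopy_class_def)
 from homotopic_with_imp_continuous_maps[OF h] homotopic_with_imp_property[OF h] show ?thesis by (simp add: spheroids_def)
qed

lemma spheroid_const: "(%_. x0):spheroids n X x0"
 using u0 by (auto simp: spheroids_def topspace_X x0_def)

text \<open>From dimension 2 on the boundary of the cube is connected, so the lift of a spheroid is
  constant on it. All lifts then agree on the boundary and are homotopic.\<close>

lemma higher_class:
 assumes n: "2 <= n" and f: "f:spheroids n X x0" shows "homotopy_class n X x0 f = spheroids n X x0"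
proof (intro equalityI subsetI)
 show "g:spheroids n X x0" if "g:homotopy_class n X x0 f" for g by (rule class_sub[OF that])
 fix g assume g: "g:spheroids n X x0"
 have n0: "0 < n" using n by simp
 have bd_const: "L x = u0" if f: "f:spheroids n X x0" and L: "tmap (cb n) L" "!!x. x:cb n ==> p (L x) = f x" "L z0 = u0" and x: "x:bd n" for f L x
 proof -
  have xc: "x:cb n" using x bd_subset by blast
  obtain i where i: "i < n" "x i = 0 | x i = 1" using x by (auto simp: bd_def)
  \<comment> \<open>The origin is joined to \<open>x\<close> inside the boundary by two segments:
    the first keeps coordinate \<open>j\<close> at 0, the second keeps coordinate \<open>i\<close>
    at 0 or 1.\<close>
  define j :: nat where "j = (if i = 0 then 1 else 0)"
  have j: "j < n" "j ~= i" using n by (auto simp: j_def)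
  define z where "z = x(j := 0)"
  have zc: "z:cb n" using xc by (auto simp: z_def cb_def)
  have sc: "(%i. (1 - t) * u i + t * v i):cb n" if "u:cb n" "v:cb n" "t:{0..1}" for u v t using cb_seg[of n] that unfolding seg_def by blast
  have pb: "p (L y) = x0" if "y:bd n" for y using L(2)[of y] spheroidD(2)[OF f that] bd_subset[of n] that by auto
  define l1 where "l1 = (%t::real. (%i. (1 - t) * z0 i + t * z i))"
  define l2' where "l2' = (%t::real. (%i. (1 - t) * z i + t * x i))"
  have c1: "l1 t:cb n" if "t:{0..1}" for t unfolding l1_def by (rule sc[OF z0_bd(2) zc that])
  have b1: "l1 t:bd n" if "t:{0..1}" for t
   using c1[OF that] j unfolding bd_def by (intro CollectI conjI exI[of _ j]) (auto simp: l1_def z_def)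
  have c2: "l2' t:cb n" if "t:{0..1}" for t unfolding l2'_def by (rule sc[OF zc xc that])
  have b2: "l2' t:bd n" if "t:{0..1}" for t
  proof -
   have "l2' t i = x i" using j(2) by (simp add: l2'_def z_def algebra_simps)
   thus ?thesis using c2[OF that] i unfolding bd_def by (intro CollectI conjI exI[of _ i]) auto
  qed
  have "L (l1 1) = L (l1 0)"
  proof (rule lift_const_path[OF L(1)])
   show "continuous_on {0..1} l1" unfolding l1_def by (rule line_continuous)
   show "l1 t:cb n" if "t:{0..1}" for t by (rule c1[OF that])
   show "p (L (l1 t)) = x0" if "t:{0..1}" for t by (rule pb[OF b1[OF that]])
  qed
  moreover have "L (l2' 1) = L (l2' 0)"
  proof (rule lift_const_path[OF L(1)])
   show "continuous_on {0..1} l2'" unfolding l2'_def by (rule line_continuous)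
   show "l2' t:cb n" if "t:{0..1}" for t by (rule c2[OF that])
   show "p (L (l2' t)) = x0" if "t:{0..1}" for t by (rule pb[OF b2[OF that]])
  qed
  ultimately show ?thesis using L(3) by (simp add: l1_def l2'_def)
 qed
 obtain L where L: "tmap (cb n) L" "!!x. x:cb n ==> p (L x) = f x" "L z0 = u0" by (rule spheroid_lift[OF f n0]) (rule that, assumption, simp_all)
 obtain L' where L': "tmap (cb n) L'" "!!x. x:cb n ==> p (L' x) = g x" "L' z0 = u0" by (rule spheroid_lift[OF g n0]) (rule that, assumption, simp_all)
 have "homotopic_with (%h. ALL t:cube_boundary n. h t = x0) (cube n) X f g"
  by (rule homotopic_of_lifts[OF L(1) L'(1) _ L(2) L'(2) spheroidD(2)[OF f]]) (use bd_const[OF f L] bd_const[OF g L'] in auto)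
 thus "g:homotopy_class n X x0 f" by (simp add: homotopy_class_def)
qed

lemma higher_trivial: assumes n: "2 <= n" shows "trivial_group (homotopy_group n X x0)"
proof -
 let ?S = "spheroids n X x0"
 have c: "homotopy_class n X x0 f = ?S" if "f:?S" for f by (rule higher_class[OF n that])
 have ne: "?S ~= {}" using spheroid_const by blast
 have "mult (homotopy_group n X x0) ?S ?S = (UN f:?S. UN g:?S. homotopy_class n X x0 (cube_concat f g))" by (simp add: homotopy_group_def)
 also have "\<dots> = (UN f:?S. UN g:?S. ?S)" using c[OF spheroid_concat] n by simp
 also have "\<dots> = ?S" using ne by simp
 finally have m: "mult (homotopy_group n X x0) ?S ?S = ?S" .
 have ca: "carrier (homotopy_group n X x0) = {?S}" using c ne by (auto simp: homotopy_group_def)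
 have o: "one (homotopy_group n X x0) = ?S" using c[OF spheroid_const] by (simp add: homotopy_group_def)
 have "group (homotopy_group n X x0)" by (rule groupI) (simp_all add: ca m o)
 thus ?thesis by (simp add: trivial_group_def ca o)
qed

text \<open>The deck transformation of a loop: its lift starting at \<open>u0\<close> ends at the
  translate of \<open>u0\<close> by \<open>g\<close>.\<close>

definition dl :: "(rseq => nat => real) => 'a => bool" where
 "dl f g \<longleftrightarrow> g:carrier G & (EX L. tmap (cb 1) L & (ALL x:cb 1. p (L x) = f x) & L z0 = u0 & L e1 = gx g u0)"

lemma dl_ex: assumes f: "f:spheroids 1 X x0" shows "EX g:carrier G. dl f g"
proof -
 obtain L where L: "tmap (cb 1) L" "!!x. x:cb 1 ==> p (L x) = f x" "L z0 = u0" by (rule spheroid_lift[OF f zero_less_one]) (rule that, assumption, simp_all)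
 have "p (L e1) = p u0" using L(2)[OF e1_bd(2)] spheroidD(2)[OF f e1_bd(1)] by (simp add: x0_def)
 then obtain g where "g:carrier G" "L e1 = gx g u0" using fibre[OF u0 cmap_in[OF L(1) e1_bd(2)]] p_eq by auto
 thus ?thesis using L by (auto simp: dl_def)
qed

lemma dl_unique: assumes "dl f g" "dl f h" shows "g = h"
proof -
 obtain L where g: "g:carrier G" and L: "tmap (cb 1) L" "ALL x:cb 1. p (L x) = f x" "L z0 = u0" "L e1 = gx g u0" using assms(1) unfolding dl_def by (elim conjE exE)
 obtain L' where h: "h:carrier G" and L': "tmap (cb 1) L'" "ALL x:cb 1. p (L' x) = f x" "L' z0 = u0" "L' e1 = gx h u0" using assms(2) unfolding dl_def by (elim conjE exE)
 have "L e1 = L' e1" by (rule lift_unique[OF L(1) L'(1) _ z0_bd(2) _ e1_bd(2)]) (use L L' in auto)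
 hence "gx (inv h \<otimes> g) u0 = gx (inv h \<otimes> h) u0" using L(4) L'(4) g h gx_mult[of "inv h" g u0] gx_mult[of "inv h" h u0] by simp
 hence "gx (inv h \<otimes> g) u0 = u0" using h gx1[OF u0] by simp
 hence "inv h \<otimes> g = \<one>" using act_freeT[OF _ u0] g h by simp
 hence "h \<otimes> (inv h \<otimes> g) = h" using h by simp
 thus ?thesis using g h by (simp add: m_assoc[symmetric])
qed

lemma dl_homotopic:
 assumes f: "f:spheroids 1 X x0" and fg: "dl f g" and h: "dl f' g"
 shows "homotopic_with (%h. ALL t:cube_boundary 1. h t = x0) (cube 1) X f f'"
proof -
 obtain L where L: "tmap (cb 1) L" "ALL x:cb 1. p (L x) = f x" "L z0 = u0" "L e1 = gx g u0" using fg unfolding dl_def by (elim conjE exE)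
 obtain L' where L': "tmap (cb 1) L'" "ALL x:cb 1. p (L' x) = f' x" "L' z0 = u0" "L' e1 = gx g u0" using h unfolding dl_def by (elim conjE exE)
 show ?thesis
  by (rule homotopic_of_lifts[OF L(1) L'(1) _ _ _ spheroidD(2)[OF f]]) (use L L' in \<open>auto simp: bd_1\<close>)
qed

text \<open>The homotopy is lifted as a map of the square. Its sides project to the base point,
  hence are constant, so the top edge is a lift of \<open>f'\<close> with the same end points as
  \<open>L\<close>.\<close>

lemma homotopic_dl:
 assumes f: "f:spheroids 1 X x0" and hom: "homotopic_with (%h. ALL t:cube_boundary 1. h t = x0) (cube 1) X f f'" and fg: "dl f g"
 shows "dl f' g"
proof -
 obtain L where g: "g:carrier G" and L: "tmap (cb 1) L" "ALL x:cb 1. p (L x) = f x" "L z0 = u0" "L e1 = gx g u0" using fg unfolding dl_def by (elim conjE exE)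
 obtain h where h: "continuous_map (top_of_set ({0..1} \<times> cb 1)) X h" "ALL y:cb 1. h (0, y) = f y & h (1::real, y) = f' y"
  "ALL t:{0..1}. ALL y:bd 1. h (t, y) = x0" using hom unfolding cube_homotopic by (elim exE conjE)
 \<comment> \<open>Coordinate 1 of the square is the time.\<close>
 define f2 where "f2 = (%x::nat => real. h (x 1, x(1 := 0)))"
 have cb2: "x(1 := t):cb 2" if "x:cb 1" "t:{0..1}" for x t using cb_put[OF that(1), of t] that(2) by (simp add: numeral_2_eq_2)
 have f2v: "f2 (x(1 := t)) = h (t, x)" if "x:cb 1" for x t
  using cb_0n[OF that] fun_upd_idem[of x 1 0] by (simp add: f2_def)
 have "continuous_on (cb 2) (%x::nat => real. (x 1, x(1 := 0)))"
  by (intro ctn)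
 moreover have "(x 1, x(1 := 0)):{0..1} \<times> cb 1" if "x:cb 2" for x
  using cb_drop[of x 1] that by (auto simp: numeral_2_eq_2 cb_def)
 ultimately have "continuous_map (cube 2) (top_of_set ({0..1} \<times> cb 1)) (%x. (x 1, x(1 := 0)))" by (auto simp: cube_eq)
 from continuous_map_compose[OF this h(1)] have f2: "continuous_map (cube 2) X f2" by (simp add: f2_def o_def)
 have z00: "p u0 = f2 z0" using f2v[OF z0_bd(2), of 0] h(3) z0_bd(1)[of 1] by (simp add: x0_def fun_upd_idem)
 obtain L2 where L2: "tmap (cb 2) L2" "!!x. x:cb 2 ==> p (L2 x) = f2 x" "L2 z0 = u0" by (rule lift[OF f2 z0_bd(2) u0 z00]) (rule that, assumption, simp_all)
 have sub: "cb 1 <= cb 2"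
 proof
  fix x assume x: "x:cb 1"
  show "x:cb 2" using cb_range[OF x] x by (simp add: cb_def)
 qed
 have bot: "L x = L2 x" if "x:cb 1" for x
 proof (rule lift_unique[OF L(1) cmap_subset[OF L2(1) sub] _ z0_bd(2) _ that])
  show "L z0 = L2 z0" using L(3) L2(3) by simp
  fix x assume x: "x:cb 1"
  have "x(1 := 0) = x" using cb_0n[OF x] by (rule fun_upd_idem)
  hence "f2 x = f x" using f2v[OF x, of 0] h(2) x by simp
  thus "p (L x) = p (L2 x)" using L(2) L2(2)[of x] x sub by auto
 qed
 have side: "L2 (b(1 := 1)) = L2 (b(1 := 0))" if b: "b:bd 1" for b
 proof -
  have bc: "b:cb 1" using b bd_subset by blast
  show ?thesis
   by (rule lift_const_path[OF L2(1), of "%t. b(1 := t)" x0])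
    (use cb2[OF bc] L2(2) f2v[OF bc] h(3) b in \<open>auto intro!: ctn\<close>)
 qed
 define L' where "L' = (%x. L2 (x(1 := 1)))"
 have "tmap (cb 1) L'" unfolding L'_def
  by (rule cmap_compose[OF L2(1)], intro ctn) (use cb2 in auto)
 moreover have "p (L' x) = f' x" if "x:cb 1" for x
  using L2(2)[OF cb2[OF that, of 1]] f2v[OF that, of 1] h(2) that by (simp add: L'_def)
 moreover have "L' z0 = u0" using side[OF z0_bd(1)] L2(3) by (simp add: L'_def fun_upd_idem)
 moreover have "L' e1 = gx g u0"
 proof -
  have "e1(1 := 0) = e1" by (rule fun_upd_idem) (simp add: e1_def)
  thus ?thesis using side[OF e1_bd(1)] bot[OF e1_bd(2)] L(4) by (simp add: L'_def)
 qed
 ultimately show ?thesis using g unfolding dl_def by blast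
qed

lemma path_exists: assumes u: "u:PT" "v:PT" shows "EX L. tmap (cb 1) L & L z0 = u & L e1 = v"
proof -
 define k where "k = (%x::rseq. if x = z0 then u else v)"
 have z: "z0 ~= e1" by (simp add: e1_def fun_eq_iff)
 have "tmap {z0} k" using cmap_const[OF u(1)] by (rule cmap_cong[THEN iffD1, rotated]) (simp add: k_def)
 moreover have "tmap {e1} k" using cmap_const[OF u(2)] by (rule cmap_cong[THEN iffD1, rotated]) (use z in \<open>auto simp: k_def\<close>)
 ultimately have "tmap ({z0} Un {e1}) k" by (intro cmap_Un) simp_all
 moreover have "bd 1 = {z0} Un {e1}" by (auto simp: bd_1)
 ultimately have "tmap (bd 1) k" by (simp only:)
 from fillT[OF this] show ?thesis using z by (auto simp: bd_1 k_def)
qed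

lemma dl_surj: assumes g: "g:carrier G" shows "EX f:spheroids 1 X x0. dl f g"
proof -
 obtain L where L: "tmap (cb 1) L" "L z0 = u0" "L e1 = gx g u0" using path_exists[OF u0 gxT[OF g u0]] by blast
 define f where "f = (%x. p (L x))"
 have "f:spheroids 1 X x0"
  using p_map[OF compact_cb L(1), of f] L(2,3) p_gx[OF g u0] by (auto simp: spheroids_def cube_eq cube_boundary_eq bd_1 f_def x0_def)
 moreover have "dl f g" unfolding dl_def using g L by (auto simp: f_def)
 ultimately show ?thesis by blast
qed
text \<open>The second lift must start where the first one ends, so it is translated by
  \<open>g\<close>; its end is then the translate of \<open>u0\<close> by the product in this
  order.\<close>

lemma dl_concat:
 assumes fg: "dl f g" and fh: "dl f' h" shows "dl (cube_concat f f') (g \<otimes> h)"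
proof -
 obtain L where g: "g:carrier G" and L: "tmap (cb 1) L" "ALL x:cb 1. p (L x) = f x" "L z0 = u0" "L e1 = gx g u0" using fg unfolding dl_def by (elim conjE exE)
 obtain L' where h: "h:carrier G" and L': "tmap (cb 1) L'" "ALL x:cb 1. p (L' x) = f' x" "L' z0 = u0" "L' e1 = gx h u0" using fh unfolding dl_def by (elim conjE exE)
 have upd: "x(0 := 1) = e1" "x(0 := 0) = z0" if "x:cb 1" for x :: rseq
  using that by (auto simp: cb_def e1_def fun_eq_iff)
 let ?m = "cube_concat L (%x. gx g (L' x))"
 have "tmap (cb 1) ?m"
  by (rule cmap_concat[OF L(1) cmap_gx[OF g L'(1)] zero_less_one]) (simp only: upd L(4) L'(3))
 moreover have "p (?m x) = cube_concat f f' x" if x: "x:cb 1" for x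
  using cube_concat_arg[OF zero_less_one x] L(2) L'(2) p_gx[OF g cmap_in[OF L'(1)]] by (simp add: cube_concat_def)
 moreover have "?m z0 = u0" using L(3) upd(2)[OF z0_bd(2)] by (simp add: cube_concat_def)
 moreover have "?m e1 = gx (g \<otimes> h) u0" using L'(4) upd(1)[OF e1_bd(2)] gx_mult[OF g h] by (simp add: cube_concat_def e1_def)
 ultimately show ?thesis using g h unfolding dl_def by blast
qed
lemma class_dl: assumes f: "f:spheroids 1 X x0" "dl f g" shows "homotopy_class 1 X x0 f = {f':spheroids 1 X x0. dl f' g}"
 using class_sub homotopic_dl[OF f(1) _ f(2)] dl_homotopic[OF f] by (auto simp: homotopy_class_def)

text \<open>The loops with a given deck transformation form exactly one homotopy class, so
  \<open>Fi\<close> is the isomorphism.\<close>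

lemma pi_1: "G \<cong> homotopy_group 1 X x0"
proof -
 define Fi where "Fi = (%g. {f:spheroids 1 X x0. dl f g})"
 have ne: "Fi g ~= {}" if "g:carrier G" for g using dl_surj[OF that] by (auto simp: Fi_def)
 have ca: "carrier (homotopy_group 1 X x0) = Fi`carrier G"
 proof (intro equalityI subsetI)
  fix A assume "A:carrier (homotopy_group 1 X x0)"
  then obtain f where f: "f:spheroids 1 X x0" "A = homotopy_class 1 X x0 f" by (auto simp: homotopy_group_def)
  obtain g where g: "g:carrier G" "dl f g" using dl_ex[OF f(1)] by blast
  thus "A:Fi`carrier G" using class_dl[OF f(1) g(2)] f(2) by (auto simp: Fi_def)
 next
  fix A assume "A:Fi`carrier G"
  then obtain g where g: "g:carrier G" "A = Fi g" by blast
  obtain f where f: "f:spheroids 1 X x0" "dl f g" using dl_surj[OF g(1)] by blast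
  thus "A:carrier (homotopy_group 1 X x0)" using class_dl[OF f] g(2) by (auto simp: Fi_def homotopy_group_def)
 qed
 have "inj_on Fi (carrier G)"
 proof (rule inj_onI)
  fix g h assume g: "g:carrier G" "h:carrier G" "Fi g = Fi h"
  then obtain f where "dl f g" "dl f h" using ne[OF g(1)] by (auto simp: Fi_def)
  thus "g = h" by (rule dl_unique)
 qed
 moreover have "Fi (g \<otimes> h) = Fi g \<otimes>\<^bsub>homotopy_group 1 X x0\<^esub> Fi h" if g: "g:carrier G" "h:carrier G" for g h
 proof -
  have c: "homotopy_class 1 X x0 (cube_concat f f') = Fi (g \<otimes> h)" if "f:Fi g" "f':Fi h" for f f'
   using class_dl[OF spheroid_concat dl_concat] that by (auto simp: Fi_def)
  have "Fi g \<otimes>\<^bsub>homotopy_group 1 X x0\<^esub> Fi h = (UN f:Fi g. UN f':Fi h. homotopy_class 1 X x0 (cube_concat f f'))" by (simp add: homotopy_group_def)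
  also have "\<dots> = (UN f:Fi g. UN f':Fi h. Fi (g \<otimes> h))" using c by simp
  also have "\<dots> = Fi (g \<otimes> h)" using ne g by simp
  finally show ?thesis ..
 qed
 ultimately have "Fi:iso G (homotopy_group 1 X x0)"
  using ca by (auto simp: iso_def hom_def bij_betw_def)
 thus ?thesis by (auto simp: is_iso_def)
qed

lemma path_connected_X: "path_connected_space X"
 unfolding path_connected_space_def
proof (intro ballI)
 fix x y assume "x:topspace X" "y:topspace X"
 then obtain u v where u: "u:PT" "x = p u" and v: "v:PT" "y = p v" by (auto simp: topspace_X)
 obtain L where L: "tmap (cb 1) L" and ends: "L z0 = u" "L e1 = v" using path_exists[OF u(1) v(1)] by blast
 define l where "l = (%t::real. z0(0 := t))"
 have l: "continuous_on {0..1} l" unfolding l_def by (intro ctn)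
 have l01: "l 0 = z0" "l 1 = e1" by (auto simp: l_def e1_def fun_eq_iff)
 have "tmap {0..1} (%t. L (l t))" by (rule cmap_compose[OF L l]) (auto simp: l_def cb_def)
 hence "continuous_map (top_of_set {0..1}) X (%t. p (L (l t)))" by (rule p_map[rotated]) simp_all
 hence "pathin X (%t. p (L (l t)))" by (simp add: pathin_def)
 thus "EX g. pathin X g & g 0 = x & g 1 = y" using ends l01 u(2) v(2) by (intro exI[of _ "%t. p (L (l t))"]) simp
qed

lemma K1: "is_K1 G X"
proof -
 have "x0:topspace X" using u0 by (simp add: topspace_X x0_def)
 thus ?thesis unfolding is_K1_def using path_connected_X pi_1 higher_trivial by blast
qed

lemma F_infinity: "type_F_infinity G"
proof -
 have "finite {i. (n, i):JX}" for n by (simp add: JX_def)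
 thus ?thesis unfolding type_F_infinity_def using is_group W.cw K1 by blast
qed

end

context brown
begin

lemma F_infinity: "type_F_infinity G"
proof -
 obtain N a where N: "!!j. snd j < N (fst j) ==> gmap (bd (fst j)) a (JJ N (fst j)) (a j)"
  "!!d f. gmap (bd d) a {j. snd j < N (fst j)} f ==>
   gfills d a {j. snd j < N (fst j)} f"
 proof (rule brown_complex)
  fix N a assume a: "!!j. snd j < N (fst j) ==> gmap (bd (fst j)) a (JJ N (fst j)) (a j)"
   "!!d f. gmap (bd d) a {j. snd j < N (fst j)} f ==>
   gfills d a {j. snd j < N (fst j)} f"
  show thesis by (rule that[OF a])
 qed
 have "cover G N a" by unfold_locales (fact N)+
 thus ?thesis by (rule cover.F_infinity)
qed

end

section \<open>The three groups\<close>

context labelled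
begin

definition avx :: "vmap => (nat \<times> vmap) \<times> nat => (nat \<times> vmap) \<times> nat" where
 "avx g v = (act g (fst v), snd v)"

lemma snd_avx [simp]: "snd (avx g v) = snd v"
 by (simp add: avx_def)

lemma Cx_LV: "si:Cx r ==> v:si ==> fst v:LV & fst (fst v) <= r & snd v < r"
 unfolding Cx_def Ex_def chains_def by force

lemma Cx_inj: "si:Cx r ==> v:si ==> w:si ==> snd v = snd w ==> v = w"
 unfolding Cx_def by (auto dest: inj_onD)

lemma avx_Cx: assumes g: "g:carrier GX" and s: "si:Cx r" shows "avx g`si:Cx r"
proof (rule CxI)
 show "finite (avx g`si)" "avx g`si ~= {}" using s by (simp_all add: Cx_def)
 show "snd`avx g`si <= {..<r}" using Cx_LV[OF s] by auto
 show "inj_on snd (avx g`si)"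
 proof (rule inj_onI)
  fix a b assume "a:avx g`si" "b:avx g`si" and ab: "snd a = snd b"
  then obtain v w where "v:si" "a = avx g v" "w:si" "b = avx g w" by blast
  thus "a = b" using Cx_inj[OF s, of v w] ab by simp
 qed
 have im: "fst`avx g`si = act g`fst`si" by (simp add: image_image avx_def)
 have ch: "fst`si:Ex r" using s by (simp add: Cx_def)
 show "fst`avx g`si:Ex r"
  unfolding im Ex_def chains_def
 proof (intro CollectI conjI ballI)
  show "finite (act g`fst`si)" "act g`fst`si ~= {}" using s by (simp_all add: Cx_def)
  show "act g`fst`si <= {x:LV. fst x <= r}" using Cx_LV[OF s] act_LV[OF _ g] by auto
  fix x y assume "x:act g`fst`si" "y:act g`fst`si"
  then obtain v w where v: "v:fst`si" "x = act g v" "w:fst`si" "y = act g w" by blast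
  hence "ble v w | ble w v" using ch unfolding Ex_def chains_def by blast
  thus "ble x y | ble y x" using act_ble[OF g] v(2,4) by blast
 qed
qed

text \<open>An element of maximal level is above the others, because comparable elements of one
  level are equivalent.\<close>

lemma chain_greatest: assumes s: "si:Ex r" shows "EX x:si. ALL y:si. ble y x"
proof -
 have f: "finite si" "si ~= {}" "si <= LV" "!!x y. x:si ==> y:si ==> ble x y | ble y x"
  using s by (auto simp: Ex_def chains_def)
 have "Max (fst`si):fst`si" using f(1,2) by (intro Max_in) auto
 then obtain x where x: "x:si" "fst x = Max (fst`si)" by auto
 have "ble y x" if y: "y:si" for y
 proof (cases "ble x y")
  case True
  have LV: "x:LV" "y:LV" using x(1) y f(3) by auto
  have "fst y <= fst x" using f(1) y x(2) by simp
  hence "fst x = fst y" using ble_lev[OF LV True] by simp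
  thus ?thesis by (rule ble_lev_eq[OF LV True])
 next
  case False
  thus ?thesis using f(4)[OF x(1) y] by simp
 qed
 thus ?thesis using x(1) by blast
qed

text \<open>Translate the greatest base of the chain to the chosen base of its level. The rest of
  the chain then lies among the finitely many bases below that one, and the colours are bounded by
  \<open>r\<close>.\<close>

lemma Cx_orbits: "EX R. finite R & R <= Cx r & (ALL si:Cx r. EX g:carrier GX. EX rh:R. si = avx g`rh)"
proof -
 define b where "b = (%n. SOME x. x:LV & fst x = n)"
 have b: "b (fst x):LV & fst (b (fst x)) = fst x" if "x:LV" for x
  unfolding b_def by (rule someI[of _ x]) (use that in simp)
 define B where "B = (UN n:{n. n <= r & b n:LV}. {y:LV. ble y (b n)})"
 have "finite B" unfolding B_def using finite_below by (intro finite_UN_I) auto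
 hence fin: "finite (Pow (B \<times> {..<r}))" by simp
 define R where "R = {si:Cx r. si <= B \<times> {..<r}}"
 have "R <= Pow (B \<times> {..<r})" by (auto simp: R_def)
 hence "finite R" using fin by (rule finite_subset)
 moreover have "EX g:carrier GX. EX rh:R. si = avx g`rh" if s: "si:Cx r" for si
 proof -
  have "fst`si:Ex r" using s by (simp add: Cx_def)
  from chain_greatest[OF this] obtain v where v: "v:si" "ALL w:si. ble (fst w) (fst v)" by blast
  let ?x = "fst v"
  have x: "?x:LV" "fst ?x <= r" using Cx_LV[OF s v(1)] by auto
  obtain g where g: "g:carrier GX" "act g ?x = b (fst ?x)"
   using act_transitive[OF x(1), of "b (fst ?x)"] b[OF x(1)] by auto
  have "avx g`si <= B \<times> {..<r}"
  proof
   fix a assume "a:avx g`si"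
   then obtain w where w: "w:si" "a = avx g w" by blast
   have "ble (act g (fst w)) (b (fst ?x))" using act_ble[OF g(1), of "fst w" ?x] v(2) w(1) g(2) by auto
   moreover have "act g (fst w):LV" using act_LV[OF _ g(1)] Cx_LV[OF s w(1)] by blast
   ultimately have "act g (fst w):B" using b[OF x(1)] x(2) unfolding B_def by blast
   thus "a:B \<times> {..<r}" using Cx_LV[OF s w(1)] w(2) by (simp add: avx_def)
  qed
  hence r: "avx g`si:R" using avx_Cx[OF g(1) s] by (simp add: R_def)
  have "avx (inv\<^bsub>GX\<^esub> g) (avx g w) = w" if "w:si" for w
  proof -
   have w: "fst w:LV" using Cx_LV[OF s that] by blast
   have "act (inv\<^bsub>GX\<^esub> g) (act g (fst w)) = fst w"
    using act_mult[OF inv_GX[OF g(1)] g(1), of "fst w"] act_one[OF w] group.l_inv[OF group_GX g(1)] by simp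
   thus ?thesis by (simp add: avx_def)
  qed
  hence "si = avx (inv\<^bsub>GX\<^esub> g)`avx g`si" by (simp add: image_image)
  thus ?thesis using inv_GX[OF g(1)] r by blast
 qed
 ultimately show ?thesis by (intro exI[of _ R]) (auto simp: R_def)
qed

lemma brown_GX: "brown GX (%r. Cx (Suc r)) avx"
proof (intro brown.intro brown_axioms.intro)
 show "group GX" by (rule group_GX)
 show "scomplex (Cx (Suc r))" for r by (rule scomplex_Cx)
 show "Cx (Suc r) <= Cx (Suc s)" if "r <= s" for r s using that by (intro Cx_mono) simp
 show "avx g`si:Cx (Suc r)" if "g:carrier GX" "si:Cx (Suc r)" for g si r by (rule avx_Cx[OF that])
 have LV: "fst v:LV" if "{v}:Cx (Suc r)" for v r using Cx_LV[OF that] by simp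
 show "avx \<one>\<^bsub>GX\<^esub> v = v" if "{v}:Cx (Suc r)" for v r using act_one[OF LV[OF that]] by (simp add: avx_def)
 show "avx (g \<otimes>\<^bsub>GX\<^esub> h) v = avx g (avx h v)" if "g:carrier GX" "h:carrier GX" for g h v
  using act_mult[OF that] by (simp add: avx_def)
 \<comment> \<open>The action keeps colours, and these are distinct within a simplex, so a simplex
   mapped to itself is fixed vertex by vertex.\<close>
 show "g = \<one>\<^bsub>GX\<^esub>" if g: "g:carrier GX" and s: "si:Cx (Suc r)" and eq: "avx g`si = si" for g si r
 proof -
  obtain v where v: "v:si" using s by (auto simp: Cx_def)
  have "avx g v:si" using v eq by blast
  hence "avx g v = v" using Cx_inj[OF s _ v] by simp
  hence "act g (fst v) = fst v" by (simp add: avx_def prod_eq_iff)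
  thus ?thesis using act_free[OF _ g] Cx_LV[OF s v] by blast
 qed
 show "EX R. finite R & R <= Cx (Suc r) & (ALL si:Cx (Suc r). EX g:carrier GX. EX rh:R. si = avx g`rh)" for r
  by (rule Cx_orbits)
 show "EX s>=r. ALL d<=n. ALL f. smap (bd d) (skel n (Cx (Suc r))) f -->
   (EX F. smap (cb d) (skel (Suc n) (Cx (Suc s))) F & (ALL x:bd d. F x = f x))" for r n
 proof -
  obtain s where s: "Suc r <= s" "ALL d<=n. ALL f. smap (bd d) (skel n (Cx (Suc r))) f -->
   sfills d (skel (Suc n) (Cx s)) f" using Cx_fill[of "Suc r" n] by (elim exE conjE)
  then obtain t where "s = Suc t" by (cases s) auto
  thus ?thesis using s by (intro exI[of _ t]) simp
 qed
qed

lemma F_infinity_GX: "type_F_infinity GX"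
 by (rule brown.F_infinity[OF brown_GX])

lemma GX_eq: "GX = (QV k l)\<lparr>carrier := {h:carrier (QV k l). pres m k h}\<rparr>"
proof -
 have "{h. (0, h):LV} = {h:carrier (QV k l). pres m k h}"
  by (auto simp: LV_def QV_def quasi_def Bij_def Om_def)
 thus ?thesis by (simp add: GX_def QV_def Om_def)
qed

end

theorem theorem5p1:
 fixes k l :: nat
 shows "type_F_infinity (QF k l) \<and> type_F_infinity (QT k l) \<and> type_F_infinity (QV k l)"
proof -
 have "QF k l = labelled.GX MF k l" "QT k l = labelled.GX MT k l" "QV k l = labelled.GX MV k l"
  by (simp_all add: labelled.GX_eq QF_def QT_def pres_def)
 thus ?thesis using labelled.F_infinity_GX[of MF k l] labelled.F_infinity_GX[of MT k l] labelled.F_infinity_GX[of MV k l] by simp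
qed

end
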